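(* Let $S$ be a local set theory in a local language $\mathcal L$, let $X=\{x:\alpha\}$ and $Y=\{y:\beta\}$ be $S$-sets, and let $f:X\to Y$ be an $S$-function whose graph is $|f|=\{\langle x,y\rangle:\gamma\}$. Let $f^*$ be the $\mathrm{Th}(\mathscr T(S))$-function $(|f^*|,U_{\mathbf X},U_{\mathbf Y})$ with $|f^*|=\{\langle u,v\rangle:\gamma(x/\mathbf{i_X}(u),y/\mathbf{i_Y}(v))\}$, where $u,v$ are variables of types $\mathbf X,\mathbf Y$. Then $$\vdash_{\mathrm{Th}(\mathscr T(S))}\langle u,\mathbf f(u)\rangle\in|f^*|;$$ in other words, $f^*=(u\mapsto\mathbf f(u))$.
   Context: Local languages and local set theories are in the sense of J. L. Bell (Toposes and Local Set Theories). An $S$-set is a closed term of power type; $U_{\mathbf A}=\{x_{\mathbf A}:true\}$. An $S$-function $f:X\to Y$ is a triple $(|f|,X,Y)$ with $\vdash_S|f|\in Y^X$; these form the linguistic topos $\mathscr T(S)$. $(u\mapsto\tau)$ is the function with graph $\{\langle u,\tau\rangle:u\in U\}$; for $X$ of type $\mathbf{PA}$, $i_X=(x\mapsto x):X\to U_{\mathbf A}$. For a topos $\mathscr E$, $\mathcal L(\mathscr E)$ is its internal language (a type symbol $\mathbf Z$ for each object $Z$, a function symbol $\mathbf g$ of signature $\mathbf{dom\,g}\to\mathbf{cod\,g}$ for each arrow $g$) and $\mathrm{Th}(\mathscr E)$ the local set theory of sequents valid in the natural interpretation of $\mathcal L(\mathscr E)$ in $\mathscr E$. The canonical translation $\eta_S:\mathcal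 L\to\mathcal L(\mathscr T(S))$ sends each type $\mathbf A$ to the type symbol of $U_{\mathbf A}$ and each function symbol $\mathbf h$ to that of $(x\mapsto\mathbf h(x))$; it is conservative, and via it formulae of $S$ (such as $\gamma$) are regarded as formulae of $\mathrm{Th}(\mathscr T(S))$. $\mathbf X,\mathbf Y$ denote the type symbols of the objects $X,Y$ of $\mathscr T(S)$, and $\mathbf f,\mathbf{i_X},\mathbf{i_Y}$ the function symbols of the arrows $f,i_X,i_Y$. (That $f^*$ is indeed a $\mathrm{Th}(\mathscr T(S))$-function is established in the paper.) *)

theory Defs
  imports Main
begin

section \<open>Local languages\<close>

text \<open>
  Product types are n-ary. By convention the product of no types is the unity type and the
  product of one type is that type itself, so \<open>TProd\<close> is only well formed on lists of length at
  least 2; \<open>mk_prod\<close>, \<open>mk_tuple\<close> and \<open>mk_prj\<close> extend the notation to lists of any length.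
\<close>

datatype 'g ty = TUnit | TOmega | TGround 'g | TPow "'g ty" | TProd "'g ty list"

text \<open>A variable \<open>(n, A)\<close> is the n-th variable of type \<open>A\<close>.\<close>

type_synonym 'g var = "nat \<times> 'g ty"

text \<open>
  Terms are represented locally nameless: free variables are named, bound ones are de Bruijn
  indices, and \<open>compr x \<alpha>\<close> below is the term \<open>{x : \<alpha>}\<close>. Terms are thereby identified up to
  renaming of bound variables, and every term is free for every variable in every formula.
  Projections count from 0, that is \<open>Prj As i t\<close> is the (i+1)-st component of \<open>t\<close>, and are
  annotated with the factors \<open>As\<close> of the type of \<open>t\<close>.
\<close>

datatype ('g, 'f) trm =
    Bound nat
  | Var "'g var"
  | Star
  | App 'f "('g, 'f) trm"
  | Tuple "('g, 'f) trm list"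
  | Prj "'g ty list" nat "('g, 'f) trm"
  | Compr "'g ty" "('g, 'f) trm"
  | Eq "('g, 'f) trm" "('g, 'f) trm"  (infix "\<doteq>" 50)
  | Mem "('g, 'f) trm" "('g, 'f) trm"  (infix "\<in>\<^sub>t" 50)

record ('g, 'f) lang =
  ground :: "'g set"
  funs :: "'f set"
  sig :: "'f \<Rightarrow> 'g ty \<times> 'g ty"

fun is_ty :: "'g set \<Rightarrow> 'g ty \<Rightarrow> bool" where
  "is_ty G TUnit \<longleftrightarrow> True"
| "is_ty G TOmega \<longleftrightarrow> True"
| "is_ty G (TGround g) \<longleftrightarrow> g \<in> G"
| "is_ty G (TPow A) \<longleftrightarrow> is_ty G A"
| "is_ty G (TProd As) \<longleftrightarrow> 2 \<le> length As \<and> (\<forall>A\<in>set As. is_ty G A)"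

definition local_language :: "('g, 'f, 'z) lang_scheme \<Rightarrow> bool" where
  "local_language L \<longleftrightarrow> (\<forall>h\<in>funs L. is_ty (ground L) (fst (sig L h)) \<and> is_ty (ground L) (snd (sig L h)))"

text \<open>\<open>has_type L Bs t A\<close>: \<open>t\<close> is a term of type \<open>A\<close> whose dangling indices \<open>0, 1, \<dots>\<close> have the types
  listed in \<open>Bs\<close>. Genuine terms are those typed with \<open>Bs = []\<close>.\<close>

inductive has_type :: "('g, 'f, 'z) lang_scheme \<Rightarrow> 'g ty list \<Rightarrow> ('g, 'f) trm \<Rightarrow> 'g ty \<Rightarrow> bool"
  for L where
  Bound: "i < length Bs \<Longrightarrow> has_type L Bs (Bound i) (Bs ! i)"
| Var: "is_ty (ground L) (snd x) \<Longrightarrow> has_type L Bs (Var x) (snd x)"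
| Star: "has_type L Bs Star TUnit"
| App: "h \<in> funs L \<Longrightarrow> sig L h = (A, B) \<Longrightarrow> has_type L Bs t A \<Longrightarrow> has_type L Bs (App h t) B"
| Tuple: "2 \<le> length ts \<Longrightarrow> list_all2 (has_type L Bs) ts As \<Longrightarrow> has_type L Bs (Tuple ts) (TProd As)"
| Prj: "has_type L Bs t (TProd As) \<Longrightarrow> i < length As \<Longrightarrow> has_type L Bs (Prj As i t) (As ! i)"
| Compr: "is_ty (ground L) A \<Longrightarrow> has_type L (A # Bs) a TOmega \<Longrightarrow> has_type L Bs (Compr A a) (TPow A)"
| Eq: "has_type L Bs s A \<Longrightarrow> has_type L Bs t A \<Longrightarrow> has_type L Bs (s \<doteq> t) TOmega"
| Mem: "has_type L Bs s A \<Longrightarrow> has_type L Bs t (TPow A) \<Longrightarrow> has_type L Bs (s \<in>\<^sub>t t) TOmega"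

abbreviation formula :: "('g, 'f, 'z) lang_scheme \<Rightarrow> ('g, 'f) trm \<Rightarrow> bool" where
  "formula L \<alpha> \<equiv> has_type L [] \<alpha> TOmega"

primrec fv :: "('g, 'f) trm \<Rightarrow> 'g var set" where
  "fv (Bound i) = {}"
| "fv (Var x) = {x}"
| "fv Star = {}"
| "fv (App h t) = fv t"
| "fv (Tuple ts) = \<Union> (set (map fv ts))"
| "fv (Prj As i t) = fv t"
| "fv (Compr A a) = fv a"
| "fv (s \<doteq> t) = fv s \<union> fv t"
| "fv (s \<in>\<^sub>t t) = fv s \<union> fv t"

text \<open>Simultaneous substitution of terms (without dangling indices) for free variables.\<close>

primrec subst :: "('g var \<Rightarrow> ('g, 'f) trm) \<Rightarrow> ('g, 'f) trm \<Rightarrow> ('g, 'f) trm" where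
  "subst \<sigma> (Bound i) = Bound i"
| "subst \<sigma> (Var x) = \<sigma> x"
| "subst \<sigma> Star = Star"
| "subst \<sigma> (App h t) = App h (subst \<sigma> t)"
| "subst \<sigma> (Tuple ts) = Tuple (map (subst \<sigma>) ts)"
| "subst \<sigma> (Prj As i t) = Prj As i (subst \<sigma> t)"
| "subst \<sigma> (Compr A a) = Compr A (subst \<sigma> a)"
| "subst \<sigma> (s \<doteq> t) = (subst \<sigma> s \<doteq> subst \<sigma> t)"
| "subst \<sigma> (s \<in>\<^sub>t t) = (subst \<sigma> s \<in>\<^sub>t subst \<sigma> t)"

abbreviation subst1 :: "'g var \<Rightarrow> ('g, 'f) trm \<Rightarrow> ('g, 'f) trm \<Rightarrow> ('g, 'f) trm" where
  "subst1 x \<tau> \<equiv> subst (Var(x := \<tau>))"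

fun bind :: "'g var \<Rightarrow> ('g, 'f) trm \<Rightarrow> nat \<Rightarrow> ('g, 'f) trm" where
  "bind x (Bound i) k = Bound i"
| "bind x (Var y) k = (if y = x then Bound k else Var y)"
| "bind x Star k = Star"
| "bind x (App h t) k = App h (bind x t k)"
| "bind x (Tuple ts) k = Tuple (map (\<lambda>t. bind x t k) ts)"
| "bind x (Prj As i t) k = Prj As i (bind x t k)"
| "bind x (Compr A a) k = Compr A (bind x a (Suc k))"
| "bind x (s \<doteq> t) k = (bind x s k \<doteq> bind x t k)"
| "bind x (s \<in>\<^sub>t t) k = (bind x s k \<in>\<^sub>t bind x t k)"

definition compr :: "'g var \<Rightarrow> ('g, 'f) trm \<Rightarrow> ('g, 'f) trm" where
  "compr x \<alpha> = Compr (snd x) (bind x \<alpha> 0)"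

definition mk_prod :: "'g ty list \<Rightarrow> 'g ty" where
  "mk_prod As = (case As of [] \<Rightarrow> TUnit | [A] \<Rightarrow> A | _ \<Rightarrow> TProd As)"

definition mk_tuple :: "('g, 'f) trm list \<Rightarrow> ('g, 'f) trm" where
  "mk_tuple ts = (case ts of [] \<Rightarrow> Star | [t] \<Rightarrow> t | _ \<Rightarrow> Tuple ts)"

definition mk_prj :: "'g ty list \<Rightarrow> nat \<Rightarrow> ('g, 'f) trm \<Rightarrow> ('g, 'f) trm" where
  "mk_prj As i t = (if length As = 1 then t else Prj As i t)"


subsection \<open>Defined logical and set-theoretic operations\<close>

text \<open>
  The capitalised quantifiers take a body in which the quantified variable is the dangling index
  0 (and no index above it dangles); the binders introduced inside a definition are therefore
  addressed by explicit indices. Set arguments of the operations below have no dangling index, so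
  they can be placed under a binder without shifting.
\<close>

definition Tru :: "('g, 'f) trm" where
  "Tru = (Star \<doteq> Star)"

definition And :: "('g, 'f) trm \<Rightarrow> ('g, 'f) trm \<Rightarrow> ('g, 'f) trm"  (infixr "\<and>\<^sub>t" 35) where
  "(\<alpha> \<and>\<^sub>t \<beta>) = (Tuple [\<alpha>, \<beta>] \<doteq> Tuple [Tru, Tru])"

definition Imp :: "('g, 'f) trm \<Rightarrow> ('g, 'f) trm \<Rightarrow> ('g, 'f) trm"  (infixr "\<longrightarrow>\<^sub>t" 25) where
  "(\<alpha> \<longrightarrow>\<^sub>t \<beta>) = ((\<alpha> \<and>\<^sub>t \<beta>) \<doteq> \<alpha>)"

definition All :: "'g ty \<Rightarrow> ('g, 'f) trm \<Rightarrow> ('g, 'f) trm" where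
  "All A a = (Compr A a \<doteq> Compr A Tru)"

text \<open>Existence of \<open>x\<close> with \<open>\<alpha>\<close> is \<open>\<forall>\<omega>. (\<forall>x. \<alpha> \<longrightarrow> \<omega>) \<longrightarrow> \<omega>\<close>.\<close>

definition Ex :: "'g ty \<Rightarrow> ('g, 'f) trm \<Rightarrow> ('g, 'f) trm" where
  "Ex A a = All TOmega (All A (a \<longrightarrow>\<^sub>t Bound 1) \<longrightarrow>\<^sub>t Bound 0)"

text \<open>Unique existence of \<open>x\<close> with \<open>\<alpha>\<close> is \<open>\<exists>x. \<alpha> \<and> (\<forall>y. \<alpha>(x/y) \<longrightarrow> x = y)\<close>.\<close>

definition Ex1 :: "'g ty \<Rightarrow> ('g, 'f) trm \<Rightarrow> ('g, 'f) trm" where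
  "Ex1 A a = Ex A (a \<and>\<^sub>t All A (a \<longrightarrow>\<^sub>t (Bound 1 \<doteq> Bound 0)))"

definition all :: "'g var \<Rightarrow> ('g, 'f) trm \<Rightarrow> ('g, 'f) trm" where
  "all x \<alpha> = All (snd x) (bind x \<alpha> 0)"

definition ex :: "'g var \<Rightarrow> ('g, 'f) trm \<Rightarrow> ('g, 'f) trm" where
  "ex x \<alpha> = Ex (snd x) (bind x \<alpha> 0)"

definition ex1 :: "'g var \<Rightarrow> ('g, 'f) trm \<Rightarrow> ('g, 'f) trm" where
  "ex1 x \<alpha> = Ex1 (snd x) (bind x \<alpha> 0)"

definition fresh :: "'g ty \<Rightarrow> 'g var set \<Rightarrow> 'g var" where
  "fresh A V = (LEAST n. (n, A) \<notin> V, A)"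

text \<open>\<open>set_of A [x\<^sub>1, \<dots>, x\<^sub>n] \<tau> \<alpha>\<close> is \<open>{\<tau> : \<alpha>} = {z : \<exists>x\<^sub>1 \<dots> x\<^sub>n. z = \<tau> \<and> \<alpha>}\<close>, where \<open>\<tau>\<close> has type \<open>A\<close>.\<close>

definition set_of :: "'g ty \<Rightarrow> 'g var list \<Rightarrow> ('g, 'f) trm \<Rightarrow> ('g, 'f) trm \<Rightarrow> ('g, 'f) trm" where
  "set_of A xs \<tau> \<alpha> =
    (let z = fresh A (set xs \<union> fv \<tau> \<union> fv \<alpha>) in compr z (foldr ex xs ((Var z \<doteq> \<tau>) \<and>\<^sub>t \<alpha>)))"

definition U :: "'g ty \<Rightarrow> ('g, 'f) trm" where
  "U A = Compr A Tru"

definition subset_of :: "'g ty \<Rightarrow> ('g, 'f) trm \<Rightarrow> ('g, 'f) trm \<Rightarrow> ('g, 'f) trm" where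
  "subset_of A s t = All A ((Bound 0 \<in>\<^sub>t s) \<longrightarrow>\<^sub>t (Bound 0 \<in>\<^sub>t t))"

text \<open>In the remaining operations of this section the set arguments are closed terms, so the
  named variables cannot capture anything.\<close>

definition prod_set :: "'g ty list \<Rightarrow> ('g, 'f) trm list \<Rightarrow> ('g, 'f) trm" where
  "prod_set As Xs =
    (let xs = zip [0..<length As] As in
      set_of (mk_prod As) xs (mk_tuple (map Var xs))
        (foldr And (map2 (\<lambda>x X. Var x \<in>\<^sub>t X) xs Xs) Tru))"

definition pow_set :: "'g ty \<Rightarrow> ('g, 'f) trm \<Rightarrow> ('g, 'f) trm" where
  "pow_set A X = (let u = (0, TPow A) in compr u (subset_of A (Var u) X))"

text \<open>\<open>fun_set A B X Y\<close> is \<open>Y\<^sup>X = {u : u \<subseteq> X \<times> Y \<and> (\<forall>x\<in>X. \<exists>!y. y \<in> Y \<and> \<langle>x, y\<rangle> \<in> u)}\<close>.\<close>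

definition fun_set :: "'g ty \<Rightarrow> 'g ty \<Rightarrow> ('g, 'f) trm \<Rightarrow> ('g, 'f) trm \<Rightarrow> ('g, 'f) trm" where
  "fun_set A B X Y =
    (let u = (0, TPow (TProd [A, B])); x = (1, A); y = (2, B) in
      compr u
        (subset_of (TProd [A, B]) (Var u) (prod_set [A, B] [X, Y]) \<and>\<^sub>t
         all x ((Var x \<in>\<^sub>t X) \<longrightarrow>\<^sub>t
           ex1 y ((Var y \<in>\<^sub>t Y) \<and>\<^sub>t (Tuple [Var x, Var y] \<in>\<^sub>t Var u)))))"

text \<open>\<open>graph x y \<gamma>\<close> is \<open>{\<langle>x, y\<rangle> : \<gamma>}\<close>.\<close>

definition graph :: "'g var \<Rightarrow> 'g var \<Rightarrow> ('g, 'f) trm \<Rightarrow> ('g, 'f) trm" where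
  "graph x y \<gamma> = set_of (TProd [snd x, snd y]) [x, y] (Tuple [Var x, Var y]) \<gamma>"

text \<open>\<open>maps_graph x X B \<tau>\<close> is \<open>{\<langle>x, \<tau>\<rangle> : x \<in> X}\<close>, where \<open>\<tau>\<close> has type \<open>B\<close>.\<close>

definition maps_graph ::
  "'g var \<Rightarrow> ('g, 'f) trm \<Rightarrow> 'g ty \<Rightarrow> ('g, 'f) trm \<Rightarrow> ('g, 'f) trm" where
  "maps_graph x X B \<tau> = set_of (TProd [snd x, B]) [x] (Tuple [Var x, \<tau>]) (Var x \<in>\<^sub>t X)"

definition comp_graph ::
  "'g ty \<Rightarrow> 'g ty \<Rightarrow> 'g ty \<Rightarrow> ('g, 'f) trm \<Rightarrow> ('g, 'f) trm \<Rightarrow> ('g, 'f) trm" where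
  "comp_graph A B C G F =
    (let x = (0, A); y = (1, B); z = (2, C) in
      graph x z (ex y ((Tuple [Var x, Var y] \<in>\<^sub>t F) \<and>\<^sub>t (Tuple [Var y, Var z] \<in>\<^sub>t G))))"


section \<open>Local set theories\<close>

type_synonym ('g, 'f) sequent = "('g, 'f) trm set \<times> ('g, 'f) trm"

definition sequents :: "('g, 'f, 'z) lang_scheme \<Rightarrow> ('g, 'f) sequent set" where
  "sequents L = {(\<Gamma>, \<alpha>). finite \<Gamma> \<and> (\<forall>\<beta>\<in>\<Gamma>. formula L \<beta>) \<and> formula L \<alpha>}"

inductive derives ::
  "('g, 'f, 'z) lang_scheme \<Rightarrow> ('g, 'f) sequent set \<Rightarrow> ('g, 'f) trm set \<Rightarrow> ('g, 'f) trm \<Rightarrow> bool"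
  for L S where
  premise: "(\<Gamma>, \<alpha>) \<in> S \<Longrightarrow> derives L S \<Gamma> \<alpha>"
| tautology: "formula L \<alpha> \<Longrightarrow> derives L S {\<alpha>} \<alpha>"
| unity: "snd x = TUnit \<Longrightarrow> derives L S {} (Var x \<doteq> Star)"
| equality: "formula L \<alpha> \<Longrightarrow> is_ty (ground L) (snd z) \<Longrightarrow> snd x = snd z \<Longrightarrow> snd y = snd z \<Longrightarrow>
    derives L S {Var x \<doteq> Var y, subst1 z (Var x) \<alpha>} (subst1 z (Var y) \<alpha>)"
| product_prj: "is_ty (ground L) (TProd (map snd xs)) \<Longrightarrow> i < length xs \<Longrightarrow>
    derives L S {} (Prj (map snd xs) i (Tuple (map Var xs)) \<doteq> Var (xs ! i))"
| product_tuple: "snd x = TProd As \<Longrightarrow> is_ty (ground L) (TProd As) \<Longrightarrow>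
    derives L S {} (Var x \<doteq> Tuple (map (\<lambda>i. Prj As i (Var x)) [0..<length As]))"
| comprehension: "formula L \<alpha> \<Longrightarrow> is_ty (ground L) (snd x) \<Longrightarrow>
    derives L S {} ((Var x \<in>\<^sub>t compr x \<alpha>) \<doteq> \<alpha>)"
| thinning: "derives L S \<Gamma> \<alpha> \<Longrightarrow> formula L \<beta> \<Longrightarrow> derives L S (insert \<beta> \<Gamma>) \<alpha>"
| cut: "derives L S \<Gamma> \<alpha> \<Longrightarrow> derives L S (insert \<alpha> \<Gamma>) \<beta> \<Longrightarrow> fv \<alpha> \<subseteq> \<Union> (fv ` \<Gamma>) \<union> fv \<beta> \<Longrightarrow>
    derives L S \<Gamma> \<beta>"
| substitution: "derives L S \<Gamma> \<alpha> \<Longrightarrow> has_type L [] \<tau> (snd x) \<Longrightarrow>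
    derives L S (subst1 x \<tau> ` \<Gamma>) (subst1 x \<tau> \<alpha>)"
| extensionality: "derives L S \<Gamma> ((Var x \<in>\<^sub>t \<sigma>) \<doteq> (Var x \<in>\<^sub>t \<tau>)) \<Longrightarrow>
    x \<notin> \<Union> (fv ` \<Gamma>) \<union> fv \<sigma> \<union> fv \<tau> \<Longrightarrow> derives L S \<Gamma> (\<sigma> \<doteq> \<tau>)"
| equivalence: "derives L S (insert \<alpha> \<Gamma>) \<beta> \<Longrightarrow> derives L S (insert \<beta> \<Gamma>) \<alpha> \<Longrightarrow>
    derives L S \<Gamma> (\<alpha> \<doteq> \<beta>)"

definition local_set_theory :: "('g, 'f, 'z) lang_scheme \<Rightarrow> ('g, 'f) sequent set \<Rightarrow> bool" where
  "local_set_theory L S \<longleftrightarrow> S \<subseteq> sequents L \<and> (\<forall>\<Gamma> \<alpha>. derives L S \<Gamma> \<alpha> \<longrightarrow> (\<Gamma>, \<alpha>) \<in> S)"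

definition entails ::
  "('g, 'f) trm set \<Rightarrow> ('g, 'f) sequent set \<Rightarrow> ('g, 'f) trm \<Rightarrow> bool"  ("(_ \<turnstile>[_] _)" [51, 0, 20] 20)
  where "(\<Gamma> \<turnstile>[S] \<alpha>) \<longleftrightarrow> (\<Gamma>, \<alpha>) \<in> S"

definition closed_term :: "('g, 'f, 'z) lang_scheme \<Rightarrow> ('g, 'f) trm \<Rightarrow> 'g ty \<Rightarrow> bool" where
  "closed_term L t A \<longleftrightarrow> has_type L [] t A \<and> fv t = {}"

definition is_sset :: "('g, 'f, 'z) lang_scheme \<Rightarrow> ('g, 'f) trm \<Rightarrow> bool" where
  "is_sset L X \<longleftrightarrow> (\<exists>A. closed_term L X (TPow A))"

definition elem_ty :: "('g, 'f, 'z) lang_scheme \<Rightarrow> ('g, 'f) trm \<Rightarrow> 'g ty" where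
  "elem_ty L X = (THE A. has_type L [] X (TPow A))"

text \<open>\<open>is_sfun L S F X Y\<close>: the triple \<open>(F, X, Y)\<close> is an S-function.\<close>

definition is_sfun ::
  "('g, 'f, 'z) lang_scheme \<Rightarrow> ('g, 'f) sequent set \<Rightarrow>
    ('g, 'f) trm \<Rightarrow> ('g, 'f) trm \<Rightarrow> ('g, 'f) trm \<Rightarrow> bool" where
  "is_sfun L S F X Y \<longleftrightarrow>
    is_sset L X \<and> is_sset L Y \<and> is_sset L F \<and>
    ({} \<turnstile>[S] F \<in>\<^sub>t fun_set (elem_ty L X) (elem_ty L Y) X Y)"


section \<open>Toposes\<close>

text \<open>
  A topos comes with chosen finite products (\<open>Prod []\<close> is the terminal object), a truth-value
  object \<open>Omega\<close> with \<open>Truth : 1 \<rightarrow> Omega\<close>, and power objects with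
  \<open>Ev A : A \<times> PowOb A \<rightarrow> Omega\<close>. Composition is in the order \<open>Comp g f = g \<circ> f\<close>.
\<close>

record ('o, 'a) topos =
  Ob :: "'o set"
  Arr :: "'a set"
  Dom :: "'a \<Rightarrow> 'o"
  Cod :: "'a \<Rightarrow> 'o"
  Comp :: "'a \<Rightarrow> 'a \<Rightarrow> 'a"
  Ident :: "'o \<Rightarrow> 'a"
  Prod :: "'o list \<Rightarrow> 'o"
  Proj :: "'o list \<Rightarrow> nat \<Rightarrow> 'a"
  Omega :: "'o"
  Truth :: "'a"
  PowOb :: "'o \<Rightarrow> 'o"
  Ev :: "'o \<Rightarrow> 'a"

definition Hom :: "('o, 'a, 'z) topos_scheme \<Rightarrow> 'o \<Rightarrow> 'o \<Rightarrow> 'a set" where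
  "Hom E A B = {f \<in> Arr E. Dom E f = A \<and> Cod E f = B}"

text \<open>\<open>is_tuple E D fs h\<close>: \<open>h = \<langle>f\<^sub>1, \<dots>, f\<^sub>n\<rangle>\<close> for arrows \<open>f\<^sub>i\<close> with domain \<open>D\<close>.\<close>

definition is_tuple :: "('o, 'a, 'z) topos_scheme \<Rightarrow> 'o \<Rightarrow> 'a list \<Rightarrow> 'a \<Rightarrow> bool" where
  "is_tuple E D fs h \<longleftrightarrow>
    h \<in> Hom E D (Prod E (map (Cod E) fs)) \<and>
    (\<forall>i<length fs. Comp E (Proj E (map (Cod E) fs) i) h = fs ! i)"

definition tuple :: "('o, 'a, 'z) topos_scheme \<Rightarrow> 'o \<Rightarrow> 'a list \<Rightarrow> 'a" where
  "tuple E D fs = (THE h. is_tuple E D fs h)"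

definition true_on :: "('o, 'a, 'z) topos_scheme \<Rightarrow> 'o \<Rightarrow> 'a" where
  "true_on E D = Comp E (Truth E) (tuple E D [])"

definition mono_arrow :: "('o, 'a, 'z) topos_scheme \<Rightarrow> 'a \<Rightarrow> bool" where
  "mono_arrow E m \<longleftrightarrow> m \<in> Arr E \<and>
    (\<forall>f\<in>Arr E. \<forall>g\<in>Arr E. Dom E f = Dom E g \<and> Cod E f = Dom E m \<and> Cod E g = Dom E m \<and>
      Comp E m f = Comp E m g \<longrightarrow> f = g)"

text \<open>\<open>classifies E m c\<close>: \<open>m\<close> is a pullback of \<open>Truth\<close> along \<open>c\<close>.\<close>

definition classifies :: "('o, 'a, 'z) topos_scheme \<Rightarrow> 'a \<Rightarrow> 'a \<Rightarrow> bool" where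
  "classifies E m c \<longleftrightarrow>
    m \<in> Arr E \<and> c \<in> Hom E (Cod E m) (Omega E) \<and> Comp E c m = true_on E (Dom E m) \<and>
    (\<forall>h\<in>Arr E. Cod E h = Cod E m \<and> Comp E c h = true_on E (Dom E h) \<longrightarrow>
      (\<exists>!k. k \<in> Hom E (Dom E h) (Dom E m) \<and> Comp E m k = h))"

definition chi :: "('o, 'a, 'z) topos_scheme \<Rightarrow> 'a \<Rightarrow> 'a" where
  "chi E m = (THE c. classifies E m c)"

text \<open>\<open>is_transpose E A D c h\<close>: \<open>h : D \<rightarrow> PowOb A\<close> is the power transpose of \<open>c : A \<times> D \<rightarrow> Omega\<close>,
  that is \<open>Ev A \<circ> (1 \<times> h) = c\<close>.\<close>

definition is_transpose :: "('o, 'a, 'z) topos_scheme \<Rightarrow> 'o \<Rightarrow> 'o \<Rightarrow> 'a \<Rightarrow> 'a \<Rightarrow> bool" where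
  "is_transpose E A D c h \<longleftrightarrow>
    h \<in> Hom E D (PowOb E A) \<and>
    Comp E (Ev E A)
      (tuple E (Prod E [A, D]) [Proj E [A, D] 0, Comp E h (Proj E [A, D] 1)]) = c"

definition transpose :: "('o, 'a, 'z) topos_scheme \<Rightarrow> 'o \<Rightarrow> 'o \<Rightarrow> 'a \<Rightarrow> 'a" where
  "transpose E A D c = (THE h. is_transpose E A D c h)"

text \<open>
  The axioms on the data above. They make the definite descriptions \<open>tuple\<close>, \<open>chi\<close> (on
  monomorphisms) and \<open>transpose\<close> well defined.
\<close>

definition is_category :: "('o, 'a, 'z) topos_scheme \<Rightarrow> bool" where
  "is_category E \<longleftrightarrow>
    (\<forall>f\<in>Arr E. Dom E f \<in> Ob E \<and> Cod E f \<in> Ob E) \<and>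
    (\<forall>A\<in>Ob E. Ident E A \<in> Hom E A A) \<and>
    (\<forall>f\<in>Arr E. \<forall>g\<in>Arr E. Dom E g = Cod E f \<longrightarrow> Comp E g f \<in> Hom E (Dom E f) (Cod E g)) \<and>
    (\<forall>f\<in>Arr E. Comp E f (Ident E (Dom E f)) = f \<and> Comp E (Ident E (Cod E f)) f = f) \<and>
    (\<forall>f\<in>Arr E. \<forall>g\<in>Arr E. \<forall>h\<in>Arr E. Dom E g = Cod E f \<and> Dom E h = Cod E g \<longrightarrow>
      Comp E h (Comp E g f) = Comp E (Comp E h g) f)"

definition is_topos :: "('o, 'a, 'z) topos_scheme \<Rightarrow> bool" where
  "is_topos E \<longleftrightarrow>
    is_category E \<and>
    (\<forall>As. set As \<subseteq> Ob E \<longrightarrow> Prod E As \<in> Ob E \<and>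
      (\<forall>i<length As. Proj E As i \<in> Hom E (Prod E As) (As ! i))) \<and>
    (\<forall>A\<in>Ob E. Prod E [A] = A \<and> Proj E [A] 0 = Ident E A) \<and>
    (\<forall>D\<in>Ob E. \<forall>fs. (\<forall>f\<in>set fs. f \<in> Arr E \<and> Dom E f = D) \<longrightarrow> (\<exists>!h. is_tuple E D fs h)) \<and>
    Omega E \<in> Ob E \<and> Truth E \<in> Hom E (Prod E []) (Omega E) \<and>
    (\<forall>c\<in>Arr E. Cod E c = Omega E \<longrightarrow> (\<exists>m. classifies E m c)) \<and>
    (\<forall>m. mono_arrow E m \<longrightarrow> (\<exists>!c. classifies E m c)) \<and>
    (\<forall>A\<in>Ob E. PowOb E A \<in> Ob E \<and> Ev E A \<in> Hom E (Prod E [A, PowOb E A]) (Omega E) \<and>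
      (\<forall>D\<in>Ob E. \<forall>c\<in>Hom E (Prod E [A, D]) (Omega E). \<exists>!h. is_transpose E A D c h))"

definition diag_eq :: "('o, 'a, 'z) topos_scheme \<Rightarrow> 'o \<Rightarrow> 'a" where
  "diag_eq E A = chi E (tuple E A [Ident E A, Ident E A])"

text \<open>The meet and the order of arrows \<open>D \<rightarrow> Omega\<close>.\<close>

definition meet :: "('o, 'a, 'z) topos_scheme \<Rightarrow> 'o \<Rightarrow> 'a \<Rightarrow> 'a \<Rightarrow> 'a" where
  "meet E D a b =
    Comp E (chi E (tuple E (Prod E []) [Truth E, Truth E])) (tuple E D [a, b])"

definition below :: "('o, 'a, 'z) topos_scheme \<Rightarrow> 'o \<Rightarrow> 'a \<Rightarrow> 'a \<Rightarrow> bool" where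
  "below E D a b \<longleftrightarrow> meet E D a b = a"


subsection \<open>The internal language and its theory\<close>

primrec ty_obj :: "('o, 'a, 'z) topos_scheme \<Rightarrow> 'o ty \<Rightarrow> 'o" where
  "ty_obj E TUnit = Prod E []"
| "ty_obj E TOmega = Omega E"
| "ty_obj E (TGround Z) = Z"
| "ty_obj E (TPow A) = PowOb E (ty_obj E A)"
| "ty_obj E (TProd As) = Prod E (map (ty_obj E) As)"

text \<open>
  The ground type symbols of the internal language are the objects other than 1 and \<open>Omega\<close>,
  which are matched by the unity and truth-value types. A function symbol is an arrow \<open>g\<close> together
  with types \<open>A\<close>, \<open>B\<close> denoting its domain and codomain: as types are freely generated, an object
  may be denoted by several types (such as \<open>TGround (PowOb E Z)\<close> and \<open>TPow (TGround Z)\<close>).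
\<close>

type_synonym ('o, 'a) fsym = "'a \<times> 'o ty \<times> 'o ty"

definition int_lang :: "('o, 'a, 'z) topos_scheme \<Rightarrow> ('o, ('o, 'a) fsym) lang" where
  "int_lang E =
    (let G = Ob E - {Prod E [], Omega E} in
      \<lparr>ground = G,
       funs = {(g, A, B). is_ty G A \<and> is_ty G B \<and> g \<in> Hom E (ty_obj E A) (ty_obj E B)},
       sig = snd\<rparr>)"

definition type_sym :: "('o, 'a, 'z) topos_scheme \<Rightarrow> 'o \<Rightarrow> 'o ty" where
  "type_sym E Z = (if Z = Prod E [] then TUnit else if Z = Omega E then TOmega else TGround Z)"

definition fun_sym :: "('o, 'a, 'z) topos_scheme \<Rightarrow> 'a \<Rightarrow> ('o, 'a) fsym" where
  "fun_sym E g = (g, type_sym E (Dom E g), type_sym E (Cod E g))"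

text \<open>The canonical isomorphism \<open>A \<times> (D\<^sub>1 \<times> \<dots> \<times> D\<^sub>n) \<rightarrow> A \<times> D\<^sub>1 \<times> \<dots> \<times> D\<^sub>n\<close>.\<close>

definition can :: "('o, 'a, 'z) topos_scheme \<Rightarrow> 'o \<Rightarrow> 'o list \<Rightarrow> 'a" where
  "can E A Ds =
    tuple E (Prod E [A, Prod E Ds])
      (Proj E [A, Prod E Ds] 0 #
       map (\<lambda>i. Comp E (Proj E Ds i) (Proj E [A, Prod E Ds] 1)) [0..<length Ds])"

definition ctx :: "('o, 'a, 'z) topos_scheme \<Rightarrow> 'o var list \<Rightarrow> 'o ty list \<Rightarrow> 'o list" where
  "ctx E xs Bs = map (ty_obj E) (Bs @ map snd xs)"

text \<open>
  \<open>interp E xs t []\<close> is the interpretation of \<open>t\<close> with respect to a list \<open>xs\<close> of distinct variables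
  containing those free in \<open>t\<close>, an arrow with domain the product of the types of \<open>xs\<close>. In general
  the dangling indices, of types \<open>Bs\<close>, act as additional variables in front of \<open>xs\<close>.
\<close>

fun interp ::
  "('o, 'a, 'z) topos_scheme \<Rightarrow> 'o var list \<Rightarrow> ('o, ('o, 'a) fsym) trm \<Rightarrow> 'o ty list \<Rightarrow> 'a" where
  "interp E xs (Bound i) Bs = Proj E (ctx E xs Bs) i"
| "interp E xs (Var x) Bs =
    Proj E (ctx E xs Bs) (length Bs + length (takeWhile (\<lambda>y. y \<noteq> x) xs))"
| "interp E xs Star Bs = tuple E (Prod E (ctx E xs Bs)) []"
| "interp E xs (App h t) Bs = Comp E (fst h) (interp E xs t Bs)"
| "interp E xs (Tuple ts) Bs =
    tuple E (Prod E (ctx E xs Bs)) (map (\<lambda>t. interp E xs t Bs) ts)"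
| "interp E xs (Prj As i t) Bs = Comp E (Proj E (map (ty_obj E) As) i) (interp E xs t Bs)"
| "interp E xs (Compr A a) Bs =
    transpose E (ty_obj E A) (Prod E (ctx E xs Bs))
      (Comp E (interp E xs a (A # Bs)) (can E (ty_obj E A) (ctx E xs Bs)))"
| "interp E xs (s \<doteq> t) Bs =
    Comp E (diag_eq E (Cod E (interp E xs s Bs)))
      (tuple E (Prod E (ctx E xs Bs)) [interp E xs s Bs, interp E xs t Bs])"
| "interp E xs (s \<in>\<^sub>t t) Bs =
    Comp E (Ev E (Cod E (interp E xs s Bs)))
      (tuple E (Prod E (ctx E xs Bs)) [interp E xs s Bs, interp E xs t Bs])"

text \<open>A sequent is valid if the meet of its antecedent is below its succedent, interpreted with
  respect to exactly the variables free in the sequent; the order in which the variables and the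
  antecedent are listed is immaterial.\<close>

definition valid ::
  "('o, 'a, 'z) topos_scheme \<Rightarrow> ('o, ('o, 'a) fsym) trm set \<Rightarrow> ('o, ('o, 'a) fsym) trm \<Rightarrow> bool" where
  "valid E \<Gamma> \<alpha> \<longleftrightarrow>
    (\<forall>xs \<gamma>s. distinct xs \<and> set xs = \<Union> (fv ` \<Gamma>) \<union> fv \<alpha> \<and> distinct \<gamma>s \<and> set \<gamma>s = \<Gamma> \<longrightarrow>
      (let D = Prod E (ctx E xs []) in
        below E D (foldr (\<lambda>\<gamma>. meet E D (interp E xs \<gamma> [])) \<gamma>s (true_on E D)) (interp E xs \<alpha> [])))"

definition Th :: "('o, 'a, 'z) topos_scheme \<Rightarrow> ('o, ('o, 'a) fsym) sequent set" where
  "Th E = {(\<Gamma>, \<alpha>). (\<Gamma>, \<alpha>) \<in> sequents (int_lang E) \<and> valid E \<Gamma> \<alpha>}"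


section \<open>The linguistic topos\<close>

text \<open>As usual, closed terms are identified when \<open>S\<close> proves them equal: the objects and
  the graphs of arrows of the linguistic topos are classes of closed terms.\<close>

definition cls :: "('g, 'f) sequent set \<Rightarrow> ('g, 'f) trm \<Rightarrow> ('g, 'f) trm set" where
  "cls S t = {t'. fv t' = {} \<and> ({} \<turnstile>[S] t \<doteq> t')}"

definition rep :: "('g, 'f) trm set \<Rightarrow> ('g, 'f) trm" where
  "rep Z = (SOME X. X \<in> Z)"

type_synonym ('g, 'f) sobj = "('g, 'f) trm set"
type_synonym ('g, 'f) sarr = "('g, 'f) trm set \<times> ('g, 'f) sobj \<times> ('g, 'f) sobj"

text \<open>The triple \<open>(F, X, Y)\<close> as an arrow, and the special case \<open>(x \<mapsto> \<tau>) : X \<rightarrow> Y\<close>.\<close>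

definition sfun ::
  "('g, 'f) sequent set \<Rightarrow> ('g, 'f) trm \<Rightarrow> ('g, 'f) trm \<Rightarrow> ('g, 'f) trm \<Rightarrow> ('g, 'f) sarr" where
  "sfun S F X Y = (cls S F, cls S X, cls S Y)"

definition maps_to ::
  "('g, 'f, 'z) lang_scheme \<Rightarrow> ('g, 'f) sequent set \<Rightarrow>
    'g var \<Rightarrow> ('g, 'f) trm \<Rightarrow> ('g, 'f) trm \<Rightarrow> ('g, 'f) trm \<Rightarrow> ('g, 'f) sarr" where
  "maps_to L S x \<tau> X Y = sfun S (maps_graph x X (elem_ty L Y) \<tau>) X Y"

definition ling_topos ::
  "('g, 'f, 'z) lang_scheme \<Rightarrow> ('g, 'f) sequent set \<Rightarrow> (('g, 'f) sobj, ('g, 'f) sarr) topos" where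
  "ling_topos L S =
    (let ety = \<lambda>Z. elem_ty L (rep Z);
         prods = \<lambda>Zs. prod_set (map ety Zs) (map rep Zs) in
    \<lparr>Ob = {cls S X | X. is_sset L X},
     Arr = {sfun S F X Y | F X Y. is_sfun L S F X Y},
     Dom = (\<lambda>(F, X, Y). X),
     Cod = (\<lambda>(F, X, Y). Y),
     Comp = (\<lambda>(G, Y', Z) (F, X, Y).
       (cls S (comp_graph (ety X) (ety Y) (ety Z) (rep G) (rep F)), X, Z)),
     Ident = (\<lambda>Z. let x = (0, ety Z) in maps_to L S x (Var x) (rep Z) (rep Z)),
     Prod = (\<lambda>Zs. cls S (prods Zs)),
     Proj = (\<lambda>Zs i. let z = (0, mk_prod (map ety Zs)) in
       maps_to L S z (mk_prj (map ety Zs) i (Var z)) (prods Zs) (rep (Zs ! i))),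
     Omega = cls S (U TOmega),
     Truth = maps_to L S (0, TUnit) Tru (U TUnit) (U TOmega),
     PowOb = (\<lambda>Z. cls S (pow_set (ety Z) (rep Z))),
     Ev = (\<lambda>Z. let A = ety Z; X = rep Z; x = (0, A); u = (1, TPow A) in
       sfun S
         (set_of (TProd [TProd [A, TPow A], TOmega]) [x, u]
           (Tuple [Tuple [Var x, Var u], Var x \<in>\<^sub>t Var u])
           ((Var x \<in>\<^sub>t X) \<and>\<^sub>t (Var u \<in>\<^sub>t pow_set A X)))
         (prod_set [A, TPow A] [X, pow_set A X])
         (U TOmega))\<rparr>)"


subsection \<open>The canonical translation\<close>

text \<open>
  On types, the canonical translation sends ground types \<open>A\<close>, as well as 1 and the truth-value
  type, to the type symbol of \<open>U A\<close>, and it preserves products and powers. In all cases the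
  image of \<open>A\<close> denotes the object \<open>U A\<close> of the linguistic topos.
\<close>

primrec eta_ty ::
  "('g, 'f, 'z) lang_scheme \<Rightarrow> ('g, 'f) sequent set \<Rightarrow> 'g ty \<Rightarrow> ('g, 'f) sobj ty" where
  "eta_ty L S TUnit = TUnit"
| "eta_ty L S TOmega = TOmega"
| "eta_ty L S (TGround g) = type_sym (ling_topos L S) (cls S (U (TGround g)))"
| "eta_ty L S (TPow A) = TPow (eta_ty L S A)"
| "eta_ty L S (TProd As) = TProd (map (eta_ty L S) As)"

definition eta_var ::
  "('g, 'f, 'z) lang_scheme \<Rightarrow> ('g, 'f) sequent set \<Rightarrow> 'g var \<Rightarrow> ('g, 'f) sobj var" where
  "eta_var L S x = (fst x, eta_ty L S (snd x))"

definition eta_fun ::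
  "('g, 'f, 'z) lang_scheme \<Rightarrow> ('g, 'f) sequent set \<Rightarrow> 'f \<Rightarrow>
    (('g, 'f) sobj, ('g, 'f) sarr) fsym" where
  "eta_fun L S h =
    (let (A, B) = sig L h; x = (0, A) in
      (maps_to L S x (App h (Var x)) (U A) (U B), eta_ty L S A, eta_ty L S B))"

primrec eta ::
  "('g, 'f, 'z) lang_scheme \<Rightarrow> ('g, 'f) sequent set \<Rightarrow> ('g, 'f) trm \<Rightarrow>
    (('g, 'f) sobj, (('g, 'f) sobj, ('g, 'f) sarr) fsym) trm" where
  "eta L S (Bound i) = Bound i"
| "eta L S (Var x) = Var (eta_var L S x)"
| "eta L S Star = Star"
| "eta L S (App h t) = App (eta_fun L S h) (eta L S t)"
| "eta L S (Tuple ts) = Tuple (map (eta L S) ts)"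
| "eta L S (Prj As i t) = Prj (map (eta_ty L S) As) i (eta L S t)"
| "eta L S (Compr A a) = Compr (eta_ty L S A) (eta L S a)"
| "eta L S (s \<doteq> t) = (eta L S s \<doteq> eta L S t)"
| "eta L S (s \<in>\<^sub>t t) = (eta L S s \<in>\<^sub>t eta L S t)"

text \<open>
  The function symbol of \<open>i\<^sub>X = (x \<mapsto> x) : X \<rightarrow> U A\<close>. Its codomain type is the translation of \<open>A\<close>, so
  that it can be substituted for translated variables of type \<open>A\<close>.
\<close>

definition incl_sym ::
  "('g, 'f, 'z) lang_scheme \<Rightarrow> ('g, 'f) sequent set \<Rightarrow> ('g, 'f) trm \<Rightarrow>
    (('g, 'f) sobj, ('g, 'f) sarr) fsym" where
  "incl_sym L S X =
    (let A = elem_ty L X; x = (0, A) in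
      (maps_to L S x (Var x) X (U A), type_sym (ling_topos L S) (cls S X), eta_ty L S A))"

text \<open>The graph \<open>{\<langle>u, v\<rangle> : \<gamma>(x/i\<^sub>X(u), y/i\<^sub>Y(v))}\<close>.\<close>

definition star_graph ::
  "('g, 'f, 'z) lang_scheme \<Rightarrow> ('g, 'f) sequent set \<Rightarrow> ('g, 'f) trm \<Rightarrow> ('g, 'f) trm \<Rightarrow>
    'g var \<Rightarrow> 'g var \<Rightarrow> ('g, 'f) trm \<Rightarrow> ('g, 'f) sobj var \<Rightarrow> ('g, 'f) sobj var \<Rightarrow>
    (('g, 'f) sobj, (('g, 'f) sobj, ('g, 'f) sarr) fsym) trm" where
  "star_graph L S X Y x y \<gamma> u v =
    graph u v
      (subst (Var(eta_var L S x := App (incl_sym L S X) (Var u),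
                  eta_var L S y := App (incl_sym L S Y) (Var v)))
        (eta L S \<gamma>))"

end

theory Submission
  imports Defs
begin

text \<open>
  The proof evaluates both sides in the linguistic topos. A world consists of finitely many variables and
  hypotheses, and a formula is forced at a world if \<open>S\<close> derives it there; the logical operations
  then have the usual Kripke-Joyal clauses, so that derivations in \<open>S\<close> become ordinary arguments
  about all later worlds and all terms. An arrow of the topos is determined by the pairs \<open>(s, t)\<close>
  for which \<open>\<langle>s, t\<rangle>\<close> is forced to lie in its graph, and tuples, classifying arrows and transposes
  are computed from this description. By induction, a term of the internal language denotes an
  arrow whose value at given elements is an explicit term of \<open>L\<close>. For a translated term the value
  is the original term, while \<open>i\<^sub>X\<close> has the identity as its value, so the interpretations of \<open>|f\<^sup>*|\<close>
  and of the graph of \<open>(u \<mapsto> f(u))\<close> both evaluate to \<open>{\<langle>x, y\<rangle> : \<gamma>}\<close>.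
\<close>

section \<open>Substitution and typing\<close>

text \<open>The obstacle is that a value need not be named by a term. A function of \<open>S\<close>
  is total in the internal logic only, so at a given world no term of \<open>L\<close> may denote
  its value, and a type may have no closed term at all. Totality is therefore always used in
  eliminated form: a formula that is forced at all later worlds with a value is forced already. This
  yields formulas and nothing else, so every argument is arranged to end in a membership or an
  equation, and two arrows are compared through their pairs at all worlds.

  The interpretation is computed in the linguistic topos itself. Each definite description that it
  meets (\<open>tuple\<close>, \<open>chi\<close>, \<open>transpose\<close>) is shown to have a
  unique solution there, and the value of that solution is recorded. Validity in \<open>Th E\<close>
  depends on interpretations only. Hence closed terms with the same interpretation have the same
  class of provable equals, which gives the equality of the two functions; and the membership of the
  pair \<open>(u, f(u))\<close> holds because its interpretation is the arrow that is constantly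
  true.\<close>

text \<open>Local closure. Neither \<open>subst\<close> nor \<open>msub\<close> shifts the terms
  that it inserts under a binder; for terms satisfying \<open>lc 0\<close> no shift is due.\<close>

fun lc :: "nat \<Rightarrow> ('g, 'f) trm \<Rightarrow> bool" where
  "lc k (Bound i) \<longleftrightarrow> i < k"
| "lc k (Var x) \<longleftrightarrow> True"
| "lc k Star \<longleftrightarrow> True"
| "lc k (App h t) \<longleftrightarrow> lc k t"
| "lc k (Tuple ts) \<longleftrightarrow> (\<forall>t\<in>set ts. lc k t)"
| "lc k (Prj As i t) \<longleftrightarrow> lc k t"
| "lc k (Compr A a) \<longleftrightarrow> lc (Suc k) a"
| "lc k (s \<doteq> t) \<longleftrightarrow> lc k s \<and> lc k t"
| "lc k (s \<in>\<^sub>t t) \<longleftrightarrow> lc k s \<and> lc k t"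

text \<open>Instantiates the free variables by \<open>\<theta>\<close> and the dangling indices \<open>k, k + 1, \<dots>\<close> by \<open>\<delta>\<close>.
  Indices beyond \<open>k + length \<delta>\<close> are not shifted down.\<close>

fun msub :: "('g var \<Rightarrow> ('g, 'f) trm) \<Rightarrow> ('g, 'f) trm list \<Rightarrow> nat \<Rightarrow> ('g, 'f) trm \<Rightarrow> ('g, 'f) trm"
  where
  "msub \<theta> \<delta> k (Bound i) = (if k \<le> i \<and> i < k + length \<delta> then \<delta> ! (i - k) else Bound i)"
| "msub \<theta> \<delta> k (Var x) = \<theta> x"
| "msub \<theta> \<delta> k Star = Star"
| "msub \<theta> \<delta> k (App h t) = App h (msub \<theta> \<delta> k t)"
| "msub \<theta> \<delta> k (Tuple ts) = Tuple (map (msub \<theta> \<delta> k) ts)"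
| "msub \<theta> \<delta> k (Prj As i t) = Prj As i (msub \<theta> \<delta> k t)"
| "msub \<theta> \<delta> k (Compr A a) = Compr A (msub \<theta> \<delta> (Suc k) a)"
| "msub \<theta> \<delta> k (s \<doteq> t) = (msub \<theta> \<delta> k s \<doteq> msub \<theta> \<delta> k t)"
| "msub \<theta> \<delta> k (s \<in>\<^sub>t t) = (msub \<theta> \<delta> k s \<in>\<^sub>t msub \<theta> \<delta> k t)"

abbreviation inst :: "('g, 'f) trm \<Rightarrow> ('g, 'f) trm \<Rightarrow> ('g, 'f) trm" where
  "inst s \<equiv> msub Var [s] 0"

section \<open>Substitution and instantiation of indices\<close>

lemma subst_Var [simp]: "subst Var t = t"
  by (induction t) (auto simp: map_idI)

lemma subst_cong: "(\<And>x. x \<in> fv t \<Longrightarrow> \<sigma> x = \<tau> x) \<Longrightarrow> subst \<sigma> t = subst \<tau> t"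
  by (induction t) auto

lemma subst_closed: "fv t = {} \<Longrightarrow> subst \<sigma> t = t"
  using subst_cong[of t \<sigma> Var] by simp

lemma msub_cong: "(\<And>x. x \<in> fv t \<Longrightarrow> \<sigma> x = \<tau> x) \<Longrightarrow> msub \<sigma> \<delta> k t = msub \<tau> \<delta> k t"
proof (induction t arbitrary: k)
  case (Tuple ts)
  then show ?case by (simp, blast)
qed simp_all

text \<open>All dangling indices lie below \<open>m\<close>, so the replacement of indices from
  \<open>m\<close> on never applies and only the free variables change.\<close>

lemma msub_lc: "lc k t \<Longrightarrow> k \<le> m \<Longrightarrow> msub \<theta> \<delta> m t = subst \<theta> t"
proof (induction t arbitrary: k m)
  case (Compr A a)
  then show ?case using Compr.IH[of "Suc k" "Suc m"] by simp
qed auto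

lemma msub_Nil: "msub \<theta> [] k t = subst \<theta> t"
  by (induction t arbitrary: k) auto

lemma subst_msub: "subst \<sigma> (msub \<theta> \<delta> k t) = msub (\<lambda>x. subst \<sigma> (\<theta> x)) (map (subst \<sigma>) \<delta>) k t"
  by (induction t arbitrary: k) auto

lemma subst_subst: "subst \<sigma> (subst \<theta> t) = subst (\<lambda>x. subst \<sigma> (\<theta> x)) t"
  by (induction t) auto

text \<open>The inner instantiation inserts locally closed terms, on which the outer one acts as a
  plain substitution. The indices replaced by the outer one are those just below the inner ones,
  which is why \<open>\<delta>'\<close> comes in front.\<close>

lemma msub_msub:
  assumes "\<And>x. x \<in> fv t \<Longrightarrow> lc 0 (\<theta> x)" and "\<And>s. s \<in> set \<delta> \<Longrightarrow> lc 0 s"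
  shows "msub \<theta>' \<delta>' k (msub \<theta> \<delta> (k + length \<delta>') t)
    = msub (\<lambda>x. subst \<theta>' (\<theta> x)) (\<delta>' @ map (subst \<theta>') \<delta>) k t"
  using assms(1)
proof (induction t arbitrary: k)
  case (Bound i)
  show ?case
    using assms(2) by (auto simp: nth_append msub_lc[where k = 0])
next
  case (Compr A a)
  then show ?case using Compr.IH[of "Suc k"] by simp
next
  case (Tuple ts)
  then show ?case by (simp, blast)
qed (simp_all add: msub_lc[where k = 0])

text \<open>After \<open>bind\<close> no index above \<open>k\<close> dangles, so the tail
  \<open>\<delta>\<close> is never consulted.\<close>

lemma msub_bind: "lc k t \<Longrightarrow> msub \<theta> (s # \<delta>) k (bind x t k) = subst (\<theta>(x := s)) t"
  by (induction t arbitrary: k) auto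

lemma bind_msub: "x \<notin> fv t \<Longrightarrow> bind x (msub Var [Var x] k t) k = t"
  by (induction t arbitrary: k) (auto simp: map_idI)

lemma msub_subst_bind:
  assumes "lc 0 \<phi>" and "\<And>v. v \<noteq> x \<Longrightarrow> lc 0 (\<sigma> v)"
  shows "inst t (subst \<sigma> (bind x \<phi> 0)) = subst (\<sigma>(x := t)) \<phi>"
proof -
  have x: "x \<notin> fv (bind x \<phi> k)" for k
    by (induction \<phi> arbitrary: k) auto
  \<comment> \<open>\<open>x\<close> does not occur after \<open>bind\<close>, so its value may be
    reset to \<open>Star\<close>. All values are then locally closed and the two instantiations can
    be composed.\<close>
  let ?\<sigma> = "\<sigma>(x := Star)"
  have "subst \<sigma> (bind x \<phi> 0) = subst ?\<sigma> (bind x \<phi> 0)"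
    using x by (intro subst_cong) auto
  also have "\<dots> = msub ?\<sigma> [] (0 + length [t]) (bind x \<phi> 0)" by (simp add: msub_Nil)
  finally have "inst t (subst \<sigma> (bind x \<phi> 0)) = msub ?\<sigma> [t] 0 (bind x \<phi> 0)"
    using msub_msub[of "bind x \<phi> 0" ?\<sigma> "[]" Var "[t]" 0] assms(2)
    by (simp add: fun_upd_def)
  also have "\<dots> = subst (\<sigma>(x := t)) \<phi>"
    using msub_bind[OF assms(1), of ?\<sigma> t "[]" x] by simp
  finally show ?thesis .
qed

lemma fv_bind [simp]: "fv (bind x t k) = fv t - {x}"
  by (induction t arbitrary: k) auto

lemma finite_fv [simp]: "finite (fv t)"
  by (induction t) auto

lemma fv_msub_subset:
  "fv (msub \<theta> \<delta> k t) \<subseteq> (\<Union>x\<in>fv t. fv (\<theta> x)) \<union> \<Union> (fv ` set \<delta>)"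
proof (induction t arbitrary: k)
  case (Bound i)
  then show ?case by (auto intro!: bexI[of _ "\<delta> ! (i - k)"])
next
  case (Tuple ts)
  then have "\<Union> (fv ` set (map (msub \<theta> \<delta> k) ts))
      \<subseteq> (\<Union>t\<in>set ts. (\<Union>x\<in>fv t. fv (\<theta> x)) \<union> \<Union> (fv ` set \<delta>))"
    unfolding set_map image_image by (intro UN_mono) simp_all
  also have "\<dots> \<subseteq> (\<Union>x\<in>fv (Tuple ts). fv (\<theta> x)) \<union> \<Union> (fv ` set \<delta>)" by auto
  finally show ?case by simp
next
  case (Eq s t)
  show ?case using Eq.IH[of k] unfolding msub.simps fv.simps UN_Un by blast
next
  case (Mem s t)
  show ?case using Mem.IH[of k] unfolding msub.simps fv.simps UN_Un by blast
qed simp_all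

lemma fv_subst: "fv (subst \<theta> t) = (\<Union>x\<in>fv t. fv (\<theta> x))"
  by (induction t) auto

lemma fv_inst_subset: "fv a \<subseteq> V \<Longrightarrow> fv s \<subseteq> V \<Longrightarrow> fv (inst s a) \<subseteq> V"
  using fv_msub_subset[of Var "[s]" 0 a] by auto

lemma inst_lc [simp]: "lc 0 t \<Longrightarrow> msub Var \<delta> k t = t"
  using msub_lc[of 0 t k Var] by simp

\<comment> \<open>Typing and its stability\<close>
inductive_simps has_type_simps [simp]:
  "has_type L Bs (Bound i) A"
  "has_type L Bs (Var x) A"
  "has_type L Bs Star A"
  "has_type L Bs (App h t) A"
  "has_type L Bs (Tuple ts) A"
  "has_type L Bs (Prj As i t) A"
  "has_type L Bs (Compr B a) A"
  "has_type L Bs (s \<doteq> t) A"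
  "has_type L Bs (s \<in>\<^sub>t t) A"

lemma has_type_lc: "has_type L Bs t A \<Longrightarrow> lc (length Bs) t"
proof (induction t arbitrary: Bs A)
  case (Tuple ts)
  then show ?case by (fastforce simp: list_all2_conv_all_nth in_set_conv_nth)
qed fastforce+

lemma has_type_lc0: "has_type L [] t A \<Longrightarrow> lc 0 t"
  using has_type_lc by fastforce

text \<open>Variables, projections and set terms carry their types and function symbols have a fixed
  signature, so the type can be read off the term.\<close>

lemma has_type_unique: "has_type L Bs t A \<Longrightarrow> has_type L Bs t B \<Longrightarrow> A = B"
proof (induction t arbitrary: Bs A B)
  case (Tuple ts)
  from Tuple.prems obtain As Bs' where A: "A = TProd As" "B = TProd Bs'"
    and "list_all2 (has_type L Bs) ts As" "list_all2 (has_type L Bs) ts Bs'" by auto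
  then have "As = Bs'"
    using Tuple.IH by (intro nth_equalityI) (simp_all add: list_all2_conv_all_nth, metis nth_mem)
  then show ?case using A by simp
qed fastforce+

text \<open>Index 0 belongs to the innermost binder, so types appended at the end renumber
  nothing.\<close>

lemma has_type_weaken: "has_type L Bs t A \<Longrightarrow> has_type L (Bs @ Cs) t A"
proof (induction t arbitrary: Bs A)
  case (Bound i)
  then show ?case by (auto simp: nth_append)
next
  case (Tuple ts)
  then show ?case by (fastforce simp: list_all2_conv_all_nth)
next
  case (Compr B a)
  then show ?case using Compr.IH[of "B # Bs"] by auto
qed fastforce+

lemma has_type_weaken0: "has_type L [] t A \<Longrightarrow> has_type L Cs t A"
  using has_type_weaken[of L "[]"] by simp

lemma has_type_fv: "has_type L Bs t A \<Longrightarrow> x \<in> fv t \<Longrightarrow> is_ty (ground L) (snd x)"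
proof (induction t arbitrary: Bs A)
  case (Tuple ts)
  then show ?case by (fastforce simp: list_all2_conv_all_nth in_set_conv_nth)
qed fastforce+

text \<open>The inserted terms have no dangling indices and keep their types below any binder;
  \<open>Cs\<close> collects the binders passed on the way down.\<close>

lemma has_type_msub:
  assumes "has_type L (Cs @ Bs) t B"
    and "list_all2 (has_type L []) \<delta> Bs"
    and "\<And>x. x \<in> fv t \<Longrightarrow> has_type L [] (\<theta> x) (snd x)"
  shows "has_type L Cs (msub \<theta> \<delta> (length Cs) t) B"
  using assms(1,3)
proof (induction t arbitrary: Cs B)
  case (Bound i)
  then show ?case using assms(2)
    by (auto simp: nth_append list_all2_conv_all_nth intro: has_type_weaken0)
next
  case (Var x)
  then show ?case by (simp add: has_type_weaken0)
next
  case (App h t)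
  then show ?case by (simp, blast)
next
  case (Tuple ts)
  then obtain As where As: "B = TProd As" "2 \<le> length ts" "list_all2 (has_type L (Cs @ Bs)) ts As"
    by auto
  have "has_type L Cs (msub \<theta> \<delta> (length Cs) (ts ! i)) (As ! i)" if "i < length ts" for i
    using Tuple.IH[of "ts ! i"] Tuple.prems(2) As(3) that
    by (simp add: list_all2_conv_all_nth, metis nth_mem)
  then show ?case using As by (simp add: list_all2_conv_all_nth)
next
  case (Prj As i t)
  then show ?case by simp
next
  case (Compr A a)
  then show ?case using Compr.IH[of "A # Cs"] by auto
next
  case (Eq s t)
  then show ?case by (simp, metis UnI1 UnI2)
next
  case (Mem s t)
  then show ?case by (simp, metis UnI1 UnI2)
qed simp

lemma has_type_inst:
  assumes "has_type L [A] a B" and "has_type L [] s A"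
  shows "has_type L [] (inst s a) B"
  using has_type_msub[of L "[]" "[A]" a B "[s]" Var] has_type_fv[OF assms(1)] assms by simp

lemma has_type_subst:
  assumes "has_type L Bs t A" and "\<And>x. x \<in> fv t \<Longrightarrow> has_type L [] (\<sigma> x) (snd x)"
  shows "has_type L Bs (subst \<sigma> t) A"
  using has_type_msub[of L Bs "[]" t A "[]" \<sigma>] assms by (simp add: msub_Nil)

lemma has_type_bind:
  "has_type L Bs t A \<Longrightarrow> is_ty (ground L) (snd x) \<Longrightarrow> has_type L (Bs @ [snd x]) (bind x t (length Bs)) A"
proof (induction t arbitrary: Bs A)
  case (Bound i)
  then show ?case by (auto simp: nth_append)
next
  case (Tuple ts)
  then show ?case by (fastforce simp: list_all2_conv_all_nth)
next
  case (Compr B a)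
  then show ?case using Compr.IH[of "B # Bs"] by auto
qed fastforce+

text \<open>Well-formedness of \<open>L\<close> enters at function symbols, whose signatures it
  makes well formed.\<close>

lemma has_type_is_ty:
  assumes "local_language L" and "has_type L Bs t A" and "\<forall>B\<in>set Bs. is_ty (ground L) B"
  shows "is_ty (ground L) A"
  using assms(2,3)
proof (induction t arbitrary: Bs A)
  case (App h t)
  then show ?case using assms(1) by (fastforce simp: local_language_def)
next
  case (Tuple ts)
  then obtain As where As: "A = TProd As" "2 \<le> length ts" "list_all2 (has_type L Bs) ts As"
    by auto
  have "is_ty (ground L) (As ! i)" if "i < length ts" for i
    using Tuple.IH[of "ts ! i"] Tuple.prems(2) As(3) that by (auto simp: list_all2_conv_all_nth)
  then show ?case using As by (auto simp: list_all2_conv_all_nth in_set_conv_nth)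
next
  case (Prj As i t)
  then have "is_ty (ground L) (TProd As)" using Prj.IH[of Bs "TProd As"] by simp
  then show ?case using Prj.prems(1) by auto
next
  case (Compr B a)
  then show ?case by auto
qed auto

section \<open>Forcing\<close>

lemma ex_fresh:
  fixes V :: "'g var set"
  assumes "finite V"
  shows "\<exists>z. z \<notin> V \<and> snd z = A"
proof -
  have "\<exists>n. n \<notin> fst ` V" by (rule ex_new_if_finite[OF infinite_UNIV_nat]) (simp add: assms)
  then obtain n where "n \<notin> fst ` V" ..
  then have "(n, A) \<notin> V" using image_eqI[of n fst "(n, A)" V] by auto
  then show ?thesis by (intro exI[of _ "(n, A)"]) simp
qed

lemma msub_connectives [simp]:
  "msub \<theta> \<delta> k Tru = Tru"
  "msub \<theta> \<delta> k (\<alpha> \<and>\<^sub>t \<beta>) = (msub \<theta> \<delta> k \<alpha> \<and>\<^sub>t msub \<theta> \<delta> k \<beta>)"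
  "msub \<theta> \<delta> k (\<alpha> \<longrightarrow>\<^sub>t \<beta>) = (msub \<theta> \<delta> k \<alpha> \<longrightarrow>\<^sub>t msub \<theta> \<delta> k \<beta>)"
  "msub \<theta> \<delta> k (All A a) = All A (msub \<theta> \<delta> (Suc k) a)"
  "msub \<theta> \<delta> k (Ex A a) = Ex A (msub \<theta> \<delta> (Suc (Suc k)) a)"
  by (simp_all add: Tru_def And_def Imp_def All_def Ex_def)

lemma subst_connectives [simp]:
  "subst \<sigma> Tru = Tru"
  "subst \<sigma> (\<alpha> \<and>\<^sub>t \<beta>) = (subst \<sigma> \<alpha> \<and>\<^sub>t subst \<sigma> \<beta>)"
  "subst \<sigma> (\<alpha> \<longrightarrow>\<^sub>t \<beta>) = (subst \<sigma> \<alpha> \<longrightarrow>\<^sub>t subst \<sigma> \<beta>)"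
  "subst \<sigma> (All A a) = All A (subst \<sigma> a)"
  "subst \<sigma> (Ex A a) = Ex A (subst \<sigma> a)"
  by (simp_all add: Tru_def And_def Imp_def All_def Ex_def)

lemma fv_connectives [simp]:
  "fv Tru = {}"
  "fv (\<alpha> \<and>\<^sub>t \<beta>) = fv \<alpha> \<union> fv \<beta>"
  "fv (\<alpha> \<longrightarrow>\<^sub>t \<beta>) = fv \<alpha> \<union> fv \<beta>"
  "fv (All A a) = fv a"
  "fv (Ex A a) = fv a"
  by (auto simp: Tru_def And_def Imp_def All_def Ex_def)

lemma lc_connectives [simp]:
  "lc k Tru"
  "lc k (\<alpha> \<and>\<^sub>t \<beta>) \<longleftrightarrow> lc k \<alpha> \<and> lc k \<beta>"
  "lc k (\<alpha> \<longrightarrow>\<^sub>t \<beta>) \<longleftrightarrow> lc k \<alpha> \<and> lc k \<beta>"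
  "lc k (All A a) \<longleftrightarrow> lc (Suc k) a"
  "lc k (Ex A a) \<longleftrightarrow> lc (Suc (Suc k)) a"
  by (auto simp: Tru_def And_def Imp_def All_def Ex_def)

lemma has_type_connectives [simp]:
  "has_type L Bs Tru T \<longleftrightarrow> T = TOmega"
  "has_type L Bs (\<alpha> \<and>\<^sub>t \<beta>) T \<longleftrightarrow> T = TOmega \<and> has_type L Bs \<alpha> TOmega \<and> has_type L Bs \<beta> TOmega"
  "has_type L Bs (\<alpha> \<longrightarrow>\<^sub>t \<beta>) T \<longleftrightarrow> T = TOmega \<and> has_type L Bs \<alpha> TOmega \<and> has_type L Bs \<beta> TOmega"
  "has_type L Bs (All A a) T \<longleftrightarrow> T = TOmega \<and> is_ty (ground L) A \<and> has_type L (A # Bs) a TOmega"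
  "has_type L Bs (Ex A a) T \<longleftrightarrow>
    T = TOmega \<and> is_ty (ground L) A \<and> has_type L (A # TOmega # Bs) a TOmega"
proof -
  show *: "has_type L Bs Tru T \<longleftrightarrow> T = TOmega" for Bs T by (auto simp: Tru_def)
  show **: "has_type L Bs (\<alpha> \<and>\<^sub>t \<beta>) T \<longleftrightarrow> T = TOmega \<and> has_type L Bs \<alpha> TOmega \<and> has_type L Bs \<beta> TOmega"
    for Bs \<alpha> \<beta> T by (auto simp: And_def * list_all2_Cons1)
  show ***: "has_type L Bs (\<alpha> \<longrightarrow>\<^sub>t \<beta>) T \<longleftrightarrow> T = TOmega \<and> has_type L Bs \<alpha> TOmega \<and> has_type L Bs \<beta> TOmega"
    for Bs \<alpha> \<beta> T by (auto simp: Imp_def **)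
  show ****: "has_type L Bs (All A a) T \<longleftrightarrow>
      T = TOmega \<and> is_ty (ground L) A \<and> has_type L (A # Bs) a TOmega" for Bs A a T
    by (auto simp: All_def *)
  show "has_type L Bs (Ex A a) T \<longleftrightarrow>
      T = TOmega \<and> is_ty (ground L) A \<and> has_type L (A # TOmega # Bs) a TOmega"
    by (auto simp: Ex_def *** ****)
qed

datatype ('g, 'f) world = World (vars: "'g var set") (hyps: "('g, 'f) trm set")

locale set_theory =
  fixes L :: "('g, 'f) lang" and S :: "('g, 'f) sequent set"
  assumes L: "local_language L" and S: "local_set_theory L S"
begin

section \<open>Derived rules for the sequents of \<open>S\<close>\<close>

lemma S_seq: "(\<Gamma>, \<alpha>) \<in> S \<Longrightarrow> finite \<Gamma> \<and> (\<forall>\<beta>\<in>\<Gamma>. formula L \<beta>) \<and> formula L \<alpha>"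
  using S unfolding local_set_theory_def sequents_def by blast

lemma S_closed: "derives L S \<Gamma> \<alpha> \<Longrightarrow> (\<Gamma>, \<alpha>) \<in> S"
  using S unfolding local_set_theory_def by blast

lemma S_thin:
  assumes "(\<Gamma>, \<alpha>) \<in> S" and "finite \<Delta>" and "\<forall>\<beta>\<in>\<Delta>. formula L \<beta>"
  shows "(\<Gamma> \<union> \<Delta>, \<alpha>) \<in> S"
  using assms(2,3)
proof (induction \<Delta>)
  case empty
  then show ?case using assms(1) by simp
next
  case (insert \<beta> \<Delta>)
  then show ?case using S_closed[OF derives.thinning[OF derives.premise[of "\<Gamma> \<union> \<Delta>"]]] by simp
qed

lemma S_cut: "(\<Gamma>, \<alpha>) \<in> S \<Longrightarrow> (insert \<alpha> \<Gamma>, \<beta>) \<in> S \<Longrightarrow> fv \<alpha> \<subseteq> \<Union> (fv ` \<Gamma>) \<union> fv \<beta> \<Longrightarrow> (\<Gamma>, \<beta>) \<in> S"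
  by (rule S_closed[OF derives.cut[OF derives.premise derives.premise]])

lemma S_subst1: "(\<Gamma>, \<alpha>) \<in> S \<Longrightarrow> has_type L [] \<tau> (snd x) \<Longrightarrow> (subst1 x \<tau> ` \<Gamma>, subst1 x \<tau> \<alpha>) \<in> S"
  by (rule S_closed[OF derives.substitution[OF derives.premise]])

text \<open>The substitution rule replaces one variable at a time. As the terms \<open>ts\<close>
  contain none of the variables \<open>xs\<close>, successive replacements amount to a simultaneous
  one.\<close>

lemma S_substs:
  assumes "(\<Gamma>, \<alpha>) \<in> S" and "distinct xs" and "length ts = length xs"
    and "\<forall>t\<in>set ts. fv t \<inter> set xs = {}"
    and "list_all2 (\<lambda>x t. has_type L [] t (snd x)) xs ts"
  obtains \<sigma> where "(subst \<sigma> ` \<Gamma>, subst \<sigma> \<alpha>) \<in> S"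
    and "\<And>i. i < length xs \<Longrightarrow> \<sigma> (xs ! i) = ts ! i" and "\<And>x. x \<notin> set xs \<Longrightarrow> \<sigma> x = Var x"
  using assms(2-5)
proof (induction xs arbitrary: ts thesis)
  case Nil
  from Nil(1)[of Var] show ?case using assms(1) by simp
next
  case (Cons x xs)
  then obtain t ts' where ts: "ts = t # ts'" by (metis length_Suc_conv length_Cons)
  obtain \<sigma> where \<sigma>: "(subst \<sigma> ` \<Gamma>, subst \<sigma> \<alpha>) \<in> S"
    "\<And>i. i < length xs \<Longrightarrow> \<sigma> (xs ! i) = ts' ! i" "\<And>x. x \<notin> set xs \<Longrightarrow> \<sigma> x = Var x"
    using Cons.IH[of ts'] Cons.prems(2-5) ts by auto
  let ?\<tau> = "\<lambda>y. subst1 x t (\<sigma> y)"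
  have "(subst ?\<tau> ` \<Gamma>, subst ?\<tau> \<alpha>) \<in> S"
    using S_subst1[OF \<sigma>(1), of t x] Cons.prems(5) ts by (simp add: image_image subst_subst)
  moreover have "?\<tau> ((x # xs) ! i) = ts ! i" if "i < length (x # xs)" for i
  proof (cases i)
    case 0
    then show ?thesis using \<sigma>(3)[of x] Cons.prems(2) ts by simp
  next
    case (Suc j)
    then have "ts' ! j \<in> set ts'" "\<sigma> (xs ! j) = ts' ! j" using that Cons.prems(3) ts \<sigma>(2) by auto
    then have "subst1 x t (ts' ! j) = subst Var (ts' ! j)"
      using Cons.prems(4) ts by (intro subst_cong) auto
    then show ?thesis using \<open>\<sigma> (xs ! j) = ts' ! j\<close> Suc ts by simp
  qed
  moreover have "?\<tau> y = Var y" if "y \<notin> set (x # xs)" for y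
    using that \<sigma>(3) by simp
  ultimately show ?case using Cons.prems(1) by blast
qed

text \<open>The equality axiom exchanges variables \<open>x\<close> and \<open>y\<close> at the
  place marked by a variable \<open>z\<close>. With all three fresh, \<open>z\<close> can stand for
  the dangling index, and the substitution rule carries the axiom to arbitrary terms
  \<open>s\<close> and \<open>t\<close>.\<close>

lemma S_leibniz:
  assumes a: "has_type L [A] a TOmega" and s: "has_type L [] s A" and t: "has_type L [] t A"
  shows "({s \<doteq> t, inst s a}, inst t a) \<in> S"
proof -
  have A: "is_ty (ground L) A" using has_type_is_ty[OF L s] by simp
  let ?V = "fv a \<union> fv s \<union> fv t"
  obtain z where z: "z \<notin> ?V" "snd z = A" using ex_fresh[of ?V A] by auto
  obtain x where x: "x \<notin> insert z ?V" "snd x = A" using ex_fresh[of "insert z ?V" A] by auto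
  obtain y where y: "y \<notin> insert x (insert z ?V)" "snd y = A"
    using ex_fresh[of "insert x (insert z ?V)" A] by auto
  have fm: "formula L (inst (Var z) a)" using has_type_inst[OF a, of "Var z"] z A by simp
  have ax: "({Var x \<doteq> Var y, subst1 z (Var x) (inst (Var z) a)}, subst1 z (Var y) (inst (Var z) a)) \<in> S"
    by (rule S_closed[OF derives.equality[OF fm]]) (use x y z A in auto)
  have eq: "subst1 v r (inst (Var v) a) = inst r a" if "v \<notin> ?V" for v r
    unfolding subst_msub using that by (auto intro!: msub_cong)
  have "({Var x \<doteq> Var y, inst (Var x) a}, inst (Var y) a) \<in> S" using ax eq[of z] z by simp
  from S_subst1[OF this, of s x] have "({s \<doteq> Var y, inst s a}, subst1 x s (inst (Var y) a)) \<in> S"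
    using eq[of x] x y s by (simp split: if_splits)
  moreover have "subst1 x s (inst (Var y) a) = inst (Var y) a"
    unfolding subst_msub using x y by (auto intro!: msub_cong)
  ultimately have "({s \<doteq> Var y, inst s a}, inst (Var y) a) \<in> S" by simp
  from S_subst1[OF this, of t y] have *: "({subst1 y t s \<doteq> t, subst1 y t (inst s a)}, inst t a) \<in> S"
    using eq[of y] y t by simp
  have "subst1 y t s = subst Var s" using y by (intro subst_cong) auto
  moreover have "subst1 y t (inst s a) = subst Var (inst s a)"
    using y fv_inst_subset[of a ?V s] by (intro subst_cong) auto
  ultimately show ?thesis using * by simp
qed

text \<open>Reflexivity is not a primitive rule. The product axiom gives \<open>p = x\<close> for
  the first projection \<open>p\<close> of the pair \<open>(x, x)\<close>, and rewriting the left
  side of this equation by the equation itself yields \<open>x = x\<close>. The cut is permitted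
  since both equations have the same variable.\<close>

lemma S_refl:
  assumes "has_type L [] t A"
  shows "({}, t \<doteq> t) \<in> S"
proof -
  have A: "is_ty (ground L) A" using has_type_is_ty[OF L assms] by simp
  define x :: "'g var" where "x = (0, A)"
  let ?p = "Prj [A, A] 0 (Tuple [Var x, Var x])"
  have p: "({}, ?p \<doteq> Var x) \<in> S"
    using S_closed[OF derives.product_prj[of L "[x, x]" 0]] A by (simp add: x_def)
  have tp: "has_type L [] ?p A" "has_type L [] (Var x) A"
    using A by (auto simp: x_def)
  have "({?p \<doteq> Var x, ?p \<doteq> Var x}, Var x \<doteq> Var x) \<in> S"
    using S_leibniz[of A "Bound 0 \<doteq> Var x" ?p "Var x"] tp A by (simp add: x_def)
  then have "({}, Var x \<doteq> Var x) \<in> S" using S_cut[OF p] by simp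
  then show ?thesis using S_subst1[of "{}" "Var x \<doteq> Var x" t x] assms by (simp add: x_def)
qed

section \<open>Worlds and forcing\<close>

definition wd :: "('g, 'f) world \<Rightarrow> bool" where
  "wd w \<longleftrightarrow> finite (vars w) \<and> (\<forall>x\<in>vars w. is_ty (ground L) (snd x)) \<and> finite (hyps w) \<and>
    (\<forall>\<phi>\<in>hyps w. formula L \<phi> \<and> fv \<phi> \<subseteq> vars w)"

text \<open>The cut rule may not discard variables, as a type need not be inhabited; the equations
  \<open>x \<doteq> x\<close> keep all variables of the world present in the antecedent.\<close>

definition hyp :: "('g, 'f) world \<Rightarrow> ('g, 'f) trm set" where
  "hyp w = hyps w \<union> (\<lambda>x. Var x \<doteq> Var x) ` vars w"

definition force :: "('g, 'f) world \<Rightarrow> ('g, 'f) trm \<Rightarrow> bool" (infix "\<Turnstile>" 45) where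
  "w \<Turnstile> \<phi> \<longleftrightarrow> wd w \<and> fv \<phi> \<subseteq> vars w \<and> (hyp w, \<phi>) \<in> S"

text \<open>Later worlds arise by inclusion alone. A change of context along a substitution is
  replaced by quantifying over the terms available at later worlds.\<close>

definition ext :: "('g, 'f) world \<Rightarrow> ('g, 'f) world \<Rightarrow> bool"
  (infix "\<sqsubseteq>" 50) where
  "w \<sqsubseteq> w' \<longleftrightarrow> wd w \<and> wd w' \<and> vars w \<subseteq> vars w' \<and> hyps w \<subseteq> hyps w'"

definition tm :: "('g, 'f) world \<Rightarrow> ('g, 'f) trm \<Rightarrow> 'g ty \<Rightarrow> bool" where
  "tm w t A \<longleftrightarrow> wd w \<and> has_type L [] t A \<and> fv t \<subseteq> vars w"

lemma ext_refl [simp]: "w \<sqsubseteq> w \<longleftrightarrow> wd w" by (auto simp: ext_def)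
lemma ext_trans [trans]: "w \<sqsubseteq> w' \<Longrightarrow> w' \<sqsubseteq> w'' \<Longrightarrow> w \<sqsubseteq> w''" by (auto simp: ext_def)
lemma ext_wd: "w \<sqsubseteq> w' \<Longrightarrow> wd w" "w \<sqsubseteq> w' \<Longrightarrow> wd w'" by (auto simp: ext_def)
lemma force_wd: "w \<Turnstile> \<phi> \<Longrightarrow> wd w" by (auto simp: force_def)
lemma tm_wd: "tm w t A \<Longrightarrow> wd w" by (auto simp: tm_def)
lemma tm_mono: "tm w t A \<Longrightarrow> w \<sqsubseteq> w' \<Longrightarrow> tm w' t A" by (auto simp: tm_def ext_def)
lemma tm_unique: "tm w t A \<Longrightarrow> tm w' t B \<Longrightarrow> A = B" by (auto simp: tm_def dest: has_type_unique)
lemma tm_is_ty: "tm w t A \<Longrightarrow> is_ty (ground L) A"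
  unfolding tm_def using has_type_is_ty[OF L] by fastforce
lemma tm_lc: "tm w t A \<Longrightarrow> lc 0 t" by (auto simp: tm_def dest: has_type_lc0)
lemma wd_hyp: "wd w \<Longrightarrow> finite (hyp w) \<and> (\<forall>\<phi>\<in>hyp w. formula L \<phi>) \<and> \<Union> (fv ` hyp w) = vars w"
  unfolding wd_def hyp_def by auto
lemma force_tm: "w \<Turnstile> \<phi> \<Longrightarrow> tm w \<phi> TOmega"
  by (auto simp: force_def tm_def dest: S_seq)
lemma force_mono: "w \<Turnstile> \<phi> \<Longrightarrow> w \<sqsubseteq> w' \<Longrightarrow> w' \<Turnstile> \<phi>"
proof -
  assume a: "w \<Turnstile> \<phi>" "w \<sqsubseteq> w'"
  then have "hyp w \<union> hyp w' = hyp w'" by (auto simp: ext_def hyp_def)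
  then show ?thesis
    using a S_thin[of "hyp w" \<phi> "hyp w'"] wd_hyp[of w'] by (auto simp: force_def ext_def)
qed

text \<open>The formulas of \<open>\<Delta>\<close> are cut away one at a time. The side condition
  on variables holds at every step, because \<open>hyp w\<close> contains an equation for each
  variable of \<open>w\<close>.\<close>

lemma force_cut:
  assumes "(\<Delta>, \<psi>) \<in> S" and "\<And>\<phi>. \<phi> \<in> \<Delta> \<Longrightarrow> w \<Turnstile> \<phi>" and "wd w" and "fv \<psi> \<subseteq> vars w"
  shows "w \<Turnstile> \<psi>"
proof -
  have "finite \<Delta>" using assms(1) S_seq by blast
  then have "(hyp w \<union> \<Delta>, \<psi>) \<in> S \<Longrightarrow> (hyp w, \<psi>) \<in> S" using assms(2)
  proof (induction \<Delta>)
    case (insert \<phi> \<Delta>)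
    have \<phi>: "w \<Turnstile> \<phi>" using insert.prems by blast
    have "(hyp w \<union> \<Delta>, \<phi>) \<in> S"
      using \<phi> S_thin[of "hyp w" \<phi> \<Delta>] insert.hyps(1) force_tm[OF insert.prems(2)]
      by (simp add: force_def tm_def)
    then have "(hyp w \<union> \<Delta>, \<psi>) \<in> S"
      by (rule S_cut) (use insert.prems \<phi> wd_hyp[OF assms(3)] in \<open>auto simp: force_def\<close>)
    then show ?case using insert by blast
  qed simp
  moreover have "(\<Delta> \<union> hyp w, \<psi>) \<in> S" using S_thin[OF assms(1)] wd_hyp[OF assms(3)] by blast
  ultimately show ?thesis using assms by (simp add: force_def Un_commute)
qed

lemma force_taut: "tm w \<phi> TOmega \<Longrightarrow> \<phi> \<in> hyps w \<Longrightarrow> w \<Turnstile> \<phi>"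
proof -
  assume a: "tm w \<phi> TOmega" "\<phi> \<in> hyps w"
  have "({\<phi>}, \<phi>) \<in> S" using S_closed[OF derives.tautology] a by (auto simp: tm_def)
  then have "({\<phi>} \<union> hyp w, \<phi>) \<in> S"
    using S_thin[of "{\<phi>}" \<phi> "hyp w"] wd_hyp[of w] a by (auto simp: tm_def)
  moreover have "{\<phi>} \<union> hyp w = hyp w" using a by (auto simp: hyp_def)
  ultimately show ?thesis using a by (auto simp: force_def tm_def)
qed

section \<open>Equality at a world\<close>

lemma force_refl: "tm w t A \<Longrightarrow> w \<Turnstile> t \<doteq> t"
  by (rule force_cut[OF S_refl]) (auto simp: tm_def)

lemma force_Tru: "wd w \<Longrightarrow> w \<Turnstile> Tru"
  using force_refl[of w Star TUnit] by (simp add: Tru_def tm_def)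

lemma force_leibniz:
  assumes "w \<Turnstile> s \<doteq> t" and "w \<Turnstile> inst s a" and "has_type L [A] a TOmega" and "fv a \<subseteq> vars w"
    and "has_type L [] s A"
  shows "w \<Turnstile> inst t a"
proof -
  have "has_type L [] t A"
    using force_tm[OF assms(1)] assms(5) by (auto simp: tm_def dest: has_type_unique)
  moreover have "fv s \<subseteq> vars w" "fv t \<subseteq> vars w" using force_tm[OF assms(1)] by (auto simp: tm_def)
  ultimately show ?thesis
    using force_cut[OF S_leibniz[OF assms(3,5)], of t w] assms fv_inst_subset[of a "vars w" t]
      force_wd by auto
qed

lemma tm_simps [simp]:
  "tm w (s \<doteq> t) B \<longleftrightarrow> B = TOmega \<and> (\<exists>A. tm w s A \<and> tm w t A)"
  "tm w (s \<in>\<^sub>t t) B \<longleftrightarrow> B = TOmega \<and> (\<exists>A. tm w s A \<and> tm w t (TPow A))"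
  "tm w (Tuple ts) B \<longleftrightarrow> wd w \<and> (\<exists>As. B = TProd As \<and> 2 \<le> length ts \<and> list_all2 (tm w) ts As)"
  "tm w (Prj As i t) B \<longleftrightarrow> B = As ! i \<and> tm w t (TProd As) \<and> i < length As"
  "tm w (\<alpha> \<and>\<^sub>t \<beta>) B \<longleftrightarrow> B = TOmega \<and> tm w \<alpha> TOmega \<and> tm w \<beta> TOmega"
  "tm w (\<alpha> \<longrightarrow>\<^sub>t \<beta>) B \<longleftrightarrow> B = TOmega \<and> tm w \<alpha> TOmega \<and> tm w \<beta> TOmega"
  "tm w Star B \<longleftrightarrow> wd w \<and> B = TUnit"
  "tm w Tru B \<longleftrightarrow> wd w \<and> B = TOmega"
  by (fastforce simp: tm_def list_all2_conv_all_nth in_set_conv_nth)+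

lemma force_eqD: "w \<Turnstile> \<alpha> \<doteq> \<beta> \<Longrightarrow> w \<Turnstile> \<alpha> \<Longrightarrow> w \<Turnstile> \<beta>"
  using force_leibniz[of w \<alpha> \<beta> "Bound 0" TOmega] force_tm[of w \<alpha>] by (simp add: tm_def)

lemma force_eq_tm: "w \<Turnstile> s \<doteq> t \<Longrightarrow> tm w s A \<or> tm w t A \<Longrightarrow> tm w s A \<and> tm w t A"
  by (drule force_tm) (auto dest: tm_unique)

lemma force_sym: "w \<Turnstile> s \<doteq> t \<Longrightarrow> w \<Turnstile> t \<doteq> s"
proof -
  assume a: "w \<Turnstile> s \<doteq> t"
  then obtain A where A: "tm w s A" "tm w t A" using force_tm by fastforce
  then have "has_type L [A] s A" by (auto simp: tm_def intro: has_type_weaken0)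
  then show ?thesis
    using force_leibniz[OF a, of "Bound 0 \<doteq> s" A] A force_refl[OF A(1)] tm_lc[OF A(1)]
    by (auto simp: tm_def)
qed

lemma force_trans [trans]: "w \<Turnstile> r \<doteq> s \<Longrightarrow> w \<Turnstile> s \<doteq> t \<Longrightarrow> w \<Turnstile> r \<doteq> t"
proof -
  assume a: "w \<Turnstile> r \<doteq> s" "w \<Turnstile> s \<doteq> t"
  then obtain A where A: "tm w r A" "tm w s A" using force_tm by fastforce
  then have "has_type L [A] r A" by (auto simp: tm_def intro: has_type_weaken0)
  then show ?thesis
    using force_leibniz[OF a(2), of "r \<doteq> Bound 0" A] A a(1) tm_lc[OF A(1)]
    by (auto simp: tm_def)
qed

lemma force_cong:
  assumes "w \<Turnstile> s \<doteq> t" and "tm w s A" and "has_type L [A] c B" and "fv c \<subseteq> vars w"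
  shows "w \<Turnstile> inst s c \<doteq> inst t c"
proof -
  have h: "has_type L [] (inst s c) B" using has_type_inst[OF assms(3)] assms(2) by (simp add: tm_def)
  have "fv (inst s c) \<subseteq> vars w" using fv_inst_subset[OF assms(4)] assms(2) by (simp add: tm_def)
  then have "tm w (inst s c) B" using h assms(2) by (auto simp: tm_def)
  from force_refl[OF this] show ?thesis
    using force_leibniz[OF assms(1), of "inst s c \<doteq> c" A] assms h has_type_weaken0[OF h, of "[A]"]
      has_type_lc0[OF h] \<open>fv (inst s c) \<subseteq> vars w\<close> by (auto simp: tm_def)
qed

lemma force_mem_cong: "w \<Turnstile> s \<doteq> s' \<Longrightarrow> w \<Turnstile> t \<doteq> t' \<Longrightarrow> w \<Turnstile> s \<in>\<^sub>t t \<Longrightarrow> w \<Turnstile> s' \<in>\<^sub>t t'"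
proof -
  assume a: "w \<Turnstile> s \<doteq> s'" "w \<Turnstile> t \<doteq> t'" "w \<Turnstile> s \<in>\<^sub>t t"
  then obtain A where A: "tm w s A" "tm w t (TPow A)" using force_tm by fastforce
  then have A': "tm w s' A" using force_eq_tm[OF a(1)] by blast
  have "w \<Turnstile> s' \<in>\<^sub>t t"
    using force_leibniz[OF a(1), of "Bound 0 \<in>\<^sub>t t" A] A a(3) tm_lc[OF A(2)]
    by (auto simp: tm_def intro: has_type_weaken0)
  then show ?thesis
    using force_leibniz[OF a(2), of "s' \<in>\<^sub>t Bound 0" "TPow A"] A A' tm_lc[OF A'(1)]
    by (auto simp: tm_def intro: has_type_weaken0)
qed

section \<open>Equivalence and extensionality at a world\<close>

definition addh :: "('g, 'f) world \<Rightarrow> ('g, 'f) trm \<Rightarrow> ('g, 'f) world" where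
  "addh w \<phi> = World (vars w) (insert \<phi> (hyps w))"

definition addv :: "('g, 'f) world \<Rightarrow> 'g var \<Rightarrow> ('g, 'f) world" where
  "addv w x = World (insert x (vars w)) (hyps w)"

lemma ext_addh: "tm w \<phi> TOmega \<Longrightarrow> w \<sqsubseteq> addh w \<phi>"
  by (auto simp: addh_def ext_def wd_def tm_def)

lemma ext_addv: "wd w \<Longrightarrow> is_ty (ground L) (snd x) \<Longrightarrow> w \<sqsubseteq> addv w x"
  by (auto simp: addv_def ext_def wd_def)

lemma force_addh: "tm w \<phi> TOmega \<Longrightarrow> addh w \<phi> \<Turnstile> \<phi>"
  by (rule force_taut) (use ext_addh in \<open>auto simp: addh_def tm_def ext_def\<close>)

text \<open>Equality of truth values is equivalence. The premises about all later worlds are used at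
  the two worlds that add \<open>\<alpha>\<close> or \<open>\<beta>\<close> as a hypothesis.\<close>

lemma force_eqI:
  assumes "tm w \<alpha> TOmega" and "tm w \<beta> TOmega"
    and "\<And>w'. w \<sqsubseteq> w' \<Longrightarrow> w' \<Turnstile> \<alpha> \<Longrightarrow> w' \<Turnstile> \<beta>" and "\<And>w'. w \<sqsubseteq> w' \<Longrightarrow> w' \<Turnstile> \<beta> \<Longrightarrow> w' \<Turnstile> \<alpha>"
  shows "w \<Turnstile> \<alpha> \<doteq> \<beta>"
proof -
  have "addh w \<alpha> \<Turnstile> \<beta>" "addh w \<beta> \<Turnstile> \<alpha>"
    using assms ext_addh force_addh by auto
  moreover have "hyp (addh w \<phi>) = insert \<phi> (hyp w)" for \<phi> by (simp add: hyp_def addh_def)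
  ultimately have "(insert \<alpha> (hyp w), \<beta>) \<in> S" "(insert \<beta> (hyp w), \<alpha>) \<in> S"
    by (simp_all add: force_def)
  then have "(hyp w, \<alpha> \<doteq> \<beta>) \<in> S"
    by (rule S_closed[OF derives.equivalence[OF derives.premise derives.premise]])
  then show ?thesis using assms(1,2) by (auto simp: force_def tm_def)
qed

text \<open>The antecedent belonging to \<open>addv w x\<close> contains \<open>x = x\<close>,
  whereas the extensionality rule wants an antecedent without \<open>x\<close>. The equation is
  derivable and is cut away beforehand.\<close>

lemma force_ext_var:
  assumes "x \<notin> vars w" and "is_ty (ground L) (snd x)" and "fv \<sigma> \<subseteq> vars w" and "fv \<tau> \<subseteq> vars w"
    and "addv w x \<Turnstile> (Var x \<in>\<^sub>t \<sigma>) \<doteq> (Var x \<in>\<^sub>t \<tau>)" and "wd w"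
  shows "w \<Turnstile> \<sigma> \<doteq> \<tau>"
proof -
  have "({} \<union> hyp w, Var x \<doteq> Var x) \<in> S"
    using S_thin[OF S_refl[of "Var x"]] wd_hyp[OF assms(6)] assms(2) by auto
  moreover have "(insert (Var x \<doteq> Var x) (hyp w), (Var x \<in>\<^sub>t \<sigma>) \<doteq> (Var x \<in>\<^sub>t \<tau>)) \<in> S"
    using assms(5) by (simp add: force_def hyp_def addv_def)
  ultimately have "(hyp w, (Var x \<in>\<^sub>t \<sigma>) \<doteq> (Var x \<in>\<^sub>t \<tau>)) \<in> S"
    using S_cut[of "hyp w" "Var x \<doteq> Var x"] by simp
  moreover have "x \<notin> \<Union> (fv ` hyp w) \<union> fv \<sigma> \<union> fv \<tau>"
    using assms wd_hyp[OF assms(6)] by blast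
  ultimately have "(hyp w, \<sigma> \<doteq> \<tau>) \<in> S"
    by (rule S_closed[OF derives.extensionality[OF derives.premise]])
  then show ?thesis using assms by (simp add: force_def)
qed

text \<open>A fresh variable serves as the generic element. The premises are applied to it at the
  worlds above \<open>addv w x\<close>.\<close>

lemma force_ext:
  assumes \<sigma>: "tm w \<sigma> (TPow A)" and \<tau>: "tm w \<tau> (TPow A)"
    and "\<And>w' t. w \<sqsubseteq> w' \<Longrightarrow> tm w' t A \<Longrightarrow> w' \<Turnstile> t \<in>\<^sub>t \<sigma> \<Longrightarrow> w' \<Turnstile> t \<in>\<^sub>t \<tau>"
    and "\<And>w' t. w \<sqsubseteq> w' \<Longrightarrow> tm w' t A \<Longrightarrow> w' \<Turnstile> t \<in>\<^sub>t \<tau> \<Longrightarrow> w' \<Turnstile> t \<in>\<^sub>t \<sigma>"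
  shows "w \<Turnstile> \<sigma> \<doteq> \<tau>"
proof -
  have w: "wd w" using \<sigma> tm_wd by blast
  then obtain x where x: "x \<notin> vars w" "snd x = A" using ex_fresh[of "vars w" A] by (auto simp: wd_def)
  have A: "is_ty (ground L) A" using tm_is_ty[OF \<sigma>] by simp
  let ?w = "addv w x"
  have e: "w \<sqsubseteq> ?w" using ext_addv w A x by simp
  have tx: "tm ?w (Var x) A" using e A x by (simp add: tm_def ext_def) (simp add: addv_def)
  have "?w \<Turnstile> (Var x \<in>\<^sub>t \<sigma>) \<doteq> (Var x \<in>\<^sub>t \<tau>)"
  proof (rule force_eqI)
    show "tm ?w (Var x \<in>\<^sub>t \<sigma>) TOmega" "tm ?w (Var x \<in>\<^sub>t \<tau>) TOmega"
      using tx tm_mono[OF \<sigma> e] tm_mono[OF \<tau> e] by auto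
  qed (use assms(3,4) e tx tm_mono ext_trans in meson)+
  then show ?thesis using force_ext_var[of x w \<sigma> \<tau>] x w A \<sigma> \<tau> by (simp add: tm_def)
qed

section \<open>Tuples and projections at a world\<close>

lemma ex_fresh_list:
  "finite (V :: 'g var set) \<Longrightarrow> \<exists>xs. distinct xs \<and> map snd xs = As \<and> set xs \<inter> V = {}"
proof (induction As arbitrary: V)
  case (Cons A As)
  obtain x where x: "x \<notin> V" "snd x = A" using ex_fresh[OF Cons.prems] by blast
  obtain xs where "distinct xs" "map snd xs = As" "set xs \<inter> insert x V = {}"
    using Cons.IH[of "insert x V"] Cons.prems by auto
  then show ?case using x by (intro exI[of _ "x # xs"]) auto
qed simp

text \<open>The product axiom is about variables. It is taken for distinct variables that are fresh
  for \<open>ts\<close>, and these are then replaced by \<open>ts\<close>.\<close>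

lemma force_Prj_Tuple:
  assumes ts: "list_all2 (tm w) ts As" and n: "2 \<le> length ts" and i: "i < length ts"
  shows "w \<Turnstile> Prj As i (Tuple ts) \<doteq> ts ! i"
proof -
  have l: "length As = length ts" using ts by (simp add: list_all2_lengthD)
  have ti: "tm w (ts ! j) (As ! j)" if "j < length ts" for j using ts that by (simp add: list_all2_nthD)
  have w: "wd w" using ti[OF i] tm_wd by blast
  obtain xs where xs: "distinct xs" "map snd xs = As" "set xs \<inter> \<Union> (fv ` set ts) = {}"
    using ex_fresh_list[of "\<Union> (fv ` set ts)" As] by auto
  have lx: "length xs = length ts" using xs(2) l by (metis length_map)
  have "is_ty (ground L) (TProd As)"
    using n l tm_is_ty[OF ti] by (auto simp: in_set_conv_nth)
  then have ax: "({}, Prj As i (Tuple (map Var xs)) \<doteq> Var (xs ! i)) \<in> S"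
    using S_closed[OF derives.product_prj[of L xs i]] xs(2) i lx by simp
  have "list_all2 (\<lambda>x t. has_type L [] t (snd x)) xs ts"
    using lx ti xs(2) by (auto simp: list_all2_conv_all_nth tm_def)
  note * = this
  obtain \<sigma> where \<sigma>: "(subst \<sigma> ` {}, subst \<sigma> (Prj As i (Tuple (map Var xs)) \<doteq> Var (xs ! i))) \<in> S"
    "\<And>i. i < length xs \<Longrightarrow> \<sigma> (xs ! i) = ts ! i"
  proof (rule S_substs[OF ax xs(1)])
    show "length ts = length xs" using lx by simp
    show "\<forall>t\<in>set ts. fv t \<inter> set xs = {}" using xs(3) by blast
    show "list_all2 (\<lambda>x t. has_type L [] t (snd x)) xs ts" by (rule *)
  qed blast
  have "map (subst \<sigma>) (map Var xs) = ts" using \<sigma>(2) lx by (intro nth_equalityI) auto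
  then have "({}, Prj As i (Tuple ts) \<doteq> ts ! i) \<in> S" using \<sigma> i lx by simp
  then show ?thesis
    by (rule force_cut) (use w ti i in \<open>auto simp: tm_def in_set_conv_nth subset_iff\<close>)
qed

lemma force_Tuple_eta:
  assumes "tm w t (TProd As)"
  shows "w \<Turnstile> t \<doteq> Tuple (map (\<lambda>i. Prj As i t) [0..<length As])"
proof -
  define x :: "'g var" where "x = (0, TProd As)"
  have "({}, Var x \<doteq> Tuple (map (\<lambda>i. Prj As i (Var x)) [0..<length As])) \<in> S"
    using tm_is_ty[OF assms] by (intro S_closed derives.product_tuple) (simp_all add: x_def)
  from S_subst1[OF this, of t x]
  have "({}, t \<doteq> Tuple (map (\<lambda>i. Prj As i t) [0..<length As])) \<in> S"
    using assms by (simp add: tm_def x_def o_def)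
  then show ?thesis
    by (rule force_cut) (use assms in \<open>auto simp: tm_def\<close>)
qed

lemma force_Star: "tm w t TUnit \<Longrightarrow> w \<Turnstile> t \<doteq> Star"
proof -
  assume t: "tm w t TUnit"
  have "({}, Var (0, TUnit) \<doteq> Star) \<in> S" by (intro S_closed derives.unity) simp
  from S_subst1[OF this, of t "(0, TUnit)"] have "({}, t \<doteq> Star) \<in> S" using t by (simp add: tm_def)
  then show ?thesis by (rule force_cut) (use t in \<open>auto simp: tm_def\<close>)
qed

text \<open>Components are exchanged one by one from the left: at stage \<open>k\<close> the first
  \<open>k\<close> of them come from \<open>ts\<close>, the others still from
  \<open>ss\<close>.\<close>

lemma force_Tuple_cong:
  assumes "list_all2 (\<lambda>s t. w \<Turnstile> s \<doteq> t) ss ts" and "2 \<le> length ss"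
  shows "w \<Turnstile> Tuple ss \<doteq> Tuple ts"
proof -
  have l: "length ss = length ts" using assms(1) by (simp add: list_all2_lengthD)
  have e: "w \<Turnstile> ss ! i \<doteq> ts ! i" if "i < length ss" for i
    using list_all2_nthD[OF assms(1) that] .
  have "\<forall>i<length ss. \<exists>A. tm w (ss ! i) A \<and> tm w (ts ! i) A" using e force_tm by fastforce
  then obtain A where A: "\<And>i. i < length ss \<Longrightarrow> tm w (ss ! i) (A i) \<and> tm w (ts ! i) (A i)" by metis
  have w: "wd w" using e[of 0] assms(2) force_wd by fastforce
  have "w \<Turnstile> Tuple ss \<doteq> Tuple (take k ts @ drop k ss)" if "k \<le> length ss" for k
    using that
  proof (induction k)
    case 0
    have "tm w (Tuple ss) (TProd (map A [0..<length ss]))"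
      using w assms(2) A by (simp add: list_all2_conv_all_nth)
    then show ?case by (simp add: force_refl del: tm_simps)
  next
    case (Suc k)
    \<comment> \<open>The intermediate tuple with a hole at position \<open>k\<close>; filling in
      \<open>ss ! k\<close> or \<open>ts ! k\<close> gives two successive stages.\<close>
    let ?c = "Tuple (take k ts @ [Bound 0] @ drop (Suc k) ss)"
    have lcs: "lc 0 t" "fv t \<subseteq> vars w" if "t \<in> set ss \<union> set ts" for t
      using that A l by (auto simp: in_set_conv_nth dest: tm_lc) (auto simp: tm_def)
    have inst_c: "inst r ?c = Tuple (take k ts @ r # drop (Suc k) ss)" for r
      using lcs by (auto intro!: map_idI dest!: in_set_takeD in_set_dropD)
    have "has_type L [A k] ?c (TProd (map A [0..<length ss]))"
    proof -
      have "has_type L [A k] ((take k ts @ [Bound 0] @ drop (Suc k) ss) ! i) (A i)" if "i < length ss" for i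
        using A[OF that] that Suc.prems l
        by (cases "i < k"; cases "i = k") (auto simp: nth_append tm_def intro: has_type_weaken0)
      moreover have "length (take k ts @ [Bound 0] @ drop (Suc k) ss) = length ss"
        using Suc.prems l by simp
      ultimately show ?thesis
        unfolding has_type_simps list_all2_conv_all_nth using assms(2) by simp
    qed
    moreover have "fv ?c \<subseteq> vars w" using lcs(2) by (auto dest!: in_set_takeD in_set_dropD)
    moreover have "w \<Turnstile> ss ! k \<doteq> ts ! k" "tm w (ss ! k) (A k)" using e A Suc.prems by simp_all
    ultimately have "w \<Turnstile> inst (ss ! k) ?c \<doteq> inst (ts ! k) ?c" by (intro force_cong)
    then have "w \<Turnstile> Tuple (take k ts @ ss ! k # drop (Suc k) ss) \<doteq> Tuple (take k ts @ ts ! k # drop (Suc k) ss)"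
      unfolding inst_c .
    then have "w \<Turnstile> Tuple (take k ts @ drop k ss) \<doteq> Tuple (take (Suc k) ts @ drop (Suc k) ss)"
      using Suc.prems l by (simp add: Cons_nth_drop_Suc take_Suc_conv_app_nth)
    from force_trans[OF Suc.IH this] show ?case using Suc.prems by simp
  qed
  from this[of "length ss"] show ?thesis using l by simp
qed

lemma force_Prj_cong: "w \<Turnstile> s \<doteq> t \<Longrightarrow> tm w s (TProd As) \<Longrightarrow> i < length As \<Longrightarrow> w \<Turnstile> Prj As i s \<doteq> Prj As i t"
  using force_cong[of w s t "TProd As" "Prj As i (Bound 0)"] by simp

section \<open>Kripke-Joyal clauses\<close>

lemma force_Tru_iff: "w \<Turnstile> \<alpha> \<doteq> Tru \<longleftrightarrow> w \<Turnstile> \<alpha>"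
proof
  assume "w \<Turnstile> \<alpha> \<doteq> Tru"
  then show "w \<Turnstile> \<alpha>" using force_eqD[OF force_sym] force_Tru force_wd by blast
next
  assume "w \<Turnstile> \<alpha>"
  then show "w \<Turnstile> \<alpha> \<doteq> Tru"
    using force_tm force_wd force_Tru force_mono ext_wd by (intro force_eqI) simp_all
qed

text \<open>A conjunction is by definition an equation between the pair of its members and the pair
  of two truths. Projecting gives one direction, congruence of pairs the other.\<close>

lemma force_And: "w \<Turnstile> (\<alpha> \<and>\<^sub>t \<beta>) \<longleftrightarrow> w \<Turnstile> \<alpha> \<and> w \<Turnstile> \<beta>"
proof
  assume a: "w \<Turnstile> (\<alpha> \<and>\<^sub>t \<beta>)"
  let ?P = "[TOmega, TOmega]"
  have t: "tm w \<alpha> TOmega" "tm w \<beta> TOmega" using force_tm[OF a] by auto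
  have w: "wd w" using a force_wd by blast
  have *: "w \<Turnstile> Prj ?P i (Tuple [\<alpha>, \<beta>]) \<doteq> Prj ?P i (Tuple [Tru, Tru])" if "i < 2" for i
    using force_Prj_cong[OF a[unfolded And_def], of ?P i] t w that by simp
  have "w \<Turnstile> [\<alpha>, \<beta>] ! i \<doteq> [Tru, Tru] ! i" if "i < 2" for i
  proof -
    have "w \<Turnstile> Prj ?P i (Tuple [\<alpha>, \<beta>]) \<doteq> [\<alpha>, \<beta>] ! i"
      by (rule force_Prj_Tuple) (use t that in auto)
    moreover have "w \<Turnstile> Prj ?P i (Tuple [Tru, Tru]) \<doteq> [Tru, Tru] ! i"
      by (rule force_Prj_Tuple) (use w that in auto)
    ultimately show ?thesis using *[OF that] force_sym force_trans by meson
  qed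
  from this[of 0] this[of 1] show "w \<Turnstile> \<alpha> \<and> w \<Turnstile> \<beta>" by (simp add: force_Tru_iff)
next
  assume "w \<Turnstile> \<alpha> \<and> w \<Turnstile> \<beta>"
  then show "w \<Turnstile> (\<alpha> \<and>\<^sub>t \<beta>)"
    unfolding And_def by (intro force_Tuple_cong) (simp_all add: force_Tru_iff)
qed

lemma force_Imp:
  assumes "tm w \<alpha> TOmega" and "tm w \<beta> TOmega"
  shows "w \<Turnstile> (\<alpha> \<longrightarrow>\<^sub>t \<beta>) \<longleftrightarrow> (\<forall>w'. w \<sqsubseteq> w' \<longrightarrow> w' \<Turnstile> \<alpha> \<longrightarrow> w' \<Turnstile> \<beta>)"
proof
  assume "w \<Turnstile> (\<alpha> \<longrightarrow>\<^sub>t \<beta>)"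
  then show "\<forall>w'. w \<sqsubseteq> w' \<longrightarrow> w' \<Turnstile> \<alpha> \<longrightarrow> w' \<Turnstile> \<beta>"
    unfolding Imp_def using force_mono force_eqD[OF force_sym] force_And by blast
next
  assume "\<forall>w'. w \<sqsubseteq> w' \<longrightarrow> w' \<Turnstile> \<alpha> \<longrightarrow> w' \<Turnstile> \<beta>"
  then show "w \<Turnstile> (\<alpha> \<longrightarrow>\<^sub>t \<beta>)"
    unfolding Imp_def using assms by (intro force_eqI) (auto simp: force_And)
qed

lemma force_Compr_eq:
  assumes s: "tm w s A" and a: "has_type L [A] a TOmega" "fv a \<subseteq> vars w"
  shows "w \<Turnstile> (s \<in>\<^sub>t Compr A a) \<doteq> inst s a"
proof -
  obtain z where z: "z \<notin> fv a \<union> fv s" "snd z = A" using ex_fresh[of "fv a \<union> fv s" A] by auto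
  have A: "is_ty (ground L) A" using tm_is_ty[OF s] .
  have fm: "formula L (inst (Var z) a)" using has_type_inst[OF a(1)] z A by simp
  have "compr z (inst (Var z) a) = Compr A a" using z by (simp add: compr_def bind_msub)
  then have "({}, (Var z \<in>\<^sub>t Compr A a) \<doteq> inst (Var z) a) \<in> S"
    using S_closed[OF derives.comprehension[OF fm, of z]] A z by simp
  from S_subst1[OF this, of s z] have *: "({}, (s \<in>\<^sub>t Compr A (subst1 z s a)) \<doteq> subst1 z s (inst (Var z) a)) \<in> S"
    using s z by (simp add: tm_def)
  have "subst1 z s a = subst Var a" using z by (intro subst_cong) auto
  moreover have "subst1 z s (inst (Var z) a) = inst s a"
    unfolding subst_msub using z by (auto intro!: msub_cong)
  ultimately have "({}, (s \<in>\<^sub>t Compr A a) \<doteq> inst s a) \<in> S" using * by simp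
  then show ?thesis
    by (rule force_cut) (use s a fv_inst_subset[of a "vars w" s] in \<open>auto simp: tm_def\<close>)
qed

lemma force_mem_Compr:
  assumes "has_type L [A] a TOmega" and "fv a \<subseteq> vars w"
  shows "w \<Turnstile> s \<in>\<^sub>t Compr A a \<longleftrightarrow> tm w s A \<and> w \<Turnstile> inst s a"
proof
  assume f: "w \<Turnstile> s \<in>\<^sub>t Compr A a"
  then have "tm w s A" using force_tm by (fastforce simp: tm_def)
  then show "tm w s A \<and> w \<Turnstile> inst s a" using force_eqD[OF force_Compr_eq f] assms by blast
next
  assume "tm w s A \<and> w \<Turnstile> inst s a"
  then show "w \<Turnstile> s \<in>\<^sub>t Compr A a"
    using force_eqD[OF force_sym[OF force_Compr_eq]] assms by blast
qed

lemma tm_Compr: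
  "wd w \<Longrightarrow> is_ty (ground L) A \<Longrightarrow> has_type L [A] a TOmega \<Longrightarrow> fv a \<subseteq> vars w \<Longrightarrow> tm w (Compr A a) (TPow A)"
  by (simp add: tm_def)

text \<open>A universal quantification is by definition the equation of \<open>{x : a}\<close> with
  \<open>{x : true}\<close>, so its clause is extensionality combined with comprehension.\<close>

lemma force_All:
  assumes "wd w" and A: "is_ty (ground L) A" and a: "has_type L [A] a TOmega" and "fv a \<subseteq> vars w"
  shows "w \<Turnstile> All A a \<longleftrightarrow> (\<forall>w' t. w \<sqsubseteq> w' \<longrightarrow> tm w' t A \<longrightarrow> w' \<Turnstile> inst t a)"
proof
  assume f: "w \<Turnstile> All A a"
  show "\<forall>w' t. w \<sqsubseteq> w' \<longrightarrow> tm w' t A \<longrightarrow> w' \<Turnstile> inst t a"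
  proof (intro allI impI)
    fix w' t
    assume w': "w \<sqsubseteq> w'" and t: "tm w' t A"
    have e: "w' \<Turnstile> Compr A Tru \<doteq> Compr A a"
      using force_sym[OF force_mono[OF f w', unfolded All_def]] .
    have "w' \<Turnstile> t \<in>\<^sub>t Compr A Tru" using t force_Tru[of w'] ext_wd[OF w'] by (simp add: force_mem_Compr)
    then have "w' \<Turnstile> t \<in>\<^sub>t Compr A a" using force_mem_cong[OF force_refl[OF t] e] by blast
    then show "w' \<Turnstile> inst t a"
      using force_mem_Compr[OF a, of w' t] assms(4) w' by (auto simp: ext_def)
  qed
next
  assume *: "\<forall>w' t. w \<sqsubseteq> w' \<longrightarrow> tm w' t A \<longrightarrow> w' \<Turnstile> inst t a"
  have m: "w' \<Turnstile> t \<in>\<^sub>t Compr A a \<longleftrightarrow> tm w' t A \<and> w' \<Turnstile> inst t a" if "w \<sqsubseteq> w'" for w' t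
    using force_mem_Compr[OF a, of w' t] assms(4) that by (auto simp: ext_def)
  show "w \<Turnstile> All A a"
    unfolding All_def
  proof (rule force_ext)
    show "tm w (Compr A a) (TPow A)" "tm w (Compr A Tru) (TPow A)" using assms by (simp_all add: tm_def)
  qed (use * m force_Tru ext_wd in \<open>auto simp: force_mem_Compr\<close>)
qed

lemma force_Ex:
  assumes w: "wd w" and A: "is_ty (ground L) A" and a: "has_type L [A] a TOmega" and v: "fv a \<subseteq> vars w"
  shows "w \<Turnstile> Ex A a \<longleftrightarrow> (\<forall>w' \<omega>. w \<sqsubseteq> w' \<longrightarrow> tm w' \<omega> TOmega \<longrightarrow>
    (\<forall>w'' t. w' \<sqsubseteq> w'' \<longrightarrow> tm w'' t A \<longrightarrow> w'' \<Turnstile> inst t a \<longrightarrow> w'' \<Turnstile> \<omega>) \<longrightarrow> w' \<Turnstile> \<omega>)"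
proof -
  let ?b = "All A (a \<longrightarrow>\<^sub>t Bound 1) \<longrightarrow>\<^sub>t Bound 0"
  have a2: "has_type L [A, TOmega] a TOmega" using has_type_weaken[OF a, of "[TOmega]"] by simp
  \<comment> \<open>Below the two binders of \<open>Ex\<close> the index 1 is the truth value. The
    body \<open>a\<close> refers to index 0 only, so instantiating the truth value leaves it
    alone.\<close>
  have "msub Var [\<omega>] (Suc 0) a = a" for \<omega>
    using has_type_lc[OF a] msub_lc[of 1 a "Suc 0" Var] by simp
  then have b: "inst \<omega> ?b = (All A (a \<longrightarrow>\<^sub>t \<omega>) \<longrightarrow>\<^sub>t \<omega>)" for \<omega> by simp
  have "w \<Turnstile> Ex A a \<longleftrightarrow> (\<forall>w' \<omega>. w \<sqsubseteq> w' \<longrightarrow> tm w' \<omega> TOmega \<longrightarrow> w' \<Turnstile> (All A (a \<longrightarrow>\<^sub>t \<omega>) \<longrightarrow>\<^sub>t \<omega>))"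
    unfolding Ex_def b[symmetric] by (rule force_All) (use w A a2 v in auto)
  also have "\<dots> \<longleftrightarrow> (\<forall>w' \<omega>. w \<sqsubseteq> w' \<longrightarrow> tm w' \<omega> TOmega \<longrightarrow>
    (\<forall>w'' t. w' \<sqsubseteq> w'' \<longrightarrow> tm w'' t A \<longrightarrow> w'' \<Turnstile> inst t a \<longrightarrow> w'' \<Turnstile> \<omega>) \<longrightarrow> w' \<Turnstile> \<omega>)"
  proof -
    have 1: "w' \<Turnstile> All A (a \<longrightarrow>\<^sub>t \<omega>) \<longleftrightarrow>
        (\<forall>w'' t. w' \<sqsubseteq> w'' \<longrightarrow> tm w'' t A \<longrightarrow> w'' \<Turnstile> inst t a \<longrightarrow> w'' \<Turnstile> \<omega>)"
      if w': "w \<sqsubseteq> w'" and \<omega>: "tm w' \<omega> TOmega" for w' \<omega>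
    proof -
      have i: "inst t (a \<longrightarrow>\<^sub>t \<omega>) = (inst t a \<longrightarrow>\<^sub>t \<omega>)" for t using tm_lc[OF \<omega>] by simp
      have tia: "tm w'' (inst t a) TOmega" if "w' \<sqsubseteq> w''" "tm w'' t A" for w'' t
        using that has_type_inst[OF a, of t] fv_inst_subset[of a "vars w''" t] v w'
        by (simp add: tm_def ext_def, blast)
      have "w' \<Turnstile> All A (a \<longrightarrow>\<^sub>t \<omega>) \<longleftrightarrow>
          (\<forall>w'' t. w' \<sqsubseteq> w'' \<longrightarrow> tm w'' t A \<longrightarrow> w'' \<Turnstile> (inst t a \<longrightarrow>\<^sub>t \<omega>))"
        unfolding i[symmetric]
        by (rule force_All) (use w' \<omega> A a v has_type_weaken0 in \<open>auto simp: tm_def ext_def\<close>)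
      also have "\<dots> \<longleftrightarrow> (\<forall>w'' t. w' \<sqsubseteq> w'' \<longrightarrow> tm w'' t A \<longrightarrow> w'' \<Turnstile> inst t a \<longrightarrow> w'' \<Turnstile> \<omega>)"
        (is "?l = ?r")
      proof
        assume ?l
        then show ?r using force_Imp[OF tia tm_mono[OF \<omega>]] ext_refl ext_wd(2) by blast
      next
        assume r: ?r
        show ?l
        proof (intro allI impI)
          fix w'' t
          assume w'': "w' \<sqsubseteq> w''" and t: "tm w'' t A"
          show "w'' \<Turnstile> (inst t a \<longrightarrow>\<^sub>t \<omega>)"
            unfolding force_Imp[OF tia[OF w'' t] tm_mono[OF \<omega> w'']]
            using r ext_trans[OF w''] tm_mono[OF t] by blast
        qed
      qed
      finally show ?thesis .
    qed
    have 2: "tm w' (All A (a \<longrightarrow>\<^sub>t \<omega>)) TOmega" if "w \<sqsubseteq> w'" "tm w' \<omega> TOmega" for w' \<omega>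
      using that A a v has_type_weaken0 by (auto simp: tm_def ext_def)
    show ?thesis (is "?l = ?r")
    proof
      assume l: ?l
      show ?r
      proof (intro allI impI)
        fix w' \<omega>
        assume a: "w \<sqsubseteq> w'" "tm w' \<omega> TOmega" "\<forall>w'' t. w' \<sqsubseteq> w'' \<longrightarrow> tm w'' t A \<longrightarrow> w'' \<Turnstile> inst t a \<longrightarrow> w'' \<Turnstile> \<omega>"
        then show "w' \<Turnstile> \<omega>"
          using l 1 force_Imp[OF 2[OF a(1,2)] a(2)] ext_refl ext_wd(2)[OF a(1)] by blast
      qed
    next
      assume r: ?r
      show ?l
      proof (intro allI impI)
        fix w' \<omega>
        assume a: "w \<sqsubseteq> w'" "tm w' \<omega> TOmega"
        show "w' \<Turnstile> (All A (a \<longrightarrow>\<^sub>t \<omega>) \<longrightarrow>\<^sub>t \<omega>)"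
          unfolding force_Imp[OF 2[OF a] a(2)]
        proof (intro allI impI)
          fix w''
          assume b: "w' \<sqsubseteq> w''" "w'' \<Turnstile> All A (a \<longrightarrow>\<^sub>t \<omega>)"
          have c: "w \<sqsubseteq> w''" "tm w'' \<omega> TOmega" using a b ext_trans tm_mono by blast+
          then show "w'' \<Turnstile> \<omega>" using r 1[OF c] b(2) by blast
        qed
      qed
    qed
  qed
  finally show ?thesis .
qed

text \<open>Existence is local: a formula is forced as soon as it is forced at all later worlds
  that have a witness. There need not be a witness at \<open>w\<close> itself.\<close>

lemma force_ExI:
  assumes "w \<Turnstile> inst t a" and "tm w t A" and a: "has_type L [A] a TOmega" and v: "fv a \<subseteq> vars w"
  shows "w \<Turnstile> Ex A a"
  unfolding force_Ex[OF tm_wd[OF assms(2)] tm_is_ty[OF assms(2)] a v]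
proof (intro allI impI)
  fix w' \<omega>
  assume w': "w \<sqsubseteq> w'" and "\<forall>w'' t. w' \<sqsubseteq> w'' \<longrightarrow> tm w'' t A \<longrightarrow> w'' \<Turnstile> inst t a \<longrightarrow> w'' \<Turnstile> \<omega>"
  then show "w' \<Turnstile> \<omega>"
    using force_mono[OF assms(1) w'] tm_mono[OF assms(2) w'] ext_wd(2)[OF w'] ext_refl by blast
qed

lemma force_ExE:
  assumes "w \<Turnstile> Ex A a" and "has_type L [A] a TOmega" and "tm w \<omega> TOmega"
    and "\<And>w' t. w \<sqsubseteq> w' \<Longrightarrow> tm w' t A \<Longrightarrow> w' \<Turnstile> inst t a \<Longrightarrow> w' \<Turnstile> \<omega>"
  shows "w \<Turnstile> \<omega>"
proof -
  have "tm w (Ex A a) TOmega" using force_tm[OF assms(1)] .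
  then have "is_ty (ground L) A" "fv a \<subseteq> vars w" "wd w" by (auto simp: tm_def)
  from assms(1)[unfolded force_Ex[OF this(3,1) assms(2) this(2)], rule_format, of w \<omega>]
  show ?thesis using assms(3,4) \<open>wd w\<close> by simp
qed

end

section \<open>Sets and functions\<close>

lemma fresh_notin: "finite V \<Longrightarrow> fresh A V \<notin> V"
proof -
  assume "finite V"
  then obtain z where "z \<notin> V" "snd z = A" using ex_fresh[of V A] by blast
  then have "(fst z, A) \<notin> V" by auto
  then show ?thesis unfolding fresh_def by (rule LeastI)
qed

lemma snd_fresh [simp]: "snd (fresh A V) = A"
  by (simp add: fresh_def)

lemma subst_ex: "subst \<sigma> (ex x \<phi>) = Ex (snd x) (subst \<sigma> (bind x \<phi> 0))"
  by (simp add: ex_def)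

lemma fv_ex [simp]: "fv (ex x \<phi>) = fv \<phi> - {x}"
  by (simp add: ex_def)

lemma fv_foldr_ex [simp]: "fv (foldr ex xs \<phi>) = fv \<phi> - set xs"
  by (induction xs) auto

lemma has_type_foldr_ex:
  "\<forall>x\<in>set xs. is_ty (ground L) (snd x) \<Longrightarrow> formula L \<phi> \<Longrightarrow> formula L (foldr ex xs \<phi>)"
proof (induction xs)
  case (Cons x xs)
  then have "has_type L ([snd x] @ [TOmega]) (bind x (foldr ex xs \<phi>) 0) TOmega"
    using has_type_bind[of L "[]" "foldr ex xs \<phi>" TOmega x] by (intro has_type_weaken) auto
  then show ?case using Cons.prems by (simp add: ex_def[of x])
qed simp

lemma fv_set_of [simp]: "fv (set_of A xs \<tau> \<alpha>) = fv \<tau> \<union> fv \<alpha> - set xs"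
proof -
  have "fresh A (set xs \<union> fv \<tau> \<union> fv \<alpha>) \<notin> set xs \<union> fv \<tau> \<union> fv \<alpha>" by (intro fresh_notin) simp
  then show ?thesis by (auto simp: set_of_def Let_def compr_def)
qed

lemma has_type_set_of:
  assumes "\<forall>x\<in>set xs. is_ty (ground L) (snd x)" and "has_type L [] \<tau> A" and "formula L \<alpha>"
    and A: "is_ty (ground L) A"
  shows "has_type L [] (set_of A xs \<tau> \<alpha>) (TPow A)"
proof -
  let ?z = "fresh A (set xs \<union> fv \<tau> \<union> fv \<alpha>)"
  have "formula L (foldr ex xs ((Var ?z \<doteq> \<tau>) \<and>\<^sub>t \<alpha>))"
    by (rule has_type_foldr_ex) (use assms in auto)
  from has_type_bind[OF this, of ?z] show ?thesis
    using A by (simp add: set_of_def Let_def compr_def)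
qed

context set_theory
begin

section \<open>Substitution of equal terms\<close>

text \<open>Turning \<open>x\<close> into a dangling index makes the substituted formula a context
  with a hole, to which Leibniz' rule applies.\<close>

lemma force_subst_cong1:
  assumes "formula L \<phi>" and "\<And>v. lc 0 (\<sigma> v)" and "\<And>v. v \<in> fv \<phi> \<Longrightarrow> v \<noteq> x \<Longrightarrow> tm w (\<sigma> v) (snd v)"
    and "w \<Turnstile> s \<doteq> t" and "tm w s (snd x)" and "w \<Turnstile> subst (\<sigma>(x := s)) \<phi>"
  shows "w \<Turnstile> subst (\<sigma>(x := t)) \<phi>"
proof -
  let ?a = "subst \<sigma> (bind x \<phi> 0)"
  have i: "inst r ?a = subst (\<sigma>(x := r)) \<phi>" for r
    using msub_subst_bind[OF has_type_lc0[OF assms(1)]] assms(2) by blast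
  have "has_type L [snd x] (bind x \<phi> 0) TOmega"
    using has_type_bind[of L "[]" \<phi> TOmega x] assms(1) tm_is_ty[OF assms(5)] by simp
  then have "has_type L [snd x] ?a TOmega"
    by (rule has_type_subst) (use assms(3) in \<open>auto simp: tm_def\<close>)
  moreover have "fv ?a \<subseteq> vars w" using assms(3) by (fastforce simp: fv_subst tm_def)
  ultimately have "w \<Turnstile> inst t ?a"
    using force_leibniz[OF assms(4), of ?a "snd x"] assms(5,6) i by (auto simp: tm_def)
  then show ?thesis using i by simp
qed

text \<open>The free variables change from \<open>\<sigma>\<close> to \<open>\<tau>\<close> one at a
  time, \<open>V\<close> being those already changed. Elsewhere the value is set to
  \<open>Star\<close>: nothing is known of \<open>\<sigma>\<close> there, and the rule for one
  variable wants locally closed values throughout.\<close>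

lemma force_subst_cong:
  assumes \<phi>: "formula L \<phi>" and e: "\<And>v. v \<in> fv \<phi> \<Longrightarrow> w \<Turnstile> \<sigma> v \<doteq> \<tau> v"
    and t: "\<And>v. v \<in> fv \<phi> \<Longrightarrow> tm w (\<sigma> v) (snd v)" and f: "w \<Turnstile> subst \<sigma> \<phi>"
  shows "w \<Turnstile> subst \<tau> \<phi>"
proof -
  have t': "tm w (\<tau> v) (snd v)" if "v \<in> fv \<phi>" for v
    using force_eq_tm[OF e[OF that]] t[OF that] by blast
  have "w \<Turnstile> subst (\<lambda>v. if v \<in> fv \<phi> then if v \<in> V then \<tau> v else \<sigma> v else Star) \<phi>"
    if "finite V" "V \<subseteq> fv \<phi>" for V
    using that
  proof (induction V)
    case empty
    have "subst (\<lambda>v. if v \<in> fv \<phi> then if v \<in> {} then \<tau> v else \<sigma> v else Star) \<phi> = subst \<sigma> \<phi>"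
      by (rule subst_cong) simp
    then show ?case using f by simp
  next
    case (insert x V)
    let ?\<sigma> = "\<lambda>v. if v \<in> fv \<phi> then if v \<in> V then \<tau> v else \<sigma> v else Star"
    have x: "x \<in> fv \<phi>" using insert by simp
    have *: "?\<sigma>(x := \<tau> x) = (\<lambda>v. if v \<in> fv \<phi> then if v \<in> insert x V then \<tau> v else \<sigma> v else Star)"
      using insert by auto
    have **: "?\<sigma>(x := \<sigma> x) = ?\<sigma>" using x insert.hyps(2) by auto
    have "w \<Turnstile> subst (?\<sigma>(x := \<tau> x)) \<phi>"
    proof (rule force_subst_cong1[OF \<phi> _ _ e[OF x] t[OF x]])
      show "lc 0 (?\<sigma> v)" for v using tm_lc[OF t] tm_lc[OF t'] by simp
      show "tm w (?\<sigma> v) (snd v)" if "v \<in> fv \<phi>" for v using t t' that by simp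
      show "w \<Turnstile> subst (?\<sigma>(x := \<sigma> x)) \<phi>" unfolding ** using insert by simp
    qed
    then show ?case unfolding * .
  qed
  from this[of "fv \<phi>"] have "w \<Turnstile> subst (\<lambda>v. if v \<in> fv \<phi> then if v \<in> fv \<phi> then \<tau> v else \<sigma> v else Star) \<phi>"
    by simp
  moreover have "subst (\<lambda>v. if v \<in> fv \<phi> then if v \<in> fv \<phi> then \<tau> v else \<sigma> v else Star) \<phi> = subst \<tau> \<phi>"
    by (rule subst_cong) simp
  ultimately show ?thesis by simp
qed

lemma tm_subst:
  assumes "has_type L [] \<tau> A" and "\<And>v. v \<in> fv \<tau> \<Longrightarrow> tm w (\<sigma> v) (snd v)" and "wd w"
  shows "tm w (subst \<sigma> \<tau>) A"
  using has_type_subst[OF assms(1), of \<sigma>] assms by (auto simp: tm_def fv_subst subset_iff)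

text \<open>Congruence for terms follows from the one for formulas, applied to
  \<open>z = \<tau>\<close> with the fresh \<open>z\<close> held at
  \<open>subst \<sigma> \<tau>\<close> on both sides.\<close>

lemma force_subst_eq:
  assumes \<tau>: "has_type L [] \<tau> A" and e: "\<And>v. v \<in> fv \<tau> \<Longrightarrow> w \<Turnstile> \<sigma> v \<doteq> \<rho> v"
    and t: "\<And>v. v \<in> fv \<tau> \<Longrightarrow> tm w (\<sigma> v) (snd v)" and w: "wd w"
  shows "w \<Turnstile> subst \<sigma> \<tau> \<doteq> subst \<rho> \<tau>"
proof -
  obtain z where z: "z \<notin> fv \<tau>" "snd z = A" using ex_fresh[of "fv \<tau>" A] by auto
  let ?r = "subst \<sigma> \<tau>"
  have A: "is_ty (ground L) A" using has_type_is_ty[OF L \<tau>] by simp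
  have r: "tm w ?r A" by (rule tm_subst) (use assms in auto)
  have eq: "subst (\<pi>(z := ?r)) \<tau> = subst \<pi> \<tau>" for \<pi> using z by (intro subst_cong) auto
  have "w \<Turnstile> subst (\<rho>(z := ?r)) (Var z \<doteq> \<tau>)"
  proof (rule force_subst_cong[where \<sigma> = "\<sigma>(z := ?r)"])
    show "formula L (Var z \<doteq> \<tau>)" using \<tau> z A by auto
    show "w \<Turnstile> (\<sigma>(z := ?r)) v \<doteq> (\<rho>(z := ?r)) v" if "v \<in> fv (Var z \<doteq> \<tau>)" for v
      using that e[of v] force_refl[OF r] by (cases "v = z") auto
    show "tm w ((\<sigma>(z := ?r)) v) (snd v)" if "v \<in> fv (Var z \<doteq> \<tau>)" for v 
      using that t[of v] r z by (cases "v = z") auto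
    show "w \<Turnstile> subst (\<sigma>(z := ?r)) (Var z \<doteq> \<tau>)" using force_refl[OF r] by (simp add: eq)
  qed
  then show ?thesis by (simp add: eq)
qed

lemma subst_bind_typed:
  assumes "formula L \<phi>" and "is_ty (ground L) (snd x)" and "wd w"
    and "\<And>v. v \<in> fv \<phi> - {x} \<Longrightarrow> tm w (\<sigma> v) (snd v)"
  shows "has_type L [snd x] (subst \<sigma> (bind x \<phi> 0)) TOmega" and "fv (subst \<sigma> (bind x \<phi> 0)) \<subseteq> vars w"
proof -
  have "has_type L [snd x] (bind x \<phi> 0) TOmega"
    using has_type_bind[of L "[]" \<phi> TOmega x] assms by simp
  then show "has_type L [snd x] (subst \<sigma> (bind x \<phi> 0)) TOmega"
    by (rule has_type_subst) (use assms(4) in \<open>auto simp: tm_def\<close>)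
  show "fv (subst \<sigma> (bind x \<phi> 0)) \<subseteq> vars w" using assms(4) by (fastforce simp: fv_subst tm_def)
qed

section \<open>Blocks of existential quantifiers and set terms\<close>

text \<open>\<open>\<theta>\<close> is \<open>\<sigma>\<close> with witnesses for \<open>xs\<close>
  entered. They are entered from the outermost quantifier inwards.\<close>

lemma force_foldr_exI:
  assumes \<phi>: "formula L \<phi>" and "\<And>v. lc 0 (\<sigma> v)" and "\<And>v. v \<in> fv \<phi> \<union> set xs \<Longrightarrow> tm w (\<theta> v) (snd v)"
    and "\<And>v. v \<notin> set xs \<Longrightarrow> \<theta> v = \<sigma> v" and "w \<Turnstile> subst \<theta> \<phi>"
  shows "w \<Turnstile> subst \<sigma> (foldr ex xs \<phi>)"
  using assms(2-4)
proof (induction xs arbitrary: \<sigma>)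
  case Nil
  then have "subst \<sigma> \<phi> = subst \<theta> \<phi>" by (intro subst_cong) simp
  then show ?case using assms(5) by simp
next
  case (Cons x xs)
  have tx: "tm w (\<theta> x) (snd x)" using Cons.prems(2) by simp
  have ty: "\<forall>x\<in>set xs. is_ty (ground L) (snd x)" 
    using tm_is_ty[OF Cons.prems(2)] by simp
  have fm: "formula L (foldr ex xs \<phi>)" by (rule has_type_foldr_ex[OF ty \<phi>])
  let ?\<sigma> = "\<sigma>(x := \<theta> x)"
  have "w \<Turnstile> subst ?\<sigma> (foldr ex xs \<phi>)"
    by (rule Cons.IH) (use Cons.prems tm_lc[OF tx] in auto)
  moreover have "inst (\<theta> x) (subst \<sigma> (bind x (foldr ex xs \<phi>) 0)) = subst ?\<sigma> (foldr ex xs \<phi>)"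
    by (rule msub_subst_bind) (use has_type_lc0[OF fm] Cons.prems in auto)
  moreover have "tm w (\<sigma> v) (snd v)" if "v \<in> fv (foldr ex xs \<phi>) - {x}" for v
    using Cons.prems(2)[of v] Cons.prems(3)[of v] that by simp
  ultimately show ?case
    using force_ExI[OF _ tx, of "subst \<sigma> (bind x (foldr ex xs \<phi>) 0)"]
      subst_bind_typed[OF fm tm_is_ty[OF tx] tm_wd[OF tx], of \<sigma>] by (simp add: subst_ex)
qed

text \<open>Each quantifier passes to a later world with a witness; earlier witnesses persist, and
  all of them are collected in \<open>\<theta>\<close>.\<close>

lemma force_foldr_exE:
  assumes "w \<Turnstile> subst \<sigma> (foldr ex xs \<phi>)"
    and \<phi>: "formula L \<phi>" and "\<And>v. lc 0 (\<sigma> v)" and "\<And>v. v \<in> fv \<phi> - set xs \<Longrightarrow> tm w (\<sigma> v) (snd v)"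
    and "tm w \<psi> TOmega" and "\<forall>x\<in>set xs. is_ty (ground L) (snd x)"
    and "\<And>w' \<theta>. w \<sqsubseteq> w' \<Longrightarrow> (\<And>v. v \<notin> set xs \<Longrightarrow> \<theta> v = \<sigma> v) \<Longrightarrow>
      (\<And>v. v \<in> set xs \<Longrightarrow> tm w' (\<theta> v) (snd v)) \<Longrightarrow> w' \<Turnstile> subst \<theta> \<phi> \<Longrightarrow> w' \<Turnstile> \<psi>"
  shows "w \<Turnstile> \<psi>"
  using assms(1,3-7)
proof (induction xs arbitrary: \<sigma> w)
  case Nil
  show ?case using Nil.prems(6)[of w \<sigma>] Nil.prems(1) force_wd by simp
next
  case (Cons x xs)
  have w: "wd w" using Cons.prems(1) force_wd by blast
  have fm: "formula L (foldr ex xs \<phi>)" using has_type_foldr_ex[OF _ \<phi>] Cons.prems(5) by simp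
  let ?b = "subst \<sigma> (bind x (foldr ex xs \<phi>) 0)"
  have "tm w (\<sigma> v) (snd v)" if "v \<in> fv (foldr ex xs \<phi>) - {x}" for v
    using Cons.prems(3)[of v] that by simp
  from subst_bind_typed[OF fm _ w this]
  have b: "has_type L [snd x] ?b TOmega" using Cons.prems(5) by simp
  have "w \<Turnstile> Ex (snd x) ?b" using Cons.prems(1) by (simp add: subst_ex)
  then show ?case
  proof (rule force_ExE[OF _ b Cons.prems(4)])
    fix w' t
    assume w': "w \<sqsubseteq> w'" and t: "tm w' t (snd x)" and f: "w' \<Turnstile> inst t ?b"
    let ?\<sigma> = "\<sigma>(x := t)"
    have "inst t ?b = subst ?\<sigma> (foldr ex xs \<phi>)"
      by (rule msub_subst_bind) (use has_type_lc0[OF fm] Cons.prems in auto)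
    then have "w' \<Turnstile> subst ?\<sigma> (foldr ex xs \<phi>)" using f by simp
    then show "w' \<Turnstile> \<psi>"
    proof (rule Cons.IH)
      show "lc 0 (?\<sigma> v)" for v using Cons.prems(2) tm_lc[OF t] by simp
      show "tm w' (?\<sigma> v) (snd v)" if "v \<in> fv \<phi> - set xs" for v
        using t Cons.prems(3)[of v] tm_mono[OF _ w'] that by auto
      show "tm w' \<psi> TOmega" using tm_mono[OF Cons.prems(4) w'] .
      show "\<forall>x\<in>set xs. is_ty (ground L) (snd x)" using Cons.prems(5) by simp
      fix w'' \<theta>
      assume a: "w' \<sqsubseteq> w''" "\<And>v. v \<notin> set xs \<Longrightarrow> \<theta> v = ?\<sigma> v"
        "\<And>v. v \<in> set xs \<Longrightarrow> tm w'' (\<theta> v) (snd v)" "w'' \<Turnstile> subst \<theta> \<phi>"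
      show "w'' \<Turnstile> \<psi>"
      proof (rule Cons.prems(6)[OF ext_trans[OF w' a(1)]])
        show "\<theta> v = \<sigma> v" if "v \<notin> set (x # xs)" for v using a(2) that by simp
        show "tm w'' (\<theta> v) (snd v)" if "v \<in> set (x # xs)" for v
        proof (cases "v \<in> set xs")
          case False
          then have "v = x" using that by simp
          then show ?thesis using a(2)[OF False] tm_mono[OF t a(1)] by simp
        qed (use a(3) in simp)
      qed (use a(4) in simp)
    qed
  qed
qed

lemma force_mem_compr:
  assumes "formula L \<phi>" and "is_ty (ground L) (snd z)" and "fv \<phi> \<subseteq> insert z (vars w)"
  shows "w \<Turnstile> s \<in>\<^sub>t compr z \<phi> \<longleftrightarrow> tm w s (snd z) \<and> w \<Turnstile> subst1 z s \<phi>"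
proof -
  have "has_type L [snd z] (bind z \<phi> 0) TOmega"
    using has_type_bind[of L "[]" \<phi> TOmega z] assms by simp
  moreover have "inst s (bind z \<phi> 0) = subst1 z s \<phi>" using msub_bind[OF has_type_lc0[OF assms(1)]] .
  ultimately show ?thesis
    unfolding compr_def using force_mem_Compr[of "snd z" "bind z \<phi> 0" w s] assms(3) by auto
qed

lemma set_ofI:
  assumes \<tau>: "has_type L [] \<tau> A" and \<alpha>: "formula L \<alpha>" and v: "fv \<tau> \<union> fv \<alpha> \<subseteq> set xs"
    and s: "tm w s A" and \<theta>: "\<And>v. v \<in> set xs \<Longrightarrow> tm w (\<theta> v) (snd v)"
    and f: "w \<Turnstile> s \<doteq> subst \<theta> \<tau>" "w \<Turnstile> subst \<theta> \<alpha>"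
  shows "w \<Turnstile> s \<in>\<^sub>t set_of A xs \<tau> \<alpha>"
proof -
  define z :: "'g var" where "z = fresh A (set xs \<union> fv \<tau> \<union> fv \<alpha>)"
  have z: "z \<notin> set xs" "z \<notin> fv \<tau>" "z \<notin> fv \<alpha>" "snd z = A"
    using fresh_notin[of "set xs \<union> fv \<tau> \<union> fv \<alpha>" A] by (auto simp: z_def)
  have A: "is_ty (ground L) A" using tm_is_ty[OF s] .
  let ?\<phi> = "(Var z \<doteq> \<tau>) \<and>\<^sub>t \<alpha>"
  have \<phi>: "formula L ?\<phi>" using \<tau> \<alpha> z A by auto
  have ty: "\<forall>x\<in>set xs. is_ty (ground L) (snd x)" using \<theta> tm_is_ty by blast
  \<comment> \<open>Outside \<open>xs\<close> nothing is known of \<open>\<theta>\<close>, so there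
    it is replaced by the substitution of \<open>s\<close> for \<open>z\<close> that unfolding the
    set term produces.\<close>
  let ?\<theta> = "\<lambda>v. if v \<in> set xs then \<theta> v else subst1 z s (Var v)"
  have "subst ?\<theta> \<tau> = subst \<theta> \<tau>" "subst ?\<theta> \<alpha> = subst \<theta> \<alpha>" using v by (auto intro!: subst_cong)
  then have *: "w \<Turnstile> subst ?\<theta> ?\<phi>" using f z by (simp add: force_And)
  have "w \<Turnstile> subst1 z s (foldr ex xs ?\<phi>)"
    by (rule force_foldr_exI[OF \<phi> _ _ _ *]) (use s z v \<theta> tm_lc[OF s] in auto)
  then show ?thesis
    using force_mem_compr[OF has_type_foldr_ex[OF ty \<phi>], of z w s] s A z v
    by (auto simp: set_of_def Let_def z_def[symmetric])
qed

text \<open>A member of the set gives values of \<open>xs\<close> at later worlds only, so the rule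
  eliminates into an arbitrary formula \<open>\<psi>\<close> at \<open>w\<close>.\<close>

lemma set_ofE:
  assumes "w \<Turnstile> s \<in>\<^sub>t set_of A xs \<tau> \<alpha>"
    and \<tau>: "has_type L [] \<tau> A" and \<alpha>: "formula L \<alpha>" and v: "fv \<tau> \<union> fv \<alpha> \<subseteq> set xs"
    and ty: "\<forall>x\<in>set xs. is_ty (ground L) (snd x)" and \<psi>: "tm w \<psi> TOmega"
    and "\<And>w' \<theta>. w \<sqsubseteq> w' \<Longrightarrow> (\<And>v. v \<in> set xs \<Longrightarrow> tm w' (\<theta> v) (snd v)) \<Longrightarrow>
      w' \<Turnstile> s \<doteq> subst \<theta> \<tau> \<Longrightarrow> w' \<Turnstile> subst \<theta> \<alpha> \<Longrightarrow> w' \<Turnstile> \<psi>"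
  shows "w \<Turnstile> \<psi>"
proof -
  define z :: "'g var" where "z = fresh A (set xs \<union> fv \<tau> \<union> fv \<alpha>)"
  have z: "z \<notin> set xs" "z \<notin> fv \<tau>" "z \<notin> fv \<alpha>" "snd z = A"
    using fresh_notin[of "set xs \<union> fv \<tau> \<union> fv \<alpha>" A] by (auto simp: z_def)
  have A: "is_ty (ground L) A" using has_type_is_ty[OF L \<tau>] by simp
  let ?\<phi> = "(Var z \<doteq> \<tau>) \<and>\<^sub>t \<alpha>"
  have \<phi>: "formula L ?\<phi>" using \<tau> \<alpha> z A by auto
  have s: "tm w s A" "w \<Turnstile> subst1 z s (foldr ex xs ?\<phi>)"
    using force_mem_compr[OF has_type_foldr_ex[OF ty \<phi>], of z w s] assms(1) A z v
    by (auto simp: set_of_def Let_def z_def[symmetric])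
  show ?thesis
  proof (rule force_foldr_exE[OF s(2) \<phi> _ _ \<psi> ty])
    show "lc 0 ((Var(z := s)) v)" for v using tm_lc[OF s(1)] by simp
    show "tm w ((Var(z := s)) y) (snd y)" if "y \<in> fv ?\<phi> - set xs" for y
      using s(1) z that v by auto
    fix w' \<theta>
    assume a: "w \<sqsubseteq> w'" "\<And>y. y \<notin> set xs \<Longrightarrow> \<theta> y = (Var(z := s)) y"
      "\<And>y. y \<in> set xs \<Longrightarrow> tm w' (\<theta> y) (snd y)" "w' \<Turnstile> subst \<theta> ?\<phi>"
    then have "w' \<Turnstile> s \<doteq> subst \<theta> \<tau>" "w' \<Turnstile> subst \<theta> \<alpha>" using z a(2)[of z] by (simp_all add: force_And)
    then show "w' \<Turnstile> \<psi>" using assms(7)[OF a(1,3)] by blast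
  qed
qed

end

section \<open>Tuples of any length\<close>

lemma bind_fresh: "x \<notin> fv t \<Longrightarrow> bind x t k = t"
  by (induction t arbitrary: k) (auto simp: map_idI)

lemma subst_mk_tuple [simp]: "subst \<sigma> (mk_tuple ts) = mk_tuple (map (subst \<sigma>) ts)"
  by (auto simp: mk_tuple_def split: list.splits)

lemma subst_mk_prj [simp]: "subst \<sigma> (mk_prj As i t) = mk_prj As i (subst \<sigma> t)"
  by (simp add: mk_prj_def)

lemma fv_mk_tuple [simp]: "fv (mk_tuple ts) = \<Union> (fv ` set ts)"
  by (auto simp: mk_tuple_def split: list.splits)

lemma fv_mk_prj [simp]: "fv (mk_prj As i t) = fv t"
  by (simp add: mk_prj_def)

lemma fv_foldr_And [simp]: "fv (foldr And \<phi>s Tru) = \<Union> (fv ` set \<phi>s)"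
  by (induction \<phi>s) auto

lemma subst_foldr_And [simp]: "subst \<sigma> (foldr And \<phi>s Tru) = foldr And (map (subst \<sigma>) \<phi>s) Tru"
  by (induction \<phi>s) auto

lemma formula_foldr_And [simp]: "formula L (foldr And \<phi>s Tru) \<longleftrightarrow> (\<forall>\<phi>\<in>set \<phi>s. formula L \<phi>)"
  by (induction \<phi>s) auto

lemma mk_tuple_simps [simp]: "mk_tuple [] = Star" "mk_tuple [t] = t" "mk_tuple (s # t # ts) = Tuple (s # t # ts)"
  by (simp_all add: mk_tuple_def)

lemma mk_prod_simps [simp]: "mk_prod [] = TUnit" "mk_prod [A] = A" "mk_prod (A # B # As) = TProd (A # B # As)"
  by (simp_all add: mk_prod_def)

text \<open>The distinction behind the conventions for \<open>mk_prod\<close>,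
  \<open>mk_tuple\<close> and \<open>mk_prj\<close>. The rule \<open>remdups_adj.cases\<close> is
  borrowed for its patterns: no element, one, or at least two.\<close>

lemma list_length_cases:
  obtains "xs = []" | x where "xs = [x]" | "2 \<le> length xs"
  by (cases xs rule: remdups_adj.cases) auto

lemma mk_tuple_long: "2 \<le> length ts \<Longrightarrow> mk_tuple ts = Tuple ts"
  by (cases ts rule: remdups_adj.cases) auto

lemma mk_prod_long: "2 \<le> length As \<Longrightarrow> mk_prod As = TProd As"
  by (cases As rule: remdups_adj.cases) auto

lemma has_type_mk_tuple:
  "list_all2 (has_type L Bs) ts As \<Longrightarrow> has_type L Bs (mk_tuple ts) (mk_prod As)"
  by (cases ts rule: list_length_cases)
    (auto simp: list_all2_Cons1 mk_tuple_long mk_prod_long list_all2_lengthD)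

lemma has_type_mk_prj:
  "has_type L Bs t (mk_prod As) \<Longrightarrow> i < length As \<Longrightarrow> has_type L Bs (mk_prj As i t) (As ! i)"
  by (cases As rule: list_length_cases) (auto simp: mk_prj_def mk_prod_long)

context set_theory
begin

lemma tm_mk_tuple: "wd w \<Longrightarrow> list_all2 (tm w) ts As \<Longrightarrow> tm w (mk_tuple ts) (mk_prod As)"
  by (cases ts rule: list_length_cases)
    (auto simp: list_all2_Cons1 mk_tuple_long mk_prod_long list_all2_lengthD)

lemma tm_mk_prj: "tm w t (mk_prod As) \<Longrightarrow> i < length As \<Longrightarrow> tm w (mk_prj As i t) (As ! i)"
  by (cases As rule: list_length_cases) (auto simp: mk_prj_def mk_prod_long)

lemma force_mk_prj_tuple:
  "list_all2 (tm w) ts As \<Longrightarrow> i < length ts \<Longrightarrow> w \<Turnstile> mk_prj As i (mk_tuple ts) \<doteq> ts ! i"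
  by (cases ts rule: list_length_cases)
    (auto simp: list_all2_Cons1 mk_tuple_long mk_prj_def force_refl list_all2_lengthD
      intro: force_Prj_Tuple)

lemma force_mk_eta:
  "tm w t (mk_prod As) \<Longrightarrow> w \<Turnstile> t \<doteq> mk_tuple (map (\<lambda>i. mk_prj As i t) [0..<length As])"
proof (cases As rule: list_length_cases)
  case 3
  assume "tm w t (mk_prod As)"
  then show ?thesis using 3 force_Tuple_eta[of w t As] by (simp add: mk_tuple_long mk_prod_long mk_prj_def)
qed (auto simp: mk_prj_def force_refl force_Star)

lemma force_mk_tuple_cong:
  "wd w \<Longrightarrow> list_all2 (\<lambda>s t. w \<Turnstile> s \<doteq> t) ss ts \<Longrightarrow> w \<Turnstile> mk_tuple ss \<doteq> mk_tuple ts"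
  by (cases ss rule: list_length_cases)
    (auto simp: list_all2_Cons1 mk_tuple_long list_all2_lengthD force_Star intro: force_Tuple_cong)

lemma force_mk_prj_cong:
  "w \<Turnstile> s \<doteq> t \<Longrightarrow> tm w s (mk_prod As) \<Longrightarrow> i < length As \<Longrightarrow> w \<Turnstile> mk_prj As i s \<doteq> mk_prj As i t"
  by (cases As rule: list_length_cases) (auto simp: mk_prj_def mk_prod_long force_Prj_cong)

lemma force_pair_cong: "w \<Turnstile> s \<doteq> s' \<Longrightarrow> w \<Turnstile> t \<doteq> t' \<Longrightarrow> w \<Turnstile> Tuple [s, t] \<doteq> Tuple [s', t']"
  by (intro force_Tuple_cong) auto

lemma force_pair_inj:
  assumes "w \<Turnstile> Tuple [s, t] \<doteq> Tuple [s', t']"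
  shows "w \<Turnstile> s \<doteq> s'" and "w \<Turnstile> t \<doteq> t'"
proof -
  obtain A B where a: "tm w s A" "tm w t B" "tm w s' A" "tm w t' B"
    using force_tm[OF assms] by (auto simp: list_all2_Cons1)
  have w: "wd w" using a tm_wd by blast
  have p: "w \<Turnstile> Prj [A, B] i (Tuple [s, t]) \<doteq> Prj [A, B] i (Tuple [s', t'])" if "i < 2" for i
    using force_Prj_cong[OF assms, of "[A, B]" i] a w that by simp
  have q: "w \<Turnstile> Prj [A, B] i (Tuple [s, t]) \<doteq> [s, t] ! i" "w \<Turnstile> Prj [A, B] i (Tuple [s', t']) \<doteq> [s', t'] ! i"
    if "i < 2" for i
    by (rule force_Prj_Tuple; use a that in auto)+
  have "w \<Turnstile> [s, t] ! i \<doteq> [s', t'] ! i" if "i < 2" for i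
    using force_trans[OF force_sym[OF q(1)[OF that]] force_trans[OF p[OF that] q(2)[OF that]]] .
  from this[of 0] this[of 1] show "w \<Turnstile> s \<doteq> s'" and "w \<Turnstile> t \<doteq> t'" by simp_all
qed

lemma force_pair_eta:
  assumes "tm w t (TProd [A, B])"
  shows "w \<Turnstile> t \<doteq> Tuple [Prj [A, B] 0 t, Prj [A, B] 1 t]"
  using force_Tuple_eta[OF assms] by (simp add: upt_rec)

section \<open>Closed terms and the sets built from them\<close>

lemma wd_empty: "wd (World {} {})"
  by (simp add: wd_def)

text \<open>The empty world has neither variables nor hypotheses, so its antecedent is empty. It
  ties forcing to the statements about \<open>S\<close> in the definitions.\<close>

lemma force_closed_iff: "fv \<phi> = {} \<Longrightarrow> ({}, \<phi>) \<in> S \<longleftrightarrow> World {} {} \<Turnstile> \<phi>"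
  using wd_empty by (auto simp: force_def hyp_def)

lemma ext_empty: "World {} {} \<sqsubseteq> w \<longleftrightarrow> wd w"
  using wd_empty by (auto simp: ext_def)

lemma closed_tm: "closed_term L t A \<Longrightarrow> wd w \<Longrightarrow> tm w t A"
  by (auto simp: closed_term_def tm_def)

lemma closed_is_ty: "closed_term L t A \<Longrightarrow> is_ty (ground L) A"
  using tm_is_ty[OF closed_tm[OF _ wd_empty]] .

lemma closed_Pow_is_ty: "closed_term L t (TPow A) \<Longrightarrow> is_ty (ground L) A"
  using closed_is_ty[of t "TPow A"] by simp

lemma closed_lc: "closed_term L t A \<Longrightarrow> lc 0 t"
  by (auto simp: closed_term_def dest: has_type_lc0)

lemma closed_mem_tm: "closed_term L X (TPow A) \<Longrightarrow> w \<Turnstile> s \<in>\<^sub>t X \<Longrightarrow> tm w s A"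
  by (drule force_tm) (auto simp: tm_def closed_term_def dest: has_type_unique)

lemma closed_pair_tm: "closed_term L F (TPow (TProd [A, B])) \<Longrightarrow> w \<Turnstile> Tuple [s, t] \<in>\<^sub>t F \<Longrightarrow> tm w s A \<and> tm w t B"
  by (drule (1) closed_mem_tm) (auto simp: list_all2_Cons1)

lemma elem_ty_eq: "closed_term L X (TPow A) \<Longrightarrow> elem_ty L X = A"
  unfolding elem_ty_def closed_term_def by (rule the_equality) (auto dest: has_type_unique)

lemma force_foldr_And: "wd w \<Longrightarrow> w \<Turnstile> foldr And \<phi>s Tru \<longleftrightarrow> (\<forall>\<phi>\<in>set \<phi>s. w \<Turnstile> \<phi>)"
  by (induction \<phi>s) (auto simp: force_And force_Tru)

text \<open>\<open>prod_set\<close> collects tuples under a block of existential quantifiers. A term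
  of product type equals the tuple of its projections, so the projections are the witnesses in one
  direction; in the other they recover the components.\<close>

lemma closed_prod_set:
  assumes "list_all2 (\<lambda>X A. closed_term L X (TPow A)) Xs As"
  shows "closed_term L (prod_set As Xs) (TPow (mk_prod As))"
    and "w \<Turnstile> t \<in>\<^sub>t prod_set As Xs \<longleftrightarrow>
      tm w t (mk_prod As) \<and> (\<forall>i<length As. w \<Turnstile> mk_prj As i t \<in>\<^sub>t Xs ! i)"
proof -
  define xs where "xs = zip [0..<length As] As"
  define \<tau> :: "('g, 'f) trm" where "\<tau> = mk_tuple (map Var xs)"
  define \<phi> where "\<phi> = foldr And (map2 (\<lambda>x X. Var x \<in>\<^sub>t X) xs Xs) Tru"
  have l: "length Xs = length As" using assms by (rule list_all2_lengthD)
  have X: "closed_term L (Xs ! i) (TPow (As ! i))" if "i < length As" for i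
    using assms that l by (simp add: list_all2_conv_all_nth)
  have tyi: "is_ty (ground L) (As ! i)" if "i < length As" for i
    using closed_Pow_is_ty[OF X[OF that]] .
  have xs: "length xs = length As" "\<And>i. i < length As \<Longrightarrow> xs ! i = (i, As ! i)" by (simp_all add: xs_def)
  have ty: "\<forall>x\<in>set xs. is_ty (ground L) (snd x)" using tyi xs by (auto simp: in_set_conv_nth)
  have \<tau>: "has_type L [] \<tau> (mk_prod As)"
    unfolding \<tau>_def by (rule has_type_mk_tuple) (use tyi xs in \<open>auto simp: list_all2_conv_all_nth\<close>)
  have tyP: "is_ty (ground L) (mk_prod As)" using has_type_is_ty[OF L \<tau>] by simp
  have \<phi>: "formula L \<phi>"
    unfolding \<phi>_def formula_foldr_And set_map
    using X tyi xs l by (auto simp: in_set_conv_nth closed_term_def)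
  have xi: "xs ! i \<in> set xs" if "i < length As" for i using that xs by (metis nth_mem)
  have v: "fv \<tau> \<subseteq> set xs" "fv \<phi> \<subseteq> set xs"
    using X xs l xi by (auto simp: \<tau>_def \<phi>_def closed_term_def in_set_conv_nth)
  have eq: "prod_set As Xs = set_of (mk_prod As) xs \<tau> \<phi>"
    by (simp add: prod_set_def Let_def xs_def \<tau>_def \<phi>_def)
  show c: "closed_term L (prod_set As Xs) (TPow (mk_prod As))"
    unfolding eq closed_term_def using has_type_set_of[OF ty \<tau> \<phi> tyP] v by auto
  have sub: "subst \<theta> \<phi> = foldr And (map2 (\<lambda>x X. \<theta> x \<in>\<^sub>t X) xs Xs) Tru" for \<theta>
  proof -
    have "map (subst \<theta>) (map2 (\<lambda>x X. Var x \<in>\<^sub>t X) xs Xs) = map2 (\<lambda>x X. \<theta> x \<in>\<^sub>t X) xs Xs"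
      using X xs l by (intro nth_equalityI) (auto simp: closed_term_def subst_closed)
    then show ?thesis by (simp only: \<phi>_def subst_foldr_And)
  qed
  have f\<phi>: "w \<Turnstile> subst \<theta> \<phi> \<longleftrightarrow> (\<forall>i<length As. w \<Turnstile> \<theta> (xs ! i) \<in>\<^sub>t Xs ! i)" if "wd w" for w \<theta>
  proof -
    have "map2 (\<lambda>x X. \<theta> x \<in>\<^sub>t X) xs Xs = map (\<lambda>i. \<theta> (xs ! i) \<in>\<^sub>t Xs ! i) [0..<length As]"
      using xs l by (intro nth_equalityI) auto
    then show ?thesis unfolding sub force_foldr_And[OF that] by auto
  qed
  show "w \<Turnstile> t \<in>\<^sub>t prod_set As Xs \<longleftrightarrow>
      tm w t (mk_prod As) \<and> (\<forall>i<length As. w \<Turnstile> mk_prj As i t \<in>\<^sub>t Xs ! i)"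
  proof (intro iffI conjI allI impI)
    assume f: "w \<Turnstile> t \<in>\<^sub>t prod_set As Xs"
    then show t: "tm w t (mk_prod As)" using closed_mem_tm[OF c] by blast
    fix i
    assume i: "i < length As"
    have "tm w (mk_prj As i t \<in>\<^sub>t Xs ! i) TOmega"
      using tm_mk_prj[OF t i] closed_tm[OF X[OF i] tm_wd[OF t]] by auto
    from f[unfolded eq] \<tau> \<phi> _ ty this
    show "w \<Turnstile> mk_prj As i t \<in>\<^sub>t Xs ! i"
    proof (rule set_ofE)
      show "fv \<tau> \<union> fv \<phi> \<subseteq> set xs" using v by simp
      fix w' \<theta>
      assume w': "w \<sqsubseteq> w'" and \<theta>: "\<And>v. v \<in> set xs \<Longrightarrow> tm w' (\<theta> v) (snd v)"
        and e: "w' \<Turnstile> t \<doteq> subst \<theta> \<tau>" and a: "w' \<Turnstile> subst \<theta> \<phi>"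
      have "list_all2 (tm w') (map \<theta> xs) As"
        using \<theta> xs by (simp add: list_all2_conv_all_nth in_set_conv_nth) (metis snd_conv)
      then have "w' \<Turnstile> mk_prj As i (mk_tuple (map \<theta> xs)) \<doteq> \<theta> (xs ! i)"
        using force_mk_prj_tuple[of w' "map \<theta> xs" As i] i xs by simp
      moreover have "w' \<Turnstile> mk_prj As i t \<doteq> mk_prj As i (mk_tuple (map \<theta> xs))"
        using force_mk_prj_cong[OF e _ i] tm_mono[OF t w'] by (simp add: \<tau>_def o_def)
      ultimately have "w' \<Turnstile> \<theta> (xs ! i) \<doteq> mk_prj As i t" using force_trans force_sym by blast
      moreover have "w' \<Turnstile> \<theta> (xs ! i) \<in>\<^sub>t Xs ! i" using a f\<phi>[OF ext_wd(2)[OF w']] i by blast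
      ultimately show "w' \<Turnstile> mk_prj As i t \<in>\<^sub>t Xs ! i"
        using force_mem_cong force_refl[OF closed_tm[OF X[OF i] ext_wd(2)[OF w']]] by blast
    qed
  next
    assume a: "tm w t (mk_prod As) \<and> (\<forall>i<length As. w \<Turnstile> mk_prj As i t \<in>\<^sub>t Xs ! i)"
    \<comment> \<open>The variables in \<open>xs\<close> are numbered by their position, so the
      number \<open>fst v\<close> selects the matching projection.\<close>
    let ?\<theta> = "\<lambda>v. mk_prj As (fst v) t"
    show "w \<Turnstile> t \<in>\<^sub>t prod_set As Xs"
      unfolding eq
    proof (rule set_ofI[OF \<tau> \<phi>])
      show "fv \<tau> \<union> fv \<phi> \<subseteq> set xs" using v by simp
      show "tm w t (mk_prod As)" using a by blast
      show "tm w (?\<theta> v) (snd v)" if "v \<in> set xs" for v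
        using that a xs tm_mk_prj by (auto simp: in_set_conv_nth)
      have "map ?\<theta> xs = map (\<lambda>i. mk_prj As i t) [0..<length As]"
        using xs by (intro nth_equalityI) auto
      then show "w \<Turnstile> t \<doteq> subst ?\<theta> \<tau>" using force_mk_eta a by (simp add: \<tau>_def o_def)
      show "w \<Turnstile> subst ?\<theta> \<phi>" using f\<phi> a tm_wd xs by auto
    qed
  qed
qed

text \<open>Inclusion is a quantified implication. The later worlds introduced by the quantifier and
  those introduced by the implication merge into one quantification by transitivity.\<close>

lemma closed_pow_set:
  assumes X: "closed_term L X (TPow A)"
  shows "closed_term L (pow_set A X) (TPow (TPow A))"
    and "w \<Turnstile> s \<in>\<^sub>t pow_set A X \<longleftrightarrow>
      tm w s (TPow A) \<and> (\<forall>w' t. w \<sqsubseteq> w' \<longrightarrow> w' \<Turnstile> t \<in>\<^sub>t s \<longrightarrow> w' \<Turnstile> t \<in>\<^sub>t X)"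
proof -
  have A: "is_ty (ground L) A" using closed_Pow_is_ty[OF X] .
  have XA: "has_type L Bs X (TPow A)" for Bs using X by (simp add: closed_term_def has_type_weaken0)
  have fX: "fv X = {}" using X by (simp add: closed_term_def)
  let ?u = "(0, TPow A) :: 'g var"
  have fm: "formula L (subset_of A (Var ?u) X)" using A XA by (auto simp: subset_of_def)
  have sub: "subset_of A r X = All A (Bound 0 \<in>\<^sub>t r \<longrightarrow>\<^sub>t Bound 0 \<in>\<^sub>t X)" for r by (simp add: subset_of_def)
  have "pow_set A X = compr ?u (subset_of A (Var ?u) X)" by (simp add: pow_set_def Let_def)
  note eq = this
  show "closed_term L (pow_set A X) (TPow (TPow A))"
    using has_type_bind[OF fm, of ?u] A fX by (auto simp: eq closed_term_def compr_def sub)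
  have "w \<Turnstile> s \<in>\<^sub>t pow_set A X \<longleftrightarrow> tm w s (TPow A) \<and> w \<Turnstile> All A (Bound 0 \<in>\<^sub>t s \<longrightarrow>\<^sub>t Bound 0 \<in>\<^sub>t X)"
    unfolding eq using force_mem_compr[OF fm, of ?u w s] A fX by (auto simp: sub subst_closed)
  also have "\<dots> \<longleftrightarrow> tm w s (TPow A) \<and> (\<forall>w' t. w \<sqsubseteq> w' \<longrightarrow> w' \<Turnstile> t \<in>\<^sub>t s \<longrightarrow> w' \<Turnstile> t \<in>\<^sub>t X)"
  proof (rule conj_cong[OF refl])
    assume s: "tm w s (TPow A)"
    have i: "inst t (Bound 0 \<in>\<^sub>t s \<longrightarrow>\<^sub>t Bound 0 \<in>\<^sub>t X) = (t \<in>\<^sub>t s \<longrightarrow>\<^sub>t t \<in>\<^sub>t X)" for t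
      using tm_lc[OF s] closed_lc[OF X] by simp
    have "has_type L [A] s (TPow A)" using s by (simp add: tm_def has_type_weaken0)
    then have "w \<Turnstile> All A (Bound 0 \<in>\<^sub>t s \<longrightarrow>\<^sub>t Bound 0 \<in>\<^sub>t X) \<longleftrightarrow>
        (\<forall>w' t. w \<sqsubseteq> w' \<longrightarrow> tm w' t A \<longrightarrow> w' \<Turnstile> (t \<in>\<^sub>t s \<longrightarrow>\<^sub>t t \<in>\<^sub>t X))"
      using force_All[of w A "Bound 0 \<in>\<^sub>t s \<longrightarrow>\<^sub>t Bound 0 \<in>\<^sub>t X", unfolded i] s A XA fX
      by (auto simp: tm_def)
    also have "\<dots> \<longleftrightarrow> (\<forall>w' t. w \<sqsubseteq> w' \<longrightarrow> tm w' t A \<longrightarrow> w' \<Turnstile> t \<in>\<^sub>t s \<longrightarrow> w' \<Turnstile> t \<in>\<^sub>t X)"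
      (is "?l \<longleftrightarrow> ?r")
    proof -
      have "w' \<Turnstile> (t \<in>\<^sub>t s \<longrightarrow>\<^sub>t t \<in>\<^sub>t X) \<longleftrightarrow> (\<forall>w''. w' \<sqsubseteq> w'' \<longrightarrow> w'' \<Turnstile> t \<in>\<^sub>t s \<longrightarrow> w'' \<Turnstile> t \<in>\<^sub>t X)"
        if "w \<sqsubseteq> w'" "tm w' t A" for w' t
        by (rule force_Imp)
          (use that tm_mono[OF s that(1)] closed_tm[OF X tm_wd[OF that(2)]] in auto)
      then show ?thesis by (meson ext_trans ext_refl ext_wd tm_mono)
    qed
    also have "\<dots> \<longleftrightarrow> (\<forall>w' t. w \<sqsubseteq> w' \<longrightarrow> w' \<Turnstile> t \<in>\<^sub>t s \<longrightarrow> w' \<Turnstile> t \<in>\<^sub>t X)"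
      using force_tm tm_mono[OF s] by (fastforce dest: tm_unique)
    finally show "w \<Turnstile> All A (Bound 0 \<in>\<^sub>t s \<longrightarrow>\<^sub>t Bound 0 \<in>\<^sub>t X) \<longleftrightarrow>
        (\<forall>w' t. w \<sqsubseteq> w' \<longrightarrow> w' \<Turnstile> t \<in>\<^sub>t s \<longrightarrow> w' \<Turnstile> t \<in>\<^sub>t X)" .
  qed
  finally show "w \<Turnstile> s \<in>\<^sub>t pow_set A X \<longleftrightarrow>
      tm w s (TPow A) \<and> (\<forall>w' t. w \<sqsubseteq> w' \<longrightarrow> w' \<Turnstile> t \<in>\<^sub>t s \<longrightarrow> w' \<Turnstile> t \<in>\<^sub>t X)" .
qed

lemma closed_U:
  assumes "is_ty (ground L) A"
  shows "closed_term L (U A) (TPow A)" and "w \<Turnstile> s \<in>\<^sub>t U A \<longleftrightarrow> tm w s A"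
  using assms tm_wd force_Tru by (auto simp: U_def closed_term_def force_mem_Compr)

section \<open>Unique existence and functions\<close>

text \<open>The clause separates existence, in eliminated form, from uniqueness. Given both, any
  instance is a witness of the combined formula. Conversely, two instances are equal because each of
  them equals the common witness.\<close>

lemma force_Ex1:
  assumes w: "wd w" and B: "is_ty (ground L) B" and b: "has_type L [B] b TOmega" and v: "fv b \<subseteq> vars w"
  shows "w \<Turnstile> Ex1 B b \<longleftrightarrow>
    (\<forall>w' \<psi>. w \<sqsubseteq> w' \<longrightarrow> tm w' \<psi> TOmega \<longrightarrow>
      (\<forall>w'' t. w' \<sqsubseteq> w'' \<longrightarrow> tm w'' t B \<longrightarrow> w'' \<Turnstile> inst t b \<longrightarrow> w'' \<Turnstile> \<psi>) \<longrightarrow> w' \<Turnstile> \<psi>) \<and>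
    (\<forall>w' s t. w \<sqsubseteq> w' \<longrightarrow> tm w' s B \<longrightarrow> tm w' t B \<longrightarrow> w' \<Turnstile> inst s b \<longrightarrow> w' \<Turnstile> inst t b \<longrightarrow> w' \<Turnstile> s \<doteq> t)"
    (is "_ \<longleftrightarrow> ?E w \<and> ?I w")
proof -
  let ?a = "b \<and>\<^sub>t All B (b \<longrightarrow>\<^sub>t (Bound 1 \<doteq> Bound 0))"
  have b2: "has_type L [B, B] b TOmega" using has_type_weaken[OF b, of "[B]"] by simp
  have a: "has_type L [B] ?a TOmega" using b b2 B by (auto intro!: exI[of _ B])
  have "msub Var [t] (Suc 0) b = b" for t using has_type_lc[OF b] msub_lc[of 1 b "Suc 0" Var] by simp
  then have ia: "inst t ?a = (inst t b \<and>\<^sub>t All B (b \<longrightarrow>\<^sub>t (t \<doteq> Bound 0)))" for t by simp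
  have tb: "tm w' (inst t b) TOmega" if "w \<sqsubseteq> w'" "tm w' t B" for w' t
    using that has_type_inst[OF b, of t] fv_inst_subset[of b "vars w'" t] v
    by (auto simp: tm_def ext_def)
  have all: "w' \<Turnstile> All B (b \<longrightarrow>\<^sub>t (t \<doteq> Bound 0)) \<longleftrightarrow>
      (\<forall>w'' s. w' \<sqsubseteq> w'' \<longrightarrow> tm w'' s B \<longrightarrow> w'' \<Turnstile> inst s b \<longrightarrow> w'' \<Turnstile> t \<doteq> s)"
    if w': "w \<sqsubseteq> w'" and t: "tm w' t B" for w' t
  proof -
    have i: "inst s (b \<longrightarrow>\<^sub>t (t \<doteq> Bound 0)) = (inst s b \<longrightarrow>\<^sub>t (t \<doteq> s))" for s using tm_lc[OF t] by simp
    have "has_type L [B] t B" using t by (simp add: tm_def has_type_weaken0)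
    then have "w' \<Turnstile> All B (b \<longrightarrow>\<^sub>t (t \<doteq> Bound 0)) \<longleftrightarrow>
        (\<forall>w'' s. w' \<sqsubseteq> w'' \<longrightarrow> tm w'' s B \<longrightarrow> w'' \<Turnstile> (inst s b \<longrightarrow>\<^sub>t (t \<doteq> s)))"
      unfolding i[symmetric]
      by (intro force_All) (use b B t v w' in \<open>auto simp: tm_def ext_def intro!: exI[of _ B]\<close>)
    also have "\<dots> \<longleftrightarrow> (\<forall>w'' s. w' \<sqsubseteq> w'' \<longrightarrow> tm w'' s B \<longrightarrow> w'' \<Turnstile> inst s b \<longrightarrow> w'' \<Turnstile> t \<doteq> s)"
    proof -
      have "w'' \<Turnstile> (inst s b \<longrightarrow>\<^sub>t (t \<doteq> s)) \<longleftrightarrow> (\<forall>w'''. w'' \<sqsubseteq> w''' \<longrightarrow> w''' \<Turnstile> inst s b \<longrightarrow> w''' \<Turnstile> t \<doteq> s)"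
        if "w' \<sqsubseteq> w''" "tm w'' s B" for w'' s
        using force_Imp[OF tb[OF ext_trans[OF w' that(1)] that(2)], of "t \<doteq> s"] that tm_mono[OF t]
        by auto
      then show ?thesis by (meson ext_trans ext_refl ext_wd tm_mono)
    qed
    finally show ?thesis .
  qed
  show ?thesis
  proof (intro iffI conjI)
    assume f: "w \<Turnstile> Ex1 B b"
    have fe: "w' \<Turnstile> Ex B ?a" if "w \<sqsubseteq> w'" for w' using force_mono[OF f that] by (simp add: Ex1_def)
    show "?E w"
    proof (intro allI impI)
      fix w' \<psi>
      assume w': "w \<sqsubseteq> w'" and \<psi>: "tm w' \<psi> TOmega"
        and h: "\<forall>w'' t. w' \<sqsubseteq> w'' \<longrightarrow> tm w'' t B \<longrightarrow> w'' \<Turnstile> inst t b \<longrightarrow> w'' \<Turnstile> \<psi>"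
      show "w' \<Turnstile> \<psi>"
        by (rule force_ExE[OF fe[OF w'] a \<psi>]) (use h in \<open>simp only: ia force_And\<close>)
    qed
    show "?I w"
    proof (intro allI impI)
      fix w' s t
      assume w': "w \<sqsubseteq> w'" and t: "tm w' s B" "tm w' t B" and h: "w' \<Turnstile> inst s b" "w' \<Turnstile> inst t b"
      show "w' \<Turnstile> s \<doteq> t"
      proof (rule force_ExE[OF fe[OF w'] a])
        show "tm w' (s \<doteq> t) TOmega" using t by auto
        fix w'' r
        assume e: "w' \<sqsubseteq> w''" and r: "tm w'' r B" and "w'' \<Turnstile> inst r ?a"
        then have "\<forall>x. tm w'' x B \<longrightarrow> w'' \<Turnstile> inst x b \<longrightarrow> w'' \<Turnstile> r \<doteq> x"
          unfolding ia force_And all[OF ext_trans[OF w' e] r] using ext_refl ext_wd(2)[OF e] by blast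
        then have "w'' \<Turnstile> r \<doteq> s" "w'' \<Turnstile> r \<doteq> t"
          using t[THEN tm_mono, OF e] h[THEN force_mono, OF e] by blast+
        then show "w'' \<Turnstile> s \<doteq> t" using force_trans force_sym by blast
      qed
    qed
  next
    assume h: "?E w \<and> ?I w"
    have "w \<Turnstile> Ex B ?a"
    proof (rule h[THEN conjunct1, rule_format])
      show "w \<sqsubseteq> w" using w by simp
      show "tm w (Ex B ?a) TOmega"
        using a v w B has_type_weaken[OF a, of "[TOmega]"] by (auto simp: tm_def)
      fix w'' t
      assume e: "w \<sqsubseteq> w''" and t: "tm w'' t B" and f: "w'' \<Turnstile> inst t b"
      have "w'' \<Turnstile> inst t ?a"
        unfolding ia force_And all[OF e t]
      proof (intro conjI allI impI f)
        fix w''' s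
        assume "w'' \<sqsubseteq> w'''" "tm w''' s B" "w''' \<Turnstile> inst s b"
        then show "w''' \<Turnstile> t \<doteq> s"
          using h[THEN conjunct2, rule_format, OF ext_trans[OF e]] tm_mono[OF t] force_mono[OF f] by blast
      qed
      then show "w'' \<Turnstile> Ex B ?a" using force_ExI t a v e by (auto simp: ext_def)
    qed
    then show "w \<Turnstile> Ex1 B b" by (simp add: Ex1_def)
  qed
qed

text \<open>The last clause is totality: values exist locally.\<close>

definition sfn :: "('g, 'f) trm \<Rightarrow> 'g ty \<Rightarrow> 'g ty \<Rightarrow> ('g, 'f) trm \<Rightarrow> ('g, 'f) trm \<Rightarrow> bool" where
  "sfn F A B X Y \<longleftrightarrow> closed_term L X (TPow A) \<and> closed_term L Y (TPow B) \<and>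
    closed_term L F (TPow (TProd [A, B])) \<and>
    (\<forall>w s t. w \<Turnstile> Tuple [s, t] \<in>\<^sub>t F \<longrightarrow> w \<Turnstile> s \<in>\<^sub>t X \<and> w \<Turnstile> t \<in>\<^sub>t Y) \<and>
    (\<forall>w s t t'. w \<Turnstile> Tuple [s, t] \<in>\<^sub>t F \<longrightarrow> w \<Turnstile> Tuple [s, t'] \<in>\<^sub>t F \<longrightarrow> w \<Turnstile> t \<doteq> t') \<and>
    (\<forall>w s \<psi>. w \<Turnstile> s \<in>\<^sub>t X \<longrightarrow> tm w \<psi> TOmega \<longrightarrow>
      (\<forall>w' t. w \<sqsubseteq> w' \<longrightarrow> w' \<Turnstile> Tuple [s, t] \<in>\<^sub>t F \<longrightarrow> w' \<Turnstile> \<psi>) \<longrightarrow> w \<Turnstile> \<psi>)"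

lemma sfnI:
  assumes "closed_term L X (TPow A)" and "closed_term L Y (TPow B)"
    and "closed_term L F (TPow (TProd [A, B]))"
    and "\<And>w s t. w \<Turnstile> Tuple [s, t] \<in>\<^sub>t F \<Longrightarrow> w \<Turnstile> s \<in>\<^sub>t X \<and> w \<Turnstile> t \<in>\<^sub>t Y"
    and "\<And>w s t t'. w \<Turnstile> Tuple [s, t] \<in>\<^sub>t F \<Longrightarrow> w \<Turnstile> Tuple [s, t'] \<in>\<^sub>t F \<Longrightarrow> w \<Turnstile> t \<doteq> t'"
    and "\<And>w s \<psi>. w \<Turnstile> s \<in>\<^sub>t X \<Longrightarrow> tm w \<psi> TOmega \<Longrightarrow>
      (\<And>w' t. w \<sqsubseteq> w' \<Longrightarrow> w' \<Turnstile> Tuple [s, t] \<in>\<^sub>t F \<Longrightarrow> w' \<Turnstile> \<psi>) \<Longrightarrow> w \<Turnstile> \<psi>"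
  shows "sfn F A B X Y"
  unfolding sfn_def using assms(1-5) by (intro conjI allI impI) (blast intro: assms(6))+

lemma sfn_closed:
  assumes "sfn F A B X Y"
  shows "closed_term L X (TPow A)" "closed_term L Y (TPow B)" "closed_term L F (TPow (TProd [A, B]))"
    "is_ty (ground L) A" "is_ty (ground L) B"
  using assms closed_Pow_is_ty unfolding sfn_def by blast+

lemma sfn_dom: "sfn F A B X Y \<Longrightarrow> w \<Turnstile> Tuple [s, t] \<in>\<^sub>t F \<Longrightarrow> w \<Turnstile> s \<in>\<^sub>t X"
  and sfn_cod: "sfn F A B X Y \<Longrightarrow> w \<Turnstile> Tuple [s, t] \<in>\<^sub>t F \<Longrightarrow> w \<Turnstile> t \<in>\<^sub>t Y"
  and sfn_fun: "sfn F A B X Y \<Longrightarrow> w \<Turnstile> Tuple [s, t] \<in>\<^sub>t F \<Longrightarrow> w \<Turnstile> Tuple [s, t'] \<in>\<^sub>t F \<Longrightarrow> w \<Turnstile> t \<doteq> t'"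
  unfolding sfn_def by blast+

lemma sfn_total:
  assumes "sfn F A B X Y" and "w \<Turnstile> s \<in>\<^sub>t X" and "tm w \<psi> TOmega"
    and "\<And>w' t. w \<sqsubseteq> w' \<Longrightarrow> w' \<Turnstile> Tuple [s, t] \<in>\<^sub>t F \<Longrightarrow> w' \<Turnstile> \<psi>"
  shows "w \<Turnstile> \<psi>"
  using assms unfolding sfn_def by blast

text \<open>The first conjunct of \<open>fun_set\<close>, inclusion in the product, gives the domain
  and codomain clause of \<open>sfn\<close>; unique existence gives functionality and totality.
  Uniqueness in \<open>fun_set\<close> concerns values in \<open>Y\<close>, and the inclusion puts
  all values there.\<close>

lemma force_fun_set:
  assumes X: "closed_term L X (TPow A)" and Y: "closed_term L Y (TPow B)"
    and F: "closed_term L F (TPow (TProd [A, B]))"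
  shows "World {} {} \<Turnstile> F \<in>\<^sub>t fun_set A B X Y \<longleftrightarrow> sfn F A B X Y"
proof -
  let ?w = "World {} {} :: ('g, 'f) world"
  let ?P = "prod_set [A, B] [X, Y]" and ?u = "(0, TPow (TProd [A, B])) :: 'g var"
  have A: "is_ty (ground L) A" and B: "is_ty (ground L) B" using X Y closed_Pow_is_ty by blast+
  have P: "closed_term L ?P (TPow (TProd [A, B]))"
    and Pm: "w \<Turnstile> t \<in>\<^sub>t ?P \<longleftrightarrow> tm w t (TProd [A, B]) \<and>
      w \<Turnstile> Prj [A, B] 0 t \<in>\<^sub>t X \<and> w \<Turnstile> Prj [A, B] 1 t \<in>\<^sub>t Y" for w t
    using closed_prod_set[of "[X, Y]" "[A, B]"] X Y
    by (simp_all add: mk_prj_def less_Suc_eq all_conj_distrib numeral_2_eq_2)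
  have fvs: "fv X = {}" "fv Y = {}" "fv ?P = {}" "fv F = {}" using X Y P F by (simp_all only: closed_term_def)
  have typs: "has_type L Bs X (TPow A)" "has_type L Bs Y (TPow B)"
    "has_type L Bs ?P (TPow (TProd [A, B]))" "has_type L Bs F (TPow (TProd [A, B]))" for Bs
    using X Y P F by (simp_all only: closed_term_def has_type_weaken0)
  have lcs: "lc 0 X" "lc 0 Y" "lc 0 ?P" "lc 0 F" using closed_lc X Y P F by blast+
  define b where "b x r = (Bound 0 \<in>\<^sub>t Y \<and>\<^sub>t Tuple [x, Bound 0] \<in>\<^sub>t r)" for x r :: "('g, 'f) trm"
  \<comment> \<open>\<open>Ex\<close> hides a binder for its truth value, so \<open>x\<close> has
    index 2 below \<open>Ex B\<close> and index 3 below the further \<open>All B\<close>.\<close>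
  define q where "q r = (All (TProd [A, B]) (Bound 0 \<in>\<^sub>t r \<longrightarrow>\<^sub>t Bound 0 \<in>\<^sub>t ?P) \<and>\<^sub>t
    All A (Bound 0 \<in>\<^sub>t X \<longrightarrow>\<^sub>t Ex B (b (Bound 2) r \<and>\<^sub>t All B (b (Bound 3) r \<longrightarrow>\<^sub>t (Bound 1 \<doteq> Bound 0)))))"
    for r :: "('g, 'f) trm"
  have eq: "fun_set A B X Y = compr ?u (q (Var ?u))"
    by (simp add: fun_set_def Let_def subset_of_def all_def ex1_def Ex1_def q_def b_def bind_fresh fvs
        And_def Imp_def Ex_def All_def Tru_def numeral_2_eq_2 numeral_3_eq_3)
  have tq: "formula L (q (Var ?u))"
    using A B typs by (auto simp: q_def b_def list_all2_Cons1 numeral_2_eq_2 numeral_3_eq_3)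
  have "?w \<Turnstile> F \<in>\<^sub>t fun_set A B X Y \<longleftrightarrow> ?w \<Turnstile> subst1 ?u F (q (Var ?u))"
    unfolding eq using force_mem_compr[OF tq, of ?u ?w F] closed_tm[OF F wd_empty] A B fvs
    by (simp add: q_def b_def)
  also have "subst1 ?u F (q (Var ?u)) = q F" by (simp add: q_def b_def subst_closed fvs)
  also have "?w \<Turnstile> q F \<longleftrightarrow> ?w \<Turnstile> All (TProd [A, B]) (Bound 0 \<in>\<^sub>t F \<longrightarrow>\<^sub>t Bound 0 \<in>\<^sub>t ?P) \<and>
    ?w \<Turnstile> All A (Bound 0 \<in>\<^sub>t X \<longrightarrow>\<^sub>t Ex B (b (Bound 2) F \<and>\<^sub>t All B (b (Bound 3) F \<longrightarrow>\<^sub>t (Bound 1 \<doteq> Bound 0))))"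
    by (simp add: q_def force_And)
  also have "?w \<Turnstile> All (TProd [A, B]) (Bound 0 \<in>\<^sub>t F \<longrightarrow>\<^sub>t Bound 0 \<in>\<^sub>t ?P) \<longleftrightarrow>
    (\<forall>w s t. w \<Turnstile> Tuple [s, t] \<in>\<^sub>t F \<longrightarrow> w \<Turnstile> s \<in>\<^sub>t X \<and> w \<Turnstile> t \<in>\<^sub>t Y)"
  proof -
    have i: "inst r (Bound 0 \<in>\<^sub>t F \<longrightarrow>\<^sub>t Bound 0 \<in>\<^sub>t ?P) = (r \<in>\<^sub>t F \<longrightarrow>\<^sub>t r \<in>\<^sub>t ?P)" for r using lcs by simp
    have "?w \<Turnstile> All (TProd [A, B]) (Bound 0 \<in>\<^sub>t F \<longrightarrow>\<^sub>t Bound 0 \<in>\<^sub>t ?P) \<longleftrightarrow>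
        (\<forall>w r. ?w \<sqsubseteq> w \<longrightarrow> tm w r (TProd [A, B]) \<longrightarrow> w \<Turnstile> (r \<in>\<^sub>t F \<longrightarrow>\<^sub>t r \<in>\<^sub>t ?P))"
      using force_All[of ?w "TProd [A, B]" "Bound 0 \<in>\<^sub>t F \<longrightarrow>\<^sub>t Bound 0 \<in>\<^sub>t ?P", unfolded i]
        A B typs fvs wd_empty by auto
    also have "\<dots> \<longleftrightarrow> (\<forall>w r. w \<Turnstile> r \<in>\<^sub>t F \<longrightarrow> w \<Turnstile> r \<in>\<^sub>t ?P)"
    proof -
      have "w \<Turnstile> (r \<in>\<^sub>t F \<longrightarrow>\<^sub>t r \<in>\<^sub>t ?P) \<longleftrightarrow> (\<forall>w'. w \<sqsubseteq> w' \<longrightarrow> w' \<Turnstile> r \<in>\<^sub>t F \<longrightarrow> w' \<Turnstile> r \<in>\<^sub>t ?P)"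
        if "tm w r (TProd [A, B])" for w r
        by (rule force_Imp)
          (use that closed_tm[OF F tm_wd[OF that]] closed_tm[OF P tm_wd[OF that]] in auto)
      then show ?thesis
        using closed_mem_tm[OF F] by (meson ext_empty ext_refl force_wd)
    qed
    also have "\<dots> \<longleftrightarrow> (\<forall>w s t. w \<Turnstile> Tuple [s, t] \<in>\<^sub>t F \<longrightarrow> w \<Turnstile> s \<in>\<^sub>t X \<and> w \<Turnstile> t \<in>\<^sub>t Y)"
    proof (intro iffI allI impI)
      fix w s t
      assume "\<forall>w r. w \<Turnstile> r \<in>\<^sub>t F \<longrightarrow> w \<Turnstile> r \<in>\<^sub>t ?P" and f: "w \<Turnstile> Tuple [s, t] \<in>\<^sub>t F"
      then have *: "w \<Turnstile> Prj [A, B] 0 (Tuple [s, t]) \<in>\<^sub>t X" "w \<Turnstile> Prj [A, B] 1 (Tuple [s, t]) \<in>\<^sub>t Y"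
        unfolding Pm by blast+
      have "list_all2 (tm w) [s, t] [A, B]" using closed_pair_tm[OF F f] by simp
      from force_Prj_Tuple[OF this, of 0] force_Prj_Tuple[OF this, of 1]
      show "w \<Turnstile> s \<in>\<^sub>t X \<and> w \<Turnstile> t \<in>\<^sub>t Y"
        using force_mem_cong[OF _ force_refl[OF closed_tm[OF X force_wd[OF f]]] *(1)]
          force_mem_cong[OF _ force_refl[OF closed_tm[OF Y force_wd[OF f]]] *(2)] by simp
    next
      fix w r
      assume a: "\<forall>w s t. w \<Turnstile> Tuple [s, t] \<in>\<^sub>t F \<longrightarrow> w \<Turnstile> s \<in>\<^sub>t X \<and> w \<Turnstile> t \<in>\<^sub>t Y" and f: "w \<Turnstile> r \<in>\<^sub>t F"
      have r: "tm w r (TProd [A, B])" using closed_mem_tm[OF F f] .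
      have "w \<Turnstile> Tuple [Prj [A, B] 0 r, Prj [A, B] 1 r] \<in>\<^sub>t F"
        using force_mem_cong[OF force_pair_eta[OF r] force_refl[OF closed_tm[OF F force_wd[OF f]]] f] .
      then show "w \<Turnstile> r \<in>\<^sub>t ?P" using a r by (simp add: Pm)
    qed
    finally show ?thesis .
  qed
  also have "?w \<Turnstile> All A (Bound 0 \<in>\<^sub>t X \<longrightarrow>\<^sub>t
        Ex B (b (Bound 2) F \<and>\<^sub>t All B (b (Bound 3) F \<longrightarrow>\<^sub>t (Bound 1 \<doteq> Bound 0)))) \<longleftrightarrow>
      (\<forall>w s. w \<Turnstile> s \<in>\<^sub>t X \<longrightarrow> w \<Turnstile> Ex1 B (b s F))"
  proof -
    let ?b = "Bound 0 \<in>\<^sub>t X \<longrightarrow>\<^sub>t Ex B (b (Bound 2) F \<and>\<^sub>t All B (b (Bound 3) F \<longrightarrow>\<^sub>t (Bound 1 \<doteq> Bound 0)))"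
    have i: "inst s ?b = (s \<in>\<^sub>t X \<longrightarrow>\<^sub>t Ex1 B (b s F))" for s
      using lcs by (simp add: b_def Ex1_def numeral_2_eq_2 numeral_3_eq_3)
    have "?w \<Turnstile> All A ?b \<longleftrightarrow> (\<forall>w s. ?w \<sqsubseteq> w \<longrightarrow> tm w s A \<longrightarrow> w \<Turnstile> (s \<in>\<^sub>t X \<longrightarrow>\<^sub>t Ex1 B (b s F)))"
      by (rule force_All[of ?w A ?b, unfolded i])
        (use A B typs fvs wd_empty in \<open>auto simp: b_def list_all2_Cons1 numeral_2_eq_2 numeral_3_eq_3\<close>)
    also have "\<dots> \<longleftrightarrow> (\<forall>w s. w \<Turnstile> s \<in>\<^sub>t X \<longrightarrow> w \<Turnstile> Ex1 B (b s F))"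
    proof -
      have "w \<Turnstile> (s \<in>\<^sub>t X \<longrightarrow>\<^sub>t Ex1 B (b s F)) \<longleftrightarrow>
          (\<forall>w'. w \<sqsubseteq> w' \<longrightarrow> w' \<Turnstile> s \<in>\<^sub>t X \<longrightarrow> w' \<Turnstile> Ex1 B (b s F))"
        if "tm w s A" for w s
      proof (rule force_Imp)
        have "has_type L Bs s A" for Bs using that by (simp add: tm_def has_type_weaken0)
        then show "tm w (Ex1 B (b s F)) TOmega"
          using that B typs fvs
          by (auto simp: tm_def b_def Ex1_def list_all2_Cons1 intro!: exI[of _ "TProd [A, B]"])
        show "tm w (s \<in>\<^sub>t X) TOmega" using that closed_tm[OF X tm_wd] by auto
      qed
      then show ?thesis using closed_mem_tm[OF X] by (meson ext_empty ext_refl force_wd)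
    qed
    finally show ?thesis .
  qed
  finally have main: "?w \<Turnstile> F \<in>\<^sub>t fun_set A B X Y \<longleftrightarrow>
    (\<forall>w s t. w \<Turnstile> Tuple [s, t] \<in>\<^sub>t F \<longrightarrow> w \<Turnstile> s \<in>\<^sub>t X \<and> w \<Turnstile> t \<in>\<^sub>t Y) \<and>
    (\<forall>w s. w \<Turnstile> s \<in>\<^sub>t X \<longrightarrow> w \<Turnstile> Ex1 B (b s F))" .
  have ib: "w \<Turnstile> inst t (b s F) \<longleftrightarrow> w \<Turnstile> t \<in>\<^sub>t Y \<and> w \<Turnstile> Tuple [s, t] \<in>\<^sub>t F" if "tm w' s A" for w w' s t
    using lcs tm_lc[OF that] by (simp add: b_def force_And)
  have ex1: "w \<Turnstile> Ex1 B (b s F) \<longleftrightarrow>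
    (\<forall>w' \<psi>. w \<sqsubseteq> w' \<longrightarrow> tm w' \<psi> TOmega \<longrightarrow>
      (\<forall>w'' t. w' \<sqsubseteq> w'' \<longrightarrow> tm w'' t B \<longrightarrow> w'' \<Turnstile> t \<in>\<^sub>t Y \<and> w'' \<Turnstile> Tuple [s, t] \<in>\<^sub>t F \<longrightarrow> w'' \<Turnstile> \<psi>) \<longrightarrow> w' \<Turnstile> \<psi>) \<and>
    (\<forall>w' t t'. w \<sqsubseteq> w' \<longrightarrow> tm w' t B \<longrightarrow> tm w' t' B \<longrightarrow> w' \<Turnstile> t \<in>\<^sub>t Y \<and> w' \<Turnstile> Tuple [s, t] \<in>\<^sub>t F \<longrightarrow>
      w' \<Turnstile> t' \<in>\<^sub>t Y \<and> w' \<Turnstile> Tuple [s, t'] \<in>\<^sub>t F \<longrightarrow> w' \<Turnstile> t \<doteq> t')"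
    if s: "tm w s A" for w s
    unfolding ib[OF s, symmetric]
  proof (rule force_Ex1[OF tm_wd[OF s] B])
    show "has_type L [B] (b s F) TOmega" "fv (b s F) \<subseteq> vars w"
      using typs fvs s has_type_weaken0[of L s A "[B]"] 
      by (auto simp: b_def tm_def list_all2_Cons1 intro!: exI[of _ "TProd [A, B]"])
  qed
  show ?thesis
    unfolding main sfn_def
  proof (intro iffI conjI allI impI X Y F; (elim conjE)?)
    fix w s t
    assume "\<forall>w s t. w \<Turnstile> Tuple [s, t] \<in>\<^sub>t F \<longrightarrow> w \<Turnstile> s \<in>\<^sub>t X \<and> w \<Turnstile> t \<in>\<^sub>t Y" "w \<Turnstile> Tuple [s, t] \<in>\<^sub>t F"
    then show "w \<Turnstile> s \<in>\<^sub>t X" "w \<Turnstile> t \<in>\<^sub>t Y" by blast+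
  next
    fix w s t t'
    assume h: "\<forall>w s t. w \<Turnstile> Tuple [s, t] \<in>\<^sub>t F \<longrightarrow> w \<Turnstile> s \<in>\<^sub>t X \<and> w \<Turnstile> t \<in>\<^sub>t Y"
      "\<forall>w s. w \<Turnstile> s \<in>\<^sub>t X \<longrightarrow> w \<Turnstile> Ex1 B (b s F)"
      and f: "w \<Turnstile> Tuple [s, t] \<in>\<^sub>t F" "w \<Turnstile> Tuple [s, t'] \<in>\<^sub>t F"
    have "tm w s A" "tm w t B" "tm w t' B" using closed_pair_tm[OF F] f by blast+
    then show "w \<Turnstile> t \<doteq> t'" using ex1[of w s] h f ext_refl force_wd[OF f(1)] by blast
  next
    fix w s \<psi>
    assume h: "\<forall>w s. w \<Turnstile> s \<in>\<^sub>t X \<longrightarrow> w \<Turnstile> Ex1 B (b s F)" and s: "w \<Turnstile> s \<in>\<^sub>t X"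
      and \<psi>: "tm w \<psi> TOmega" "\<forall>w' t. w \<sqsubseteq> w' \<longrightarrow> w' \<Turnstile> Tuple [s, t] \<in>\<^sub>t F \<longrightarrow> w' \<Turnstile> \<psi>"
    then show "w \<Turnstile> \<psi>"
      by (intro ex1[OF closed_mem_tm[OF X s], THEN iffD1, THEN conjunct1, rule_format, of w \<psi>])
        (use force_wd[OF s] in auto)
  next
    fix w s
    assume h: "\<forall>w s t. w \<Turnstile> Tuple [s, t] \<in>\<^sub>t F \<longrightarrow> w \<Turnstile> s \<in>\<^sub>t X \<and> w \<Turnstile> t \<in>\<^sub>t Y"
      "\<forall>w s t t'. w \<Turnstile> Tuple [s, t] \<in>\<^sub>t F \<longrightarrow> w \<Turnstile> Tuple [s, t'] \<in>\<^sub>t F \<longrightarrow> w \<Turnstile> t \<doteq> t'"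
      "\<forall>w s \<psi>. w \<Turnstile> s \<in>\<^sub>t X \<longrightarrow> tm w \<psi> TOmega \<longrightarrow>
        (\<forall>w' t. w \<sqsubseteq> w' \<longrightarrow> w' \<Turnstile> Tuple [s, t] \<in>\<^sub>t F \<longrightarrow> w' \<Turnstile> \<psi>) \<longrightarrow> w \<Turnstile> \<psi>" and s: "w \<Turnstile> s \<in>\<^sub>t X"
    show "w \<Turnstile> Ex1 B (b s F)"
      unfolding ex1[OF closed_mem_tm[OF X s]]
    proof (intro conjI allI impI)
      fix w' \<psi>
      assume w': "w \<sqsubseteq> w'" and \<psi>: "tm w' \<psi> TOmega" and g: "\<forall>w'' t. w' \<sqsubseteq> w'' \<longrightarrow> tm w'' t B \<longrightarrow>
        w'' \<Turnstile> t \<in>\<^sub>t Y \<and> w'' \<Turnstile> Tuple [s, t] \<in>\<^sub>t F \<longrightarrow> w'' \<Turnstile> \<psi>"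
      show "w' \<Turnstile> \<psi>"
        by (rule h(3)[rule_format, OF force_mono[OF s w'] \<psi>]) (use g h(1) closed_pair_tm[OF F] in blast)
    qed (use h(2) in blast)
  qed blast+
qed

text \<open>\<open>is_sfun\<close> requires of \<open>F\<close> only that it is a set of some type.
  The derivable membership in \<open>fun_set\<close> is well typed, and this determines the
  type.\<close>

lemma is_sfun_iff:
  assumes "closed_term L X (TPow A)" and "closed_term L Y (TPow B)"
  shows "is_sfun L S F X Y \<longleftrightarrow> sfn F A B X Y"
proof
  assume f: "is_sfun L S F X Y"
  then obtain C where C: "closed_term L F (TPow C)" by (auto simp: is_sfun_def is_sset_def)
  have "({}, F \<in>\<^sub>t fun_set A B X Y) \<in> S"
    using f assms[THEN elem_ty_eq] by (simp add: is_sfun_def entails_def)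
  moreover have "fv (fun_set A B X Y) = {}"
  proof -
    have "closed_term L (prod_set [A, B] [X, Y]) (TPow (TProd [A, B]))"
      using closed_prod_set[of "[X, Y]" "[A, B]"] assms by simp
    then show ?thesis using assms
      by (auto simp: fun_set_def Let_def compr_def subset_of_def all_def ex1_def Ex1_def closed_term_def)
  qed
  ultimately have *: "World {} {} \<Turnstile> F \<in>\<^sub>t fun_set A B X Y"
    using C by (subst force_closed_iff[symmetric]) (auto simp: closed_term_def)
  then have "tm (World {} {}) F (TPow (TProd [A, B]))"
    using force_tm[OF *] by (fastforce simp: fun_set_def Let_def compr_def tm_def)
  then have "closed_term L F (TPow (TProd [A, B]))" by (simp add: tm_def closed_term_def)
  then show "sfn F A B X Y" using force_fun_set assms * by blast
next
  assume f: "sfn F A B X Y"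
  then have F: "closed_term L F (TPow (TProd [A, B]))" by (simp add: sfn_def)
  have *: "World {} {} \<Turnstile> F \<in>\<^sub>t fun_set A B X Y" using force_fun_set[OF assms F] f by blast
  then have "({}, F \<in>\<^sub>t fun_set A B X Y) \<in> S" by (simp add: force_def hyp_def)
  then show "is_sfun L S F X Y"
    using assms F assms[THEN elem_ty_eq] by (auto simp: is_sfun_def is_sset_def entails_def)
qed

section \<open>Classes of provably equal closed terms\<close>

lemma cls_mem: "t' \<in> cls S t \<longleftrightarrow> fv t' = {} \<and> ({}, t \<doteq> t') \<in> S"
  by (simp add: cls_def entails_def)

lemma S_eq_force: "closed_term L s A \<Longrightarrow> fv t = {} \<Longrightarrow> ({}, s \<doteq> t) \<in> S \<longleftrightarrow> World {} {} \<Turnstile> s \<doteq> t"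
  by (rule force_closed_iff) (simp add: closed_term_def)

lemma cls_self: "closed_term L t A \<Longrightarrow> t \<in> cls S t"
  by (auto simp: cls_mem closed_term_def intro: S_refl)

text \<open>Membership in \<open>cls S t\<close> asks that \<open>t'\<close> be closed and provably
  equal to \<open>t\<close>; the type of \<open>t'\<close> comes from that equation.\<close>

lemma cls_typed: "closed_term L t A \<Longrightarrow> t' \<in> cls S t \<Longrightarrow> closed_term L t' A \<and> World {} {} \<Turnstile> t \<doteq> t'"
proof -
  assume t: "closed_term L t A" and "t' \<in> cls S t"
  then have *: "fv t' = {}" "World {} {} \<Turnstile> t \<doteq> t'" using S_eq_force[OF t] by (auto simp: cls_mem)
  then have "tm (World {} {}) t' A" using force_eq_tm[OF *(2)] closed_tm[OF t wd_empty] by blast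
  then show ?thesis using * by (simp add: closed_term_def tm_def)
qed

lemma cls_eqI:
  assumes s: "closed_term L s A" and t: "closed_term L t A" and e: "World {} {} \<Turnstile> s \<doteq> t"
  shows "cls S s = cls S t"
proof -
  have "r \<in> cls S s \<longleftrightarrow> r \<in> cls S t" for r
    using S_eq_force[OF s, of r] S_eq_force[OF t, of r]
      force_trans[OF e, of r] force_trans[OF force_sym[OF e], of r] by (auto simp: cls_mem)
  then show ?thesis by blast
qed

lemma rep_cls:
  assumes "closed_term L t A"
  shows "closed_term L (rep (cls S t)) A" and "World {} {} \<Turnstile> t \<doteq> rep (cls S t)"
    and "cls S (rep (cls S t)) = cls S t"
proof -
  have "rep (cls S t) \<in> cls S t" unfolding rep_def using someI_ex cls_self[OF assms] by fast
  from cls_typed[OF assms this] show *: "closed_term L (rep (cls S t)) A"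
    "World {} {} \<Turnstile> t \<doteq> rep (cls S t)" by blast+
  show "cls S (rep (cls S t)) = cls S t" using cls_eqI[OF assms *] by simp
qed

lemma force_mem_eq: "World {} {} \<Turnstile> X \<doteq> Y \<Longrightarrow> w \<Turnstile> s \<in>\<^sub>t X \<Longrightarrow> w \<Turnstile> s \<in>\<^sub>t Y"
proof -
  assume a: "World {} {} \<Turnstile> X \<doteq> Y" "w \<Turnstile> s \<in>\<^sub>t X"
  have w: "World {} {} \<sqsubseteq> w" using force_wd[OF a(2)] ext_empty by blast
  have "tm w (s \<in>\<^sub>t X) TOmega" using force_tm[OF a(2)] .
  then obtain A where "tm w s A" by auto
  then show ?thesis using force_mem_cong[OF force_refl force_mono[OF a(1) w] a(2)] by blast
qed

lemma force_rep_cls: "closed_term L X A \<Longrightarrow> w \<Turnstile> s \<in>\<^sub>t rep (cls S X) \<longleftrightarrow> w \<Turnstile> s \<in>\<^sub>t X"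
  using rep_cls(2) force_mem_eq force_sym by blast

lemma closed_ext:
  assumes X: "closed_term L X (TPow A)" and Y: "closed_term L Y (TPow A)"
    and "\<And>w s. w \<Turnstile> s \<in>\<^sub>t X \<longleftrightarrow> w \<Turnstile> s \<in>\<^sub>t Y"
  shows "cls S X = cls S Y"
  by (rule cls_eqI[OF X Y], rule force_ext) (use assms closed_tm wd_empty in blast)+

text \<open>Every term of type \<open>TProd [A, B]\<close> equals the pair of its projections, so
  relations are determined by the pairs in them.\<close>

lemma closed_rel_ext:
  assumes F: "closed_term L F (TPow (TProd [A, B]))" and G: "closed_term L G (TPow (TProd [A, B]))"
    and "\<And>w s t. w \<Turnstile> Tuple [s, t] \<in>\<^sub>t F \<longleftrightarrow> w \<Turnstile> Tuple [s, t] \<in>\<^sub>t G"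
  shows "cls S F = cls S G"
proof (rule closed_ext[OF F G])
  fix w r
  have "w \<Turnstile> r \<in>\<^sub>t H \<longleftrightarrow> w \<Turnstile> Tuple [Prj [A, B] 0 r, Prj [A, B] 1 r] \<in>\<^sub>t H"
    if H: "closed_term L H (TPow (TProd [A, B]))" and r: "tm w r (TProd [A, B])" for H
    using force_mem_cong[OF force_pair_eta[OF r] force_refl[OF closed_tm[OF H tm_wd[OF r]]]]
      force_mem_cong[OF force_sym[OF force_pair_eta[OF r]] force_refl[OF closed_tm[OF H tm_wd[OF r]]]]
    by blast
  note * = this
  show "w \<Turnstile> r \<in>\<^sub>t F \<longleftrightarrow> w \<Turnstile> r \<in>\<^sub>t G"
  proof (cases "tm w r (TProd [A, B])")
    case True
    show ?thesis unfolding *[OF F True] *[OF G True] by (rule assms(3))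
  next
    case False
    then show ?thesis using closed_mem_tm[OF F] closed_mem_tm[OF G] by blast
  qed
qed

end

section \<open>The linguistic topos\<close>

context set_theory
begin

section \<open>Graphs of terms, graphs of formulas, and composition\<close>

text \<open>The first component \<open>s\<close> of a member is equal to any witness for
  \<open>x\<close>. This removes the existential quantifier hidden in the set term, and an
  equivalence remains.\<close>

lemma maps_graph_closed:
  assumes X: "closed_term L X (TPow (snd x))" and \<tau>: "has_type L [] \<tau> B" and v: "fv \<tau> \<subseteq> {x}"
  shows "closed_term L (maps_graph x X B \<tau>) (TPow (TProd [snd x, B]))"
    and "w \<Turnstile> Tuple [s, t] \<in>\<^sub>t maps_graph x X B \<tau> \<longleftrightarrow> w \<Turnstile> s \<in>\<^sub>t X \<and> w \<Turnstile> t \<doteq> subst1 x s \<tau>"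
proof -
  have ty: "is_ty (ground L) (snd x)" "is_ty (ground L) B"
    using closed_Pow_is_ty[OF X] has_type_is_ty[OF L \<tau>] by auto
  let ?t = "Tuple [Var x, \<tau>]" and ?A = "TProd [snd x, B]"
  have tt: "has_type L [] ?t ?A" using ty \<tau> by simp
  have fm: "formula L (Var x \<in>\<^sub>t X)" using ty X by (auto simp: closed_term_def)
  have fX: "fv X = {}" using X by (simp add: closed_term_def)
  show c: "closed_term L (maps_graph x X B \<tau>) (TPow ?A)"
    using has_type_set_of[of "[x]" L ?t ?A "Var x \<in>\<^sub>t X"] tt fm ty v fX
    by (auto simp: maps_graph_def closed_term_def)
  show "w \<Turnstile> Tuple [s, t] \<in>\<^sub>t maps_graph x X B \<tau> \<longleftrightarrow> w \<Turnstile> s \<in>\<^sub>t X \<and> w \<Turnstile> t \<doteq> subst1 x s \<tau>"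
  proof
    assume f: "w \<Turnstile> Tuple [s, t] \<in>\<^sub>t maps_graph x X B \<tau>"
    have st: "tm w s (snd x)" "tm w t B" using closed_pair_tm[OF c f] by auto
    have w: "wd w" using f force_wd by blast
    have s\<tau>: "tm w (subst1 x s \<tau>) B" by (rule tm_subst[OF \<tau>]) (use v st w in auto)
    have "w \<Turnstile> (s \<in>\<^sub>t X \<and>\<^sub>t t \<doteq> subst1 x s \<tau>)"
      using f[unfolded maps_graph_def] tt fm _ _ _
    proof (rule set_ofE)
      show "fv ?t \<union> fv (Var x \<in>\<^sub>t X) \<subseteq> set [x]" using v fX by auto
      show "\<forall>x\<in>set [x]. is_ty (ground L) (snd x)" using ty by simp
      show "tm w (s \<in>\<^sub>t X \<and>\<^sub>t t \<doteq> subst1 x s \<tau>) TOmega" using st s\<tau> closed_tm[OF X w] by auto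
      fix w' \<theta>
      assume w': "w \<sqsubseteq> w'" and "\<And>v. v \<in> set [x] \<Longrightarrow> tm w' (\<theta> v) (snd v)"
        and "w' \<Turnstile> Tuple [s, t] \<doteq> subst \<theta> ?t" and "w' \<Turnstile> subst \<theta> (Var x \<in>\<^sub>t X)"
      then have \<theta>: "tm w' (\<theta> x) (snd x)" and e: "w' \<Turnstile> s \<doteq> \<theta> x" "w' \<Turnstile> t \<doteq> subst \<theta> \<tau>"
        and m: "w' \<Turnstile> \<theta> x \<in>\<^sub>t X" by (auto dest: force_pair_inj simp: subst_closed fX)
      have "w' \<Turnstile> s \<in>\<^sub>t X"
        using force_mem_cong[OF force_sym[OF e(1)] force_refl[OF closed_tm[OF X tm_wd[OF \<theta>]]] m] .
      moreover have "w' \<Turnstile> subst \<theta> \<tau> \<doteq> subst1 x s \<tau>"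
        by (rule force_subst_eq[OF \<tau>]) (use v \<theta> force_sym[OF e(1)] tm_wd[OF \<theta>] in auto)
      ultimately show "w' \<Turnstile> (s \<in>\<^sub>t X \<and>\<^sub>t t \<doteq> subst1 x s \<tau>)"
        using force_trans[OF e(2)] by (simp add: force_And)
    qed
    then show "w \<Turnstile> s \<in>\<^sub>t X \<and> w \<Turnstile> t \<doteq> subst1 x s \<tau>" by (simp add: force_And)
  next
    assume f: "w \<Turnstile> s \<in>\<^sub>t X \<and> w \<Turnstile> t \<doteq> subst1 x s \<tau>"
    have s: "tm w s (snd x)" using closed_mem_tm[OF X] f by blast
    have w: "wd w" using f force_wd by blast
    have "tm w (subst1 x s \<tau>) B" by (rule tm_subst[OF \<tau>]) (use v s w in auto)
    then have t: "tm w t B" using f force_eq_tm by blast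
    show "w \<Turnstile> Tuple [s, t] \<in>\<^sub>t maps_graph x X B \<tau>"
      unfolding maps_graph_def
      by (rule set_ofI[OF tt fm, where \<theta> = "Var(x := s)"])
        (use v fX f s t w in \<open>auto simp: subst_closed intro: force_pair_cong force_refl\<close>)
  qed
qed

lemma graph_closed:
  assumes "x \<noteq> y" and ty: "is_ty (ground L) (snd x)" "is_ty (ground L) (snd y)"
    and \<gamma>: "formula L \<gamma>" and v: "fv \<gamma> \<subseteq> {x, y}"
  shows "closed_term L (graph x y \<gamma>) (TPow (TProd [snd x, snd y]))"
    and "w \<Turnstile> Tuple [s, t] \<in>\<^sub>t graph x y \<gamma> \<longleftrightarrow>
      tm w s (snd x) \<and> tm w t (snd y) \<and> w \<Turnstile> subst (Var(x := s, y := t)) \<gamma>"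
proof -
  let ?t = "Tuple [Var x, Var y]" and ?A = "TProd [snd x, snd y]"
  have tt: "has_type L [] ?t ?A" using ty by simp
  show c: "closed_term L (graph x y \<gamma>) (TPow ?A)"
    using has_type_set_of[of "[x, y]" L ?t ?A \<gamma>] tt \<gamma> ty v by (auto simp: graph_def closed_term_def)
  show "w \<Turnstile> Tuple [s, t] \<in>\<^sub>t graph x y \<gamma> \<longleftrightarrow>
      tm w s (snd x) \<and> tm w t (snd y) \<and> w \<Turnstile> subst (Var(x := s, y := t)) \<gamma>"
  proof
    assume f: "w \<Turnstile> Tuple [s, t] \<in>\<^sub>t graph x y \<gamma>"
    have st: "tm w s (snd x)" "tm w t (snd y)" using closed_pair_tm[OF c f] by auto
    have w: "wd w" using f force_wd by blast
    have "w \<Turnstile> subst (Var(x := s, y := t)) \<gamma>"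
      using f[unfolded graph_def] tt \<gamma> _ _ _
    proof (rule set_ofE)
      show "fv ?t \<union> fv \<gamma> \<subseteq> set [x, y]" using v by auto
      show "\<forall>x\<in>set [x, y]. is_ty (ground L) (snd x)" using ty by simp
      show "tm w (subst (Var(x := s, y := t)) \<gamma>) TOmega" by (rule tm_subst[OF \<gamma>]) (use v st w in auto)
      fix w' \<theta>
      assume w': "w \<sqsubseteq> w'" and "\<And>v. v \<in> set [x, y] \<Longrightarrow> tm w' (\<theta> v) (snd v)"
        and "w' \<Turnstile> Tuple [s, t] \<doteq> subst \<theta> ?t" and g: "w' \<Turnstile> subst \<theta> \<gamma>"
      then have \<theta>: "tm w' (\<theta> x) (snd x)" "tm w' (\<theta> y) (snd y)" and e: "w' \<Turnstile> s \<doteq> \<theta> x" "w' \<Turnstile> t \<doteq> \<theta> y"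
        by (auto dest: force_pair_inj)
      show "w' \<Turnstile> subst (Var(x := s, y := t)) \<gamma>"
        by (rule force_subst_cong[OF \<gamma> _ _ g]) (use v \<theta> e[THEN force_sym] assms(1) in auto)
    qed
    then show "tm w s (snd x) \<and> tm w t (snd y) \<and> w \<Turnstile> subst (Var(x := s, y := t)) \<gamma>" using st by simp
  next
    assume f: "tm w s (snd x) \<and> tm w t (snd y) \<and> w \<Turnstile> subst (Var(x := s, y := t)) \<gamma>"
    show "w \<Turnstile> Tuple [s, t] \<in>\<^sub>t graph x y \<gamma>"
      unfolding graph_def
      by (rule set_ofI[OF tt \<gamma>, where \<theta> = "Var(x := s, y := t)"])
        (use v f assms(1) tm_wd in \<open>auto intro!: force_pair_cong intro: force_refl\<close>)
  qed
qed

text \<open>The intermediate value \<open>r\<close> is not determined by a term. In contrast to the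
  graphs above there is an introduction rule and an elimination rule instead of an
  equivalence.\<close>

lemma comp_graph_closed:
  assumes F: "closed_term L F (TPow (TProd [A, B]))" and G: "closed_term L G (TPow (TProd [B, C]))"
    and ty: "is_ty (ground L) A" "is_ty (ground L) B" "is_ty (ground L) C"
  shows "closed_term L (comp_graph A B C G F) (TPow (TProd [A, C]))"
    and "w \<Turnstile> Tuple [s, r] \<in>\<^sub>t F \<Longrightarrow> w \<Turnstile> Tuple [r, t] \<in>\<^sub>t G \<Longrightarrow> w \<Turnstile> Tuple [s, t] \<in>\<^sub>t comp_graph A B C G F"
    and "w \<Turnstile> Tuple [s, t] \<in>\<^sub>t comp_graph A B C G F \<Longrightarrow> tm w \<psi> TOmega \<Longrightarrow>
      (\<And>w' r. w \<sqsubseteq> w' \<Longrightarrow> w' \<Turnstile> Tuple [s, r] \<in>\<^sub>t F \<Longrightarrow> w' \<Turnstile> Tuple [r, t] \<in>\<^sub>t G \<Longrightarrow> w' \<Turnstile> \<psi>) \<Longrightarrow> w \<Turnstile> \<psi>"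
proof -
  have fvs: "fv F = {}" "fv G = {}" using F G by (simp_all add: closed_term_def)
  have typs: "has_type L Bs F (TPow (TProd [A, B]))" "has_type L Bs G (TPow (TProd [B, C]))" for Bs
    using F G by (simp_all add: closed_term_def has_type_weaken0)
  have lcs: "lc 0 F" "lc 0 G" using closed_lc F G by blast+
  define b where "b x z = (Tuple [x, Bound 0] \<in>\<^sub>t F \<and>\<^sub>t Tuple [Bound 0, z] \<in>\<^sub>t G)" for x z :: "('g, 'f) trm"
  let ?x = "(0, A) :: 'g var" and ?z = "(2, C) :: 'g var"
  have b: "has_type L (B # Bs) (b x z) TOmega" if "has_type L (B # Bs) x A" "has_type L (B # Bs) z C"
    for x z Bs
    unfolding b_def has_type_connectives has_type_simps(9)
    using typs that
    by (intro conjI refl; intro exI[of _ "TProd [A, B]"] exI[of _ "TProd [B, C]"]) simp_all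
  have eq: "comp_graph A B C G F = graph ?x ?z (Ex B (b (Var ?x) (Var ?z)))"
    by (simp add: comp_graph_def Let_def ex_def b_def And_def Tru_def bind_fresh fvs)
  have \<gamma>: "formula L (Ex B (b (Var ?x) (Var ?z)))" using b ty by simp
  have v: "fv (Ex B (b (Var ?x) (Var ?z))) \<subseteq> {?x, ?z}" by (simp add: b_def fvs)
  have ne: "?x \<noteq> ?z" by simp
  show "closed_term L (comp_graph A B C G F) (TPow (TProd [A, C]))"
    unfolding eq using graph_closed(1)[OF ne _ _ \<gamma> v] ty by simp
  have m: "w \<Turnstile> Tuple [s, t] \<in>\<^sub>t comp_graph A B C G F \<longleftrightarrow> tm w s A \<and> tm w t C \<and> w \<Turnstile> Ex B (b s t)"
    for w s t
    unfolding eq using graph_closed(2)[OF ne _ _ \<gamma> v, of w s t] ty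
    by (simp add: b_def subst_closed fvs)
  have ib: "inst r (b s t) = (Tuple [s, r] \<in>\<^sub>t F \<and>\<^sub>t Tuple [r, t] \<in>\<^sub>t G)" if "tm w s A" "tm w t C" for w s t r
    using that[THEN tm_lc] lcs by (simp add: b_def)
  have bt: "has_type L [B] (b s t) TOmega" "fv (b s t) \<subseteq> vars w" if "tm w s A" "tm w t C" for w s t
  proof -
    show "has_type L [B] (b s t) TOmega"
      using that by (intro b) (simp_all add: tm_def has_type_weaken0)
    show "fv (b s t) \<subseteq> vars w" using that by (simp add: b_def tm_def fvs)
  qed
  show "w \<Turnstile> Tuple [s, t] \<in>\<^sub>t comp_graph A B C G F"
    if f: "w \<Turnstile> Tuple [s, r] \<in>\<^sub>t F" "w \<Turnstile> Tuple [r, t] \<in>\<^sub>t G"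
  proof -
    have st: "tm w s A" "tm w t C" "tm w r B" using closed_pair_tm[OF F f(1)] closed_pair_tm[OF G f(2)] by auto
    have "w \<Turnstile> inst r (b s t)" unfolding ib[OF st(1,2)] force_And using f by simp
    then show ?thesis unfolding m using force_ExI[OF _ st(3) bt[OF st(1,2)]] st by blast
  qed
  show "w \<Turnstile> \<psi>" if f: "w \<Turnstile> Tuple [s, t] \<in>\<^sub>t comp_graph A B C G F" and \<psi>: "tm w \<psi> TOmega"
    and h: "\<And>w' r. w \<sqsubseteq> w' \<Longrightarrow> w' \<Turnstile> Tuple [s, r] \<in>\<^sub>t F \<Longrightarrow> w' \<Turnstile> Tuple [r, t] \<in>\<^sub>t G \<Longrightarrow> w' \<Turnstile> \<psi>"
  proof -
    have st: "tm w s A" "tm w t C" "w \<Turnstile> Ex B (b s t)" using f m by auto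
    show ?thesis
      by (rule force_ExE[OF st(3) bt(1)[OF st(1,2)] \<psi>])
        (use h in \<open>simp only: ib[OF st(1,2)] force_And, blast\<close>)
  qed
qed

section \<open>Objects and arrows as classes\<close>

abbreviation E :: "(('g, 'f) sobj, ('g, 'f) sarr) topos" where
  "E \<equiv> ling_topos L S"

abbreviation ety :: "('g, 'f) sobj \<Rightarrow> 'g ty" where
  "ety Z \<equiv> elem_ty L (rep Z)"

text \<open>Membership is tested on the chosen representative of the class. By
  \<open>force_rep_cls\<close> the original set has the same members.\<close>

abbreviation el :: "('g, 'f) world \<Rightarrow> ('g, 'f) sobj \<Rightarrow> ('g, 'f) trm \<Rightarrow> bool" where
  "el w Z s \<equiv> w \<Turnstile> s \<in>\<^sub>t rep Z"

abbreviation vl :: "('g, 'f) world \<Rightarrow> ('g, 'f) sarr \<Rightarrow> ('g, 'f) trm \<Rightarrow> ('g, 'f) trm \<Rightarrow> bool" where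
  "vl w a s t \<equiv> w \<Turnstile> Tuple [s, t] \<in>\<^sub>t rep (fst a)"

lemma cls_Ob: "closed_term L X (TPow A) \<Longrightarrow> cls S X \<in> Ob E"
  by (auto simp: ling_topos_def Let_def is_sset_def)

lemma ety_cls: "closed_term L X (TPow A) \<Longrightarrow> ety (cls S X) = A"
  using rep_cls(1) elem_ty_eq by blast

lemma Ob_rep: "Z \<in> Ob E \<Longrightarrow> closed_term L (rep Z) (TPow (ety Z))"
  by (auto simp: ling_topos_def Let_def is_sset_def rep_cls ety_cls)

lemma Ob_cls: "Z \<in> Ob E \<Longrightarrow> cls S (rep Z) = Z"
  by (auto simp: ling_topos_def Let_def is_sset_def rep_cls)

lemma Ob_is_ty: "Z \<in> Ob E \<Longrightarrow> is_ty (ground L) (ety Z)"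
  using Ob_rep closed_Pow_is_ty by blast

lemma el_tm: "Z \<in> Ob E \<Longrightarrow> el w Z s \<Longrightarrow> tm w s (ety Z)"
  using Ob_rep closed_mem_tm by blast

lemma el_cls: "closed_term L X (TPow A) \<Longrightarrow> el w (cls S X) s \<longleftrightarrow> w \<Turnstile> s \<in>\<^sub>t X"
  using force_rep_cls by blast

lemma el_cong: "Z \<in> Ob E \<Longrightarrow> w \<Turnstile> s \<doteq> t \<Longrightarrow> el w Z s \<Longrightarrow> el w Z t"
  using force_mem_cong force_refl[OF closed_tm[OF Ob_rep]] force_wd by blast

lemma Dom_E [simp]: "Dom E a = fst (snd a)"
  and Cod_E [simp]: "Cod E a = snd (snd a)"
  by (simp_all add: ling_topos_def Let_def split_beta)

lemma Hom_E: "a \<in> Hom E D Z \<longleftrightarrow> a \<in> Arr E \<and> fst (snd a) = D \<and> snd (snd a) = Z"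
  by (simp add: Hom_def)

lemma Comp_E: "Comp E g f =
  (cls S (comp_graph (ety (fst (snd f))) (ety (snd (snd f))) (ety (snd (snd g))) (rep (fst g)) (rep (fst f))),
    fst (snd f), snd (snd g))"
  by (simp add: ling_topos_def Let_def split_beta)

lemma sfn_cong:
  assumes "sfn F A B X Y" and "closed_term L F' (TPow (TProd [A, B]))"
    and "closed_term L X' (TPow A)" and "closed_term L Y' (TPow B)"
    and "\<And>w s. w \<Turnstile> s \<in>\<^sub>t F' \<longleftrightarrow> w \<Turnstile> s \<in>\<^sub>t F" and "\<And>w s. w \<Turnstile> s \<in>\<^sub>t X' \<longleftrightarrow> w \<Turnstile> s \<in>\<^sub>t X"
    and "\<And>w s. w \<Turnstile> s \<in>\<^sub>t Y' \<longleftrightarrow> w \<Turnstile> s \<in>\<^sub>t Y"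
  shows "sfn F' A B X' Y'"
  using assms(1) unfolding sfn_def assms(5-7) using assms(2-4) by blast

lemma sfn_rep:
  assumes "sfn F A B X Y"
  shows "sfn (rep (cls S F)) A B (rep (cls S X)) (rep (cls S Y))"
proof -
  note c = sfn_closed(1-3)[OF assms]
  show ?thesis by (rule sfn_cong[OF assms]) (simp_all add: c[THEN rep_cls(1)] c[THEN force_rep_cls])
qed

lemma sfun_Hom: "sfn F A B X Y \<Longrightarrow> sfun S F X Y \<in> Hom E (cls S X) (cls S Y)"
  unfolding Hom_E using is_sfun_iff[of X A Y B F] sfn_closed[of F A B X Y]
  by (auto simp: ling_topos_def Let_def sfun_def)

lemma vl_sfun: "sfn F A B X Y \<Longrightarrow> vl w (sfun S F X Y) s t \<longleftrightarrow> w \<Turnstile> Tuple [s, t] \<in>\<^sub>t F"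
  by (simp add: sfun_def force_rep_cls[OF sfn_closed(3)])

text \<open>An arrow consists of three classes. The chosen representatives have the same members, at
  every world, as the terms from which the arrow was formed, so they form a function again.\<close>

lemma Hom_sfn:
  assumes "a \<in> Hom E D Z"
  shows "sfn (rep (fst a)) (ety D) (ety Z) (rep D) (rep Z)" and "D \<in> Ob E" and "Z \<in> Ob E"
    and "cls S (rep (fst a)) = fst a"
proof -
  obtain F X Y where a: "a = (cls S F, cls S X, cls S Y)" "is_sfun L S F X Y"
    using assms unfolding Hom_E by (auto simp: ling_topos_def Let_def sfun_def)
  then obtain A B where AB: "closed_term L X (TPow A)" "closed_term L Y (TPow B)"
    by (auto simp: is_sfun_def is_sset_def)
  then have s: "sfn F A B X Y" using a is_sfun_iff by blast
  have DZ: "D = cls S X" "Z = cls S Y" using assms a by (simp_all add: Hom_E)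
  show "sfn (rep (fst a)) (ety D) (ety Z) (rep D) (rep Z)"
    using sfn_rep[OF s] a AB by (simp add: DZ ety_cls)
  show "D \<in> Ob E" "Z \<in> Ob E" using AB cls_Ob by (simp_all add: DZ)
  show "cls S (rep (fst a)) = fst a" using rep_cls(3)[OF sfn_closed(3)[OF s]] a by simp
qed

lemma vl_dom: "a \<in> Hom E D Z \<Longrightarrow> vl w a s t \<Longrightarrow> el w D s"
  and vl_cod: "a \<in> Hom E D Z \<Longrightarrow> vl w a s t \<Longrightarrow> el w Z t"
  and vl_fun: "a \<in> Hom E D Z \<Longrightarrow> vl w a s t \<Longrightarrow> vl w a s t' \<Longrightarrow> w \<Turnstile> t \<doteq> t'"
  by (erule (1) sfn_dom[OF Hom_sfn(1)], erule (1) sfn_cod[OF Hom_sfn(1)], erule (2) sfn_fun[OF Hom_sfn(1)])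

lemma vl_total:
  assumes "a \<in> Hom E D Z" and "el w D s" and "tm w \<psi> TOmega"
    and "\<And>w' t. w \<sqsubseteq> w' \<Longrightarrow> vl w' a s t \<Longrightarrow> w' \<Turnstile> \<psi>"
  shows "w \<Turnstile> \<psi>"
  using sfn_total[OF Hom_sfn(1)[OF assms(1)] assms(2-4)] .

lemma vl_cong:
  assumes a: "a \<in> Hom E D Z" and "w \<Turnstile> s \<doteq> s'" and "w \<Turnstile> t \<doteq> t'" and "vl w a s t"
  shows "vl w a s' t'"
  using force_mem_cong[OF force_pair_cong[OF assms(2,3)] force_refl assms(4)]
    closed_tm[OF sfn_closed(3)[OF Hom_sfn(1)[OF a]] force_wd[OF assms(4)]] by blast

lemma vl_formula:
  assumes "a \<in> Hom E D Z" and "tm w s (ety D)" and "tm w t (ety Z)"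
  shows "tm w (Tuple [s, t] \<in>\<^sub>t rep (fst a)) TOmega"
proof -
  have "tm w (Tuple [s, t]) (TProd [ety D, ety Z])" using assms tm_wd by simp
  moreover have "tm w (rep (fst a)) (TPow (TProd [ety D, ety Z]))"
    using closed_tm[OF sfn_closed(3)[OF Hom_sfn(1)[OF assms(1)]] tm_wd[OF assms(2)]] .
  ultimately show ?thesis unfolding tm_simps(2) by blast
qed

lemma vl_tm: "a \<in> Hom E D Z \<Longrightarrow> vl w a s t \<Longrightarrow> tm w s (ety D) \<and> tm w t (ety Z)"
  by (intro conjI el_tm[OF Hom_sfn(2) vl_dom] el_tm[OF Hom_sfn(3) vl_cod])

text \<open>At each later world with a value \<open>t'\<close>, the equation \<open>t' = t\<close>
  puts the pair \<open>(s, t)\<close> into the graph; being a formula, this then holds at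
  \<open>w\<close> by totality.\<close>

lemma vlI:
  assumes a: "a \<in> Hom E D Z" and s: "el w D s" and t: "tm w t (ety Z)"
    and h: "\<And>w' t'. w \<sqsubseteq> w' \<Longrightarrow> vl w' a s t' \<Longrightarrow> w' \<Turnstile> t' \<doteq> t"
  shows "vl w a s t"
proof (rule vl_total[OF a s vl_formula[OF a _ t]])
  show "tm w s (ety D)" using el_tm[OF Hom_sfn(2)[OF a] s] .
  fix w' t'
  assume w': "w \<sqsubseteq> w'" and v: "vl w' a s t'"
  show "vl w' a s t" using vl_cong[OF a _ h[OF w' v] v] force_refl vl_tm[OF a v] by blast
qed

text \<open>One inclusion is enough: a total relation contained in a functional one is equal to
  it.\<close>

lemma arr_eqI:
  assumes a: "a \<in> Hom E D Z" and b: "b \<in> Hom E D Z" and h: "\<And>w s t. vl w a s t \<Longrightarrow> vl w b s t"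
  shows "a = b"
proof -
  have "vl w a s t" if v: "vl w b s t" for w s t
    using a vl_dom[OF b v]
  proof (rule vlI)
    show "tm w t (ety Z)" using vl_tm[OF b v] by blast
    show "w' \<Turnstile> t' \<doteq> t" if "w \<sqsubseteq> w'" "vl w' a s t'" for w' t'
      using vl_fun[OF b] h[OF that(2)] force_mono[OF v that(1)] by blast
  qed
  then have "cls S (rep (fst a)) = cls S (rep (fst b))"
    using closed_rel_ext[OF sfn_closed(3)[OF Hom_sfn(1)[OF a]] sfn_closed(3)[OF Hom_sfn(1)[OF b]]] h
    by blast
  then have "fst a = fst b" using Hom_sfn(4)[OF a] Hom_sfn(4)[OF b] by simp
  then show ?thesis using a b by (simp add: Hom_E prod_eq_iff)
qed

lemma maps_to_Hom:
  assumes X: "closed_term L X (TPow (snd x))" and Y: "closed_term L Y (TPow B)"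
    and \<tau>: "has_type L [] \<tau> B" and v: "fv \<tau> \<subseteq> {x}"
    and h: "\<And>w s. w \<Turnstile> s \<in>\<^sub>t X \<Longrightarrow> w \<Turnstile> subst1 x s \<tau> \<in>\<^sub>t Y"
  shows "maps_to L S x \<tau> X Y \<in> Hom E (cls S X) (cls S Y)"
    and "vl w (maps_to L S x \<tau> X Y) s t \<longleftrightarrow> w \<Turnstile> s \<in>\<^sub>t X \<and> w \<Turnstile> t \<doteq> subst1 x s \<tau>"
proof -
  note m = maps_graph_closed[OF X \<tau> v]
  have "sfn (maps_graph x X B \<tau>) (snd x) B X Y"
  proof (rule sfnI[OF X Y m(1)], unfold m(2))
    fix w s t
    assume f: "w \<Turnstile> s \<in>\<^sub>t X \<and> w \<Turnstile> t \<doteq> subst1 x s \<tau>"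
    then show "w \<Turnstile> s \<in>\<^sub>t X \<and> w \<Turnstile> t \<in>\<^sub>t Y"
      using force_mem_cong[OF force_sym force_refl[OF closed_tm[OF Y]] h] force_wd by blast
  next
    fix w s t t'
    assume "w \<Turnstile> s \<in>\<^sub>t X \<and> w \<Turnstile> t \<doteq> subst1 x s \<tau>" "w \<Turnstile> s \<in>\<^sub>t X \<and> w \<Turnstile> t' \<doteq> subst1 x s \<tau>"
    then show "w \<Turnstile> t \<doteq> t'" using force_trans force_sym by blast
  next
    fix w s \<psi>
    assume s: "w \<Turnstile> s \<in>\<^sub>t X" and g: "\<And>w' t. w \<sqsubseteq> w' \<Longrightarrow> w' \<Turnstile> s \<in>\<^sub>t X \<and> w' \<Turnstile> t \<doteq> subst1 x s \<tau> \<Longrightarrow> w' \<Turnstile> \<psi>"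
    have "tm w (subst1 x s \<tau>) B" using closed_mem_tm[OF Y h[OF s]] .
    then show "w \<Turnstile> \<psi>" using g[of w "subst1 x s \<tau>"] s force_refl force_wd[OF s] by simp
  qed
  from sfun_Hom[OF this] vl_sfun[OF this]
  show "maps_to L S x \<tau> X Y \<in> Hom E (cls S X) (cls S Y)"
    "vl w (maps_to L S x \<tau> X Y) s t \<longleftrightarrow> w \<Turnstile> s \<in>\<^sub>t X \<and> w \<Turnstile> t \<doteq> subst1 x s \<tau>"
    by (simp_all add: maps_to_def elem_ty_eq[OF Y] m(2))
qed

text \<open>The composite is functional because two intermediate values at the same argument are
  equal, and total by passing to a later world for each factor. Only an introduction rule for values
  is stated; together with \<open>vl_fun\<close> it pins them down.\<close>

lemma Comp_Hom:
  assumes f: "f \<in> Hom E D Y" and g: "g \<in> Hom E Y Z"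
  shows "Comp E g f \<in> Hom E D Z"
    and "vl w f s r \<Longrightarrow> vl w g r t \<Longrightarrow> vl w (Comp E g f) s t"
proof -
  let ?F = "rep (fst f)" and ?G = "rep (fst g)"
  let ?C = "comp_graph (ety D) (ety Y) (ety Z) ?G ?F"
  note sf = Hom_sfn[OF f] and sg = Hom_sfn[OF g]
  note ob = sf(2) sg(2,3)
  note c = comp_graph_closed[OF sfn_closed(3)[OF sf(1)] sfn_closed(3)[OF sg(1)] ob[THEN Ob_is_ty]]
  have s: "sfn ?C (ety D) (ety Z) (rep D) (rep Z)"
  proof (rule sfnI)
    show "closed_term L (rep D) (TPow (ety D))" "closed_term L (rep Z) (TPow (ety Z))"
      using ob Ob_rep by blast+
    show "closed_term L ?C (TPow (TProd [ety D, ety Z]))" by (rule c(1))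
    fix w s t
    assume v: "w \<Turnstile> Tuple [s, t] \<in>\<^sub>t ?C"
    have st: "tm w s (ety D)" "tm w t (ety Z)" using closed_pair_tm[OF c(1) v] by auto
    have "w \<Turnstile> (s \<in>\<^sub>t rep D \<and>\<^sub>t t \<in>\<^sub>t rep Z)"
    proof (rule c(3)[OF v])
      show "tm w (s \<in>\<^sub>t rep D \<and>\<^sub>t t \<in>\<^sub>t rep Z) TOmega"
        using st closed_tm[OF Ob_rep[OF ob(1)] tm_wd[OF st(1)]] closed_tm[OF Ob_rep[OF ob(3)] tm_wd[OF st(1)]]
        by auto
    qed (use vl_dom[OF f] vl_cod[OF g] in \<open>simp add: force_And\<close>)
    then show "el w D s \<and> el w Z t" by (simp add: force_And)
    fix t'
    assume v': "w \<Turnstile> Tuple [s, t'] \<in>\<^sub>t ?C"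
    have t': "tm w t' (ety Z)" using closed_pair_tm[OF c(1) v'] by auto
    have e: "tm w (t \<doteq> t') TOmega" using st t' by auto
    show "w \<Turnstile> t \<doteq> t'"
    proof (rule c(3)[OF v e])
      fix w' r
      assume w': "w \<sqsubseteq> w'" and a: "vl w' f s r" "vl w' g r t"
      show "w' \<Turnstile> t \<doteq> t'"
      proof (rule c(3)[OF force_mono[OF v' w'] tm_mono[OF e w']])
        fix w'' r'
        assume w'': "w' \<sqsubseteq> w''" and b: "vl w'' f s r'" "vl w'' g r' t'"
        have "w'' \<Turnstile> r' \<doteq> r" using vl_fun[OF f b(1) force_mono[OF a(1) w'']] .
        then have "vl w'' g r t'" using vl_cong[OF g _ force_refl b(2)] vl_tm[OF g b(2)] by blast
        then show "w'' \<Turnstile> t \<doteq> t'" using vl_fun[OF g] force_mono[OF a(2) w''] by blast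
      qed
    qed
  next
    fix w s \<psi>
    assume s: "el w D s" and \<psi>: "tm w \<psi> TOmega"
      and h: "\<And>w' t. w \<sqsubseteq> w' \<Longrightarrow> w' \<Turnstile> Tuple [s, t] \<in>\<^sub>t ?C \<Longrightarrow> w' \<Turnstile> \<psi>"
    show "w \<Turnstile> \<psi>"
    proof (rule vl_total[OF f s \<psi>])
      fix w' r
      assume w': "w \<sqsubseteq> w'" and r: "vl w' f s r"
      show "w' \<Turnstile> \<psi>"
      proof (rule vl_total[OF g vl_cod[OF f r] tm_mono[OF \<psi> w']])
        fix w'' t
        assume w'': "w' \<sqsubseteq> w''" and t: "vl w'' g r t"
        show "w'' \<Turnstile> \<psi>" using h[OF ext_trans[OF w' w''] c(2)[OF force_mono[OF r w''] t]] .
      qed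
    qed
  qed
  have "Comp E g f = sfun S ?C (rep D) (rep Z)"
    using f g ob[THEN Ob_cls] by (simp add: Comp_E Hom_E sfun_def)
  then show "Comp E g f \<in> Hom E D Z" and "vl w f s r \<Longrightarrow> vl w g r t \<Longrightarrow> vl w (Comp E g f) s t"
    using sfun_Hom[OF s] vl_sfun[OF s] c(2) ob Ob_cls by auto
qed

section \<open>Products\<close>

lemma Prod_E: "Prod E Zs = cls S (prod_set (map ety Zs) (map rep Zs))"
  and Proj_E: "Proj E Zs i = maps_to L S (0, mk_prod (map ety Zs))
    (mk_prj (map ety Zs) i (Var (0, mk_prod (map ety Zs)))) (prod_set (map ety Zs) (map rep Zs)) (rep (Zs ! i))"
  and Omega_E: "Omega E = cls S (U TOmega)"
  and Truth_E: "Truth E = maps_to L S (0, TUnit) Tru (U TUnit) (U TOmega)"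
  and PowOb_E: "PowOb E Z = cls S (pow_set (ety Z) (rep Z))"
  and Ident_E: "Ident E Z = maps_to L S (0, ety Z) (Var (0, ety Z)) (rep Z) (rep Z)"
  by (simp_all add: ling_topos_def Let_def)

lemma Prod_closed:
  assumes "set Zs \<subseteq> Ob E"
  shows "closed_term L (prod_set (map ety Zs) (map rep Zs)) (TPow (mk_prod (map ety Zs)))"
    and "w \<Turnstile> t \<in>\<^sub>t prod_set (map ety Zs) (map rep Zs) \<longleftrightarrow>
      tm w t (mk_prod (map ety Zs)) \<and> (\<forall>i<length Zs. el w (Zs ! i) (mk_prj (map ety Zs) i t))"
proof -
  have *: "list_all2 (\<lambda>X A. closed_term L X (TPow A)) (map rep Zs) (map ety Zs)"
    using assms nth_mem Ob_rep by (fastforce simp: list_all2_conv_all_nth)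
  show "closed_term L (prod_set (map ety Zs) (map rep Zs)) (TPow (mk_prod (map ety Zs)))"
    by (rule closed_prod_set(1)[OF *])
  show "w \<Turnstile> t \<in>\<^sub>t prod_set (map ety Zs) (map rep Zs) \<longleftrightarrow>
      tm w t (mk_prod (map ety Zs)) \<and> (\<forall>i<length Zs. el w (Zs ! i) (mk_prj (map ety Zs) i t))"
    using closed_prod_set(2)[OF *] by auto
qed

lemma Prod_Ob: "set Zs \<subseteq> Ob E \<Longrightarrow> Prod E Zs \<in> Ob E"
  and ety_Prod: "set Zs \<subseteq> Ob E \<Longrightarrow> ety (Prod E Zs) = mk_prod (map ety Zs)"
  using Prod_closed(1) cls_Ob ety_cls unfolding Prod_E by blast+

lemma el_Prod: "set Zs \<subseteq> Ob E \<Longrightarrow> el w (Prod E Zs) t \<longleftrightarrow>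
    tm w t (mk_prod (map ety Zs)) \<and> (\<forall>i<length Zs. el w (Zs ! i) (mk_prj (map ety Zs) i t))"
  unfolding Prod_E el_cls[OF Prod_closed(1)] by (rule Prod_closed(2))

lemma el_Prod_tuple:
  assumes Z: "set Zs \<subseteq> Ob E" and w: "wd w" and t: "list_all2 (el w) Zs ts"
  shows "el w (Prod E Zs) (mk_tuple ts)"
    and "i < length Zs \<Longrightarrow> w \<Turnstile> mk_prj (map ety Zs) i (mk_tuple ts) \<doteq> ts ! i"
proof -
  have l: "length ts = length Zs" using t by (simp add: list_all2_lengthD)
  have tt: "list_all2 (tm w) ts (map ety Zs)"
    using t Z l el_tm by (simp add: list_all2_conv_all_nth subset_iff)
  show *: "w \<Turnstile> mk_prj (map ety Zs) i (mk_tuple ts) \<doteq> ts ! i" if "i < length Zs" for i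
    using force_mk_prj_tuple[OF tt] that l by simp
  show "el w (Prod E Zs) (mk_tuple ts)"
    unfolding el_Prod[OF Z]
  proof (intro conjI allI impI)
    show "tm w (mk_tuple ts) (mk_prod (map ety Zs))" by (rule tm_mk_tuple[OF w tt])
    show "el w (Zs ! i) (mk_prj (map ety Zs) i (mk_tuple ts))" if "i < length Zs" for i
      using el_cong[OF _ force_sym[OF *[OF that]]] t that Z
      by (simp add: list_all2_conv_all_nth subset_iff)
  qed
qed

lemma Proj_Hom:
  assumes Z: "set Zs \<subseteq> Ob E" and i: "i < length Zs"
  shows "Proj E Zs i \<in> Hom E (Prod E Zs) (Zs ! i)"
    and "el w (Prod E Zs) t \<Longrightarrow> vl w (Proj E Zs i) t (mk_prj (map ety Zs) i t)"
proof -
  let ?A = "mk_prod (map ety Zs)" and ?X = "prod_set (map ety Zs) (map rep Zs)"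
  have Zi: "Zs ! i \<in> Ob E" using Z i by auto
  note P = Prod_closed[OF Z]
  let ?z = "(0, ?A) :: 'g var" and ?p = "mk_prj (map ety Zs) i"
  have X: "closed_term L ?X (TPow (snd ?z))" using P(1) by simp
  have \<tau>: "has_type L [] (?p (Var ?z)) (ety (Zs ! i))"
    using has_type_mk_prj[of L "[]" "Var ?z" "map ety Zs" i] i closed_Pow_is_ty[OF P(1)] by simp
  have h: "el w (Zs ! i) (subst1 ?z s (?p (Var ?z)))" if "w \<Turnstile> s \<in>\<^sub>t ?X" for w s
    using that P(2) i by simp
  note m = maps_to_Hom[OF X Ob_rep[OF Zi] \<tau> _ h, folded Proj_E, folded Prod_E, unfolded Ob_cls[OF Zi]]
  show "Proj E Zs i \<in> Hom E (Prod E Zs) (Zs ! i)" by (rule m(1)) auto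
  show "vl w (Proj E Zs i) t (?p t)" if t: "el w (Prod E Zs) t"
  proof -
    have "tm w (?p t) (ety (Zs ! i))"
      using t tm_mk_prj[of w t "map ety Zs" i] i by (simp add: el_Prod[OF Z])
    moreover have "w \<Turnstile> t \<in>\<^sub>t ?X" using t by (simp add: Prod_E el_cls[OF P(1)])
    ultimately show ?thesis using m(2)[of w t "?p t"] force_refl by simp
  qed
qed

lemma force_prod_ext:
  assumes s: "tm w s (mk_prod As)" and t: "tm w t (mk_prod As)"
    and "\<And>i. i < length As \<Longrightarrow> w \<Turnstile> mk_prj As i s \<doteq> mk_prj As i t"
  shows "w \<Turnstile> s \<doteq> t"
proof -
  have "w \<Turnstile> mk_tuple (map (\<lambda>i. mk_prj As i s) [0..<length As]) \<doteq> mk_tuple (map (\<lambda>i. mk_prj As i t) [0..<length As])"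
    by (rule force_mk_tuple_cong[OF tm_wd[OF s]]) (use assms(3) in \<open>simp add: list_all2_conv_all_nth\<close>)
  from force_trans[OF force_trans[OF force_mk_eta[OF s] this] force_sym[OF force_mk_eta[OF t]]]
  show ?thesis .
qed

text \<open>Values of finitely many arrows at one argument are obtained one after the other at later
  worlds; those already obtained persist.\<close>

lemma vl_total_list:
  assumes "\<And>f. f \<in> set fs \<Longrightarrow> f \<in> Hom E D (Cod E f)" and "el w D s" and "tm w \<psi> TOmega"
    and "\<And>w' ts. w \<sqsubseteq> w' \<Longrightarrow> list_all2 (\<lambda>f t. vl w' f s t) fs ts \<Longrightarrow> w' \<Turnstile> \<psi>"
  shows "w \<Turnstile> \<psi>"
  using assms
proof (induction fs arbitrary: w)
  case Nil
  then show ?case using ext_refl force_wd[OF Nil(2)] by blast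
next
  case (Cons f fs)
  show ?case
  proof (rule Cons.IH)
    show "g \<in> Hom E D (Cod E g)" if "g \<in> set fs" for g using Cons.prems(1) that by simp
    fix w' ts
    assume w': "w \<sqsubseteq> w'" and ts: "list_all2 (\<lambda>f t. vl w' f s t) fs ts"
    show "w' \<Turnstile> \<psi>"
    proof (rule vl_total[of f D "Cod E f"])
      show "f \<in> Hom E D (Cod E f)" using Cons.prems(1) by simp
      show "el w' D s" "tm w' \<psi> TOmega" using Cons.prems(2,3) w' force_mono tm_mono by blast+
      fix w'' t
      assume w'': "w' \<sqsubseteq> w''" and t: "vl w'' f s t"
      have "list_all2 (\<lambda>f t. vl w'' f s t) (f # fs) (t # ts)"
        using t list_all2_mono[OF ts] force_mono[OF _ w''] by auto
      then show "w'' \<Turnstile> \<psi>" using Cons.prems(4) ext_trans[OF w' w''] by blast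
    qed
  qed (use Cons.prems in auto)
qed

lemma vl_list_el:
  assumes "\<And>f. f \<in> set fs \<Longrightarrow> f \<in> Hom E D (Cod E f)" and "list_all2 (\<lambda>f t. vl w f s t) fs ts"
  shows "list_all2 (el w) (map (Cod E) fs) ts"
proof -
  have "el w (Cod E (fs ! i)) (ts ! i)" if "i < length fs" for i
    by (rule vl_cod[OF assms(1)[OF nth_mem[OF that]] list_all2_nthD[OF assms(2) that]])
  then show ?thesis using assms(2) by (simp add: list_all2_conv_all_nth)
qed

text \<open>The graph relates \<open>x\<close> to \<open>z\<close> if every projection of
  \<open>z\<close> is the value at \<open>x\<close> of the corresponding arrow. Describing
  \<open>z\<close> by its projections avoids naming the values.\<close>

lemma tuple_exists:
  assumes D: "D \<in> Ob E" and fs: "\<And>f. f \<in> set fs \<Longrightarrow> f \<in> Hom E D (Cod E f)"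
  obtains h where "h \<in> Hom E D (Prod E (map (Cod E) fs))"
    and "\<And>w s ts. el w D s \<Longrightarrow> list_all2 (\<lambda>f t. vl w f s t) fs ts \<Longrightarrow> vl w h s (mk_tuple ts)"
proof -
  let ?Zs = "map (Cod E) fs"
  let ?As = "map ety ?Zs"
  let ?A = "mk_prod ?As"
  let ?P = "Prod E ?Zs"
  have Z: "set ?Zs \<subseteq> Ob E" using fs Hom_sfn(3) by fastforce
  have P: "?P \<in> Ob E" "ety ?P = ?A" using Prod_Ob[OF Z] ety_Prod[OF Z] by auto
  have A: "is_ty (ground L) ?A" "is_ty (ground L) (ety D)" using Ob_is_ty[OF P(1)] Ob_is_ty[OF D] P(2) by auto
  define x z where "x = ((0, ety D) :: 'g var)" and "z = ((1, ?A) :: 'g var)"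
  have xz: "x \<noteq> z" "snd x = ety D" "snd z = ?A" by (simp_all add: x_def z_def)
  \<comment> \<open>The first conjunct confines \<open>x\<close> to \<open>D\<close>. For an empty
    list of arrows the remaining conjunction is trivial and would not do so.\<close>
  define \<gamma> where "\<gamma> = (Var x \<in>\<^sub>t rep D \<and>\<^sub>t
    foldr And (map (\<lambda>i. Tuple [Var x, mk_prj ?As i (Var z)] \<in>\<^sub>t rep (fst (fs ! i))) [0..<length fs]) Tru)"
  have F: "closed_term L (rep (fst (fs ! i))) (TPow (TProd [ety D, ?As ! i]))" if "i < length fs" for i
    using sfn_closed(3)[OF Hom_sfn(1)[OF fs[of "fs ! i"]]] that by simp
  have \<gamma>: "formula L \<gamma>"
  proof -
    have "formula L (Tuple [Var x, mk_prj ?As i (Var z)] \<in>\<^sub>t rep (fst (fs ! i)))" if "i < length fs" for i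
    proof -
      have "has_type L [] (mk_prj ?As i (Var z)) (?As ! i)"
        by (rule has_type_mk_prj) (use A xz that in auto)
      then have "has_type L [] (Tuple [Var x, mk_prj ?As i (Var z)]) (TProd [ety D, ?As ! i])"
        using A xz by auto
      then show ?thesis using F[OF that] unfolding closed_term_def has_type_simps(9) by blast
    qed
    moreover have "formula L (Var x \<in>\<^sub>t rep D)" using A xz Ob_rep[OF D] by (auto simp: closed_term_def)
    ultimately show ?thesis by (auto simp: \<gamma>_def simp del: has_type_simps)
  qed
  have v: "fv \<gamma> \<subseteq> {x, z}" using F Ob_rep[OF D] by (auto simp: \<gamma>_def closed_term_def)
  have sub: "w \<Turnstile> subst (Var(x := s, z := t)) \<gamma> \<longleftrightarrow>
      el w D s \<and> (\<forall>i<length fs. vl w (fs ! i) s (mk_prj ?As i t))" for w s t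
  proof -
    have "map (subst (Var(x := s, z := t)))
        (map (\<lambda>i. Tuple [Var x, mk_prj ?As i (Var z)] \<in>\<^sub>t rep (fst (fs ! i))) [0..<length fs]) =
      map (\<lambda>i. Tuple [s, mk_prj ?As i t] \<in>\<^sub>t rep (fst (fs ! i))) [0..<length fs]"
      using F xz(1) by (auto simp: closed_term_def subst_closed)
    note e = this
    have "subst (Var(x := s, z := t)) \<gamma> = (s \<in>\<^sub>t rep D \<and>\<^sub>t
      foldr And (map (\<lambda>i. Tuple [s, mk_prj ?As i t] \<in>\<^sub>t rep (fst (fs ! i))) [0..<length fs]) Tru)"
      using xz(1) Ob_rep[OF D] unfolding \<gamma>_def subst_connectives subst_foldr_And e
      by (simp only: subst.simps closed_term_def subst_closed fun_upd_apply if_True if_False refl)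
    then show ?thesis using force_foldr_And force_wd by (auto simp: force_And)
  qed
  let ?G = "graph x z \<gamma>"
  note g = graph_closed[OF xz(1) _ _ \<gamma> v, unfolded xz(2,3), OF A(2,1), unfolded sub]
  have pe: "el w ?P t" if "wd w" "tm w t ?A" "\<forall>i<length fs. vl w (fs ! i) s (mk_prj ?As i t)" for w s t
    unfolding el_Prod[OF Z] using that vl_cod[OF fs[OF nth_mem]] by (simp, blast)
  have s: "sfn ?G (ety D) ?A (rep D) (rep ?P)"
  proof (rule sfnI[OF Ob_rep[OF D] _ g(1)], unfold g(2))
    show "closed_term L (rep ?P) (TPow ?A)" using Ob_rep[OF P(1)] P(2) by simp
    show "el w D s \<and> el w ?P t" if "tm w s (ety D) \<and> tm w t ?A \<and> el w D s \<and>
        (\<forall>i<length fs. vl w (fs ! i) s (mk_prj ?As i t))" for w s t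
      using that pe tm_wd by blast
    show "w \<Turnstile> t \<doteq> t'" if "tm w s (ety D) \<and> tm w t ?A \<and> el w D s \<and>
        (\<forall>i<length fs. vl w (fs ! i) s (mk_prj ?As i t))"
      "tm w s (ety D) \<and> tm w t' ?A \<and> el w D s \<and>
        (\<forall>i<length fs. vl w (fs ! i) s (mk_prj ?As i t'))" for w s t t'
    proof (rule force_prod_ext)
      show "tm w t ?A" "tm w t' ?A" using that by auto
      show "w \<Turnstile> mk_prj ?As i t \<doteq> mk_prj ?As i t'" if "i < length ?As" for i
        using vl_fun[OF fs[OF nth_mem]] that \<open>_ \<and> _ \<and> _ \<and> (\<forall>i<length fs. vl w (fs ! i) s (mk_prj ?As i t))\<close>
          \<open>_ \<and> _ \<and> _ \<and> (\<forall>i<length fs. vl w (fs ! i) s (mk_prj ?As i t'))\<close> by (simp, blast)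
    qed
    fix w s \<psi>
    assume s: "el w D s" and \<psi>: "tm w \<psi> TOmega" and h: "\<And>w' t. w \<sqsubseteq> w' \<Longrightarrow>
      tm w' s (ety D) \<and> tm w' t ?A \<and> el w' D s \<and> (\<forall>i<length fs. vl w' (fs ! i) s (mk_prj ?As i t)) \<Longrightarrow> w' \<Turnstile> \<psi>"
    show "w \<Turnstile> \<psi>"
    proof (rule vl_total_list[OF fs s \<psi>])
      fix w' ts
      assume w': "w \<sqsubseteq> w'" and ts: "list_all2 (\<lambda>f t. vl w' f s t) fs ts"
      have l: "length ts = length fs" using ts by (simp add: list_all2_lengthD)
      have s': "el w' D s" using force_mono[OF s w'] .
      have "list_all2 (el w') ?Zs ts" by (rule vl_list_el[OF fs ts])
      note m = el_Prod_tuple[OF Z ext_wd(2)[OF w'] this]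
      have "vl w' (fs ! i) s (mk_prj ?As i (mk_tuple ts))" if "i < length fs" for i
        using vl_cong[OF fs force_refl[OF el_tm[OF D s']] force_sym[OF m(2)]] ts that
        by (simp add: list_all2_conv_all_nth)
      then show "w' \<Turnstile> \<psi>" using h[OF w', of "mk_tuple ts"] s' el_tm[OF D s'] m(1)[unfolded el_Prod[OF Z]] by blast
    qed
  qed
  show ?thesis
  proof
    show "sfun S ?G (rep D) (rep ?P) \<in> Hom E D ?P" using sfun_Hom[OF s] Ob_cls[OF D] Ob_cls[OF P(1)] by simp
    fix w s ts
    assume s': "el w D s" and ts: "list_all2 (\<lambda>f t. vl w f s t) fs ts"
    have "list_all2 (el w) ?Zs ts" by (rule vl_list_el[OF fs ts])
    note m = el_Prod_tuple[OF Z force_wd[OF s'] this]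
    have "vl w (fs ! i) s (mk_prj ?As i (mk_tuple ts))" if "i < length fs" for i
      using vl_cong[OF fs force_refl[OF el_tm[OF D s']] force_sym[OF m(2)]] ts that
      by (simp add: list_all2_conv_all_nth)
    then show "vl w (sfun S ?G (rep D) (rep ?P)) s (mk_tuple ts)"
      unfolding vl_sfun[OF s] g(2) using s' el_tm[OF D s'] m(1)[unfolded el_Prod[OF Z]] by blast
  qed
qed

text \<open>The definite description \<open>tuple\<close> is identified with the arrow constructed
  before. Any other arrow with the same components has the same values, since elements of a product
  with equal projections are equal.\<close>

lemma tuple_Hom:
  assumes D: "D \<in> Ob E" and fs: "\<And>f. f \<in> set fs \<Longrightarrow> f \<in> Hom E D (Cod E f)"
  shows "tuple E D fs \<in> Hom E D (Prod E (map (Cod E) fs))"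
    and "el w D s \<Longrightarrow> list_all2 (\<lambda>f t. vl w f s t) fs ts \<Longrightarrow> vl w (tuple E D fs) s (mk_tuple ts)"
proof -
  let ?Zs = "map (Cod E) fs"
  let ?As = "map ety ?Zs"
  let ?P = "Prod E ?Zs"
  obtain h where h: "h \<in> Hom E D ?P"
    "\<And>w s ts. el w D s \<Longrightarrow> list_all2 (\<lambda>f t. vl w f s t) fs ts \<Longrightarrow> vl w h s (mk_tuple ts)"
    using tuple_exists[OF D fs] by blast
  have Z: "set ?Zs \<subseteq> Ob E" using fs Hom_sfn(3) by fastforce
  have "is_tuple E D fs h"
    unfolding is_tuple_def
  proof (intro conjI allI impI h(1))
    fix i
    assume i: "i < length fs"
    have pj: "Proj E ?Zs i \<in> Hom E ?P (Cod E (fs ! i))" using Proj_Hom(1)[OF Z] i by simp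
    note c = Comp_Hom[OF h(1) pj]
    show "Comp E (Proj E ?Zs i) h = fs ! i"
    proof (rule arr_eqI[OF _ c(1), symmetric])
      show fi: "fs ! i \<in> Hom E D (Cod E (fs ! i))" using fs i by simp
      fix w s t
      assume v: "vl w (fs ! i) s t"
      have s: "el w D s" using vl_dom[OF fi v] .
      show "vl w (Comp E (Proj E ?Zs i) h) s t"
      proof (rule vl_total_list[OF fs s vl_formula[OF c(1)]])
        show "tm w s (ety D)" "tm w t (ety (Cod E (fs ! i)))" using vl_tm[OF fi v] by auto
        fix w' ts
        assume w': "w \<sqsubseteq> w'" and ts: "list_all2 (\<lambda>f t. vl w' f s t) fs ts"
        have hv: "vl w' h s (mk_tuple ts)" using h(2)[OF force_mono[OF s w'] ts] .
        have "list_all2 (el w') ?Zs ts" by (rule vl_list_el[OF fs ts])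
        note m = el_Prod_tuple[OF Z ext_wd(2)[OF w'] this]
        have "vl w' (fs ! i) s (ts ! i)" using ts i by (simp add: list_all2_conv_all_nth)
        then have "w' \<Turnstile> ts ! i \<doteq> t" using vl_fun[OF fi] force_mono[OF v w'] by blast
        with force_trans[OF m(2)[of i] this] i have "w' \<Turnstile> mk_prj ?As i (mk_tuple ts) \<doteq> t" by simp
        moreover have "vl w' (Comp E (Proj E ?Zs i) h) s (mk_prj ?As i (mk_tuple ts))"
          using c(2)[OF hv Proj_Hom(2)[OF Z _ m(1)]] i by simp
        ultimately show "vl w' (Comp E (Proj E ?Zs i) h) s t"
          using vl_cong[OF c(1) force_refl] vl_tm[OF h(1) hv] by blast
      qed
    qed
  qed
  moreover have "k = h" if "is_tuple E D fs k" for k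
  proof (rule arr_eqI[OF _ h(1)])
    show k: "k \<in> Hom E D ?P" using that by (simp add: is_tuple_def)
    fix w s t
    assume v: "vl w k s t"
    have s: "el w D s" and t: "el w ?P t" using vl_dom[OF k v] vl_cod[OF k v] by auto
    show "vl w h s t"
    proof (rule vl_total_list[OF fs s vl_formula[OF h(1)]])
      show "tm w s (ety D)" "tm w t (ety ?P)" using vl_tm[OF k v] by auto
      fix w' ts
      assume w': "w \<sqsubseteq> w'" and ts: "list_all2 (\<lambda>f t. vl w' f s t) fs ts"
      have hv: "vl w' h s (mk_tuple ts)" using h(2)[OF force_mono[OF s w'] ts] .
      have "list_all2 (el w') ?Zs ts" by (rule vl_list_el[OF fs ts])
      note m = el_Prod_tuple[OF Z ext_wd(2)[OF w'] this]
      have t': "el w' ?P t" using force_mono[OF t w'] .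
      have "w' \<Turnstile> mk_tuple ts \<doteq> t"
      proof (rule force_prod_ext)
        show "tm w' (mk_tuple ts) (mk_prod ?As)" "tm w' t (mk_prod ?As)"
          using m(1) t' unfolding el_Prod[OF Z] by auto
        fix i
        assume "i < length ?As"
        then have i: "i < length fs" by simp
        have pj: "Proj E ?Zs i \<in> Hom E ?P (Cod E (fs ! i))" using Proj_Hom(1)[OF Z] i by simp
        have e: "Comp E (Proj E ?Zs i) k = fs ! i" using that i by (simp add: is_tuple_def)
        have fi: "fs ! i \<in> Hom E D (Cod E (fs ! i))" using fs i by simp
        have "vl w' (fs ! i) s (mk_prj ?As i t)"
          using Comp_Hom(2)[OF k pj force_mono[OF v w'] Proj_Hom(2)[OF Z _ t']] i unfolding e by simp
        then have "w' \<Turnstile> ts ! i \<doteq> mk_prj ?As i t" by (rule vl_fun[OF fi list_all2_nthD[OF ts i]])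
        with force_trans[OF m(2)[of i] this] i
        show "w' \<Turnstile> mk_prj ?As i (mk_tuple ts) \<doteq> mk_prj ?As i t" by simp
      qed
      then show "vl w' h s t" using vl_cong[OF h(1) force_refl _ hv] vl_tm[OF h(1) hv] by blast
    qed
  qed
  ultimately have "tuple E D fs = h" unfolding tuple_def by (intro the_equality)
  then show "tuple E D fs \<in> Hom E D ?P"
    and "el w D s \<Longrightarrow> list_all2 (\<lambda>f t. vl w f s t) fs ts \<Longrightarrow> vl w (tuple E D fs) s (mk_tuple ts)"
    using h by simp_all
qed

section \<open>Truth values and classifying arrows\<close>

lemma Omega_el: "el w (Omega E) s \<longleftrightarrow> tm w s TOmega" and Omega_Ob: "Omega E \<in> Ob E"
  and ety_Omega: "ety (Omega E) = TOmega"
  using closed_U[of TOmega] cls_Ob ety_cls el_cls by (auto simp: Omega_E)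

text \<open>\<open>Truth\<close> is defined on \<open>U TUnit\<close>, while the terminal object is
  the empty product. Both sets have all terms of type \<open>TUnit\<close> as members, so the
  classes agree.\<close>

lemma Unit_eq: "cls S (U TUnit) = Prod E []"
  unfolding Prod_E
  by (rule closed_ext) (use closed_U[of TUnit] Prod_closed[of "[]"] in auto)

lemma Truth_Hom: "Truth E \<in> Hom E (Prod E []) (Omega E)"
  and vl_Truth: "tm w s TUnit \<Longrightarrow> vl w (Truth E) s Tru"
proof -
  have 1: "closed_term L (U TUnit) (TPow (snd (0 :: nat, TUnit :: 'g ty)))" "closed_term L (U TOmega) (TPow TOmega)"
    using closed_U by auto
  have 2: "has_type L [] Tru TOmega" "fv (Tru :: ('g, 'f) trm) \<subseteq> {(0, TUnit)}" by auto
  have 3: "w \<Turnstile> subst1 (0, TUnit) s Tru \<in>\<^sub>t U TOmega" if "w \<Turnstile> s \<in>\<^sub>t U TUnit" for w s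
    using that tm_wd by (auto simp: closed_U)
  note m = maps_to_Hom[OF 1 2 3, folded Truth_E Omega_E, unfolded Unit_eq]
  show "Truth E \<in> Hom E (Prod E []) (Omega E)" by (rule m(1))
  show "vl w (Truth E) s Tru" if "tm w s TUnit"
    using m(2)[of w s Tru] that closed_U[of TUnit] force_refl[of w Tru TOmega] tm_wd[OF that] by auto
qed

lemma true_on_Hom:
  assumes D: "D \<in> Ob E"
  shows "true_on E D \<in> Hom E D (Omega E)" and "el w D s \<Longrightarrow> vl w (true_on E D) s Tru"
proof -
  have t: "tuple E D [] \<in> Hom E D (Prod E [])" using tuple_Hom(1)[OF D, of "[]"] by simp
  note c = Comp_Hom[OF t Truth_Hom, folded true_on_def]
  show "true_on E D \<in> Hom E D (Omega E)" by (rule c(1))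
  show "vl w (true_on E D) s Tru" if s: "el w D s"
    using c(2)[OF tuple_Hom(2)[OF D _ s, of "[]" "[]"] vl_Truth] force_wd[OF s] by simp
qed

lemma Ident_Hom:
  assumes Z: "Z \<in> Ob E"
  shows "Ident E Z \<in> Hom E Z Z" and "el w Z s \<Longrightarrow> vl w (Ident E Z) s s"
proof -
  let ?x = "(0, ety Z) :: 'g var"
  have 1: "closed_term L (rep Z) (TPow (snd ?x))" using Ob_rep[OF Z] by simp
  have 2: "has_type L [] (Var ?x) (ety Z)" "fv (Var ?x) \<subseteq> {?x}" using Ob_is_ty[OF Z] by auto
  note m = maps_to_Hom[OF 1 Ob_rep[OF Z] 2, folded Ident_E, unfolded Ob_cls[OF Z]]
  show "Ident E Z \<in> Hom E Z Z" by (rule m(1)) simp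
  show "vl w (Ident E Z) s s" if "el w Z s"
    using m(2)[of w s s] that force_refl[OF el_tm[OF Z that]] by simp
qed

text \<open>The value of the classifying arrow at \<open>t\<close> is any formula equivalent to \<open>\<exists>x. \<langle>x, t\<rangle> \<in> |m|\<close>,
  which the last two premises express without binders.\<close>

lemma chi_Hom:
  assumes m: "m \<in> Hom E M Z"
    and inj: "\<And>w s s' t. vl w m s t \<Longrightarrow> vl w m s' t \<Longrightarrow> w \<Turnstile> s \<doteq> s'"
  shows "chi E m \<in> Hom E Z (Omega E)"
    and "\<lbrakk>el w Z t; tm w \<omega> TOmega; \<And>w' x. w \<sqsubseteq> w' \<Longrightarrow> vl w' m x t \<Longrightarrow> w' \<Turnstile> \<omega>;
      \<And>w' \<psi>. \<lbrakk>w \<sqsubseteq> w'; w' \<Turnstile> \<omega>; tm w' \<psi> TOmega; \<And>w'' x. w' \<sqsubseteq> w'' \<Longrightarrow> vl w'' m x t \<Longrightarrow> w'' \<Turnstile> \<psi>\<rbrakk> \<Longrightarrow> w' \<Turnstile> \<psi>\<rbrakk>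
      \<Longrightarrow> vl w (chi E m) t \<omega>"
proof -
  note M = Hom_sfn(2)[OF m] and Z = Hom_sfn(3)[OF m]
  let ?A = "ety M" and ?B = "ety Z" and ?F = "rep (fst m)"
  have F: "closed_term L ?F (TPow (TProd [?A, ?B]))" using sfn_closed(3)[OF Hom_sfn(1)[OF m]] .
  have fF: "fv ?F = {}" and tF: "has_type L Bs ?F (TPow (TProd [?A, ?B]))" for Bs
    using F by (simp_all add: closed_term_def has_type_weaken0)
  have ty: "is_ty (ground L) ?A" "is_ty (ground L) ?B" using M Z Ob_is_ty by blast+
  let ?z = "(0, ?B) :: 'g var"
  define b where "b t = (Tuple [Bound 0, t] \<in>\<^sub>t ?F)" for t
  have bt: "has_type L (?A # Bs) (b t) TOmega" if "has_type L (?A # Bs) t ?B" for t Bs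
    unfolding b_def has_type_simps(9) using tF that
    by (intro conjI refl exI[of _ "TProd [?A, ?B]"]) simp_all
  have ib: "inst x (b t) = (Tuple [x, t] \<in>\<^sub>t ?F)" if "tm w t ?B" for w t x
    using tm_lc[OF that] closed_lc[OF F] by (simp add: b_def)
  have bt0: "has_type L [?A] (b t) TOmega" "fv (b t) \<subseteq> vars w" if "tm w t ?B" for w t
    using that bt[of "[]" t] fF by (auto simp: tm_def has_type_weaken0 b_def)
  have imageI': "w \<Turnstile> Ex ?A (b t)" if v: "vl w m x t" for w x t
  proof -
    have xt: "tm w x ?A" "tm w t ?B" using vl_tm[OF m v] by auto
    show ?thesis by (rule force_ExI[OF _ xt(1) bt0[OF xt(2)]]) (use v ib[OF xt(2)] in simp)
  qed
  have imageE': "w \<Turnstile> \<psi>" if f: "w \<Turnstile> Ex ?A (b t)" and t: "tm w t ?B" and \<psi>: "tm w \<psi> TOmega"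
    and h: "\<And>w' x. w \<sqsubseteq> w' \<Longrightarrow> vl w' m x t \<Longrightarrow> w' \<Turnstile> \<psi>" for w t \<psi>
    by (rule force_ExE[OF f bt0(1)[OF t] \<psi>]) (use h in \<open>simp only: ib[OF t]\<close>)
  have ext: "tm w (Ex ?A (b t)) TOmega" if "tm w t ?B" for w t
    using that bt[of "[TOmega]" t] bt0(2)[OF that] ty by (simp add: tm_def has_type_weaken0)
  \<comment> \<open>The candidate sends \<open>z\<close> to the truth value of the formula that puts
    \<open>z\<close> in the image of \<open>m\<close>.\<close>
  define c where "c = maps_to L S ?z (Ex ?A (b (Var ?z))) (rep Z) (U TOmega)"
  have c: "c \<in> Hom E Z (Omega E)" and cv: "vl w c t \<omega> \<longleftrightarrow> el w Z t \<and> w \<Turnstile> \<omega> \<doteq> Ex ?A (b t)" for w t \<omega>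
  proof -
    have 1: "closed_term L (rep Z) (TPow (snd ?z))" "closed_term L (U TOmega) (TPow TOmega)"
      using Ob_rep[OF Z] closed_U by auto
    have 2: "has_type L [] (Ex ?A (b (Var ?z))) TOmega" "fv (Ex ?A (b (Var ?z))) \<subseteq> {?z}"
      using bt[of "[TOmega]" "Var ?z"] ty fF by (auto simp: b_def)
    have su: "subst1 ?z s (Ex ?A (b (Var ?z))) = Ex ?A (b s)" for s by (simp add: b_def subst_closed fF)
    have 3: "w \<Turnstile> subst1 ?z s (Ex ?A (b (Var ?z))) \<in>\<^sub>t U TOmega" if "el w Z s" for w s
      unfolding su using ext[OF el_tm[OF Z that]] closed_U(2)[of TOmega] by simp
    note k = maps_to_Hom[OF 1 2 3, folded Omega_E c_def, unfolded Ob_cls[OF Z] su]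
    show "c \<in> Hom E Z (Omega E)" "vl w c t \<omega> \<longleftrightarrow> el w Z t \<and> w \<Turnstile> \<omega> \<doteq> Ex ?A (b t)"
      using k by auto
  qed
  have cl: "classifies E m c"
    unfolding classifies_def
  proof (intro conjI ballI impI)
    show "m \<in> Arr E" "c \<in> Hom E (Cod E m) (Omega E)" using m c by (simp_all add: Hom_E)
    note cm = Comp_Hom[OF m c]
    have "Comp E c m = true_on E M"
    proof (rule arr_eqI[OF true_on_Hom(1)[OF M] cm(1), symmetric])
      fix w s \<omega>
      assume v: "vl w (true_on E M) s \<omega>"
      have s: "el w M s" using vl_dom[OF true_on_Hom(1)[OF M] v] .
      have e: "w \<Turnstile> \<omega> \<doteq> Tru" using vl_fun[OF true_on_Hom(1)[OF M] v true_on_Hom(2)[OF M s]] .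
      have t: "tm w s (ety M)" "tm w \<omega> (ety (Omega E))" using vl_tm[OF true_on_Hom(1)[OF M] v] by auto
      show "vl w (Comp E c m) s \<omega>"
      proof (rule vl_total[OF m s vl_formula[OF cm(1) t]])
        fix w' z
        assume w': "w \<sqsubseteq> w'" and z: "vl w' m s z"
        have "w' \<Turnstile> \<omega> \<doteq> Ex ?A (b z)"
          using force_trans[OF force_mono[OF e w'] force_sym] imageI'[OF z] force_Tru_iff by blast
        then have "vl w' c z \<omega>" using cv vl_cod[OF m z] by blast
        then show "vl w' (Comp E c m) s \<omega>" using cm(2)[OF z] by blast
      qed
    qed
    then show "Comp E c m = true_on E (Dom E m)" using m by (simp add: Hom_E)
    fix h
    assume "h \<in> Arr E" and hh: "Cod E h = Cod E m \<and> Comp E c h = true_on E (Dom E h)"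
    then have h: "h \<in> Hom E (Dom E h) Z" using m by (simp add: Hom_E)
    let ?D = "Dom E h"
    note D = Hom_sfn(2)[OF h]
    note ch = Comp_Hom[OF h c]
    \<comment> \<open>The value of \<open>c\<close> at \<open>z\<close> is the formula that puts
      \<open>z\<close> in the image. As \<open>c\<close> after \<open>h\<close> is true, this
      formula is forced at every value of \<open>h\<close>.\<close>
    have img: "w \<Turnstile> Ex ?A (b z)" if v: "vl w h d z" for w d z
    proof -
      have z: "tm w z ?B" "el w Z z" using vl_tm[OF h v] vl_cod[OF h v] by auto
      have "vl w c z (Ex ?A (b z))" using cv z force_refl[OF ext[OF z(1)]] by blast
      then have "vl w (true_on E ?D) d (Ex ?A (b z))" using ch(2)[OF v] hh by simp
      then have "w \<Turnstile> Ex ?A (b z) \<doteq> Tru"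
        using vl_fun[OF true_on_Hom(1)[OF D] _ true_on_Hom(2)[OF D vl_dom[OF h v]]] by blast
      then show ?thesis by (simp add: force_Tru_iff)
    qed
    have H: "closed_term L (rep (fst h)) (TPow (TProd [ety ?D, ?B]))"
      using sfn_closed(3)[OF Hom_sfn(1)[OF h]] .
    \<comment> \<open>The factor of \<open>h\<close> through \<open>m\<close> is \<open>h\<close>
      followed by the converse of the graph of \<open>m\<close>. It is total by \<open>img\<close>
      and single-valued by \<open>inj\<close>.\<close>
    let ?y = "(1, ?A) :: 'g var"
    let ?\<gamma> = "Tuple [Var ?y, Var ?z] \<in>\<^sub>t ?F"
    have g: "formula L ?\<gamma>" "fv ?\<gamma> \<subseteq> {?z, ?y}"
    proof -
      show "formula L ?\<gamma>" unfolding has_type_simps(9) using ty tF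
        by (intro conjI refl exI[of _ "TProd [?A, ?B]"]) simp_all
      show "fv ?\<gamma> \<subseteq> {?z, ?y}" using fF by simp
    qed
    have zy: "?z \<noteq> ?y" by simp
    note gc = graph_closed[OF zy _ _ g]
    let ?C = "graph ?z ?y ?\<gamma>"
    have C: "closed_term L ?C (TPow (TProd [?B, ?A]))" using gc(1) ty by simp
    have Cv: "w \<Turnstile> Tuple [t, x] \<in>\<^sub>t ?C \<longleftrightarrow> vl w m x t" for w t x
      using gc(2)[of w t x] ty vl_tm[OF m, of w x t] by (auto simp: subst_closed fF)
    note kc = comp_graph_closed[OF H C Ob_is_ty[OF D] ty(2,1), unfolded Cv]
    let ?K = "comp_graph (ety ?D) ?B ?A ?C (rep (fst h))"
    have k: "sfn ?K (ety ?D) ?A (rep ?D) (rep M)"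
    proof (rule sfnI[OF Ob_rep[OF D] Ob_rep[OF M] kc(1)])
      fix w s t
      assume v: "w \<Turnstile> Tuple [s, t] \<in>\<^sub>t ?K"
      have st: "tm w s (ety ?D)" "tm w t ?A" using closed_pair_tm[OF kc(1) v] by auto
      have "w \<Turnstile> (s \<in>\<^sub>t rep ?D \<and>\<^sub>t t \<in>\<^sub>t rep M)"
      proof (rule kc(3)[OF v])
        show "tm w (s \<in>\<^sub>t rep ?D \<and>\<^sub>t t \<in>\<^sub>t rep M) TOmega"
          using st closed_tm[OF Ob_rep[OF D] tm_wd[OF st(1)]] closed_tm[OF Ob_rep[OF M] tm_wd[OF st(1)]]
          by auto
      qed (use vl_dom[OF h] vl_dom[OF m] in \<open>simp add: force_And\<close>)
      then show "el w ?D s \<and> el w M t" by (simp add: force_And)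
      fix t'
      assume v': "w \<Turnstile> Tuple [s, t'] \<in>\<^sub>t ?K"
      have e: "tm w (t \<doteq> t') TOmega" using st closed_pair_tm[OF kc(1) v'] by auto
      show "w \<Turnstile> t \<doteq> t'"
      proof (rule kc(3)[OF v e])
        fix w' r
        assume w': "w \<sqsubseteq> w'" and a: "vl w' h s r" "vl w' m t r"
        show "w' \<Turnstile> t \<doteq> t'"
        proof (rule kc(3)[OF force_mono[OF v' w'] tm_mono[OF e w']])
          fix w'' r'
          assume w'': "w' \<sqsubseteq> w''" and b: "vl w'' h s r'" "vl w'' m t' r'"
          have "w'' \<Turnstile> r' \<doteq> r" using vl_fun[OF h b(1) force_mono[OF a(1) w'']] .
          then have "vl w'' m t' r" using vl_cong[OF m force_refl _ b(2)] vl_tm[OF m b(2)] by blast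
          then show "w'' \<Turnstile> t \<doteq> t'" using inj force_mono[OF a(2) w''] by blast
        qed
      qed
    next
      fix w s \<psi>
      assume s: "el w ?D s" and \<psi>: "tm w \<psi> TOmega"
        and g: "\<And>w' t. w \<sqsubseteq> w' \<Longrightarrow> w' \<Turnstile> Tuple [s, t] \<in>\<^sub>t ?K \<Longrightarrow> w' \<Turnstile> \<psi>"
      show "w \<Turnstile> \<psi>"
      proof (rule vl_total[OF h s \<psi>])
        fix w' z
        assume w': "w \<sqsubseteq> w'" and z: "vl w' h s z"
        show "w' \<Turnstile> \<psi>"
        proof (rule imageE'[OF img[OF z] _ tm_mono[OF \<psi> w']])
          show "tm w' z ?B" using vl_tm[OF h z] by blast
          fix w'' x
          assume w'': "w' \<sqsubseteq> w''" and x: "vl w'' m x z"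
          show "w'' \<Turnstile> \<psi>" using g[OF ext_trans[OF w' w''] kc(2)[OF force_mono[OF z w''] x]] .
        qed
      qed
    qed
    let ?k = "sfun S ?K (rep ?D) (rep M)"
    have kH: "?k \<in> Hom E ?D M" using sfun_Hom[OF k] Ob_cls[OF D] Ob_cls[OF M] by simp
    note mk = Comp_Hom[OF kH m]
    have mkh: "Comp E m ?k = h"
    proof (rule arr_eqI[OF h mk(1), symmetric])
      fix w s z
      assume v: "vl w h s z"
      have st: "tm w s (ety ?D)" "tm w z ?B" using vl_tm[OF h v] by auto
      show "vl w (Comp E m ?k) s z"
      proof (rule imageE'[OF img[OF v] st(2) vl_formula[OF mk(1) st]])
        fix w' x
        assume w': "w \<sqsubseteq> w'" and x: "vl w' m x z"
        show "vl w' (Comp E m ?k) s z"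
          using mk(2)[OF _ x] vl_sfun[OF k] kc(2)[OF force_mono[OF v w'] x] by blast
      qed
    qed
    show "\<exists>!k. k \<in> Hom E ?D (Dom E m) \<and> Comp E m k = h"
    proof (rule ex1I[of _ ?k])
      show "?k \<in> Hom E ?D (Dom E m) \<and> Comp E m ?k = h" using kH mkh m by (simp add: Hom_E)
      fix k'
      assume k': "k' \<in> Hom E ?D (Dom E m) \<and> Comp E m k' = h"
      then have k'H: "k' \<in> Hom E ?D M" using m by (simp add: Hom_E)
      show "k' = ?k"
      proof (rule arr_eqI[OF k'H kH])
        fix w s x
        assume v: "vl w k' s x"
        have st: "tm w s (ety ?D)" "tm w x ?A" using vl_tm[OF k'H v] by auto
        show "vl w ?k s x"
        proof (rule vl_total[OF m vl_cod[OF k'H v] vl_formula[OF kH st]])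
          fix w' z
          assume w': "w \<sqsubseteq> w'" and z: "vl w' m x z"
          have "vl w' h s z" using Comp_Hom(2)[OF k'H m force_mono[OF v w'] z] k' by simp
          then show "vl w' ?k s x" unfolding vl_sfun[OF k] using kc(2) z by blast
        qed
      qed
    qed
  qed
  \<comment> \<open>A rival \<open>c'\<close> is tested on the part \<open>?N\<close> of
    \<open>Z\<close> where it is true. The inclusion of \<open>?N\<close> factors through
    \<open>m\<close>, so truth of \<open>c'\<close> at \<open>z\<close> puts \<open>z\<close> in the
    image; conversely \<open>c'\<close> after \<open>m\<close> is true. Equivalent truth values are
    equal, so \<open>c'\<close> and \<open>c\<close> have the same values.\<close>
  have un: "c' = c" if "classifies E m c'" for c'
  proof -
    have c': "c' \<in> Hom E Z (Omega E)" and c'm: "Comp E c' m = true_on E M"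
      and pb: "\<And>h. h \<in> Arr E \<Longrightarrow> Cod E h = Z \<Longrightarrow> Comp E c' h = true_on E (Dom E h) \<Longrightarrow>
        \<exists>!k. k \<in> Hom E (Dom E h) M \<and> Comp E m k = h"
      using that m unfolding classifies_def by (auto simp: Hom_E)
    let ?G = "rep (fst c')"
    have G: "closed_term L ?G (TPow (TProd [?B, TOmega]))"
      using sfn_closed(3)[OF Hom_sfn(1)[OF c']] by (simp add: ety_Omega)
    let ?N = "compr ?z (Var ?z \<in>\<^sub>t rep Z \<and>\<^sub>t Tuple [Var ?z, Tru] \<in>\<^sub>t ?G)"
    have fN: "formula L (Var ?z \<in>\<^sub>t rep Z \<and>\<^sub>t Tuple [Var ?z, Tru] \<in>\<^sub>t ?G)"
    proof -
      have "has_type L [] (Tuple [Var ?z, Tru]) (TProd [?B, TOmega])" using ty by simp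
      then have "formula L (Tuple [Var ?z, Tru] \<in>\<^sub>t ?G)"
        unfolding has_type_simps(9) using G by (auto simp only: closed_term_def)
      moreover have "formula L (Var ?z \<in>\<^sub>t rep Z)" using ty Ob_rep[OF Z] by (auto simp: closed_term_def)
      ultimately show ?thesis by (simp only: has_type_connectives)
    qed
    have fvG: "fv ?G = {}" "fv (rep Z) = {}" using G Ob_rep[OF Z] by (simp_all add: closed_term_def)
    have N: "closed_term L ?N (TPow ?B)"
      using has_type_bind[OF fN, of ?z] ty fvG by (simp add: closed_term_def compr_def)
    have Nm: "w \<Turnstile> s \<in>\<^sub>t ?N \<longleftrightarrow> el w Z s \<and> vl w c' s Tru" for w s
      using force_mem_compr[OF fN, of ?z w s] ty fvG el_tm[OF Z, of w s]
      by (auto simp: force_And subst_closed)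
    let ?i = "maps_to L S ?z (Var ?z) ?N (rep Z)"
    have i: "?i \<in> Hom E (cls S ?N) Z" "vl w ?i s t \<longleftrightarrow> w \<Turnstile> s \<in>\<^sub>t ?N \<and> w \<Turnstile> t \<doteq> s" for w s t
      using maps_to_Hom[of ?N ?z "rep Z" ?B "Var ?z"] N Ob_rep[OF Z] Ob_cls[OF Z] ty Nm by auto
    note NO = cls_Ob[OF N]
    note ci = Comp_Hom[OF i(1) c']
    have cit: "Comp E c' ?i = true_on E (cls S ?N)"
    proof (rule arr_eqI[OF true_on_Hom(1)[OF NO] ci(1), symmetric])
      fix w s \<omega>
      assume v: "vl w (true_on E (cls S ?N)) s \<omega>"
      have s: "el w (cls S ?N) s" using vl_dom[OF true_on_Hom(1)[OF NO] v] .
      have e: "w \<Turnstile> \<omega> \<doteq> Tru" using vl_fun[OF true_on_Hom(1)[OF NO] v true_on_Hom(2)[OF NO s]] .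
      have s': "w \<Turnstile> s \<in>\<^sub>t ?N" using s el_cls[OF N] by blast
      have ts: "tm w s ?B" using closed_mem_tm[OF N s'] .
      have "vl w ?i s s" using i(2) s' force_refl[OF ts] by blast
      moreover have "vl w c' s \<omega>"
        using vl_cong[OF c' force_refl[OF ts] force_sym[OF e]] s' Nm by blast
      ultimately show "vl w (Comp E c' ?i) s \<omega>" by (rule ci(2))
    qed
    obtain k where k: "k \<in> Hom E (cls S ?N) M" "Comp E m k = ?i"
      using pb[of ?i] i(1) cit by (auto simp: Hom_E)
    show "c' = c"
    proof (rule arr_eqI[OF c' c])
      fix w z \<omega>
      assume v: "vl w c' z \<omega>"
      have z: "el w Z z" "tm w z ?B" "tm w \<omega> TOmega"
        using vl_dom[OF c' v] vl_tm[OF c' v] by (auto simp: ety_Omega)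
      have "w \<Turnstile> \<omega> \<doteq> Ex ?A (b z)"
      proof (rule force_eqI[OF z(3) ext[OF z(2)]])
        fix w'
        assume w': "w \<sqsubseteq> w'" and o: "w' \<Turnstile> \<omega>"
        have z': "tm w' z ?B" "el w' Z z" using tm_mono[OF z(2) w'] force_mono[OF z(1) w'] by auto
        have "w' \<Turnstile> \<omega> \<doteq> Tru" using o by (simp add: force_Tru_iff)
        then have "vl w' c' z Tru" using vl_cong[OF c' force_refl[OF z'(1)] _ force_mono[OF v w']] by blast
        then have zN: "w' \<Turnstile> z \<in>\<^sub>t ?N" using Nm z' by blast
        show "w' \<Turnstile> Ex ?A (b z)"
        proof (rule vl_total[OF k(1) _ ext[OF z'(1)]])
          show "el w' (cls S ?N) z" using zN el_cls[OF N] by blast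
          fix w'' x
          assume w'': "w' \<sqsubseteq> w''" and x: "vl w'' k z x"
          have z'': "tm w'' z ?B" using tm_mono[OF z'(1) w''] .
          show "w'' \<Turnstile> Ex ?A (b z)"
          proof (rule vl_total[OF m vl_cod[OF k(1) x] ext[OF z'']])
            fix w3 y
            assume w3: "w'' \<sqsubseteq> w3" and y: "vl w3 m x y"
            have "vl w3 ?i z y" using Comp_Hom(2)[OF k(1) m force_mono[OF x w3] y] k(2) by simp
            then have "w3 \<Turnstile> y \<doteq> z" using i(2) by blast
            then have "vl w3 m x z" using vl_cong[OF m force_refl _ y] vl_tm[OF m y] by blast
            then show "w3 \<Turnstile> Ex ?A (b z)" by (rule imageI')
          qed
        qed
      next
        fix w'
        assume w': "w \<sqsubseteq> w'" and o: "w' \<Turnstile> Ex ?A (b z)"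
        show "w' \<Turnstile> \<omega>"
        proof (rule imageE'[OF o tm_mono[OF z(2) w'] tm_mono[OF z(3) w']])
          fix w'' x
          assume w'': "w' \<sqsubseteq> w''" and x: "vl w'' m x z"
          have "vl w'' (true_on E M) x \<omega>"
            using Comp_Hom(2)[OF m c' x force_mono[OF v ext_trans[OF w' w'']]] c'm by simp
          then have "w'' \<Turnstile> \<omega> \<doteq> Tru"
            using vl_fun[OF true_on_Hom(1)[OF M] _ true_on_Hom(2)[OF M vl_dom[OF m x]]] by blast
          then show "w'' \<Turnstile> \<omega>" by (simp add: force_Tru_iff)
        qed
      qed
      then show "vl w c z \<omega>" using cv z(1) by blast
    qed
  qed
  have chi: "chi E m = c" unfolding chi_def using cl un by (rule the_equality)
  show "chi E m \<in> Hom E Z (Omega E)" using c chi by simp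
  show "vl w (chi E m) t \<omega>" if t: "el w Z t" and \<omega>: "tm w \<omega> TOmega"
    and i: "\<And>w' x. w \<sqsubseteq> w' \<Longrightarrow> vl w' m x t \<Longrightarrow> w' \<Turnstile> \<omega>"
    and e: "\<And>w' \<psi>. \<lbrakk>w \<sqsubseteq> w'; w' \<Turnstile> \<omega>; tm w' \<psi> TOmega;
      \<And>w'' x. w' \<sqsubseteq> w'' \<Longrightarrow> vl w'' m x t \<Longrightarrow> w'' \<Turnstile> \<psi>\<rbrakk> \<Longrightarrow> w' \<Turnstile> \<psi>"
  proof -
    have tt: "tm w t ?B" using el_tm[OF Z t] .
    have "w \<Turnstile> \<omega> \<doteq> Ex ?A (b t)"
    proof (rule force_eqI[OF \<omega> ext[OF tt]])
      show "w' \<Turnstile> Ex ?A (b t)" if "w \<sqsubseteq> w'" "w' \<Turnstile> \<omega>" for w'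
        by (rule e[OF that ext[OF tm_mono[OF tt that(1)]]]) (rule imageI')
      show "w' \<Turnstile> \<omega>" if "w \<sqsubseteq> w'" "w' \<Turnstile> Ex ?A (b t)" for w'
        by (rule imageE'[OF that(2) tm_mono[OF tt that(1)] tm_mono[OF \<omega> that(1)] i[OF ext_trans[OF that(1)]]])
    qed
    then show ?thesis unfolding chi using cv t by blast
  qed
qed

text \<open>For arrows with a common value that is available at \<open>w\<close> itself;
  functionality of \<open>a\<close> makes every other value of \<open>a\<close> equal to it.\<close>

lemma arr_eqI_ex:
  assumes a: "a \<in> Hom E D Z" and b: "b \<in> Hom E D Z"
    and h: "\<And>w s. el w D s \<Longrightarrow> \<exists>t. vl w a s t \<and> vl w b s t"
  shows "a = b"
proof (rule arr_eqI[OF a b])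
  fix w s t
  assume v: "vl w a s t"
  obtain t' where t': "vl w a s t'" "vl w b s t'" using h[OF vl_dom[OF a v]] by blast
  show "vl w b s t" using vl_cong[OF b force_refl vl_fun[OF a t'(1) v] t'(2)] vl_tm[OF a v] by blast
qed

lemma Pair_Hom:
  assumes a: "a \<in> Hom E D A" and b: "b \<in> Hom E D B"
  shows "tuple E D [a, b] \<in> Hom E D (Prod E [A, B])"
    and "vl w a s t \<Longrightarrow> vl w b s t' \<Longrightarrow> vl w (tuple E D [a, b]) s (Tuple [t, t'])"
proof -
  have c: "Cod E a = A" "Cod E b = B" using a b by (simp_all add: Hom_E)
  have f: "f \<in> Hom E D (Cod E f)" if "f \<in> set [a, b]" for f using that a b c by auto
  show "tuple E D [a, b] \<in> Hom E D (Prod E [A, B])"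
    using tuple_Hom(1)[OF Hom_sfn(2)[OF a], of "[a, b]"] f c by simp
  show "vl w (tuple E D [a, b]) s (Tuple [t, t'])" if "vl w a s t" "vl w b s t'"
    using tuple_Hom(2)[OF Hom_sfn(2)[OF a], of "[a, b]" w s "[t, t']"] f vl_dom[OF a that(1)] that by simp
qed

lemma el_Pair:
  assumes A: "A \<in> Ob E" and B: "B \<in> Ob E"
  shows "Prod E [A, B] \<in> Ob E" and "ety (Prod E [A, B]) = TProd [ety A, ety B]"
    and "el w A s \<Longrightarrow> el w B t \<Longrightarrow> el w (Prod E [A, B]) (Tuple [s, t])"
    and "el w (Prod E [A, B]) p \<Longrightarrow> w \<Turnstile> p \<doteq> Tuple [Prj [ety A, ety B] 0 p, Prj [ety A, ety B] 1 p] \<and>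
      el w A (Prj [ety A, ety B] 0 p) \<and> el w B (Prj [ety A, ety B] 1 p)"
proof -
  have Z: "set [A, B] \<subseteq> Ob E" using A B by simp
  show "Prod E [A, B] \<in> Ob E" by (rule Prod_Ob[OF Z])
  show "ety (Prod E [A, B]) = TProd [ety A, ety B]" using ety_Prod[OF Z] by simp
  show "el w (Prod E [A, B]) (Tuple [s, t])" if "el w A s" "el w B t"
    using el_Prod_tuple(1)[OF Z force_wd[OF that(1)], of "[s, t]"] that by simp
  show "w \<Turnstile> p \<doteq> Tuple [Prj [ety A, ety B] 0 p, Prj [ety A, ety B] 1 p] \<and>
      el w A (Prj [ety A, ety B] 0 p) \<and> el w B (Prj [ety A, ety B] 1 p)" if "el w (Prod E [A, B]) p"
    using that[unfolded el_Prod[OF Z]] force_pair_eta[of w p "ety A" "ety B"]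
    by (simp add: mk_prj_def less_Suc_eq all_conj_distrib)
qed

text \<open>A pair \<open>(s, t)\<close> is in the image of the diagonal exactly if
  \<open>s = t\<close>. This equation is thus the value of the classifying arrow, and
  \<open>chi_Hom\<close> asks no more than that.\<close>

lemma diag_Hom:
  assumes A: "A \<in> Ob E"
  shows "diag_eq E A \<in> Hom E (Prod E [A, A]) (Omega E)"
    and "el w A s \<Longrightarrow> el w A t \<Longrightarrow> vl w (diag_eq E A) (Tuple [s, t]) (s \<doteq> t)"
proof -
  let ?m = "tuple E A [Ident E A, Ident E A]"
  note i = Ident_Hom[OF A]
  note m = Pair_Hom[OF i(1) i(1)]
  have v: "vl w ?m s (Tuple [s, s])" if "el w A s" for w s using m(2) i(2)[OF that] by blast
  have e: "w \<Turnstile> p \<doteq> Tuple [s, s]" if "vl w ?m s p" for w s p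
    using vl_fun[OF m(1) that v[OF vl_dom[OF m(1) that]]] .
  have inj: "w \<Turnstile> s \<doteq> s'" if "vl w ?m s p" "vl w ?m s' p" for w s s' p
    using force_pair_inj(1)[OF force_trans[OF force_sym[OF e[OF that(1)]] e[OF that(2)]]] .
  note c = chi_Hom[OF m(1), folded diag_eq_def]
  show "diag_eq E A \<in> Hom E (Prod E [A, A]) (Omega E)" by (rule c(1)[OF inj])
  show "vl w (diag_eq E A) (Tuple [s, t]) (s \<doteq> t)" if s: "el w A s" and t: "el w A t"
  proof (rule c(2))
    show "w \<Turnstile> s \<doteq> s'" if "vl w ?m s p" "vl w ?m s' p" for w s s' p using inj[OF that] .
    show "el w (Prod E [A, A]) (Tuple [s, t])" using el_Pair(3)[OF A A s t] .
    show "tm w (s \<doteq> t) TOmega" using el_tm[OF A s] el_tm[OF A t] by auto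
    fix w' x
    assume "vl w' ?m x (Tuple [s, t])"
    from force_pair_inj[OF e[OF this]] show "w' \<Turnstile> s \<doteq> t" using force_trans force_sym by blast
  next
    fix w' \<psi>
    assume w': "w \<sqsubseteq> w'" and st: "w' \<Turnstile> s \<doteq> t"
      and h: "\<And>w'' x. w' \<sqsubseteq> w'' \<Longrightarrow> vl w'' ?m x (Tuple [s, t]) \<Longrightarrow> w'' \<Turnstile> \<psi>"
    have s': "el w' A s" using force_mono[OF s w'] .
    have r: "w' \<Turnstile> s \<doteq> s" using force_refl[OF el_tm[OF A s']] .
    have "vl w' ?m s (Tuple [s, t])" using vl_cong[OF m(1) r force_pair_cong[OF r st] v[OF s']] .
    then show "w' \<Turnstile> \<psi>" using h ext_refl ext_wd(2)[OF w'] by blast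
  qed
qed

text \<open>Validity compares the meet of the antecedent with the interpretation of the succedent.
  If the antecedent is empty and the succedent is interpreted as true, it comes down to this
  equation.\<close>

lemma meet_true_on:
  assumes D: "D \<in> Ob E"
  shows "meet E D (true_on E D) (true_on E D) = true_on E D"
proof -
  let ?P = "Prod E []" and ?O = "Omega E"
  let ?m = "tuple E ?P [Truth E, Truth E]"
  have P: "?P \<in> Ob E" using Prod_Ob[of "[]"] by simp
  have elP: "el w ?P s \<longleftrightarrow> tm w s TUnit" for w s using el_Prod[of "[]"] by simp
  note m = Pair_Hom[OF Truth_Hom Truth_Hom]
  have inj: "w \<Turnstile> s \<doteq> s'" if "vl w ?m s p" "vl w ?m s' p" for w s s' p
    using vl_dom[OF m(1)] that force_Star elP force_trans force_sym by blast
  note c = chi_Hom[OF m(1)]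
  let ?c = "chi E ?m"
  have cH: "?c \<in> Hom E (Prod E [?O, ?O]) ?O" by (rule c(1)[OF inj])
  have cv: "vl w ?c (Tuple [Tru, Tru]) Tru" if w: "wd w" for w
  proof (rule c(2))
    show "w \<Turnstile> s \<doteq> s'" if "vl w ?m s p" "vl w ?m s' p" for w s s' p using inj[OF that] .
    have O: "el w ?O Tru" if "wd w" for w using that Omega_el by simp
    show "el w (Prod E [?O, ?O]) (Tuple [Tru, Tru])" using el_Pair(3)[OF Omega_Ob Omega_Ob] O w by blast
    show "tm w Tru TOmega" using w by simp
    show "w' \<Turnstile> Tru" if "w \<sqsubseteq> w'" for w' using force_Tru ext_wd(2)[OF that] by blast
    fix w' \<psi>
    assume w': "w \<sqsubseteq> w'"
      and h: "\<And>w'' x. w' \<sqsubseteq> w'' \<Longrightarrow> vl w'' ?m x (Tuple [Tru, Tru]) \<Longrightarrow> w'' \<Turnstile> \<psi>"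
    have "tm w' Star TUnit" using ext_wd(2)[OF w'] by simp
    then have "vl w' ?m Star (Tuple [Tru, Tru])" using m(2) vl_Truth by blast
    then show "w' \<Turnstile> \<psi>" using h ext_refl ext_wd(2)[OF w'] by blast
  qed
  note t = true_on_Hom[OF D]
  note p = Pair_Hom[OF t(1) t(1)]
  note k = Comp_Hom[OF p(1) cH, folded meet_def]
  show ?thesis
  proof (rule arr_eqI_ex[OF k(1) t(1)])
    fix w s
    assume s: "el w D s"
    have "vl w (meet E D (true_on E D) (true_on E D)) s Tru"
      by (rule k(2)[OF p(2)[OF t(2)[OF s] t(2)[OF s]] cv[OF force_wd[OF s]]])
    then show "\<exists>t. vl w (meet E D (true_on E D) (true_on E D)) s t \<and> vl w (true_on E D) s t"
      using t(2)[OF s] by blast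
  qed
qed

section \<open>Power objects\<close>

lemma Pow_Ob:
  assumes Z: "Z \<in> Ob E"
  shows "PowOb E Z \<in> Ob E" and "ety (PowOb E Z) = TPow (ety Z)"
    and "el w (PowOb E Z) u \<longleftrightarrow> tm w u (TPow (ety Z)) \<and> (\<forall>w' t. w \<sqsubseteq> w' \<longrightarrow> w' \<Turnstile> t \<in>\<^sub>t u \<longrightarrow> el w' Z t)"
  using closed_pow_set[OF Ob_rep[OF Z]] cls_Ob ety_cls el_cls by (simp_all add: PowOb_E)

text \<open>The graph in the definition of \<open>Ev\<close> consists of nested pairs. It is first
  identified with that of the map sending \<open>p\<close> to the membership of its first projection
  in its second, which makes \<open>maps_to_Hom\<close> applicable.\<close>

lemma Ev_Hom:
  assumes Z: "Z \<in> Ob E"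
  shows "Ev E Z \<in> Hom E (Prod E [Z, PowOb E Z]) (Omega E)"
    and "el w Z s \<Longrightarrow> el w (PowOb E Z) u \<Longrightarrow> vl w (Ev E Z) (Tuple [s, u]) (s \<in>\<^sub>t u)"
proof -
  let ?A = "ety Z" and ?X = "rep Z"
  let ?B = "TPow ?A" and ?Y = "pow_set ?A ?X"
  let ?P = "prod_set [?A, ?B] [?X, ?Y]" and ?T = "TProd [?A, ?B]"
  let ?x = "(0, ?A) :: 'g var" and ?u = "(1, ?B) :: 'g var" and ?z = "(0, ?T) :: 'g var"
  note X = Ob_rep[OF Z]
  note Y = closed_pow_set[OF X]
  have A: "is_ty (ground L) ?A" using Ob_is_ty[OF Z] .
  have P: "closed_term L ?P (TPow ?T)"
    and Pm: "w \<Turnstile> t \<in>\<^sub>t ?P \<longleftrightarrow> tm w t ?T \<and> w \<Turnstile> Prj [?A, ?B] 0 t \<in>\<^sub>t ?X \<and> w \<Turnstile> Prj [?A, ?B] 1 t \<in>\<^sub>t ?Y" for w t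
    using closed_prod_set[of "[?X, ?Y]" "[?A, ?B]"] X Y(1)
    by (simp_all add: mk_prj_def less_Suc_eq all_conj_distrib numeral_2_eq_2)
  have PowX: "el w (PowOb E Z) t \<longleftrightarrow> w \<Turnstile> t \<in>\<^sub>t ?Y" for w t using el_cls[OF Y(1)] by (simp add: PowOb_E)
  \<comment> \<open>\<open>Ev\<close> is declared on the product formed with
    \<open>pow_set ?A ?X\<close>, whereas \<open>Prod E\<close> works with the chosen representative
    of its class.\<close>
  have PE: "cls S ?P = Prod E [Z, PowOb E Z]"
    unfolding Prod_E
  proof (rule closed_ext[OF P])
    have O: "set [Z, PowOb E Z] \<subseteq> Ob E" using Z Pow_Ob(1)[OF Z] by simp
    note p = Prod_closed[OF O]
    show "closed_term L (prod_set (map ety [Z, PowOb E Z]) (map rep [Z, PowOb E Z])) (TPow ?T)"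
      using p(1) by (simp add: Pow_Ob(2)[OF Z])
    show "w \<Turnstile> s \<in>\<^sub>t ?P \<longleftrightarrow> w \<Turnstile> s \<in>\<^sub>t prod_set (map ety [Z, PowOb E Z]) (map rep [Z, PowOb E Z])" for w s
      unfolding p(2) Pm
      by (simp add: Pow_Ob(2)[OF Z] PowX mk_prj_def less_Suc_eq all_conj_distrib numeral_2_eq_2)
  qed
  let ?\<tau> = "Prj [?A, ?B] 0 (Var ?z) \<in>\<^sub>t Prj [?A, ?B] 1 (Var ?z)"
  have \<tau>: "has_type L [] ?\<tau> TOmega" "fv ?\<tau> \<subseteq> {?z}" using A by auto
  have Pz: "closed_term L ?P (TPow (snd ?z))" using P by simp
  have h: "w \<Turnstile> subst1 ?z s ?\<tau> \<in>\<^sub>t U TOmega" if "w \<Turnstile> s \<in>\<^sub>t ?P" for w s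
    using closed_mem_tm[OF P that] closed_U(2)[of TOmega] by simp
  have U: "closed_term L (U TOmega) (TPow TOmega)" using closed_U by simp
  have m: "maps_to L S ?z ?\<tau> ?P (U TOmega) \<in> Hom E (Prod E [Z, PowOb E Z]) (Omega E)"
    "vl w (maps_to L S ?z ?\<tau> ?P (U TOmega)) s t \<longleftrightarrow> w \<Turnstile> s \<in>\<^sub>t ?P \<and> w \<Turnstile> t \<doteq> subst1 ?z s ?\<tau>" for w s t
    unfolding Omega_E PE[symmetric] by (rule maps_to_Hom[OF Pz U \<tau>]; erule h)+
  note mg = maps_graph_closed[OF Pz \<tau>]
  let ?G = "set_of (TProd [?T, TOmega]) [?x, ?u]
    (Tuple [Tuple [Var ?x, Var ?u], Var ?x \<in>\<^sub>t Var ?u]) (Var ?x \<in>\<^sub>t ?X \<and>\<^sub>t Var ?u \<in>\<^sub>t ?Y)"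
  let ?t = "Tuple [Tuple [Var ?x, Var ?u], Var ?x \<in>\<^sub>t Var ?u] :: ('g, 'f) trm"
  let ?\<phi> = "Var ?x \<in>\<^sub>t ?X \<and>\<^sub>t Var ?u \<in>\<^sub>t ?Y"
  have tt: "has_type L [] ?t (TProd [?T, TOmega])" using A by auto
  have t\<phi>: "formula L ?\<phi>" using A X Y(1) by (auto simp: closed_term_def)
  have fX: "fv ?X = {}" "fv ?Y = {}" using X Y(1) by (simp_all only: closed_term_def)
  have v: "fv ?t \<union> fv ?\<phi> \<subseteq> set [?x, ?u]" using fX by auto
  have ty: "\<forall>x\<in>set [?x, ?u]. is_ty (ground L) (snd x)" using A by simp
  have G: "closed_term L ?G (TPow (TProd [?T, TOmega]))"
    using has_type_set_of[OF ty tt t\<phi>] A fX by (auto simp: closed_term_def)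
  have "cls S ?G = cls S (maps_graph ?z ?P TOmega ?\<tau>)"
  proof (rule closed_rel_ext[OF G])
    show "closed_term L (maps_graph ?z ?P TOmega ?\<tau>) (TPow (TProd [?T, TOmega]))" using mg(1) by simp
    fix w and p \<omega> :: "('g, 'f) trm"
    let ?p0 = "Prj [?A, ?B] 0 p" and ?p1 = "Prj [?A, ?B] 1 p"
    show "w \<Turnstile> Tuple [p, \<omega>] \<in>\<^sub>t ?G \<longleftrightarrow> w \<Turnstile> Tuple [p, \<omega>] \<in>\<^sub>t maps_graph ?z ?P TOmega ?\<tau>"
      unfolding mg(2)
    proof
      assume f: "w \<Turnstile> Tuple [p, \<omega>] \<in>\<^sub>t ?G"
      have p: "tm w p ?T" "tm w \<omega> TOmega" using closed_pair_tm[OF G f] by auto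
      have w: "wd w" using force_wd[OF f] .
      have mem: "tm w (?p0 \<in>\<^sub>t ?p1) TOmega" using p by auto
      have "w \<Turnstile> (p \<in>\<^sub>t ?P \<and>\<^sub>t \<omega> \<doteq> (?p0 \<in>\<^sub>t ?p1))"
      proof (rule set_ofE[OF f tt t\<phi> v ty])
        show "tm w (p \<in>\<^sub>t ?P \<and>\<^sub>t \<omega> \<doteq> (?p0 \<in>\<^sub>t ?p1)) TOmega"
          using p mem closed_tm[OF P w] unfolding tm_simps(1,2,5) by blast
        fix w' \<theta>
        assume w': "w \<sqsubseteq> w'" and tv: "\<And>v. v \<in> set [?x, ?u] \<Longrightarrow> tm w' (\<theta> v) (snd v)"
          and e: "w' \<Turnstile> Tuple [p, \<omega>] \<doteq> subst \<theta> ?t" and g: "w' \<Turnstile> subst \<theta> ?\<phi>"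
        let ?a = "\<theta> ?x" and ?b = "\<theta> ?u"
        have ab: "tm w' ?a ?A" "tm w' ?b ?B" using tv[of ?x] tv[of ?u] by auto
        have e1: "w' \<Turnstile> p \<doteq> Tuple [?a, ?b]" and e2: "w' \<Turnstile> \<omega> \<doteq> (?a \<in>\<^sub>t ?b)"
          using force_pair_inj[of w' p \<omega> "Tuple [?a, ?b]" "?a \<in>\<^sub>t ?b"] e by auto
        have gab: "w' \<Turnstile> ?a \<in>\<^sub>t ?X" "w' \<Turnstile> ?b \<in>\<^sub>t ?Y"
          using g by (simp_all add: force_And subst_closed fX)
        have p': "tm w' p ?T" using tm_mono[OF p(1) w'] .
        have e3: "w' \<Turnstile> ?p0 \<doteq> ?a" "w' \<Turnstile> ?p1 \<doteq> ?b"
          using force_pair_inj[OF force_trans[OF force_sym[OF force_pair_eta[OF p']] e1]] by auto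
        have "w' \<Turnstile> ?p0 \<in>\<^sub>t ?X" "w' \<Turnstile> ?p1 \<in>\<^sub>t ?Y"
          using force_mem_cong[OF force_sym[OF e3(1)] force_refl[OF closed_tm[OF X ext_wd(2)[OF w']]] gab(1)]
            force_mem_cong[OF force_sym[OF e3(2)] force_refl[OF closed_tm[OF Y(1) ext_wd(2)[OF w']]] gab(2)]
          by auto
        then have "w' \<Turnstile> p \<in>\<^sub>t ?P" using p' by (simp add: Pm)
        moreover have "w' \<Turnstile> (?a \<in>\<^sub>t ?b) \<doteq> (?p0 \<in>\<^sub>t ?p1)"
        proof (rule force_eqI)
          show "tm w' (?a \<in>\<^sub>t ?b) TOmega" using ab by auto
          show "tm w' (?p0 \<in>\<^sub>t ?p1) TOmega" using tm_mono[OF mem w'] .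
        qed (use force_mem_cong e3 force_sym force_mono in meson)+
        ultimately show "w' \<Turnstile> (p \<in>\<^sub>t ?P \<and>\<^sub>t \<omega> \<doteq> (?p0 \<in>\<^sub>t ?p1))"
          using force_trans[OF e2] by (simp add: force_And)
      qed
      then show "w \<Turnstile> p \<in>\<^sub>t ?P \<and> w \<Turnstile> \<omega> \<doteq> subst1 ?z p ?\<tau>" by (simp add: force_And)
    next
      assume f: "w \<Turnstile> p \<in>\<^sub>t ?P \<and> w \<Turnstile> \<omega> \<doteq> subst1 ?z p ?\<tau>"
      have p: "tm w p ?T" using f Pm by blast
      have p01: "tm w ?p0 ?A" "tm w ?p1 ?B" using p by simp_all
      have e: "w \<Turnstile> \<omega> \<doteq> (?p0 \<in>\<^sub>t ?p1)" using f by simp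
      have \<omega>: "tm w \<omega> TOmega" using force_eq_tm[OF e, of TOmega] p01 by auto
      show "w \<Turnstile> Tuple [p, \<omega>] \<in>\<^sub>t ?G"
      proof (rule set_ofI[OF tt t\<phi> v, where \<theta> = "Var(?x := ?p0, ?u := ?p1)"])
        show "tm w (Tuple [p, \<omega>]) (TProd [?T, TOmega])" using p \<omega> tm_wd by simp
        show "tm w ((Var(?x := ?p0, ?u := ?p1)) v) (snd v)" if "v \<in> set [?x, ?u]" for v
          using that p01 by auto
        show "w \<Turnstile> Tuple [p, \<omega>] \<doteq> subst (Var(?x := ?p0, ?u := ?p1)) ?t"
          using force_pair_cong[OF force_pair_eta[OF p] e] by simp
        show "w \<Turnstile> subst (Var(?x := ?p0, ?u := ?p1)) ?\<phi>"
          using f by (simp add: force_And subst_closed fX Pm)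
      qed
    qed
  qed
  then have Ev: "Ev E Z = maps_to L S ?z ?\<tau> ?P (U TOmega)"
    by (simp add: ling_topos_def Let_def maps_to_def sfun_def elem_ty_eq[OF U])
  show "Ev E Z \<in> Hom E (Prod E [Z, PowOb E Z]) (Omega E)" unfolding Ev by (rule m(1))
  show "vl w (Ev E Z) (Tuple [s, u]) (s \<in>\<^sub>t u)" if s: "el w Z s" and u: "el w (PowOb E Z) u"
    unfolding Ev m(2)
  proof
    have st: "tm w s ?A" "tm w u ?B" using el_tm[OF Z s] u Pow_Ob(3)[OF Z] by blast+
    have *: "w \<Turnstile> s \<doteq> Prj [?A, ?B] 0 (Tuple [s, u])" "w \<Turnstile> u \<doteq> Prj [?A, ?B] 1 (Tuple [s, u])"
      using force_pair_inj[OF force_pair_eta[of w "Tuple [s, u]" ?A ?B]] st tm_wd by auto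
    show "w \<Turnstile> Tuple [s, u] \<in>\<^sub>t ?P"
      unfolding Pm
    proof (intro conjI)
      show "tm w (Tuple [s, u]) ?T" using st tm_wd by simp
      show "w \<Turnstile> Prj [?A, ?B] 0 (Tuple [s, u]) \<in>\<^sub>t ?X" using el_cong[OF Z *(1) s] .
      show "w \<Turnstile> Prj [?A, ?B] 1 (Tuple [s, u]) \<in>\<^sub>t ?Y"
        using el_cong[OF Pow_Ob(1)[OF Z] *(2) u] PowX by blast
    qed
    have "w \<Turnstile> (s \<in>\<^sub>t u) \<doteq> (Prj [?A, ?B] 0 (Tuple [s, u]) \<in>\<^sub>t Prj [?A, ?B] 1 (Tuple [s, u]))"
    proof (rule force_eqI)
      show "tm w (s \<in>\<^sub>t u) TOmega" using st by auto
      show "tm w (Prj [?A, ?B] 0 (Tuple [s, u]) \<in>\<^sub>t Prj [?A, ?B] 1 (Tuple [s, u])) TOmega"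
        using st tm_wd by auto
    qed (use force_mem_cong * force_sym force_mono in meson)+
    then show "w \<Turnstile> (s \<in>\<^sub>t u) \<doteq> subst1 ?z (Tuple [s, u]) ?\<tau>" by simp
  qed
qed

text \<open>The transpose of \<open>c\<close> sends \<open>s\<close> to the set of those
  \<open>x\<close> in \<open>A\<close> for which \<open>c\<close> is true at \<open>(x, s)\<close>.
  In the rule for values the formula \<open>\<alpha>\<close> describes \<open>c\<close> on elements
  of \<open>A\<close> only, hence the conjunct \<open>Bound 0 \<in>\<^sub>t rep A\<close> in the
  result.\<close>

lemma transpose_Hom:
  assumes A: "A \<in> Ob E" and D: "D \<in> Ob E" and c: "c \<in> Hom E (Prod E [A, D]) (Omega E)"
  shows "transpose E A D c \<in> Hom E D (PowOb E A)"
    and "\<lbrakk>el w D s; has_type L [ety A] \<alpha> TOmega; fv \<alpha> \<subseteq> vars w;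
      \<And>w' x. w \<sqsubseteq> w' \<Longrightarrow> el w' A x \<Longrightarrow> vl w' c (Tuple [x, s]) (inst x \<alpha>)\<rbrakk> \<Longrightarrow>
      vl w (transpose E A D c) s (Compr (ety A) (Bound 0 \<in>\<^sub>t rep A \<and>\<^sub>t \<alpha>))"
proof -
  let ?A = "ety A" and ?D = "ety D" and ?F = "rep (fst c)"
  let ?d = "(0, ?D) :: 'g var"
  have ty: "is_ty (ground L) ?A" "is_ty (ground L) ?D" using A D Ob_is_ty by blast+
  note X = Ob_rep[OF A]
  have F: "closed_term L ?F (TPow (TProd [TProd [?A, ?D], TOmega]))"
    using sfn_closed(3)[OF Hom_sfn(1)[OF c]] by (simp add: ety_Omega el_Pair(2)[OF A D])
  have fF: "fv ?F = {}" "fv (rep A) = {}"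
    and tF: "has_type L Bs ?F (TPow (TProd [TProd [?A, ?D], TOmega]))" "has_type L Bs (rep A) (TPow ?A)" for Bs
    using F X by (simp_all add: closed_term_def has_type_weaken0)
  define b where "b s = (Bound 0 \<in>\<^sub>t rep A \<and>\<^sub>t Tuple [Tuple [Bound 0, s], Tru] \<in>\<^sub>t ?F)" for s
  have bt: "has_type L [?A] (b s) TOmega" if "has_type L [?A] s ?D" for s
    unfolding b_def has_type_connectives has_type_simps(9) using tF that
    by (intro conjI refl; intro exI[of _ ?A] exI[of _ "TProd [TProd [?A, ?D], TOmega]"]) simp_all
  have ib: "inst x (b s) = (x \<in>\<^sub>t rep A \<and>\<^sub>t Tuple [Tuple [x, s], Tru] \<in>\<^sub>t ?F)" if "tm w s ?D" for w s x
    using tm_lc[OF that] closed_lc[OF F] closed_lc[OF X] by (simp add: b_def)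
  have bt0: "has_type L [?A] (b s) TOmega" "fv (b s) \<subseteq> vars w" if "tm w s ?D" for w s
    using that bt[of s] fF by (auto simp: tm_def has_type_weaken0 b_def)
  have mb: "w \<Turnstile> x \<in>\<^sub>t Compr ?A (b s) \<longleftrightarrow> el w A x \<and> vl w c (Tuple [x, s]) Tru" if s: "tm w s ?D" for w s x
    unfolding force_mem_Compr[OF bt0[OF s]] ib[OF s] force_And using el_tm[OF A] by blast
  have tb: "tm w (Compr ?A (b s)) (TPow ?A)" if "tm w s ?D" for w s
    using tm_Compr[OF tm_wd[OF that] ty(1) bt0[OF that]] .
  define h where "h = maps_to L S ?d (Compr ?A (b (Var ?d))) (rep D) (pow_set ?A (rep A))"
  have h: "h \<in> Hom E D (PowOb E A)" and hv: "vl w h s t \<longleftrightarrow> el w D s \<and> w \<Turnstile> t \<doteq> Compr ?A (b s)" for w s t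
  proof -
    have 1: "closed_term L (rep D) (TPow (snd ?d))" using Ob_rep[OF D] by simp
    have 2: "has_type L [] (Compr ?A (b (Var ?d))) (TPow ?A)" "fv (Compr ?A (b (Var ?d))) \<subseteq> {?d}"
      using bt[of "Var ?d"] ty fF by (auto simp: b_def)
    have su: "subst1 ?d s (Compr ?A (b (Var ?d))) = Compr ?A (b s)" for s by (simp add: b_def subst_closed fF)
    have 3: "w \<Turnstile> subst1 ?d s (Compr ?A (b (Var ?d))) \<in>\<^sub>t pow_set ?A (rep A)" if s: "el w D s" for w s
      unfolding su closed_pow_set(2)[OF X] using tb[OF el_tm[OF D s]] mb[OF tm_mono[OF el_tm[OF D s]]] by blast
    note k = maps_to_Hom[OF 1 closed_pow_set(1)[OF X] 2 3, folded PowOb_E h_def, unfolded Ob_cls[OF D] su]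
    show "h \<in> Hom E D (PowOb E A)" "vl w h s t \<longleftrightarrow> el w D s \<and> w \<Turnstile> t \<doteq> Compr ?A (b s)"
      using k by auto
  qed
  have O: "set [A, D] \<subseteq> Ob E" using A D by simp
  have pr: "Proj E [A, D] 0 \<in> Hom E (Prod E [A, D]) A" "Proj E [A, D] 1 \<in> Hom E (Prod E [A, D]) D"
    using Proj_Hom(1)[OF O, of 0] Proj_Hom(1)[OF O, of 1] by simp_all
  have prv: "vl w (Proj E [A, D] 0) (Tuple [x, s]) x" "vl w (Proj E [A, D] 1) (Tuple [x, s]) s"
    if x: "el w A x" and s: "el w D s" for w x s
  proof -
    have e: "el w (Prod E [A, D]) (Tuple [x, s])" using el_Pair(3)[OF A D x s] .
    have p: "w \<Turnstile> Tuple [x, s] \<doteq> Tuple [x, s]" using force_refl el_tm[OF el_Pair(1)[OF A D] e] by blast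
    have *: "w \<Turnstile> Prj [?A, ?D] 0 (Tuple [x, s]) \<doteq> x" "w \<Turnstile> Prj [?A, ?D] 1 (Tuple [x, s]) \<doteq> s"
      using force_pair_inj[OF force_sym[OF force_pair_eta[of w "Tuple [x, s]" ?A ?D]]]
        el_tm[OF el_Pair(1)[OF A D] e] el_Pair(2)[OF A D] by auto
    show "vl w (Proj E [A, D] 0) (Tuple [x, s]) x" "vl w (Proj E [A, D] 1) (Tuple [x, s]) s"
      using vl_cong[OF pr(1) p *(1)] vl_cong[OF pr(2) p *(2)] Proj_Hom(2)[OF O _ e, of 0]
        Proj_Hom(2)[OF O _ e, of 1] by (simp_all add: mk_prj_def)
  qed
  let ?q = "\<lambda>h. Comp E (Ev E A) (tuple E (Prod E [A, D]) [Proj E [A, D] 0, Comp E h (Proj E [A, D] 1)])"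
  have q: "?q k \<in> Hom E (Prod E [A, D]) (Omega E)"
    and qv: "vl w k s t \<Longrightarrow> el w A x \<Longrightarrow> vl w (?q k) (Tuple [x, s]) (x \<in>\<^sub>t t)"
    if k: "k \<in> Hom E D (PowOb E A)" for k w s t x
  proof -
    note kp = Comp_Hom[OF pr(2) k]
    note tp = Pair_Hom[OF pr(1) kp(1)]
    note ev = Comp_Hom[OF tp(1) Ev_Hom(1)[OF A]]
    show "?q k \<in> Hom E (Prod E [A, D]) (Omega E)" by (rule ev(1))
    show "vl w (?q k) (Tuple [x, s]) (x \<in>\<^sub>t t)" if v: "vl w k s t" and x: "el w A x"
      by (rule ev(2)[OF tp(2)[OF prv(1) kp(2)[OF prv(2) v]] Ev_Hom(2)[OF A x vl_cod[OF k v]]])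
        (use x vl_dom[OF k v] in blast)+
  qed
  have tr: "is_transpose E A D c h"
    unfolding is_transpose_def
  proof (intro conjI h arr_eqI[OF c q[OF h], symmetric])
    fix w p \<omega>
    assume v: "vl w c p \<omega>"
    let ?x = "Prj [?A, ?D] 0 p" and ?s = "Prj [?A, ?D] 1 p"
    have e: "w \<Turnstile> p \<doteq> Tuple [?x, ?s]" and x: "el w A ?x" and s: "el w D ?s"
      using el_Pair(4)[OF A D vl_dom[OF c v]] by auto
    have \<omega>: "tm w \<omega> TOmega" using vl_tm[OF c v] by (simp add: ety_Omega)
    have ts: "tm w ?s ?D" "tm w ?x ?A" using el_tm[OF D s] el_tm[OF A x] by auto
    have v': "vl w c (Tuple [?x, ?s]) \<omega>" using vl_cong[OF c e force_refl[OF \<omega>] v] .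
    have "vl w h ?s (Compr ?A (b ?s))" using hv s force_refl[OF tb[OF ts(1)]] by blast
    from qv[OF h this x] have qx: "vl w (?q h) (Tuple [?x, ?s]) (?x \<in>\<^sub>t Compr ?A (b ?s))" .
    have "w \<Turnstile> (?x \<in>\<^sub>t Compr ?A (b ?s)) \<doteq> \<omega>"
    proof (rule force_eqI[OF _ \<omega>])
      show "tm w (?x \<in>\<^sub>t Compr ?A (b ?s)) TOmega" using tb[OF ts(1)] ts(2) by (auto simp del: tm_simps(4))
      fix w'
      assume w': "w \<sqsubseteq> w'"
      note mb' = mb[OF tm_mono[OF ts(1) w'], of ?x]
      have vw: "vl w' c (Tuple [?x, ?s]) \<omega>" using force_mono[OF v' w'] .
      show "w' \<Turnstile> \<omega>" if "w' \<Turnstile> ?x \<in>\<^sub>t Compr ?A (b ?s)"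
        using vl_fun[OF c vw] that mb' force_Tru_iff by blast
      show "w' \<Turnstile> ?x \<in>\<^sub>t Compr ?A (b ?s)" if "w' \<Turnstile> \<omega>"
        unfolding mb' using force_mono[OF x w'] vl_cong[OF c force_refl _ vw] vl_tm[OF c vw] that
          force_Tru_iff by blast
    qed
    then show "vl w (?q h) p \<omega>" using vl_cong[OF q[OF h] force_sym[OF e] _ qx] by blast
  qed
  \<comment> \<open>A rival \<open>k\<close> sends \<open>s\<close> to a set \<open>t\<close> in the
    power of \<open>A\<close>. As \<open>?q k = c\<close>, the members of \<open>t\<close> are the
    elements of \<open>A\<close> at which \<open>c\<close> is true, and extensionality identifies
    \<open>t\<close> with the value of \<open>h\<close>.\<close>
  have un: "k = h" if "is_transpose E A D c k" for k
  proof -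
    have k: "k \<in> Hom E D (PowOb E A)" and kq: "?q k = c" using that by (simp_all add: is_transpose_def)
    show "k = h"
    proof (rule arr_eqI[OF k h])
      fix w s t
      assume v: "vl w k s t"
      have s: "el w D s" and t: "el w (PowOb E A) t" using vl_dom[OF k v] vl_cod[OF k v] by auto
      have ts: "tm w s ?D" "tm w t (TPow ?A)" using el_tm[OF D s] t Pow_Ob(3)[OF A] by auto
      have kv: "vl w' c (Tuple [x, s]) (x \<in>\<^sub>t t)" if "w \<sqsubseteq> w'" "el w' A x" for w' x
        using qv[OF k force_mono[OF v that(1)] that(2)] kq by simp
      have "w \<Turnstile> t \<doteq> Compr ?A (b s)"
      proof (rule force_ext[OF ts(2) tb[OF ts(1)]])
        fix w' x
        assume w': "w \<sqsubseteq> w'"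
        note mb' = mb[OF tm_mono[OF ts(1) w'], of x]
        show "w' \<Turnstile> x \<in>\<^sub>t Compr ?A (b s)" if m: "w' \<Turnstile> x \<in>\<^sub>t t"
        proof -
          have x: "el w' A x" using t w' m Pow_Ob(3)[OF A] by blast
          have vx: "vl w' c (Tuple [x, s]) (x \<in>\<^sub>t t)" using kv[OF w' x] .
          have "w' \<Turnstile> (x \<in>\<^sub>t t) \<doteq> Tru" using m by (simp add: force_Tru_iff)
          then have "vl w' c (Tuple [x, s]) Tru"
            using vl_cong[OF c force_refl _ vx] vl_tm[OF c vx] by blast
          then show ?thesis unfolding mb' using x by blast
        qed
        show "w' \<Turnstile> x \<in>\<^sub>t t" if m: "w' \<Turnstile> x \<in>\<^sub>t Compr ?A (b s)"
        proof -
          have "el w' A x" "vl w' c (Tuple [x, s]) Tru" using m mb' by blast+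
          then have "w' \<Turnstile> (x \<in>\<^sub>t t) \<doteq> Tru" using vl_fun[OF c kv[OF w']] by blast
          then show ?thesis by (simp add: force_Tru_iff)
        qed
      qed
      then show "vl w h s t" using hv s by blast
    qed
  qed
  have T: "transpose E A D c = h" unfolding transpose_def using tr un by (rule the_equality)
  show "transpose E A D c \<in> Hom E D (PowOb E A)" unfolding T by (rule h)
  show "vl w (transpose E A D c) s (Compr ?A (Bound 0 \<in>\<^sub>t rep A \<and>\<^sub>t \<alpha>))"
    if s: "el w D s" and \<alpha>: "has_type L [?A] \<alpha> TOmega" "fv \<alpha> \<subseteq> vars w"
      and a: "\<And>w' x. w \<sqsubseteq> w' \<Longrightarrow> el w' A x \<Longrightarrow> vl w' c (Tuple [x, s]) (inst x \<alpha>)"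
  proof -
    let ?a = "Bound 0 \<in>\<^sub>t rep A \<and>\<^sub>t \<alpha>"
    have ts: "tm w s ?D" using el_tm[OF D s] .
    have at: "has_type L [?A] ?a TOmega" "fv ?a \<subseteq> vars w" using \<alpha> tF fF by auto
    have ia: "inst x ?a = (x \<in>\<^sub>t rep A \<and>\<^sub>t inst x \<alpha>)" for x using closed_lc[OF X] by simp
    have ma: "w' \<Turnstile> x \<in>\<^sub>t Compr ?A ?a \<longleftrightarrow> el w' A x \<and> w' \<Turnstile> inst x \<alpha>" if "w \<sqsubseteq> w'" for w' x
      using force_mem_Compr[OF at(1), of w' x] at(2) that el_tm[OF A, of w' x]
      unfolding ia force_And by (auto simp: ext_def)
    have "w \<Turnstile> Compr ?A ?a \<doteq> Compr ?A (b s)"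
    proof (rule force_ext[OF tm_Compr[OF tm_wd[OF ts] ty(1) at] tb[OF ts]])
      fix w' x
      assume w': "w \<sqsubseteq> w'"
      note mb' = mb[OF tm_mono[OF ts w'], of x]
      show "w' \<Turnstile> x \<in>\<^sub>t Compr ?A (b s)" if "w' \<Turnstile> x \<in>\<^sub>t Compr ?A ?a"
      proof -
        have x: "el w' A x" "w' \<Turnstile> inst x \<alpha> \<doteq> Tru" using that ma[OF w'] force_Tru_iff by blast+
        have vx: "vl w' c (Tuple [x, s]) (inst x \<alpha>)" using a[OF w' x(1)] .
        then have "vl w' c (Tuple [x, s]) Tru" using vl_cong[OF c force_refl x(2) vx] vl_tm[OF c vx] by blast
        then show ?thesis unfolding mb' using x(1) by blast
      qed
      show "w' \<Turnstile> x \<in>\<^sub>t Compr ?A ?a" if "w' \<Turnstile> x \<in>\<^sub>t Compr ?A (b s)"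
      proof -
        have x: "el w' A x" "vl w' c (Tuple [x, s]) Tru" using that mb' by blast+
        have "w' \<Turnstile> inst x \<alpha> \<doteq> Tru" using vl_fun[OF c a[OF w' x(1)] x(2)] .
        then show ?thesis unfolding ma[OF w'] using x(1) force_Tru_iff by blast
      qed
    qed
    then show ?thesis unfolding T hv using s by blast
  qed
qed

end

section \<open>Evaluating terms of the internal language\<close>

context set_theory
begin

abbreviation LE :: "(('g, 'f) sobj, (('g, 'f) sobj, ('g, 'f) sarr) fsym) lang" where
  "LE \<equiv> int_lang E"

abbreviation ob :: "('g, 'f) sobj ty \<Rightarrow> ('g, 'f) sobj" where
  "ob \<equiv> ty_obj E"

section \<open>Types of the internal language and interpretations as arrows\<close>

lemma ground_LE: "ground LE = Ob E - {Prod E [], Omega E}"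
  by (simp add: int_lang_def Let_def)

lemma funs_LE: "h \<in> funs LE \<longleftrightarrow> is_ty (ground LE) (fst (snd h)) \<and> is_ty (ground LE) (snd (snd h)) \<and>
    fst h \<in> Hom E (ob (fst (snd h))) (ob (snd (snd h)))"
  by (cases h) (auto simp: int_lang_def Let_def)

lemma sig_LE: "sig LE h = snd h"
  by (simp add: int_lang_def Let_def)

lemma local_language_LE: "local_language LE"
  by (simp add: local_language_def sig_LE funs_LE)

lemma ob_Ob: "is_ty (ground LE) T \<Longrightarrow> ob T \<in> Ob E"
proof (induction T)
  case TUnit
  then show ?case using Prod_Ob[of "[]"] by simp
next
  case TOmega
  then show ?case using Omega_Ob by simp
next
  case (TGround Z)
  then show ?case by (simp add: ground_LE)
next
  case (TPow T)
  then show ?case using Pow_Ob(1) by simp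
next
  case (TProd Ts)
  then have "set (map ob Ts) \<subseteq> Ob E" by auto
  then show ?case using Prod_Ob[of "map ob Ts"] by simp
qed

lemma type_sym_ob: "ob (type_sym E Z) = Z"
  by (simp add: type_sym_def)

lemma type_sym_is_ty: "Z \<in> Ob E \<Longrightarrow> is_ty (ground LE) (type_sym E Z)"
  by (simp add: type_sym_def ground_LE)

lemma ctx_Ob:
  assumes "\<forall>B\<in>set Bs. is_ty (ground LE) B" and "\<forall>x\<in>set xs. is_ty (ground LE) (snd x)"
  shows "set (ctx E xs Bs) \<subseteq> Ob E"
  using assms ob_Ob by (auto simp: ctx_def)

lemma nth_takeWhile_neq:
  assumes "x \<in> set xs"
  shows "length (takeWhile (\<lambda>y. y \<noteq> x) xs) < length xs"
    and "xs ! length (takeWhile (\<lambda>y. y \<noteq> x) xs) = x"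
  using assms by (induction xs) auto

text \<open>In a transpose the bound variable is paired with the whole context, in the body it is
  one more component of it. On values \<open>can\<close> flattens the pair.\<close>

lemma can_Hom:
  assumes A: "A \<in> Ob E" and Ds: "set Ds \<subseteq> Ob E"
  shows "can E A Ds \<in> Hom E (Prod E [A, Prod E Ds]) (Prod E (A # Ds))"
    and "el w A x \<Longrightarrow> list_all2 (el w) Ds ds \<Longrightarrow> vl w (can E A Ds) (Tuple [x, mk_tuple ds]) (mk_tuple (x # ds))"
proof -
  let ?P = "Prod E Ds"
  let ?Q = "Prod E [A, ?P]"
  note P = Prod_Ob[OF Ds]
  note Q = el_Pair(1)[OF A P]
  have O: "set [A, ?P] \<subseteq> Ob E" using A P by simp
  let ?p0 = "Proj E [A, ?P] 0" and ?p1 = "Proj E [A, ?P] 1"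
  have p0: "?p0 \<in> Hom E ?Q A" and p1: "?p1 \<in> Hom E ?Q ?P"
    using Proj_Hom(1)[OF O, of 0] Proj_Hom(1)[OF O, of 1] by simp_all
  have q: "Comp E (Proj E Ds i) ?p1 \<in> Hom E ?Q (Ds ! i)" if "i < length Ds" for i
    using Comp_Hom(1)[OF p1 Proj_Hom(1)[OF Ds that]] .
  let ?fs = "?p0 # map (\<lambda>i. Comp E (Proj E Ds i) ?p1) [0..<length Ds]"
  have fs: "f \<in> Hom E ?Q (Cod E f)" if "f \<in> set ?fs" for f
    using that p0 q by (auto simp: Hom_E)
  have cod: "map (Cod E) ?fs = A # Ds"
    using p0 q by (auto simp: Hom_E intro!: nth_equalityI)
  have *: "can E A Ds = tuple E ?Q ?fs" by (simp add: can_def)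
  show "can E A Ds \<in> Hom E ?Q (Prod E (A # Ds))"
    unfolding * cod[symmetric] by (rule tuple_Hom(1)[OF Q fs])
  show "vl w (can E A Ds) (Tuple [x, mk_tuple ds]) (mk_tuple (x # ds))"
    if x: "el w A x" and ds: "list_all2 (el w) Ds ds"
    unfolding *
  proof (rule tuple_Hom(2)[OF Q fs])
    let ?d = "mk_tuple ds"
    have w: "wd w" using force_wd[OF x] .
    note d = el_Prod_tuple[OF Ds w ds]
    have l: "length ds = length Ds" using ds by (simp add: list_all2_lengthD)
    show e: "el w ?Q (Tuple [x, ?d])" using el_Pair(3)[OF A P x d(1)] .
    have tt: "tm w (Tuple [x, ?d]) (TProd [ety A, ety ?P])" using el_tm[OF Q e] el_Pair(2)[OF A P] by simp
    have r: "w \<Turnstile> Tuple [x, ?d] \<doteq> Tuple [x, ?d]" using force_refl[OF tt] .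
    have e01: "w \<Turnstile> Prj [ety A, ety ?P] 0 (Tuple [x, ?d]) \<doteq> x" "w \<Turnstile> Prj [ety A, ety ?P] 1 (Tuple [x, ?d]) \<doteq> ?d"
      using force_pair_inj[OF force_sym[OF force_pair_eta[OF tt]]] by auto
    have v0: "vl w ?p0 (Tuple [x, ?d]) x"
      using vl_cong[OF p0 r e01(1)] Proj_Hom(2)[OF O _ e, of 0] by (simp add: mk_prj_def)
    have v1: "vl w ?p1 (Tuple [x, ?d]) ?d"
      using vl_cong[OF p1 r e01(2)] Proj_Hom(2)[OF O _ e, of 1] by (simp add: mk_prj_def)
    have "vl w (Comp E (Proj E Ds i) ?p1) (Tuple [x, ?d]) (ds ! i)" if i: "i < length Ds" for i
      using vl_cong[OF q[OF i] r d(2)[OF i]]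
        Comp_Hom(2)[OF p1 Proj_Hom(1)[OF Ds i] v1 Proj_Hom(2)[OF Ds i d(1)]] by blast
    then show "list_all2 (\<lambda>f t. vl w f (Tuple [x, ?d]) t) ?fs (x # ds)"
      using v0 l by (simp only: list_all2_Cons) (simp add: list_all2_conv_all_nth)
  qed
qed

text \<open>\<open>interp\<close> reads objects off the codomains of interpreted subterms, as for
  equality and membership. The induction shows that these are the objects denoted by the
  types.\<close>

lemma interp_Hom:
  assumes "has_type LE Bs t T" and "fv t \<subseteq> set xs"
    and "\<forall>B\<in>set Bs. is_ty (ground LE) B" and xs: "\<forall>x\<in>set xs. is_ty (ground LE) (snd x)"
  shows "interp E xs t Bs \<in> Hom E (Prod E (ctx E xs Bs)) (ob T)"
  using assms(1-3)
proof (induction t arbitrary: Bs T)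
  case (Bound i)
  note C = ctx_Ob[OF Bound.prems(3) xs]
  have "i < length (ctx E xs Bs)" "ctx E xs Bs ! i = ob T" using Bound.prems(1) by (auto simp: ctx_def nth_append)
  then show ?case using Proj_Hom(1)[OF C, of i] by simp
next
  case (Var x)
  note C = ctx_Ob[OF Var.prems(3) xs]
  let ?k = "length Bs + length (takeWhile (\<lambda>y. y \<noteq> x) xs)"
  have "?k < length (ctx E xs Bs)" "ctx E xs Bs ! ?k = ob T"
    using Var.prems(1,2) nth_takeWhile_neq[of x xs] by (auto simp: ctx_def nth_append)
  then show ?case using Proj_Hom(1)[OF C, of ?k] by simp
next
  case Star
  note C = ctx_Ob[OF Star.prems(3) xs]
  show ?case using tuple_Hom(1)[OF Prod_Ob[OF C], of "[]"] Star.prems(1) by simp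
next
  case (App h t)
  then obtain A where h: "h \<in> funs LE" "sig LE h = (A, T)" "has_type LE Bs t A" by auto
  then have "fst h \<in> Hom E (ob A) (ob T)" unfolding funs_LE sig_LE by simp
  then show ?case using Comp_Hom(1)[OF App.IH[OF h(3)]] App.prems by simp
next
  case (Tuple ts)
  note C = ctx_Ob[OF Tuple.prems(3) xs]
  obtain As where As: "T = TProd As" "list_all2 (has_type LE Bs) ts As" using Tuple.prems(1) by auto
  have l: "length As = length ts" using As(2) by (simp add: list_all2_lengthD)
  have i: "interp E xs (ts ! i) Bs \<in> Hom E (Prod E (ctx E xs Bs)) (ob (As ! i))" if "i < length ts" for i
  proof (rule Tuple.IH)
    show "ts ! i \<in> set ts" using that by simp
    then show "fv (ts ! i) \<subseteq> set xs" using Tuple.prems(2) by auto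
  qed (use list_all2_nthD[OF As(2) that] Tuple.prems(3) in auto)
  let ?fs = "map (\<lambda>t. interp E xs t Bs) ts"
  have "map (Cod E) ?fs = map ob As" using i l by (intro nth_equalityI) (auto simp: Hom_E)
  moreover have "f \<in> Hom E (Prod E (ctx E xs Bs)) (Cod E f)" if "f \<in> set ?fs" for f
    using that i by (auto simp: in_set_conv_nth Hom_E)
  ultimately show ?case using tuple_Hom(1)[OF Prod_Ob[OF C], of ?fs] As(1) by simp
next
  case (Prj As i t)
  then have t: "has_type LE Bs t (TProd As)" and i: "i < length As" "T = As ! i" by auto
  have "is_ty (ground LE) (TProd As)" using has_type_is_ty[OF local_language_LE t Prj.prems(3)] .
  then have O: "set (map ob As) \<subseteq> Ob E" using ob_Ob by auto
  have "interp E xs t Bs \<in> Hom E (Prod E (ctx E xs Bs)) (ob (TProd As))"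
    by (rule Prj.IH) (use t Prj.prems in auto)
  then show ?case using Comp_Hom(1)[OF _ Proj_Hom(1)[OF O, of i]] i by simp
next
  case (Compr A a)
  note C = ctx_Ob[OF Compr.prems(3) xs]
  have A: "is_ty (ground LE) A" and a: "has_type LE (A # Bs) a TOmega" and T: "T = TPow A"
    using Compr.prems(1) by auto
  have "interp E xs a (A # Bs) \<in> Hom E (Prod E (ctx E xs (A # Bs))) (ob TOmega)"
    by (rule Compr.IH[OF a]) (use Compr.prems A in auto)
  then have "Comp E (interp E xs a (A # Bs)) (can E (ob A) (ctx E xs Bs))
      \<in> Hom E (Prod E [ob A, Prod E (ctx E xs Bs)]) (Omega E)"
    using Comp_Hom(1)[OF can_Hom(1)[OF ob_Ob[OF A] C]] by (simp add: ctx_def)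
  then show ?case using transpose_Hom(1)[OF ob_Ob[OF A] Prod_Ob[OF C]] T by simp
next
  case (Eq s t)
  then obtain A where A: "has_type LE Bs s A" "has_type LE Bs t A" and T: "T = TOmega" by auto
  have i: "interp E xs s Bs \<in> Hom E (Prod E (ctx E xs Bs)) (ob A)" "interp E xs t Bs \<in> Hom E (Prod E (ctx E xs Bs)) (ob A)"
    using Eq.IH(1)[OF A(1)] Eq.IH(2)[OF A(2)] Eq.prems by auto
  have "Cod E (interp E xs s Bs) = ob A" using i(1) by (simp add: Hom_E)
  then show ?case
    using Comp_Hom(1)[OF Pair_Hom(1)[OF i] diag_Hom(1)[OF Hom_sfn(3)[OF i(1)]]] T by simp
next
  case (Mem s t)
  then obtain A where A: "has_type LE Bs s A" "has_type LE Bs t (TPow A)" and T: "T = TOmega" by auto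
  have i: "interp E xs s Bs \<in> Hom E (Prod E (ctx E xs Bs)) (ob A)"
    "interp E xs t Bs \<in> Hom E (Prod E (ctx E xs Bs)) (PowOb E (ob A))"
    using Mem.IH(1)[OF A(1)] Mem.IH(2)[OF A(2)] Mem.prems by auto
  have "Cod E (interp E xs s Bs) = ob A" using i(1) by (simp add: Hom_E)
  then show ?case
    using Comp_Hom(1)[OF Pair_Hom(1)[OF i] Ev_Hom(1)[OF Hom_sfn(3)[OF i(1)]]] T by simp
qed

section \<open>The evaluation relation\<close>

text \<open>Terms whose only possible type is \<open>TOmega\<close>. Connectives and quantifiers are
  among them, as all are defined by equations.\<close>

definition is_atom :: "('o, 'h) trm \<Rightarrow> bool" where
  "is_atom t \<longleftrightarrow> (\<exists>r s. t = (r \<doteq> s) \<or> t = (r \<in>\<^sub>t s))"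

text \<open>
  \<open>sem \<rho> w \<delta> t b\<close>: at \<open>w\<close>, the term \<open>t\<close> has the value \<open>b\<close> if the free variables and the dangling
  indices have the values \<open>\<rho>\<close> and \<open>\<delta>\<close>. In a set term the bound variable ranges over the object
  denoted by its type. The rule \<open>sLocal\<close> is needed because values of an arbitrary arrow \<open>f\<close>
  exist only locally; it is restricted to terms whose type must be \<open>TOmega\<close>, so that the type of
  \<open>b\<close> is known even if there is no world with a value.
\<close>

inductive sem :: "(('g, 'f) sobj var \<Rightarrow> ('g, 'f) trm) \<Rightarrow> ('g, 'f) world \<Rightarrow> ('g, 'f) trm list \<Rightarrow>
    (('g, 'f) sobj, (('g, 'f) sobj, ('g, 'f) sarr) fsym) trm \<Rightarrow> ('g, 'f) trm \<Rightarrow> bool"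
  for \<rho> where
  sBound: "i < length \<delta> \<Longrightarrow> wd w \<Longrightarrow> sem \<rho> w \<delta> (Bound i) (\<delta> ! i)"
| sVar: "wd w \<Longrightarrow> sem \<rho> w \<delta> (Var x) (\<rho> x)"
| sStar: "wd w \<Longrightarrow> sem \<rho> w \<delta> Star Star"
| sApp: "sem \<rho> w \<delta> t b \<Longrightarrow> vl w (fst h) b c \<Longrightarrow> sem \<rho> w \<delta> (App h t) c"
| sTuple: "list_all2 (sem \<rho> w \<delta>) ts bs \<Longrightarrow> wd w \<Longrightarrow> sem \<rho> w \<delta> (Tuple ts) (Tuple bs)"
| sPrj: "sem \<rho> w \<delta> t b \<Longrightarrow> sem \<rho> w \<delta> (Prj As i t) (Prj (map (\<lambda>A. ety (ob A)) As) i b)"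
| sCompr: "has_type L [ety (ob A)] \<alpha> TOmega \<Longrightarrow> fv \<alpha> \<subseteq> vars w \<Longrightarrow> wd w \<Longrightarrow>
    (\<And>w' x. w \<sqsubseteq> w' \<Longrightarrow> el w' (ob A) x \<Longrightarrow> sem \<rho> w' (x # \<delta>) a (inst x \<alpha>)) \<Longrightarrow>
    sem \<rho> w \<delta> (Compr A a) (Compr (ety (ob A)) (Bound 0 \<in>\<^sub>t rep (ob A) \<and>\<^sub>t \<alpha>))"
| sEq: "sem \<rho> w \<delta> s a \<Longrightarrow> sem \<rho> w \<delta> t b \<Longrightarrow> sem \<rho> w \<delta> (s \<doteq> t) (a \<doteq> b)"
| sMem: "sem \<rho> w \<delta> s a \<Longrightarrow> sem \<rho> w \<delta> t b \<Longrightarrow> sem \<rho> w \<delta> (s \<in>\<^sub>t t) (a \<in>\<^sub>t b)"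
| sEqual: "sem \<rho> w \<delta> t b \<Longrightarrow> w \<Turnstile> b \<doteq> b' \<Longrightarrow> sem \<rho> w \<delta> t b'"
| sLocal: "is_atom t \<Longrightarrow> f \<in> Hom E D Z \<Longrightarrow> el w D s \<Longrightarrow> tm w b TOmega \<Longrightarrow>
    (\<And>w' r. w \<sqsubseteq> w' \<Longrightarrow> vl w' f s r \<Longrightarrow> sem \<rho> w' \<delta> t b) \<Longrightarrow> sem \<rho> w \<delta> t b"

lemma ctx_el:
  assumes "list_all2 (\<lambda>B s. el w (ob B) s) Bs \<delta>" and "\<forall>x\<in>set xs. el w (ob (snd x)) (\<rho> x)"
  shows "list_all2 (el w) (ctx E xs Bs) (\<delta> @ map \<rho> xs)"
  using assms
  by (auto simp: ctx_def list_all2_map1 list_all2_map2 list_all2_append list_all2_lengthD list_all2_same)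

text \<open>Each rule of \<open>sem\<close> that builds a term mirrors the rule for values of the
  arrow interpreting that term. The two others are sound because values respect equality at a world,
  and because a pair lies in a graph as soon as it does so at all later worlds where
  \<open>f\<close> has a value.\<close>

lemma sem_adequate:
  assumes "sem \<rho> w \<delta> t b" and "has_type LE Bs t T" and "fv t \<subseteq> set xs"
    and "\<forall>B\<in>set Bs. is_ty (ground LE) B" and xs: "\<forall>x\<in>set xs. is_ty (ground LE) (snd x)"
    and "list_all2 (\<lambda>B s. el w (ob B) s) Bs \<delta>" and "\<forall>x\<in>set xs. el w (ob (snd x)) (\<rho> x)"
  shows "vl w (interp E xs t Bs) (mk_tuple (\<delta> @ map \<rho> xs)) b"
  using assms(1-4,6,7)
proof (induction arbitrary: Bs T)
  case (sBound i \<delta> w)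
  note C = ctx_Ob[OF sBound.prems(3) xs]
  let ?d = "mk_tuple (\<delta> @ map \<rho> xs)"
  note d = el_Prod_tuple[OF C sBound.hyps(2) ctx_el[OF sBound.prems(4,5)]]
  have i: "i < length (ctx E xs Bs)" using sBound.prems(1) by (simp add: ctx_def)
  have "(\<delta> @ map \<rho> xs) ! i = \<delta> ! i" using sBound.hyps by (simp add: nth_append)
  then show ?case
    using vl_cong[OF Proj_Hom(1)[OF C i] force_refl[OF el_tm[OF Prod_Ob[OF C] d(1)]] d(2)[OF i]
        Proj_Hom(2)[OF C i d(1)]] by simp
next
  case (sVar w \<delta> x)
  note C = ctx_Ob[OF sVar.prems(3) xs]
  let ?d = "mk_tuple (\<delta> @ map \<rho> xs)"
  have l: "length \<delta> = length Bs" using sVar.prems(4) by (simp add: list_all2_lengthD)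
  note d = el_Prod_tuple[OF C sVar.hyps(1) ctx_el[OF sVar.prems(4,5)]]
  let ?k = "length Bs + length (takeWhile (\<lambda>y. y \<noteq> x) xs)"
  have x: "x \<in> set xs" using sVar.prems(2) by simp
  have i: "?k < length (ctx E xs Bs)" using nth_takeWhile_neq[OF x] by (simp add: ctx_def)
  have "(\<delta> @ map \<rho> xs) ! ?k = \<rho> x" using nth_takeWhile_neq[OF x] l by (simp add: nth_append)
  then show ?case
    using vl_cong[OF Proj_Hom(1)[OF C i] force_refl[OF el_tm[OF Prod_Ob[OF C] d(1)]] d(2)[OF i]
        Proj_Hom(2)[OF C i d(1)]] by simp
next
  case (sStar w \<delta>)
  note C = ctx_Ob[OF sStar.prems(3) xs]
  note d = el_Prod_tuple[OF C sStar.hyps(1) ctx_el[OF sStar.prems(4,5)]]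
  show ?case using tuple_Hom(2)[OF Prod_Ob[OF C] _ d(1), of "[]" "[]"] by simp
next
  case (sApp w \<delta> t b h c)
  obtain A where h: "h \<in> funs LE" "sig LE h = (A, T)" "has_type LE Bs t A" using sApp.prems(1) by auto
  then have g: "fst h \<in> Hom E (ob A) (ob T)" unfolding funs_LE sig_LE by simp
  have ft: "fv t \<subseteq> set xs" using sApp.prems(2) by simp
  show ?case
    using Comp_Hom(2)[OF interp_Hom[OF h(3) ft sApp.prems(3) xs] g
        sApp.IH[OF h(3) ft sApp.prems(3-5)] sApp.hyps(2)] by simp
next
  case (sTuple w \<delta> ts bs)
  note C = ctx_Ob[OF sTuple.prems(3) xs]
  note d = el_Prod_tuple[OF C sTuple.hyps(1) ctx_el[OF sTuple.prems(4,5)]]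
  obtain As where As: "T = TProd As" "list_all2 (has_type LE Bs) ts As" "2 \<le> length ts"
    using sTuple.prems(1) by auto
  have l: "length As = length ts" "length bs = length ts"
    using list_all2_lengthD[OF As(2)] list_all2_lengthD[OF sTuple.IH] by simp_all
  have v: "vl w (interp E xs (ts ! i) Bs) (mk_tuple (\<delta> @ map \<rho> xs)) (bs ! i)"
    and i: "interp E xs (ts ! i) Bs \<in> Hom E (Prod E (ctx E xs Bs)) (ob (As ! i))" if "i < length ts" for i
  proof -
    have f: "fv (ts ! i) \<subseteq> set xs" using that sTuple.prems(2) by (auto dest: nth_mem)
    note ti = list_all2_nthD[OF As(2) that]
    show "vl w (interp E xs (ts ! i) Bs) (mk_tuple (\<delta> @ map \<rho> xs)) (bs ! i)"
      using list_all2_nthD[OF sTuple.IH that] ti f sTuple.prems(3-5) by blast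
    show "interp E xs (ts ! i) Bs \<in> Hom E (Prod E (ctx E xs Bs)) (ob (As ! i))"
      by (rule interp_Hom[OF ti f sTuple.prems(3) xs])
  qed
  let ?fs = "map (\<lambda>t. interp E xs t Bs) ts"
  have f: "f \<in> Hom E (Prod E (ctx E xs Bs)) (Cod E f)" if "f \<in> set ?fs" for f
    using that i by (auto simp: in_set_conv_nth Hom_E)
  have "list_all2 (\<lambda>f t. vl w f (mk_tuple (\<delta> @ map \<rho> xs)) t) ?fs bs"
    using v l by (simp add: list_all2_conv_all_nth)
  from tuple_Hom(2)[OF Prod_Ob[OF C] f d(1) this]
  show ?case using l As(3) by (simp add: mk_tuple_long)
next
  case (sPrj w \<delta> t b As i)
  have t: "has_type LE Bs t (TProd As)" and i: "i < length As" "T = As ! i" using sPrj.prems(1) by auto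
  have ty: "is_ty (ground LE) (TProd As)" using has_type_is_ty[OF local_language_LE t sPrj.prems(3)] .
  then have O: "set (map ob As) \<subseteq> Ob E" using ob_Ob by auto
  have ft: "fv t \<subseteq> set xs" using sPrj.prems(2) by simp
  have it: "interp E xs t Bs \<in> Hom E (Prod E (ctx E xs Bs)) (Prod E (map ob As))"
    using interp_Hom[OF t ft sPrj.prems(3) xs] by simp
  have v: "vl w (interp E xs t Bs) (mk_tuple (\<delta> @ map \<rho> xs)) b" using sPrj.IH[OF t ft sPrj.prems(3-5)] .
  have "mk_prj (map ety (map ob As)) i b = Prj (map (\<lambda>A. ety (ob A)) As) i b"
    using ty by (simp add: mk_prj_def o_def)
  then show ?case
    using Comp_Hom(2)[OF it Proj_Hom(1)[OF O, of i] v Proj_Hom(2)[OF O _ vl_cod[OF it v], of i]] i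
    by (simp only: interp.simps length_map)
next
  case (sCompr A \<alpha> w \<delta> a)
  note C = ctx_Ob[OF sCompr.prems(3) xs]
  have A: "is_ty (ground LE) A" and a: "has_type LE (A # Bs) a TOmega" using sCompr.prems(1) by auto
  have cs: "list_all2 (el w') (ctx E xs Bs) (\<delta> @ map \<rho> xs)" if w': "w \<sqsubseteq> w'" for w'
    by (rule list_all2_mono[OF ctx_el[OF sCompr.prems(4,5)]]) (rule force_mono[OF _ w'])
  have fa: "fv a \<subseteq> set xs" using sCompr.prems(2) by simp
  have AB: "\<forall>B\<in>set (A # Bs). is_ty (ground LE) B" using A sCompr.prems(3) by simp
  have ia: "interp E xs a (A # Bs) \<in> Hom E (Prod E (ob A # ctx E xs Bs)) (Omega E)"
    using interp_Hom[OF a fa AB xs] by (simp add: ctx_def)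
  note can = can_Hom[OF ob_Ob[OF A] C]
  note k = Comp_Hom[OF can(1) ia]
  have "vl w (transpose E (ob A) (Prod E (ctx E xs Bs)) (Comp E (interp E xs a (A # Bs)) (can E (ob A) (ctx E xs Bs))))
    (mk_tuple (\<delta> @ map \<rho> xs)) (Compr (ety (ob A)) (Bound 0 \<in>\<^sub>t rep (ob A) \<and>\<^sub>t \<alpha>))"
  proof (rule transpose_Hom(2)[OF ob_Ob[OF A] Prod_Ob[OF C] k(1) _ sCompr.hyps(1,2)])
    show "el w (Prod E (ctx E xs Bs)) (mk_tuple (\<delta> @ map \<rho> xs))"
      using el_Prod_tuple(1)[OF C sCompr.hyps(3) cs] sCompr.hyps(3) by simp
    fix w' x
    assume w': "w \<sqsubseteq> w'" and x: "el w' (ob A) x"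
    have 1: "list_all2 (\<lambda>B s. el w' (ob B) s) (A # Bs) (x # \<delta>)"
      using x list_all2_mono[OF sCompr.prems(4)] force_mono[OF _ w'] by auto
    have 2: "\<forall>x\<in>set xs. el w' (ob (snd x)) (\<rho> x)" using sCompr.prems(5) force_mono[OF _ w'] by blast
    have "vl w' (interp E xs a (A # Bs)) (mk_tuple (x # \<delta> @ map \<rho> xs)) (inst x \<alpha>)"
      using sCompr.IH[OF w' x a fa AB 1 2] by simp
    then show "vl w' (Comp E (interp E xs a (A # Bs)) (can E (ob A) (ctx E xs Bs)))
        (Tuple [x, mk_tuple (\<delta> @ map \<rho> xs)]) (inst x \<alpha>)"
      by (rule k(2)[OF can(2)[OF x cs[OF w']]])
  qed
  then show ?case by simp
next
  case (sEq w \<delta> s a t b)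
  obtain A where A: "has_type LE Bs s A" "has_type LE Bs t A" using sEq.prems(1) by auto
  have f: "fv s \<subseteq> set xs" "fv t \<subseteq> set xs" using sEq.prems(2) by auto
  note i = interp_Hom[OF A(1) f(1) sEq.prems(3) xs] interp_Hom[OF A(2) f(2) sEq.prems(3) xs]
  note v = sEq.IH(1)[OF A(1) f(1) sEq.prems(3-5)] sEq.IH(2)[OF A(2) f(2) sEq.prems(3-5)]
  note O = Hom_sfn(3)[OF i(1)]
  have "Cod E (interp E xs s Bs) = ob A" using i(1) by (simp add: Hom_E)
  then show ?case
    using Comp_Hom(2)[OF Pair_Hom(1)[OF i] diag_Hom(1)[OF O] Pair_Hom(2)[OF i v]
        diag_Hom(2)[OF O vl_cod[OF i(1) v(1)] vl_cod[OF i(2) v(2)]]] by simp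
next
  case (sMem w \<delta> s a t b)
  obtain A where A: "has_type LE Bs s A" "has_type LE Bs t (TPow A)" using sMem.prems(1) by auto
  have f: "fv s \<subseteq> set xs" "fv t \<subseteq> set xs" using sMem.prems(2) by auto
  note i = interp_Hom[OF A(1) f(1) sMem.prems(3) xs] interp_Hom[OF A(2) f(2) sMem.prems(3) xs, simplified]
  note v = sMem.IH(1)[OF A(1) f(1) sMem.prems(3-5)] sMem.IH(2)[OF A(2) f(2) sMem.prems(3-5)]
  note O = Hom_sfn(3)[OF i(1)]
  have "Cod E (interp E xs s Bs) = ob A" using i(1) by (simp add: Hom_E)
  then show ?case
    using Comp_Hom(2)[OF Pair_Hom(1)[OF i] Ev_Hom(1)[OF O] Pair_Hom(2)[OF i v]
        Ev_Hom(2)[OF O vl_cod[OF i(1) v(1)] vl_cod[OF i(2) v(2)]]] by simp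
next
  case (sEqual w \<delta> t b b')
  note i = interp_Hom[OF sEqual.prems(1-3) xs]
  note v = sEqual.IH[OF sEqual.prems]
  show ?case using vl_cong[OF i force_refl sEqual.hyps(2) v] vl_tm[OF i v] by blast
next
  case (sLocal t f D Z w s b \<delta>)
  have T: "T = TOmega" using sLocal.hyps(1) sLocal.prems(1) by (auto simp: is_atom_def)
  note i = interp_Hom[OF sLocal.prems(1-3) xs]
  note C = ctx_Ob[OF sLocal.prems(3) xs]
  have w: "wd w" using force_wd[OF sLocal.hyps(3)] .
  note d = el_Prod_tuple[OF C w ctx_el[OF sLocal.prems(4,5)]]
  show ?case
  proof (rule vl_total[OF sLocal.hyps(2,3) vl_formula[OF i el_tm[OF Prod_Ob[OF C] d(1)]]])
    show "tm w b (ety (ob T))" using sLocal.hyps(4) T by (simp add: ety_Omega)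
    fix w' r
    assume w': "w \<sqsubseteq> w'" and r: "vl w' f s r"
    have 1: "list_all2 (\<lambda>B s. el w' (ob B) s) Bs \<delta>"
      using list_all2_mono[OF sLocal.prems(4)] force_mono[OF _ w'] by auto
    have 2: "\<forall>x\<in>set xs. el w' (ob (snd x)) (\<rho> x)" using sLocal.prems(5) force_mono[OF _ w'] by blast
    show "vl w' (interp E xs t Bs) (mk_tuple (\<delta> @ map \<rho> xs)) b"
      by (rule sLocal.IH[OF w' r sLocal.prems(1-3) 1 2])
  qed
qed

lemma sem_mono: "sem \<rho> w \<delta> t b \<Longrightarrow> w \<sqsubseteq> w' \<Longrightarrow> sem \<rho> w' \<delta> t b"
proof (induction arbitrary: w' rule: sem.induct)
  case (sTuple w \<delta> ts bs)
  then show ?case using ext_wd(2) by (intro sem.sTuple) (auto elim!: list_all2_mono)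
next
  case (sCompr A \<alpha> w \<delta> a)
  show ?case
  proof (rule sem.sCompr[OF sCompr.hyps(1)])
    show "fv \<alpha> \<subseteq> vars w'" "wd w'" using sCompr.hyps(2) sCompr.prems by (auto simp: ext_def)
    show "sem \<rho> w'' (x # \<delta>) a (inst x \<alpha>)" if "w' \<sqsubseteq> w''" "el w'' (ob A) x" for w'' x
      using sCompr.IH[OF ext_trans[OF sCompr.prems that(1)] that(2)] ext_wd(2)[OF that(1)] by simp
  qed
next
  case (sLocal t f D Z w s b \<delta>)
  show ?case
    by (rule sem.sLocal[OF sLocal.hyps(1,2) force_mono[OF sLocal.hyps(3) sLocal.prems]
          tm_mono[OF sLocal.hyps(4) sLocal.prems]])
      (use sLocal.IH[OF ext_trans[OF sLocal.prems]] ext_refl ext_wd(2) in blast)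
qed (auto intro: sem.intros force_mono dest: ext_wd(2))

lemma sem_weaken: "sem \<rho> w \<delta> t b \<Longrightarrow> sem \<rho> w (\<delta> @ \<delta>') t b"
proof (induction rule: sem.induct)
  case (sBound i \<delta> w)
  then show ?case using sem.sBound[of i "\<delta> @ \<delta>'" w \<rho>] by (simp add: nth_append)
next
  case (sTuple w \<delta> ts bs)
  then show ?case by (intro sem.sTuple) (auto elim!: list_all2_mono)
next
  case (sCompr A \<alpha> w \<delta> a)
  then show ?case by (intro sem.sCompr) auto
qed (auto intro: sem.intros)

text \<open>At depth \<open>length \<delta>\<close> the abstracted variable becomes the next index,
  so its value moves to the end of \<open>\<delta>\<close>.\<close>

lemma sem_bind: "sem (\<rho>(u := s)) w \<delta> t b \<Longrightarrow> sem \<rho> w (\<delta> @ [s]) (bind u t (length \<delta>)) b"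
proof (induction rule: sem.induct)
  case (sBound i \<delta> w)
  then show ?case using sem.sBound[of i "\<delta> @ [s]" w \<rho>] by (simp add: nth_append)
next
  case (sVar w \<delta> x)
  then show ?case using sem.sBound[of "length \<delta>" "\<delta> @ [s]" w \<rho>] by (auto intro: sem.sVar)
next
  case (sTuple w \<delta> ts bs)
  then show ?case by (auto intro!: sem.sTuple simp: list_all2_map1 elim!: list_all2_mono)
next
  case (sCompr A \<alpha> w \<delta> a)
  then show ?case by (auto intro!: sem.sCompr)
next
  case (sLocal t f D Z w s b \<delta>)
  have "is_atom (bind u t (length \<delta>))" using sLocal.hyps(1) by (auto simp: is_atom_def)
  then show ?case using sem.sLocal sLocal by blast
qed (auto intro: sem.intros)

end

lemma fv_eta: "fv (eta L S t) = eta_var L S ` fv t"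
  by (induction t) auto

context set_theory
begin

section \<open>Values of connectives and of existence\<close>

lemma sem_Tru: "wd w \<Longrightarrow> sem \<rho> w \<delta> Tru Tru"
  unfolding Tru_def by (intro sEq sStar)

lemma sem_And: "sem \<rho> w \<delta> \<alpha> a \<Longrightarrow> sem \<rho> w \<delta> \<beta> b \<Longrightarrow> wd w \<Longrightarrow> sem \<rho> w \<delta> (\<alpha> \<and>\<^sub>t \<beta>) (a \<and>\<^sub>t b)"
  unfolding And_def by (intro sEq sTuple) (simp_all add: sem_Tru)

lemma sem_Imp: "sem \<rho> w \<delta> \<alpha> a \<Longrightarrow> sem \<rho> w \<delta> \<beta> b \<Longrightarrow> wd w \<Longrightarrow> sem \<rho> w \<delta> (\<alpha> \<longrightarrow>\<^sub>t \<beta>) (a \<longrightarrow>\<^sub>t b)"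
  unfolding Imp_def by (intro sEq sem_And)

text \<open>Evaluated literally, the second-order definition of existence gives an equation of sets
  of truth values, with the bound variable confined to \<open>Z\<close>. The lemma replaces it by
  any formula \<open>\<psi>\<close> equivalent to having an instance. Premise \<open>2\<close> asks
  for an instance at the same world; in the uses below a projection provides it.\<close>

lemma sem_ex:
  fixes u :: "('g, 'f) sobj var"
  defines "Z \<equiv> ob (snd u)"
  assumes Z: "Z \<in> Ob E" and w: "wd w"
    and \<alpha>: "has_type L [ety Z] \<alpha> TOmega" "fv \<alpha> \<subseteq> vars w"
    and s: "\<And>w' a. w \<sqsubseteq> w' \<Longrightarrow> el w' Z a \<Longrightarrow> sem (\<rho>(u := a)) w' [] \<phi> (inst a \<alpha>)"
    and \<psi>: "tm w \<psi> TOmega"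
    and 1: "\<And>w' a. w \<sqsubseteq> w' \<Longrightarrow> el w' Z a \<Longrightarrow> w' \<Turnstile> inst a \<alpha> \<Longrightarrow> w' \<Turnstile> \<psi>"
    and 2: "\<And>w'. w \<sqsubseteq> w' \<Longrightarrow> w' \<Turnstile> \<psi> \<Longrightarrow> \<exists>a. el w' Z a \<and> w' \<Turnstile> inst a \<alpha>"
  shows "sem \<rho> w [] (ex u \<phi>) \<psi>"
proof -
  let ?A = "ety Z" and ?R = "rep Z" and ?RO = "rep (Omega E)" and ?a = "bind u \<phi> 0"
  have A: "is_ty (ground L) ?A" using Ob_is_ty[OF Z] .
  have tR: "has_type L Bs ?R (TPow ?A)" "has_type L Bs ?RO (TPow TOmega)"
    and fR: "fv ?R = {}" "fv ?RO = {}" for Bs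
    using Ob_rep[OF Z] Ob_rep[OF Omega_Ob] by (simp_all add: closed_term_def has_type_weaken0 ety_Omega)
  have lR: "lc 0 ?R" "lc 0 ?RO" using closed_lc Ob_rep[OF Z] Ob_rep[OF Omega_Ob] by blast+
  have \<alpha>1: "msub Var [\<omega>] (Suc 0) \<alpha> = \<alpha>" for \<omega>
    using has_type_lc[OF \<alpha>(1)] msub_lc[of 1 \<alpha> "Suc 0" Var] by simp
  have \<alpha>2: "has_type L [?A, TOmega] \<alpha> TOmega" using has_type_weaken[OF \<alpha>(1), of "[TOmega]"] by simp
  let ?c = "\<lambda>\<omega>. Compr ?A (Bound 0 \<in>\<^sub>t ?R \<and>\<^sub>t (\<alpha> \<longrightarrow>\<^sub>t \<omega>))"
  let ?d = "Compr ?A (Bound 0 \<in>\<^sub>t ?R \<and>\<^sub>t Tru)"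
  \<comment> \<open>The value of the body of the outer quantifier, with the truth value as index 0.
    Inside \<open>?c\<close> it lies below one more binder and has index 1.\<close>
  define \<zeta> where "\<zeta> = (?c (Bound 1) \<doteq> ?d \<longrightarrow>\<^sub>t Bound 0)"
  have i\<zeta>: "inst \<omega> \<zeta> = (?c \<omega> \<doteq> ?d \<longrightarrow>\<^sub>t \<omega>)" for \<omega>
    using lR by (simp add: \<zeta>_def \<alpha>1)
  have t\<zeta>: "has_type L [TOmega] \<zeta> TOmega" "fv \<zeta> \<subseteq> vars w"
    using A \<alpha> \<alpha>2 tR fR by (auto simp: \<zeta>_def)
  let ?P = "Compr TOmega (Bound 0 \<in>\<^sub>t ?RO \<and>\<^sub>t \<zeta>)" and ?Q = "Compr TOmega (Bound 0 \<in>\<^sub>t ?RO \<and>\<^sub>t Tru)"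
  have semO: "sem \<rho> w' [\<omega>] (All (snd u) (?a \<longrightarrow>\<^sub>t Bound 1) \<longrightarrow>\<^sub>t Bound 0) (inst \<omega> \<zeta>)"
    if w': "w \<sqsubseteq> w'" and \<omega>: "tm w' \<omega> TOmega" for w' \<omega>
    unfolding i\<zeta> All_def
  proof (intro sem_Imp sEq)
    have wd: "wd w'" using ext_wd(2)[OF w'] .
    have t\<omega>: "has_type L Bs \<omega> TOmega" for Bs using \<omega> by (simp add: tm_def has_type_weaken0)
    show "sem \<rho> w' [\<omega>] (Compr (snd u) (?a \<longrightarrow>\<^sub>t Bound 1)) (?c \<omega>)"
    proof (rule sCompr[where A = "snd u", folded Z_def])
      show "has_type L [?A] (\<alpha> \<longrightarrow>\<^sub>t \<omega>) TOmega" using \<alpha> t\<omega> by simp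
      show "fv (\<alpha> \<longrightarrow>\<^sub>t \<omega>) \<subseteq> vars w'" using \<alpha> \<omega> w' by (auto simp: tm_def ext_def)
      fix w'' x
      assume w'': "w' \<sqsubseteq> w''" and x: "el w'' Z x"
      have "sem \<rho> w'' ([x] @ [\<omega>]) ?a (inst x \<alpha>)"
        using sem_weaken[OF sem_bind[OF s[OF ext_trans[OF w' w''] x]], of "[\<omega>]"] by simp
      moreover have "sem \<rho> w'' [x, \<omega>] (Bound 1) \<omega>"
        using sBound[of 1 "[x, \<omega>]" w'' \<rho>] ext_wd(2)[OF w''] by simp
      ultimately show "sem \<rho> w'' [x, \<omega>] (?a \<longrightarrow>\<^sub>t Bound 1) (inst x (\<alpha> \<longrightarrow>\<^sub>t \<omega>))"
        using sem_Imp ext_wd(2)[OF w''] tm_lc[OF \<omega>] by simp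
    qed (rule wd)
    show "sem \<rho> w' [\<omega>] (Compr (snd u) Tru) ?d"
      by (rule sCompr[where A = "snd u", folded Z_def]) (use wd sem_Tru ext_wd in auto)
    show "sem \<rho> w' [\<omega>] (Bound 0) \<omega>" using sBound[of 0 "[\<omega>]" w' \<rho>] wd by simp
  qed (rule ext_wd(2)[OF w'])
  have "sem \<rho> w [] (ex u \<phi>) (?P \<doteq> ?Q)"
    unfolding ex_def Ex_def All_def[of TOmega]
  proof (rule sEq)
    have O: "ob TOmega = Omega E" by simp
    note c = sCompr[of TOmega _ w \<rho>, unfolded O ety_Omega]
    show "sem \<rho> w [] (Compr TOmega (All (snd u) (?a \<longrightarrow>\<^sub>t Bound 1) \<longrightarrow>\<^sub>t Bound 0)) ?P"
      by (rule c[OF t\<zeta> w]) (rule semO, simp_all only: Omega_el)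
    show "sem \<rho> w [] (Compr TOmega Tru) ?Q"
      by (rule c) (use w sem_Tru ext_wd in auto)
  qed
  moreover have "w \<Turnstile> (?P \<doteq> ?Q) \<doteq> \<psi>"
  proof -
    have tPQ: "tm w' ?P (TPow TOmega)" "tm w' ?Q (TPow TOmega)" if "w \<sqsubseteq> w'" for w'
      using that t\<zeta> tR fR by (auto simp: tm_def ext_def)
    have mP: "w' \<Turnstile> \<omega> \<in>\<^sub>t ?P \<longleftrightarrow> tm w' \<omega> TOmega \<and> w' \<Turnstile> inst \<omega> \<zeta>" if "w \<sqsubseteq> w'" for w' \<omega>
    proof -
      have "w' \<Turnstile> \<omega> \<in>\<^sub>t ?P \<longleftrightarrow> tm w' \<omega> TOmega \<and> w' \<Turnstile> inst \<omega> (Bound 0 \<in>\<^sub>t ?RO \<and>\<^sub>t \<zeta>)"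
        by (rule force_mem_Compr) (use that t\<zeta> tR fR in \<open>auto simp: ext_def\<close>)
      then show ?thesis using lR Omega_el by (auto simp: force_And)
    qed
    have mQ: "w' \<Turnstile> \<omega> \<in>\<^sub>t ?Q \<longleftrightarrow> tm w' \<omega> TOmega" for w' \<omega>
    proof -
      have "w' \<Turnstile> \<omega> \<in>\<^sub>t ?Q \<longleftrightarrow> tm w' \<omega> TOmega \<and> w' \<Turnstile> inst \<omega> (Bound 0 \<in>\<^sub>t ?RO \<and>\<^sub>t Tru)"
        by (rule force_mem_Compr) (use tR fR in auto)
      then show ?thesis using lR Omega_el force_Tru tm_wd by (auto simp: force_And)
    qed
    have cd: "w' \<Turnstile> ?c \<omega> \<doteq> ?d \<longleftrightarrow> (\<forall>w'' x. w' \<sqsubseteq> w'' \<longrightarrow> el w'' Z x \<longrightarrow> w'' \<Turnstile> inst x \<alpha> \<longrightarrow> w'' \<Turnstile> \<omega>)"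
      and tcd: "tm w' (?c \<omega> \<doteq> ?d) TOmega"
      if w': "w \<sqsubseteq> w'" and \<omega>: "tm w' \<omega> TOmega" for w' \<omega>
    proof -
      have t\<omega>: "has_type L Bs \<omega> TOmega" for Bs using \<omega> by (simp add: tm_def has_type_weaken0)
      have tc: "has_type L [?A] (Bound 0 \<in>\<^sub>t ?R \<and>\<^sub>t (\<alpha> \<longrightarrow>\<^sub>t \<omega>)) TOmega"
        "has_type L [?A] (Bound 0 \<in>\<^sub>t ?R \<and>\<^sub>t Tru) TOmega"
        using \<alpha> t\<omega> tR by auto
      have fc: "fv (Bound 0 \<in>\<^sub>t ?R \<and>\<^sub>t (\<alpha> \<longrightarrow>\<^sub>t \<omega>)) \<subseteq> vars w''" "fv (Bound 0 \<in>\<^sub>t ?R \<and>\<^sub>t Tru) \<subseteq> vars w''"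
        if "w' \<sqsubseteq> w''" for w''
        using that \<alpha> \<omega> w' fR by (auto simp: tm_def ext_def)
      have wd: "wd w'" using ext_wd(2)[OF w'] .
      have tcd': "tm w' (?c \<omega>) (TPow ?A)" "tm w' ?d (TPow ?A)"
        using tm_Compr[OF wd A tc(1)] tm_Compr[OF wd A tc(2)] fc[of w'] wd by auto
      then show "tm w' (?c \<omega> \<doteq> ?d) TOmega" by (simp only: tm_simps(1)) blast
      have mc: "w'' \<Turnstile> x \<in>\<^sub>t ?c \<omega> \<longleftrightarrow> el w'' Z x \<and> (\<forall>w3. w'' \<sqsubseteq> w3 \<longrightarrow> w3 \<Turnstile> inst x \<alpha> \<longrightarrow> w3 \<Turnstile> \<omega>)"
        if w'': "w' \<sqsubseteq> w''" for w'' x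
      proof -
        have "w'' \<Turnstile> x \<in>\<^sub>t ?c \<omega> \<longleftrightarrow> tm w'' x ?A \<and> w'' \<Turnstile> inst x (Bound 0 \<in>\<^sub>t ?R \<and>\<^sub>t (\<alpha> \<longrightarrow>\<^sub>t \<omega>))"
          by (rule force_mem_Compr[OF tc(1) fc(1)[OF w'']])
        also have "\<dots> \<longleftrightarrow> tm w'' x ?A \<and> el w'' Z x \<and> w'' \<Turnstile> (inst x \<alpha> \<longrightarrow>\<^sub>t \<omega>)"
          using lR tm_lc[OF \<omega>] by (simp add: force_And)
        also have "\<dots> \<longleftrightarrow> el w'' Z x \<and> (\<forall>w3. w'' \<sqsubseteq> w3 \<longrightarrow> w3 \<Turnstile> inst x \<alpha> \<longrightarrow> w3 \<Turnstile> \<omega>)"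
        proof -
          have "w'' \<Turnstile> (inst x \<alpha> \<longrightarrow>\<^sub>t \<omega>) \<longleftrightarrow> (\<forall>w3. w'' \<sqsubseteq> w3 \<longrightarrow> w3 \<Turnstile> inst x \<alpha> \<longrightarrow> w3 \<Turnstile> \<omega>)"
            if x: "tm w'' x ?A"
          proof (rule force_Imp)
            show "tm w'' \<omega> TOmega" using tm_mono[OF \<omega> w''] .
            have "fv \<alpha> \<subseteq> vars w''" using \<alpha>(2) w' w'' by (auto simp: ext_def)
            then show "tm w'' (inst x \<alpha>) TOmega"
              using has_type_inst[OF \<alpha>(1), of x] x fv_inst_subset[of \<alpha> "vars w''" x] by (simp add: tm_def)
          qed
          then show ?thesis using el_tm[OF Z] by blast
        qed
        finally show ?thesis .
      qed
      have md: "w'' \<Turnstile> x \<in>\<^sub>t ?d \<longleftrightarrow> el w'' Z x" if w'': "w' \<sqsubseteq> w''" for w'' x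
      proof -
        have "w'' \<Turnstile> x \<in>\<^sub>t ?d \<longleftrightarrow> tm w'' x ?A \<and> w'' \<Turnstile> inst x (Bound 0 \<in>\<^sub>t ?R \<and>\<^sub>t Tru)"
          by (rule force_mem_Compr[OF tc(2) fc(2)[OF w'']])
        then show ?thesis using lR el_tm[OF Z] force_Tru[OF force_wd] by (auto simp: force_And)
      qed
      show "w' \<Turnstile> ?c \<omega> \<doteq> ?d \<longleftrightarrow> (\<forall>w'' x. w' \<sqsubseteq> w'' \<longrightarrow> el w'' Z x \<longrightarrow> w'' \<Turnstile> inst x \<alpha> \<longrightarrow> w'' \<Turnstile> \<omega>)"
      proof (intro iffI allI impI)
        fix w'' x
        assume e: "w' \<Turnstile> ?c \<omega> \<doteq> ?d" and w'': "w' \<sqsubseteq> w''" and x: "el w'' Z x" "w'' \<Turnstile> inst x \<alpha>"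
        have "w'' \<Turnstile> x \<in>\<^sub>t ?c \<omega>"
          using force_mem_cong[OF force_refl[OF el_tm[OF Z x(1)]] force_sym[OF force_mono[OF e w'']]]
            md[OF w''] x(1) by blast
        then show "w'' \<Turnstile> \<omega>" using mc[OF w''] x(2) ext_refl ext_wd(2)[OF w''] by blast
      next
        assume h: "\<forall>w'' x. w' \<sqsubseteq> w'' \<longrightarrow> el w'' Z x \<longrightarrow> w'' \<Turnstile> inst x \<alpha> \<longrightarrow> w'' \<Turnstile> \<omega>"
        show "w' \<Turnstile> ?c \<omega> \<doteq> ?d"
        proof (rule force_ext[OF tcd'])
          fix w'' x
          assume w'': "w' \<sqsubseteq> w''"
          show "w'' \<Turnstile> x \<in>\<^sub>t ?d" if "w'' \<Turnstile> x \<in>\<^sub>t ?c \<omega>" using that mc[OF w''] md[OF w''] by blast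
          show "w'' \<Turnstile> x \<in>\<^sub>t ?c \<omega>" if "w'' \<Turnstile> x \<in>\<^sub>t ?d"
            using that mc[OF w''] md[OF w''] h ext_trans[OF w''] force_mono by blast
        qed
      qed
    qed
    have z: "w' \<Turnstile> inst \<omega> \<zeta> \<longleftrightarrow> (\<forall>w''. w' \<sqsubseteq> w'' \<longrightarrow>
        (\<forall>w3 x. w'' \<sqsubseteq> w3 \<longrightarrow> el w3 Z x \<longrightarrow> w3 \<Turnstile> inst x \<alpha> \<longrightarrow> w3 \<Turnstile> \<omega>) \<longrightarrow> w'' \<Turnstile> \<omega>)"
      if w': "w \<sqsubseteq> w'" and \<omega>: "tm w' \<omega> TOmega" for w' \<omega>
      unfolding i\<zeta> force_Imp[OF tcd[OF w' \<omega>] \<omega>]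
      using cd ext_trans[OF w'] tm_mono[OF \<omega>] by simp
    show ?thesis
    proof (rule force_eqI[OF _ \<psi>])
      show "tm w (?P \<doteq> ?Q) TOmega" using tPQ[of w] w by (simp only: tm_simps(1)) auto
      fix w'
      assume w': "w \<sqsubseteq> w'"
      have wd: "wd w'" using ext_wd(2)[OF w'] .
      \<comment> \<open>The quantifier over truth values is applied to \<open>\<psi>\<close> itself;
        premise \<open>1\<close> is then the antecedent of the resulting implication.\<close>
      show "w' \<Turnstile> \<psi>" if e: "w' \<Turnstile> ?P \<doteq> ?Q"
      proof -
        have t: "tm w' \<psi> TOmega" using tm_mono[OF \<psi> w'] .
        have "w' \<Turnstile> \<psi> \<in>\<^sub>t ?P"
          using force_mem_cong[OF force_refl[OF t] force_sym[OF e]] t mQ by blast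
        then have "w' \<Turnstile> inst \<psi> \<zeta>" using mP[OF w'] by blast
        then show ?thesis unfolding z[OF w' t] using 1 ext_trans[OF w'] ext_refl wd by blast
      qed
      show "w' \<Turnstile> ?P \<doteq> ?Q" if p: "w' \<Turnstile> \<psi>"
      proof (rule force_ext[OF tPQ[OF w']])
        fix w'' \<omega>
        assume w'': "w' \<sqsubseteq> w''" and \<omega>: "tm w'' \<omega> TOmega"
        note ww = ext_trans[OF w' w'']
        show "w'' \<Turnstile> \<omega> \<in>\<^sub>t ?Q" using \<omega> mQ by blast
        have "w'' \<Turnstile> inst \<omega> \<zeta>"
          unfolding z[OF ww \<omega>]
        proof (intro allI impI)
          fix w3
          assume w3: "w'' \<sqsubseteq> w3" and h: "\<forall>w4 x. w3 \<sqsubseteq> w4 \<longrightarrow> el w4 Z x \<longrightarrow> w4 \<Turnstile> inst x \<alpha> \<longrightarrow> w4 \<Turnstile> \<omega>"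
          obtain a where "el w3 Z a" "w3 \<Turnstile> inst a \<alpha>"
            using 2[OF ext_trans[OF ww w3] force_mono[OF p ext_trans[OF w'' w3]]] by blast
          then show "w3 \<Turnstile> \<omega>" using h ext_refl ext_wd(2)[OF w3] by blast
        qed
        then show "w'' \<Turnstile> \<omega> \<in>\<^sub>t ?P" using mP[OF ww] \<omega> by blast
      qed
    qed
  qed
  ultimately show ?thesis by (rule sEqual)
qed

lemma sem_compr:
  assumes "has_type L [ety (ob (snd z))] \<alpha> TOmega" and "fv \<alpha> \<subseteq> vars w" and "wd w"
    and "\<And>w' x. w \<sqsubseteq> w' \<Longrightarrow> el w' (ob (snd z)) x \<Longrightarrow> sem (\<rho>(z := x)) w' [] \<phi> (inst x \<alpha>)"
  shows "sem \<rho> w [] (compr z \<phi>) (Compr (ety (ob (snd z))) (Bound 0 \<in>\<^sub>t rep (ob (snd z)) \<and>\<^sub>t \<alpha>))"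
  unfolding compr_def using sem_bind[OF assms(4)] by (intro sCompr assms(1-3)) simp

section \<open>The canonical translation\<close>

text \<open>The power set of \<open>U A\<close> and the product of sets \<open>U A\<close> contain
  all terms of their types. They are therefore provably the sets \<open>U\<close> of the power and
  product types, and \<open>eta_ty\<close> may be defined by recursion on types.\<close>

lemma ob_eta: "is_ty (ground L) A \<Longrightarrow> ob (eta_ty L S A) = cls S (U A)"
proof (induction A)
  case TUnit
  then show ?case by (simp add: Unit_eq)
next
  case TOmega
  then show ?case by (simp add: Omega_E)
next
  case (TGround g)
  then show ?case by (simp add: type_sym_ob)
next
  case (TPow A)
  then have A: "is_ty (ground L) A" and e: "ob (eta_ty L S A) = cls S (U A)" by auto
  note U = closed_U(1)[OF A]
  note O = cls_Ob[OF U]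
  have UP: "closed_term L (U (TPow A)) (TPow (TPow A))" using closed_U TPow.prems by blast
  have "cls S (pow_set A (rep (cls S (U A)))) = cls S (U (TPow A))"
  proof (rule closed_ext[OF _ UP])
    show "closed_term L (pow_set A (rep (cls S (U A)))) (TPow (TPow A))"
      using closed_pow_set(1)[OF Ob_rep[OF O]] ety_cls[OF U] by simp
    fix w s
    have "w' \<Turnstile> t \<in>\<^sub>t rep (cls S (U A))" if s: "tm w s (TPow A)" and "w \<sqsubseteq> w'" "w' \<Turnstile> t \<in>\<^sub>t s" for w' t
    proof -
      have "tm w' t A" using force_tm[OF that(3)] tm_mono[OF s that(2)] by (auto dest: tm_unique)
      then show ?thesis using el_cls[OF U] closed_U(2)[OF A] by blast
    qed
    then show "w \<Turnstile> s \<in>\<^sub>t pow_set A (rep (cls S (U A))) \<longleftrightarrow> w \<Turnstile> s \<in>\<^sub>t U (TPow A)"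
      using closed_pow_set(2)[OF Ob_rep[OF O]] ety_cls[OF U] closed_U(2)[OF TPow.prems] by auto
  qed
  then show ?case by (simp add: e PowOb_E ety_cls[OF U])
next
  case (TProd As)
  let ?Zs = "map (\<lambda>A. cls S (U A)) As"
  have A: "is_ty (ground L) A" "ob (eta_ty L S A) = cls S (U A)" if "A \<in> set As" for A
    using TProd that by auto
  have O: "set ?Zs \<subseteq> Ob E" using A(1) closed_U(1) cls_Ob by auto
  have et: "map ety ?Zs = As" using A(1) ety_cls[OF closed_U(1)] by (auto intro!: map_idI)
  have l: "2 \<le> length As" using TProd.prems by simp
  have UP: "closed_term L (U (TProd As)) (TPow (TProd As))" using closed_U TProd.prems by blast
  note P = Prod_closed[OF O, unfolded et mk_prod_long[OF l]]
  have "cls S (prod_set As (map rep ?Zs)) = cls S (U (TProd As))"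
  proof (rule closed_ext[OF P(1) UP])
    fix w t
    have "el w (?Zs ! i) (mk_prj As i t)" if "tm w t (TProd As)" "i < length As" for i
      using tm_mk_prj[of w t As i] that l el_cls[OF closed_U(1)[OF A(1)]] closed_U(2)[OF A(1)]
      by (simp add: mk_prod_long)
    then show "w \<Turnstile> t \<in>\<^sub>t prod_set As (map rep ?Zs) \<longleftrightarrow> w \<Turnstile> t \<in>\<^sub>t U (TProd As)"
      unfolding P(2) closed_U(2)[OF TProd.prems] by auto
  qed
  moreover have "map ob (map (eta_ty L S) As) = ?Zs" using A(2) by simp
  ultimately show ?case unfolding eta_ty.simps ty_obj.simps Prod_E by (simp only: et)
qed

lemma eta_is_ty: "is_ty (ground L) A \<Longrightarrow> is_ty (ground LE) (eta_ty L S A)"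
proof (induction A)
  case (TGround g)
  then show ?case using type_sym_is_ty[OF cls_Ob[OF closed_U(1)]] by simp
qed auto

lemma ety_ob_eta: "is_ty (ground L) A \<Longrightarrow> ety (ob (eta_ty L S A)) = A"
  using ob_eta ety_cls[OF closed_U(1)] by simp

text \<open>The object denoted by \<open>eta_ty L S A\<close> has element type \<open>A\<close>, so
  the translation identifies no two types. Without this the substitutions for the translations of
  \<open>x\<close> and \<open>y\<close> could collide.\<close>

lemma eta_var_inj:
  assumes "is_ty (ground L) (snd x)" and "is_ty (ground L) (snd y)" and "eta_var L S x = eta_var L S y"
  shows "x = y"
proof -
  have "fst x = fst y" "eta_ty L S (snd x) = eta_ty L S (snd y)" using assms(3) by (auto simp: eta_var_def)
  then have "snd x = snd y" using ety_ob_eta[OF assms(1)] ety_ob_eta[OF assms(2)] by metis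
  with \<open>fst x = fst y\<close> show ?thesis by (simp add: prod_eq_iff)
qed

lemma eta_fun_Hom:
  assumes h: "h \<in> funs L" and s: "sig L h = (A, B)"
  shows "fst (eta_fun L S h) \<in> Hom E (cls S (U A)) (cls S (U B))"
    and "vl w (fst (eta_fun L S h)) r t \<longleftrightarrow> tm w r A \<and> w \<Turnstile> t \<doteq> App h r"
    and "is_ty (ground L) A" and "is_ty (ground L) B"
    and "snd (eta_fun L S h) = (eta_ty L S A, eta_ty L S B)"
proof -
  show A: "is_ty (ground L) A" and B: "is_ty (ground L) B" using L h s by (auto simp: local_language_def)
  let ?x = "(0, A) :: 'g var"
  have 1: "closed_term L (U A) (TPow (snd ?x))" "closed_term L (U B) (TPow B)" using closed_U(1) A B by auto
  have 2: "has_type L [] (App h (Var ?x)) B" "fv (App h (Var ?x)) \<subseteq> {?x}" using h s A by auto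
  have 3: "w \<Turnstile> subst1 ?x r (App h (Var ?x)) \<in>\<^sub>t U B" if "w \<Turnstile> r \<in>\<^sub>t U A" for w r
    using that h s unfolding closed_U(2)[OF A] closed_U(2)[OF B] by (simp add: tm_def)
  have e: "fst (eta_fun L S h) = maps_to L S ?x (App h (Var ?x)) (U A) (U B)"
    "snd (eta_fun L S h) = (eta_ty L S A, eta_ty L S B)"
    using s by (simp_all add: eta_fun_def Let_def)
  show "fst (eta_fun L S h) \<in> Hom E (cls S (U A)) (cls S (U B))"
    unfolding e by (rule maps_to_Hom(1)[OF 1 2]) (rule 3)
  show "vl w (fst (eta_fun L S h)) r t \<longleftrightarrow> tm w r A \<and> w \<Turnstile> t \<doteq> App h r"
    using maps_to_Hom(2)[OF 1 2 3, of w r t] closed_U(2)[OF A] by (simp add: e)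
  show "snd (eta_fun L S h) = (eta_ty L S A, eta_ty L S B)" by (rule e(2))
qed

text \<open>\<open>\<sigma>\<close> may put terms outside the image of the translation in place of
  translated variables, such as an application of the symbol of \<open>i_X\<close>.\<close>

lemma eta_typed:
  assumes "has_type L Bs t B" and "\<And>x. x \<in> fv t \<Longrightarrow> has_type LE [] (\<sigma> (eta_var L S x)) (eta_ty L S (snd x))"
  shows "has_type LE (map (eta_ty L S) Bs) (subst \<sigma> (eta L S t)) (eta_ty L S B)"
  using assms
proof (induction t arbitrary: Bs B)
  case (Var x)
  then show ?case using has_type_weaken0[OF Var.prems(2)] by simp
next
  case (App h t)
  then obtain A where h: "h \<in> funs L" "sig L h = (A, B)" and t: "has_type L Bs t A" by auto
  note e = eta_fun_Hom[OF h]
  have "eta_fun L S h \<in> funs LE"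
    unfolding funs_LE e(5) using e eta_is_ty ob_eta by simp
  moreover have "sig LE (eta_fun L S h) = (eta_ty L S A, eta_ty L S B)" unfolding sig_LE e(5) ..
  moreover have "has_type LE (map (eta_ty L S) Bs) (subst \<sigma> (eta L S t)) (eta_ty L S A)"
    by (rule App.IH[OF t]) (use App.prems(2) in simp)
  ultimately show ?case by auto
next
  case (Tuple ts)
  then obtain As where As: "B = TProd As" "2 \<le> length ts" "list_all2 (has_type L Bs) ts As" by auto
  have "has_type LE (map (eta_ty L S) Bs) (subst \<sigma> (eta L S (ts ! i))) (eta_ty L S (As ! i))"
    if "i < length ts" for i
  proof (rule Tuple.IH[OF nth_mem[OF that] list_all2_nthD[OF As(3) that]])
    fix x
    assume "x \<in> fv (ts ! i)"
    then have "x \<in> fv (Tuple ts)" using that by auto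
    then show "has_type LE [] (\<sigma> (eta_var L S x)) (eta_ty L S (snd x))" by (rule Tuple.prems(2))
  qed
  then show ?case using As list_all2_lengthD[OF As(3)] by (simp add: list_all2_conv_all_nth)
next
  case (Prj As i t)
  then have t: "has_type L Bs t (TProd As)" and i: "i < length As" "B = As ! i" by auto
  have "has_type LE (map (eta_ty L S) Bs) (subst \<sigma> (eta L S t)) (eta_ty L S (TProd As))"
    by (rule Prj.IH[OF t]) (use Prj.prems(2) in simp)
  then show ?case using i by simp
next
  case (Compr A a)
  then have a: "has_type L (A # Bs) a TOmega" and A: "is_ty (ground L) A" "B = TPow A" by auto
  have "has_type LE (map (eta_ty L S) (A # Bs)) (subst \<sigma> (eta L S a)) (eta_ty L S TOmega)"
    by (rule Compr.IH[OF a]) (use Compr.prems(2) in simp)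
  then show ?case using A eta_is_ty by simp
next
  case (Eq s t)
  then obtain A where "has_type L Bs s A" "has_type L Bs t A" "B = TOmega" by auto
  then show ?case using Eq.IH[of Bs A] Eq.prems(2) by (simp, metis UnI1 UnI2)
next
  case (Mem s t)
  then obtain A where "has_type L Bs s A" "has_type L Bs t (TPow A)" "B = TOmega" by auto
  then show ?case using Mem.IH(1)[of Bs A] Mem.IH(2)[of Bs "TPow A"] Mem.prems(2) by (simp, metis UnI1 UnI2)
qed auto

lemma tm_msub:
  assumes "has_type L Bs t B" and "list_all2 (tm w) \<delta> Bs" and "\<And>x. x \<in> fv t \<Longrightarrow> tm w (\<theta> x) (snd x)" and "wd w"
  shows "tm w (msub \<theta> \<delta> 0 t) B"
proof -
  have "list_all2 (has_type L []) \<delta> Bs" by (rule list_all2_mono[OF assms(2)]) (simp add: tm_def)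
  then have "has_type L [] (msub \<theta> \<delta> 0 t) B"
    using has_type_msub[of L "[]" Bs t B \<delta> \<theta>] assms(1,3) by (simp add: tm_def)
  moreover have "fv (msub \<theta> \<delta> 0 t) \<subseteq> vars w"
  proof -
    have "fv s \<subseteq> vars w" if "s \<in> set \<delta>" for s
      using that assms(2) by (auto simp: list_all2_conv_all_nth in_set_conv_nth tm_def)
    moreover have "fv (\<theta> x) \<subseteq> vars w" if "x \<in> fv t" for x using assms(3)[OF that] by (simp add: tm_def)
    ultimately show ?thesis using fv_msub_subset[of \<theta> \<delta> 0 t] by blast
  qed
  ultimately show ?thesis using assms(4) by (simp add: tm_def)
qed

text \<open>The substitution \<open>\<sigma>\<close> is included so that \<open>i_X(u)\<close> may
  take the place of \<open>x\<close>; the values \<open>\<theta>\<close> of the substituted terms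
  then go into the original term. The case of interest is that of a set term, whose value confines
  the bound variable to an object.\<close>

lemma sem_eta:
  assumes "has_type L Bs t B" and "list_all2 (tm w) \<delta> Bs" and "wd w"
    and "\<And>x. x \<in> fv t \<Longrightarrow> tm w (\<theta> x) (snd x) \<and> sem \<rho> w [] (\<sigma> (eta_var L S x)) (\<theta> x)"
  shows "sem \<rho> w \<delta> (subst \<sigma> (eta L S t)) (msub \<theta> \<delta> 0 t)"
  using assms
proof (induction t arbitrary: Bs B w \<delta>)
  case (Bound i)
  then have "i < length \<delta>" by (simp add: list_all2_lengthD)
  then show ?case using sBound[of i \<delta> w \<rho>] Bound.prems(3) by simp
next
  case (Var x)
  then show ?case using sem_weaken[of \<rho> w "[]" _ _ \<delta>] by simp
next
  case Star
  then show ?case using sStar by simp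
next
  case (App h t)
  then obtain A where h: "h \<in> funs L" "sig L h = (A, B)" and t: "has_type L Bs t A" by auto
  have s: "sem \<rho> w \<delta> (subst \<sigma> (eta L S t)) (msub \<theta> \<delta> 0 t)"
    by (rule App.IH[OF t App.prems(2,3)]) (use App.prems(4) in simp)
  have tb: "tm w (msub \<theta> \<delta> 0 t) A" by (rule tm_msub[OF t App.prems(2)]) (use App.prems(3,4) in simp_all)
  then have "tm w (App h (msub \<theta> \<delta> 0 t)) B" using h by (auto simp: tm_def)
  then have "vl w (fst (eta_fun L S h)) (msub \<theta> \<delta> 0 t) (App h (msub \<theta> \<delta> 0 t))"
    using eta_fun_Hom(2)[OF h] tb force_refl by blast
  then show ?case using sApp[OF s] by simp
next
  case (Tuple ts)
  then obtain As where As: "B = TProd As" "list_all2 (has_type L Bs) ts As" by auto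
  have "sem \<rho> w \<delta> (subst \<sigma> (eta L S (ts ! i))) (msub \<theta> \<delta> 0 (ts ! i))" if "i < length ts" for i
  proof (rule Tuple.IH[OF nth_mem[OF that] list_all2_nthD[OF As(2) that] Tuple.prems(2,3)])
    fix x
    assume "x \<in> fv (ts ! i)"
    then have "x \<in> fv (Tuple ts)" using that by auto
    then show "tm w (\<theta> x) (snd x) \<and> sem \<rho> w [] (\<sigma> (eta_var L S x)) (\<theta> x)" by (rule Tuple.prems(4))
  qed
  then have "list_all2 (sem \<rho> w \<delta>) (map (subst \<sigma>) (map (eta L S) ts)) (map (msub \<theta> \<delta> 0) ts)"
    by (simp add: list_all2_conv_all_nth)
  from sTuple[OF this Tuple.prems(3)] show ?case by simp
next
  case (Prj As i t)
  then have t: "has_type L Bs t (TProd As)" by auto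
  have s: "sem \<rho> w \<delta> (subst \<sigma> (eta L S t)) (msub \<theta> \<delta> 0 t)"
    by (rule Prj.IH[OF t Prj.prems(2,3)]) (use Prj.prems(4) in simp)
  have "tm w (msub \<theta> \<delta> 0 t) (TProd As)"
    by (rule tm_msub[OF t Prj.prems(2)]) (use Prj.prems(3,4) in simp_all)
  then have "is_ty (ground L) (TProd As)" by (rule tm_is_ty)
  then have "map (\<lambda>A. ety (ob A)) (map (eta_ty L S) As) = As" using ety_ob_eta by (auto intro!: map_idI)
  then show ?case using sPrj[OF s, of "map (eta_ty L S) As" i] by simp
next
  case (Compr A a)
  then have a: "has_type L (A # Bs) a TOmega" and A: "is_ty (ground L) A" by auto
  let ?O = "ob (eta_ty L S A)" and ?\<alpha> = "msub \<theta> \<delta> (Suc 0) a"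
  have O: "?O = cls S (U A)" "ety ?O = A" using ob_eta[OF A] ety_ob_eta[OF A] by auto
  have elO: "el w' ?O x \<longleftrightarrow> tm w' x A" for w' x unfolding O(1) using el_cls[OF closed_U(1)[OF A]] closed_U(2)[OF A] by blast
  have OO: "?O \<in> Ob E" using cls_Ob[OF closed_U(1)[OF A]] O by simp
  have d: "list_all2 (has_type L []) \<delta> Bs" by (rule list_all2_mono[OF Compr.prems(2)]) (simp add: tm_def)
  have \<theta>: "tm w (\<theta> x) (snd x)" if "x \<in> fv a" for x using Compr.prems(4) that by simp
  have ld: "lc 0 s" if "s \<in> set \<delta>" for s
    using that d by (auto simp: list_all2_conv_all_nth in_set_conv_nth dest: has_type_lc0)
  have \<alpha>: "has_type L [A] ?\<alpha> TOmega" using has_type_msub[of L "[A]" Bs a TOmega \<delta> \<theta>] a d \<theta> by (simp add: tm_def)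
  have f\<alpha>: "fv ?\<alpha> \<subseteq> vars w"
  proof -
    have "fv s \<subseteq> vars w" if "s \<in> set \<delta>" for s
      using that Compr.prems(2) by (auto simp: list_all2_conv_all_nth in_set_conv_nth tm_def)
    moreover have "fv (\<theta> x) \<subseteq> vars w" if "x \<in> fv a" for x using \<theta>[OF that] by (simp add: tm_def)
    ultimately show ?thesis using fv_msub_subset[of \<theta> \<delta> "Suc 0" a] by blast
  qed
  have ia: "inst x ?\<alpha> = msub \<theta> (x # \<delta>) 0 a" for x
    using msub_msub[of a \<theta> \<delta> Var "[x]" 0] tm_lc[OF \<theta>] ld by (simp add: map_idI)
  have "sem \<rho> w \<delta> (Compr (eta_ty L S A) (subst \<sigma> (eta L S a))) (Compr (ety ?O) (Bound 0 \<in>\<^sub>t rep ?O \<and>\<^sub>t ?\<alpha>))"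
  proof (rule sCompr[OF _ f\<alpha> Compr.prems(3)])
    show "has_type L [ety ?O] ?\<alpha> TOmega" using \<alpha> O by simp
    fix w' x
    assume w': "w \<sqsubseteq> w'" and x: "el w' ?O x"
    show "sem \<rho> w' (x # \<delta>) (subst \<sigma> (eta L S a)) (inst x ?\<alpha>)"
      unfolding ia
    proof (rule Compr.IH[OF a _ ext_wd(2)[OF w']])
      show "list_all2 (tm w') (x # \<delta>) (A # Bs)"
        using x elO list_all2_mono[OF Compr.prems(2)] tm_mono[OF _ w'] by auto
      show "tm w' (\<theta> v) (snd v) \<and> sem \<rho> w' [] (\<sigma> (eta_var L S v)) (\<theta> v)" if "v \<in> fv a" for v
        using Compr.prems(4)[of v] that tm_mono[OF _ w'] sem_mono[OF _ w'] by simp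
    qed
  qed
  \<comment> \<open>The object here is \<open>U A\<close>, so the confining conjunct holds for every
    term of type \<open>A\<close> and the set is the expected one by extensionality.\<close>
  moreover have "w \<Turnstile> Compr (ety ?O) (Bound 0 \<in>\<^sub>t rep ?O \<and>\<^sub>t ?\<alpha>) \<doteq> Compr A ?\<alpha>"
  proof -
    have b: "has_type L [A] (Bound 0 \<in>\<^sub>t rep ?O \<and>\<^sub>t ?\<alpha>) TOmega" "fv (Bound 0 \<in>\<^sub>t rep ?O \<and>\<^sub>t ?\<alpha>) \<subseteq> vars w"
      using \<alpha> f\<alpha> Ob_rep[OF OO] O(2) by (auto simp: closed_term_def has_type_weaken0)
    show ?thesis
      unfolding O(2)
    proof (rule force_ext[OF tm_Compr[OF Compr.prems(3) A b] tm_Compr[OF Compr.prems(3) A \<alpha> f\<alpha>]])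
      fix w' x
      assume w': "w \<sqsubseteq> w'" and x: "tm w' x A"
      have "w' \<Turnstile> x \<in>\<^sub>t Compr A (Bound 0 \<in>\<^sub>t rep ?O \<and>\<^sub>t ?\<alpha>) \<longleftrightarrow> w' \<Turnstile> x \<in>\<^sub>t Compr A ?\<alpha>"
      proof -
        have f: "fv (Bound 0 \<in>\<^sub>t rep ?O \<and>\<^sub>t ?\<alpha>) \<subseteq> vars w'" "fv ?\<alpha> \<subseteq> vars w'"
          using b(2) f\<alpha> w' by (auto simp: ext_def)
        show ?thesis
          unfolding force_mem_Compr[OF b(1) f(1)] force_mem_Compr[OF \<alpha> f(2)]
          using x elO closed_lc[OF Ob_rep[OF OO]] by (simp add: force_And)
      qed
      then show "w' \<Turnstile> x \<in>\<^sub>t Compr A ?\<alpha>" if "w' \<Turnstile> x \<in>\<^sub>t Compr A (Bound 0 \<in>\<^sub>t rep ?O \<and>\<^sub>t ?\<alpha>)" using that by blast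
      show "w' \<Turnstile> x \<in>\<^sub>t Compr A (Bound 0 \<in>\<^sub>t rep ?O \<and>\<^sub>t ?\<alpha>)" if "w' \<Turnstile> x \<in>\<^sub>t Compr A ?\<alpha>"
        using that \<open>w' \<Turnstile> x \<in>\<^sub>t Compr A (Bound 0 \<in>\<^sub>t rep ?O \<and>\<^sub>t ?\<alpha>) \<longleftrightarrow> w' \<Turnstile> x \<in>\<^sub>t Compr A ?\<alpha>\<close> by blast
    qed
  qed
  ultimately show ?case using sEqual by simp
next
  case (Eq s t)
  then obtain A where A: "has_type L Bs s A" "has_type L Bs t A" by auto
  have "sem \<rho> w \<delta> (subst \<sigma> (eta L S s)) (msub \<theta> \<delta> 0 s)"
    by (rule Eq.IH(1)[OF A(1) Eq.prems(2,3)]) (use Eq.prems(4) in simp)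
  moreover have "sem \<rho> w \<delta> (subst \<sigma> (eta L S t)) (msub \<theta> \<delta> 0 t)"
    by (rule Eq.IH(2)[OF A(2) Eq.prems(2,3)]) (use Eq.prems(4) in simp)
  ultimately show ?case using sEq by simp
next
  case (Mem s t)
  then obtain A where A: "has_type L Bs s A" "has_type L Bs t (TPow A)" by auto
  have "sem \<rho> w \<delta> (subst \<sigma> (eta L S s)) (msub \<theta> \<delta> 0 s)"
    by (rule Mem.IH(1)[OF A(1) Mem.prems(2,3)]) (use Mem.prems(4) in simp)
  moreover have "sem \<rho> w \<delta> (subst \<sigma> (eta L S t)) (msub \<theta> \<delta> 0 t)"
    by (rule Mem.IH(2)[OF A(2) Mem.prems(2,3)]) (use Mem.prems(4) in simp)
  ultimately show ?case using sMem by simp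
qed

end

section \<open>The graph of the translated function\<close>

context set_theory
begin

section \<open>The inclusions and the two graphs\<close>

lemma incl_Hom:
  assumes X: "closed_term L X (TPow A)"
  shows "fst (incl_sym L S X) \<in> Hom E (cls S X) (cls S (U A))"
    and "vl w (fst (incl_sym L S X)) r t \<longleftrightarrow> w \<Turnstile> r \<in>\<^sub>t X \<and> w \<Turnstile> t \<doteq> r"
    and "snd (incl_sym L S X) = (type_sym E (cls S X), eta_ty L S A)"
proof -
  have A: "is_ty (ground L) A" using closed_Pow_is_ty[OF X] .
  let ?x = "(0, A) :: 'g var"
  have 1: "closed_term L X (TPow (snd ?x))" "closed_term L (U A) (TPow A)" using X closed_U(1) A by auto
  have 2: "has_type L [] (Var ?x) A" "fv (Var ?x) \<subseteq> {?x}" using A by auto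
  have 3: "w \<Turnstile> subst1 ?x r (Var ?x) \<in>\<^sub>t U A" if "w \<Turnstile> r \<in>\<^sub>t X" for w r
    using closed_mem_tm[OF X that] closed_U(2)[OF A] by simp
  have e: "fst (incl_sym L S X) = maps_to L S ?x (Var ?x) X (U A)"
    "snd (incl_sym L S X) = (type_sym E (cls S X), eta_ty L S A)"
    by (simp_all add: incl_sym_def Let_def elem_ty_eq[OF X])
  show "fst (incl_sym L S X) \<in> Hom E (cls S X) (cls S (U A))"
    unfolding e by (rule maps_to_Hom(1)[OF 1 2]) (rule 3)
  show "vl w (fst (incl_sym L S X)) r t \<longleftrightarrow> w \<Turnstile> r \<in>\<^sub>t X \<and> w \<Turnstile> t \<doteq> r"
    using maps_to_Hom(2)[OF 1 2 3, of w r t] by (simp add: e)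
  show "snd (incl_sym L S X) = (type_sym E (cls S X), eta_ty L S A)" by (rule e(2))
qed

lemma incl_typed:
  assumes X: "closed_term L X (TPow A)" and u: "snd u = type_sym E (cls S X)"
  shows "has_type LE [] (App (incl_sym L S X) (Var u)) (eta_ty L S A)"
proof -
  note i = incl_Hom[OF X]
  have A: "is_ty (ground L) A" using closed_Pow_is_ty[OF X] .
  have t: "is_ty (ground LE) (snd u)" using type_sym_is_ty[OF cls_Ob[OF X]] u by simp
  have "incl_sym L S X \<in> funs LE"
    unfolding funs_LE i(3) using i(1) type_sym_is_ty[OF cls_Ob[OF X]] eta_is_ty[OF A] ob_eta[OF A]
    by (simp add: type_sym_ob)
  moreover have "sig LE (incl_sym L S X) = (snd u, eta_ty L S A)" unfolding sig_LE i(3) u ..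
  ultimately show ?thesis using t by auto
qed

lemma sem_incl:
  assumes X: "closed_term L X (TPow A)" and u: "w \<Turnstile> \<rho> u \<in>\<^sub>t X"
  shows "sem \<rho> w [] (App (incl_sym L S X) (Var u)) (\<rho> u)"
  using incl_Hom(2)[OF X] u force_refl[OF closed_mem_tm[OF X u]] force_wd[OF u] by (intro sApp[OF sVar]) auto

text \<open>Shared by the two graphs to be compared: the value depends on \<open>T\<close>,
  \<open>P\<close> and \<open>G\<close> alone, so both receive literally the same term. Letting
  \<open>z\<close> range over all fresh variables hides the choice made inside
  \<open>set_of\<close>.\<close>

lemma sem_set_of:
  assumes T: "ob A = P" "ety P = T" and G: "closed_term L G (TPow T)" and w: "wd w"
    and h: "\<And>z w' p. snd z = A \<Longrightarrow> z \<notin> set us \<union> fv \<tau> \<union> fv \<phi> \<Longrightarrow> w \<sqsubseteq> w' \<Longrightarrow> el w' P p \<Longrightarrow>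
      sem (\<rho>(z := p)) w' [] (foldr ex us (Var z \<doteq> \<tau> \<and>\<^sub>t \<phi>)) (p \<in>\<^sub>t G)"
  shows "sem \<rho> w [] (set_of A us \<tau> \<phi>) (Compr T (Bound 0 \<in>\<^sub>t rep P \<and>\<^sub>t Bound 0 \<in>\<^sub>t G))"
proof -
  let ?V = "set us \<union> fv \<tau> \<union> fv \<phi>"
  let ?z = "fresh A ?V"
  have z: "?z \<notin> ?V" by (rule fresh_notin) simp
  have e: "ety (ob (snd ?z)) = T" "ob (snd ?z) = P" using T by simp_all
  have tG: "has_type L Bs G (TPow T)" for Bs using G by (simp add: closed_term_def has_type_weaken0)
  note c = sem_compr[of ?z "Bound 0 \<in>\<^sub>t G" w \<rho>, unfolded e T(2)]
  have "sem \<rho> w [] (compr ?z (foldr ex us (Var ?z \<doteq> \<tau> \<and>\<^sub>t \<phi>))) (Compr T (Bound 0 \<in>\<^sub>t rep P \<and>\<^sub>t Bound 0 \<in>\<^sub>t G))"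
  proof (rule c[OF _ _ w])
    show "has_type L [T] (Bound 0 \<in>\<^sub>t G) TOmega" using tG by auto
    show "fv (Bound 0 \<in>\<^sub>t G) \<subseteq> vars w" using G by (simp add: closed_term_def)
    show "sem (\<rho>(?z := p)) w' [] (foldr ex us (Var ?z \<doteq> \<tau> \<and>\<^sub>t \<phi>)) (inst p (Bound 0 \<in>\<^sub>t G))"
      if "w \<sqsubseteq> w'" "el w' P p" for w' p
      using h[OF snd_fresh z that] closed_lc[OF G] by simp
  qed
  then show ?thesis by (simp only: set_of_def Let_def)
qed

text \<open>Both graphs have the value \<open>B0\<close> under every assignment, hence the same
  interpretation. Given a value \<open>t\<close> of \<open>f\<close> at \<open>u\<close>, the
  membership formula evaluates to the truth value of \<open>(s, t)\<close> lying in
  \<open>B0\<close>, which is true. Such a \<open>t\<close> exists locally only, which the rule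
  \<open>sLocal\<close> allows for.\<close>

lemma star_graph_maps_to:
  assumes xy: "x \<noteq> y" and \<gamma>: "formula L \<gamma>"
    and X: "closed_term L X (TPow (snd x))" and Y: "closed_term L Y (TPow (snd y))"
    and f: "is_sfun L S (graph x y \<gamma>) X Y"
    and u: "snd u = type_sym E (cls S X)" and v: "snd v = type_sym E (cls S Y)" and uv: "u \<noteq> v"
  defines "a \<equiv> sfun S (graph x y \<gamma>) X Y"
  shows "({}, Tuple [Var u, App (fun_sym E a) (Var u)] \<in>\<^sub>t star_graph L S X Y x y \<gamma> u v) \<in> Th E"
    and "sfun (Th E) (star_graph L S X Y x y \<gamma> u v) (U (snd u)) (U (snd v)) =
      maps_to LE (Th E) u (App (fun_sym E a) (Var u)) (U (snd u)) (U (snd v))"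
proof -
  let ?A = "snd x" and ?B = "snd y" and ?G = "graph x y \<gamma>"
  let ?X = "cls S X" and ?Y = "cls S Y" and ?T = "TProd [?A, ?B]"
  let ?Tuv = "TProd [snd u, snd v]"
  have AB: "is_ty (ground L) ?A" "is_ty (ground L) ?B" using closed_Pow_is_ty X Y by blast+
  have sf: "sfn ?G ?A ?B X Y" using f is_sfun_iff[OF X Y] by blast
  note G = sfn_closed(3)[OF sf]
  have lG: "lc 0 ?G" and fG: "fv ?G = {}" and tG: "has_type L Bs ?G (TPow ?T)" for Bs
    using closed_lc[OF G] G by (simp_all add: closed_term_def has_type_weaken0)
  \<comment> \<open>The graph is an \<open>S\<close>-set and thus closed, so \<open>\<gamma>\<close>
    has no free variables besides \<open>x\<close> and \<open>y\<close>.\<close>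
  have v\<gamma>: "fv \<gamma> \<subseteq> {x, y}" using G by (auto simp: closed_term_def graph_def)
  note Gm = graph_closed(2)[OF xy AB \<gamma> v\<gamma>]
  have XO: "?X \<in> Ob E" and YO: "?Y \<in> Ob E" using cls_Ob X Y by blast+
  have etX: "ety ?X = ?A" "ety ?Y = ?B" using ety_cls X Y by blast+
  have elX: "el w ?X s \<longleftrightarrow> w \<Turnstile> s \<in>\<^sub>t X" "el w ?Y s \<longleftrightarrow> w \<Turnstile> s \<in>\<^sub>t Y" for w s
    using el_cls X Y by blast+
  have aH: "a \<in> Hom E ?X ?Y" unfolding a_def by (rule sfun_Hom[OF sf])
  have av: "vl w a s t \<longleftrightarrow> w \<Turnstile> Tuple [s, t] \<in>\<^sub>t ?G" for w s t unfolding a_def by (rule vl_sfun[OF sf])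
  have obu: "ob (snd u) = ?X" "ob (snd v) = ?Y" unfolding u v by (simp_all add: type_sym_ob)
  have tyu: "is_ty (ground LE) (snd u)" "is_ty (ground LE) (snd v)"
    unfolding u v using type_sym_is_ty XO YO by blast+
  let ?P = "Prod E [?X, ?Y]"
  have obT: "ob ?Tuv = ?P" by (simp add: obu)
  have PO: "?P \<in> Ob E" and etP: "ety ?P = ?T" using el_Pair(1,2)[OF XO YO] etX by auto
  note elP = el_Pair(3,4)[OF XO YO, unfolded etX]
  have tup: "w \<Turnstile> t \<in>\<^sub>t ?G \<longleftrightarrow> w \<Turnstile> t' \<in>\<^sub>t ?G" if e: "w \<Turnstile> t \<doteq> t'" for w t t'
    using force_mem_cong[OF e force_refl[OF closed_tm[OF G force_wd[OF e]]]]
      force_mem_cong[OF force_sym[OF e] force_refl[OF closed_tm[OF G force_wd[OF e]]]] by blast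
  let ?p0 = "Prj [?A, ?B] 0" and ?p1 = "Prj [?A, ?B] 1"
  have eta: "w \<Turnstile> p \<doteq> Tuple [?p0 p, ?p1 p]" if "tm w p ?T" for w p using force_pair_eta[OF that] .
  have pr: "w \<Turnstile> ?p0 p \<doteq> s \<and> w \<Turnstile> ?p1 p \<doteq> t" if e: "w \<Turnstile> p \<doteq> Tuple [s, t]" and p: "tm w p ?T" for w p s t
    using force_pair_inj[OF force_trans[OF force_sym[OF eta[OF p]] e]] by blast
  \<comment> \<open>The conjunct with \<open>rep ?P\<close> is what evaluating a set term over the
    product object adds to membership in the graph.\<close>
  define B0 where "B0 = Compr ?T (Bound 0 \<in>\<^sub>t rep ?P \<and>\<^sub>t Bound 0 \<in>\<^sub>t ?G)"
  let ?f = "App (fun_sym E a) (Var u) :: (('g, 'f) sobj, (('g, 'f) sobj, ('g, 'f) sarr) fsym) trm"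
  have fs: "fun_sym E a = (a, snd u, snd v)" using aH by (simp add: fun_sym_def Hom_E u v)
  have tf: "has_type LE [] ?f (snd v)"
  proof -
    have "fun_sym E a \<in> funs LE" unfolding funs_LE fs using tyu aH obu by simp
    then show ?thesis using tyu(1) by (auto simp: sig_LE fs)
  qed
  let ?\<sigma> = "Var(eta_var L S x := App (incl_sym L S X) (Var u), eta_var L S y := App (incl_sym L S Y) (Var v))"
  define \<gamma>' where "\<gamma>' = subst ?\<sigma> (eta L S \<gamma>)"
  let ?fstar = "star_graph L S X Y x y \<gamma> u v"
  have fstar: "?fstar = set_of ?Tuv [u, v] (Tuple [Var u, Var v]) \<gamma>'"
    by (simp add: star_graph_def graph_def \<gamma>'_def)
  have exy: "eta_var L S x \<noteq> eta_var L S y" using eta_var_inj[OF AB] xy by blast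
  have \<sigma>: "?\<sigma> (eta_var L S x) = App (incl_sym L S X) (Var u)" "?\<sigma> (eta_var L S y) = App (incl_sym L S Y) (Var v)"
    using exy by simp_all
  have t\<gamma>': "formula LE \<gamma>'"
  proof -
    have "has_type LE (map (eta_ty L S) []) (subst ?\<sigma> (eta L S \<gamma>)) (eta_ty L S TOmega)"
    proof (rule eta_typed[OF \<gamma>])
      fix z
      assume "z \<in> fv \<gamma>"
      then consider "z = x" | "z = y" using v\<gamma> by blast
      then show "has_type LE [] (?\<sigma> (eta_var L S z)) (eta_ty L S (snd z))"
        using incl_typed[OF X u] incl_typed[OF Y v] \<sigma> by cases simp_all
    qed
    then show ?thesis by (simp add: \<gamma>'_def)
  qed
  have f\<gamma>': "fv \<gamma>' \<subseteq> {u, v}"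
  proof
    fix z
    assume "z \<in> fv \<gamma>'"
    then obtain r where "r \<in> fv \<gamma>" "z \<in> fv (?\<sigma> (eta_var L S r))"
      unfolding \<gamma>'_def fv_subst fv_eta by blast
    then show "z \<in> {u, v}" using v\<gamma> \<sigma> by auto
  qed
  have s\<gamma>': "sem \<rho> w [] \<gamma>' (subst (Var(x := \<rho> u, y := \<rho> v)) \<gamma>)"
    if r: "w \<Turnstile> \<rho> u \<in>\<^sub>t X" "w \<Turnstile> \<rho> v \<in>\<^sub>t Y" for \<rho> w
  proof -
    let ?\<theta> = "Var(x := \<rho> u, y := \<rho> v)"
    have "sem \<rho> w [] (subst ?\<sigma> (eta L S \<gamma>)) (msub ?\<theta> [] 0 \<gamma>)"
    proof (rule sem_eta[OF \<gamma>])
      show "list_all2 (tm w) [] []" "wd w" using force_wd[OF r(1)] by simp_all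
      fix z
      assume "z \<in> fv \<gamma>"
      then consider "z = x" | "z = y" using v\<gamma> by blast
      then show "tm w (?\<theta> z) (snd z) \<and> sem \<rho> w [] (?\<sigma> (eta_var L S z)) (?\<theta> z)"
        using sem_incl[of X _ w \<rho> u, OF X r(1)] sem_incl[of Y _ w \<rho> v, OF Y r(2)] \<sigma> xy closed_mem_tm[OF X r(1)] closed_mem_tm[OF Y r(2)]
        by cases simp_all
    qed
    then show ?thesis by (simp add: msub_Nil \<gamma>'_def)
  qed
  have semstar: "sem \<rho> w [] ?fstar B0" if w: "wd w" for \<rho> w
    unfolding fstar B0_def
  proof (rule sem_set_of[OF obT etP G w])
    fix z :: "('g, 'f) sobj var" and w1 p
    assume z: "snd z = ?Tuv" "z \<notin> set [u, v] \<union> fv (Tuple [Var u, Var v]) \<union> fv \<gamma>'"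
      and w1: "w \<sqsubseteq> w1" and p: "el w1 ?P p"
    have wd1: "wd w1" using force_wd[OF p] .
    have tp: "tm w1 p ?T" using el_tm[OF PO p] etP by simp
    let ?\<phi> = "Var z \<doteq> Tuple [Var u, Var v] \<and>\<^sub>t \<gamma>'" and ?\<rho> = "\<rho>(z := p)"
    \<comment> \<open>Once \<open>v\<close> is eliminated, the condition on a value \<open>s\<close>
      of \<open>u\<close> is that \<open>p\<close> lies in the graph and has first component
      \<open>s\<close>; the witness will be the first projection of \<open>p\<close>.\<close>
    let ?\<alpha>1 = "p \<in>\<^sub>t ?G \<and>\<^sub>t ?p0 p \<doteq> Bound 0"
    have tpB: "has_type L Bs p ?T" for Bs using tp by (simp add: tm_def has_type_weaken0)
    have fp: "fv p \<subseteq> vars w2" if "w1 \<sqsubseteq> w2" for w2 using tm_mono[OF tp that] by (simp add: tm_def)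
    have lp: "lc 0 p" using tm_lc[OF tp] .
    have "sem ?\<rho> w1 [] (ex u (ex v ?\<phi>)) (p \<in>\<^sub>t ?G)"
    proof (rule sem_ex[of u, unfolded obu, OF XO wd1, where \<alpha> = ?\<alpha>1])
      show "has_type L [ety ?X] ?\<alpha>1 TOmega" using etX tpB tG by auto
      show "fv ?\<alpha>1 \<subseteq> vars w1" using fp[of w1] wd1 fG by simp
      show "tm w1 (p \<in>\<^sub>t ?G) TOmega" using tp closed_tm[OF G wd1] by auto
      have i1: "inst s ?\<alpha>1 = (p \<in>\<^sub>t ?G \<and>\<^sub>t ?p0 p \<doteq> s)" for s using lp lG by simp
      show "w2 \<Turnstile> p \<in>\<^sub>t ?G" if "w2 \<Turnstile> inst s ?\<alpha>1" for w2 s using that unfolding i1 force_And by blast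
      show "\<exists>s. el w2 ?X s \<and> w2 \<Turnstile> inst s ?\<alpha>1" if w2: "w1 \<sqsubseteq> w2" and m: "w2 \<Turnstile> p \<in>\<^sub>t ?G" for w2
        unfolding i1 force_And using elP(2)[OF force_mono[OF p w2]] m
          force_refl[of w2 "?p0 p" ?A] tm_mono[OF tp w2] by (intro exI[of _ "?p0 p"]) simp
      fix w2 s
      assume w2: "w1 \<sqsubseteq> w2" and s: "el w2 ?X s"
      have wd2: "wd w2" using force_wd[OF s] .
      have ts: "tm w2 s ?A" using el_tm[OF XO s] etX by simp
      have tsB: "has_type L Bs s ?A" for Bs using ts by (simp add: tm_def has_type_weaken0)
      let ?\<alpha>2 = "p \<doteq> Tuple [s, Bound 0] \<and>\<^sub>t p \<in>\<^sub>t ?G"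
      have i2: "inst t ?\<alpha>2 = (p \<doteq> Tuple [s, t] \<and>\<^sub>t p \<in>\<^sub>t ?G)" for t using lp lG tm_lc[OF ts] by simp
      have p2: "tm w2 p ?T" using tm_mono[OF tp w2] .
      have "sem (?\<rho>(u := s)) w2 [] (ex v ?\<phi>) (p \<in>\<^sub>t ?G \<and>\<^sub>t ?p0 p \<doteq> s)"
      proof (rule sem_ex[of v, unfolded obu, OF YO wd2, where \<alpha> = ?\<alpha>2])
        show "has_type L [ety ?Y] ?\<alpha>2 TOmega"
          unfolding has_type_connectives has_type_simps(8,9) etX using tpB tG tsB
          by (intro conjI refl; intro exI[of _ ?T]) simp_all
        show "fv ?\<alpha>2 \<subseteq> vars w2" using fp[OF w2] ts fG by (simp add: tm_def)
        show "tm w2 (p \<in>\<^sub>t ?G \<and>\<^sub>t ?p0 p \<doteq> s) TOmega" using p2 ts closed_tm[OF G wd2] by auto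
        show "w3 \<Turnstile> (p \<in>\<^sub>t ?G \<and>\<^sub>t ?p0 p \<doteq> s)" if w3: "w2 \<sqsubseteq> w3" and m: "w3 \<Turnstile> inst t ?\<alpha>2" for w3 t
          using m pr[OF _ tm_mono[OF p2 w3]] unfolding i2 force_And by blast
        show "\<exists>t. el w3 ?Y t \<and> w3 \<Turnstile> inst t ?\<alpha>2" if w3: "w2 \<sqsubseteq> w3" and m: "w3 \<Turnstile> (p \<in>\<^sub>t ?G \<and>\<^sub>t ?p0 p \<doteq> s)" for w3
        proof (intro exI conjI)
          have p3: "tm w3 p ?T" using tm_mono[OF p2 w3] .
          show "el w3 ?Y (?p1 p)" using elP(2)[OF force_mono[OF p ext_trans[OF w2 w3]]] by simp
          have "w3 \<Turnstile> ?p1 p \<doteq> ?p1 p" by (rule force_refl[of w3 "?p1 p" ?B]) (use p3 in simp)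
          then have "w3 \<Turnstile> Tuple [?p0 p, ?p1 p] \<doteq> Tuple [s, ?p1 p]"
            using m unfolding force_And by (blast intro: force_pair_cong)
          then show "w3 \<Turnstile> inst (?p1 p) ?\<alpha>2"
            unfolding i2 force_And using m force_trans[OF eta[OF p3]] by (simp add: force_And)
        qed
        fix w3 t
        assume w3: "w2 \<sqsubseteq> w3" and t: "el w3 ?Y t"
        have wd3: "wd w3" using force_wd[OF t] .
        have tt: "tm w3 t ?B" using el_tm[OF YO t] etX by simp
        have s3: "el w3 ?X s" "tm w3 s ?A" using force_mono[OF s w3] tm_mono[OF ts w3] by auto
        have p3: "tm w3 p ?T" using tm_mono[OF p2 w3] .
        let ?\<rho>3 = "?\<rho>(u := s, v := t)"
        have r: "?\<rho>3 z = p" "?\<rho>3 u = s" "?\<rho>3 v = t" using z(2) uv by auto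
        let ?g = "subst (Var(x := s, y := t)) \<gamma>"
        have "sem ?\<rho>3 w3 [] \<gamma>' (subst (Var(x := ?\<rho>3 u, y := ?\<rho>3 v)) \<gamma>)"
          by (rule s\<gamma>') (use s3 t elX in \<open>simp_all only: r\<close>)
        then have 1: "sem ?\<rho>3 w3 [] \<gamma>' ?g" by (simp only: r)
        have 2: "sem ?\<rho>3 w3 [] (Var z \<doteq> Tuple [Var u, Var v]) (p \<doteq> Tuple [s, t])"
        proof (rule sEq)
          show "sem ?\<rho>3 w3 [] (Var z) p" using sVar[OF wd3, of ?\<rho>3 "[]" z] by (simp only: r)
          have "sem ?\<rho>3 w3 [] (Var u) s" "sem ?\<rho>3 w3 [] (Var v) t"
            using sVar[OF wd3, of ?\<rho>3 "[]"] r(2,3) by metis+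
          then show "sem ?\<rho>3 w3 [] (Tuple [Var u, Var v]) (Tuple [s, t])" by (intro sTuple wd3) simp
        qed
        \<comment> \<open>If \<open>p\<close> is the pair of \<open>s\<close> and \<open>t\<close>,
          then \<open>\<gamma>\<close> at \<open>s\<close> and \<open>t\<close> says the same as
          membership of \<open>p\<close> in the graph.\<close>
        have "w3 \<Turnstile> (p \<doteq> Tuple [s, t] \<and>\<^sub>t ?g) \<doteq> inst t ?\<alpha>2"
          unfolding i2
        proof (rule force_eqI)
          have tpe: "tm w3 (p \<doteq> Tuple [s, t]) TOmega" using p3 s3 tt wd3 by auto
          have "tm w3 ?g TOmega"
            by (rule tm_subst[OF \<gamma> _ wd3]) (use v\<gamma> s3 tt xy in auto)
          then show "tm w3 (p \<doteq> Tuple [s, t] \<and>\<^sub>t ?g) TOmega" using tpe by simp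
          show "tm w3 (p \<doteq> Tuple [s, t] \<and>\<^sub>t p \<in>\<^sub>t ?G) TOmega" using tpe p3 closed_tm[OF G wd3] by auto
          fix w4
          assume w4: "w3 \<sqsubseteq> w4"
          have st4: "tm w4 s ?A" "tm w4 t ?B" using s3(2) tt tm_mono[OF _ w4] by blast+
          have "w4 \<Turnstile> ?g \<longleftrightarrow> w4 \<Turnstile> p \<in>\<^sub>t ?G" if "w4 \<Turnstile> p \<doteq> Tuple [s, t]"
            unfolding tup[OF that] Gm using st4 by blast
          then show "w4 \<Turnstile> (p \<doteq> Tuple [s, t] \<and>\<^sub>t p \<in>\<^sub>t ?G)" if "w4 \<Turnstile> (p \<doteq> Tuple [s, t] \<and>\<^sub>t ?g)"
            using that unfolding force_And by blast
          show "w4 \<Turnstile> (p \<doteq> Tuple [s, t] \<and>\<^sub>t ?g)" if "w4 \<Turnstile> (p \<doteq> Tuple [s, t] \<and>\<^sub>t p \<in>\<^sub>t ?G)"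
            using that \<open>w4 \<Turnstile> p \<doteq> Tuple [s, t] \<Longrightarrow> w4 \<Turnstile> ?g \<longleftrightarrow> w4 \<Turnstile> p \<in>\<^sub>t ?G\<close> unfolding force_And by blast
        qed
        then show "sem ?\<rho>3 w3 [] ?\<phi> (inst t ?\<alpha>2)" by (rule sEqual[OF sem_And[OF 2 1 wd3]])
      qed
      then show "sem (?\<rho>(u := s)) w2 [] (ex v ?\<phi>) (inst s ?\<alpha>1)" unfolding i1 .
    qed
    then show "sem ?\<rho> w1 [] (foldr ex [u, v] ?\<phi>) (p \<in>\<^sub>t ?G)" by simp
  qed
  let ?U = "U (snd u) :: (('g, 'f) sobj, (('g, 'f) sobj, ('g, 'f) sarr) fsym) trm"
  let ?mg = "maps_graph u ?U (snd v) ?f"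
  have semmaps: "sem \<rho> w [] ?mg B0" if w: "wd w" for \<rho> w
    unfolding maps_graph_def B0_def
  proof (rule sem_set_of[OF obT etP G w])
    fix z :: "('g, 'f) sobj var" and w1 p
    assume z: "snd z = ?Tuv" "z \<notin> set [u] \<union> fv (Tuple [Var u, ?f]) \<union> fv (Var u \<in>\<^sub>t ?U)"
      and w1: "w \<sqsubseteq> w1" and p: "el w1 ?P p"
    have wd1: "wd w1" using force_wd[OF p] .
    have tp: "tm w1 p ?T" using el_tm[OF PO p] etP by simp
    let ?\<phi> = "Var z \<doteq> Tuple [Var u, ?f] \<and>\<^sub>t Var u \<in>\<^sub>t ?U" and ?\<rho> = "\<rho>(z := p)"
    let ?\<alpha>1 = "p \<in>\<^sub>t ?G \<and>\<^sub>t ?p0 p \<doteq> Bound 0"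
    have tpB: "has_type L Bs p ?T" for Bs using tp by (simp add: tm_def has_type_weaken0)
    have fp: "fv p \<subseteq> vars w1" using tp by (simp add: tm_def)
    have lp: "lc 0 p" using tm_lc[OF tp] .
    have "sem ?\<rho> w1 [] (ex u ?\<phi>) (p \<in>\<^sub>t ?G)"
    proof (rule sem_ex[of u, unfolded obu, OF XO wd1, where \<alpha> = ?\<alpha>1])
      show "has_type L [ety ?X] ?\<alpha>1 TOmega" using etX tpB tG by auto
      show "fv ?\<alpha>1 \<subseteq> vars w1" using fp fG by simp
      show "tm w1 (p \<in>\<^sub>t ?G) TOmega" using tp closed_tm[OF G wd1] by auto
      have i1: "inst s ?\<alpha>1 = (p \<in>\<^sub>t ?G \<and>\<^sub>t ?p0 p \<doteq> s)" for s using lp lG by simp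
      show "w2 \<Turnstile> p \<in>\<^sub>t ?G" if "w2 \<Turnstile> inst s ?\<alpha>1" for w2 s using that unfolding i1 force_And by blast
      show "\<exists>s. el w2 ?X s \<and> w2 \<Turnstile> inst s ?\<alpha>1" if w2: "w1 \<sqsubseteq> w2" and m: "w2 \<Turnstile> p \<in>\<^sub>t ?G" for w2
        unfolding i1 force_And using elP(2)[OF force_mono[OF p w2]] m
          force_refl[of w2 "?p0 p" ?A] tm_mono[OF tp w2] by (intro exI[of _ "?p0 p"]) simp
      fix w2 s
      assume w2: "w1 \<sqsubseteq> w2" and s: "el w2 ?X s"
      have wd2: "wd w2" using force_wd[OF s] .
      have ts: "tm w2 s ?A" using el_tm[OF XO s] etX by simp
      have p2: "tm w2 p ?T" using tm_mono[OF tp w2] .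
      let ?\<rho>2 = "?\<rho>(u := s)"
      have r: "?\<rho>2 z = p" "?\<rho>2 u = s" using z(2) by auto
      let ?C = "Compr ?A (Bound 0 \<in>\<^sub>t rep ?X \<and>\<^sub>t Tru)"
      \<comment> \<open>The value \<open>t\<close> of \<open>f\<close> at \<open>s\<close> exists at
        later worlds only. The value claimed for the formula does not mention \<open>t\<close>, so
        \<open>sLocal\<close> can be used.\<close>
      show "sem ?\<rho>2 w2 [] ?\<phi> (inst s ?\<alpha>1)"
        unfolding i1
      proof (rule sLocal[OF _ aH s])
        show "is_atom ?\<phi>" by (auto simp: is_atom_def And_def)
        show "tm w2 (p \<in>\<^sub>t ?G \<and>\<^sub>t ?p0 p \<doteq> s) TOmega" using p2 ts closed_tm[OF G wd2] by auto
        fix w3 t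
        assume w3: "w2 \<sqsubseteq> w3" and t: "vl w3 a s t"
        have wd3: "wd w3" using force_wd[OF t] .
        have st: "w3 \<Turnstile> Tuple [s, t] \<in>\<^sub>t ?G" using t av by blast
        have tt: "tm w3 s ?A" "tm w3 t ?B" using vl_tm[OF aH t] etX by auto
        have s3: "el w3 ?X s" using force_mono[OF s w3] .
        have p3: "tm w3 p ?T" using tm_mono[OF p2 w3] .
        have su: "sem ?\<rho>2 w3 [] (Var u) s" using sVar[OF wd3, of ?\<rho>2 "[]" u] by (simp only: r)
        have 1: "sem ?\<rho>2 w3 [] (Var z \<doteq> Tuple [Var u, ?f]) (p \<doteq> Tuple [s, t])"
        proof (rule sEq)
          show "sem ?\<rho>2 w3 [] (Var z) p" using sVar[OF wd3, of ?\<rho>2 "[]" z] by (simp only: r)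
          have "sem ?\<rho>2 w3 [] ?f t" by (rule sApp[OF su]) (use t fs in simp)
          then show "sem ?\<rho>2 w3 [] (Tuple [Var u, ?f]) (Tuple [s, t])" using su by (intro sTuple wd3) simp
        qed
        \<comment> \<open>In the internal language \<open>U\<close> denotes the whole object
          \<open>?X\<close>, so membership of \<open>s\<close> in its value holds
          automatically.\<close>
        have "sem ?\<rho>2 w3 [] ?U ?C"
          unfolding U_def by (rule sCompr[of "snd u", unfolded obu etX]) (use wd3 sem_Tru ext_wd in auto)
        then have 2: "sem ?\<rho>2 w3 [] (Var u \<in>\<^sub>t ?U) (s \<in>\<^sub>t ?C)" by (rule sMem[OF su])
        have mC: "w4 \<Turnstile> s \<in>\<^sub>t ?C" if w4: "w3 \<sqsubseteq> w4" for w4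
        proof -
          have "has_type L [?A] (Bound 0 \<in>\<^sub>t rep ?X \<and>\<^sub>t Tru) TOmega" "fv (Bound 0 \<in>\<^sub>t rep ?X \<and>\<^sub>t Tru) \<subseteq> vars w4"
            using Ob_rep[OF XO] etX by (auto simp: closed_term_def has_type_weaken0)
          from force_mem_Compr[OF this, of s] show ?thesis
            using tm_mono[OF tt(1) w4] force_mono[OF s3 w4] closed_lc[OF Ob_rep[OF XO]]
              force_Tru[OF ext_wd(2)[OF w4]] by (simp add: force_And)
        qed
        \<comment> \<open>From right to left this is functionality: \<open>p\<close> lies in the
          graph with first component \<open>s\<close>, so its second component equals the value
          \<open>t\<close>.\<close>
        have "w3 \<Turnstile> (p \<doteq> Tuple [s, t] \<and>\<^sub>t s \<in>\<^sub>t ?C) \<doteq> (p \<in>\<^sub>t ?G \<and>\<^sub>t ?p0 p \<doteq> s)"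
        proof (rule force_eqI)
          have tpe: "tm w3 (p \<doteq> Tuple [s, t]) TOmega" using p3 tt wd3 by auto
          have "tm w3 (s \<in>\<^sub>t ?C) TOmega" using force_tm[OF mC] wd3 by simp
          then show "tm w3 (p \<doteq> Tuple [s, t] \<and>\<^sub>t s \<in>\<^sub>t ?C) TOmega" using tpe by (simp only: tm_simps(5))
          show "tm w3 (p \<in>\<^sub>t ?G \<and>\<^sub>t ?p0 p \<doteq> s) TOmega" using p3 tt(1) closed_tm[OF G wd3] by auto
          fix w4
          assume w4: "w3 \<sqsubseteq> w4"
          have p4: "tm w4 p ?T" using tm_mono[OF p3 w4] .
          have st4: "w4 \<Turnstile> Tuple [s, t] \<in>\<^sub>t ?G" using force_mono[OF st w4] .
          show "w4 \<Turnstile> (p \<in>\<^sub>t ?G \<and>\<^sub>t ?p0 p \<doteq> s)" if "w4 \<Turnstile> (p \<doteq> Tuple [s, t] \<and>\<^sub>t s \<in>\<^sub>t ?C)"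
            using that tup st4 pr[OF _ p4] unfolding force_And by blast
          show "w4 \<Turnstile> (p \<doteq> Tuple [s, t] \<and>\<^sub>t s \<in>\<^sub>t ?C)" if h: "w4 \<Turnstile> (p \<in>\<^sub>t ?G \<and>\<^sub>t ?p0 p \<doteq> s)"
          proof -
            have e0: "w4 \<Turnstile> ?p0 p \<doteq> s" and pG: "w4 \<Turnstile> p \<in>\<^sub>t ?G" using h by (simp_all add: force_And)
            have r1: "w4 \<Turnstile> ?p1 p \<doteq> ?p1 p" by (rule force_refl[of w4 "?p1 p" ?B]) (use p4 in simp)
            have e1: "w4 \<Turnstile> p \<doteq> Tuple [s, ?p1 p]"
              using force_trans[OF eta[OF p4] force_pair_cong[OF e0 r1]] .
            then have "w4 \<Turnstile> Tuple [s, ?p1 p] \<in>\<^sub>t ?G" using tup pG by blast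
            then have "w4 \<Turnstile> ?p1 p \<doteq> t" using sfn_fun[OF sf _ st4] by blast
            then have "w4 \<Turnstile> p \<doteq> Tuple [s, t]"
              using force_trans[OF e1 force_pair_cong[OF force_refl[OF tm_mono[OF tt(1) w4]]]] by blast
            then show ?thesis using mC[OF w4] by (simp only: force_And)
          qed
        qed
        then show "sem ?\<rho>2 w3 [] ?\<phi> (p \<in>\<^sub>t ?G \<and>\<^sub>t ?p0 p \<doteq> s)" by (rule sEqual[OF sem_And[OF 1 2 wd3]])
      qed
    qed
    then show "sem ?\<rho> w1 [] (foldr ex [u] ?\<phi>) (p \<in>\<^sub>t ?G)" by simp
  qed
  have tyT: "is_ty (ground LE) ?Tuv" using tyu by simp
  have c1: "has_type LE [] ?fstar (TPow ?Tuv)" "fv ?fstar = {}"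
    unfolding fstar using f\<gamma>' tyu t\<gamma>' by (auto intro!: has_type_set_of)
  have c2: "has_type LE [] ?mg (TPow ?Tuv)" "fv ?mg = {}"
    unfolding maps_graph_def using tyu tf by (auto intro!: has_type_set_of simp: U_def)
  have one: "Prod E (ctx E [] []) = Prod E []" by (simp add: ctx_def)
  have i1: "interp E [] ?fstar [] \<in> Hom E (Prod E []) (ob (TPow ?Tuv))"
    and i2: "interp E [] ?mg [] \<in> Hom E (Prod E []) (ob (TPow ?Tuv))"
    using interp_Hom[OF c1(1), of "[]"] interp_Hom[OF c2(1), of "[]"] c1(2) c2(2) by (simp_all add: one)
  \<comment> \<open>Closed terms are interpreted over the terminal object, each element of which
    equals \<open>Star\<close>. The assignment is constant for want of free variables.\<close>
  have eq: "interp E [] ?fstar [] = interp E [] ?mg []"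
  proof (rule arr_eqI_ex[OF i1 i2])
    fix w s
    assume s: "el w (Prod E []) s"
    have w: "wd w" using force_wd[OF s] .
    have "tm w s TUnit" using s el_Prod[of "[]"] by simp
    then have e: "w \<Turnstile> Star \<doteq> s" using force_sym[OF force_Star] by blast
    have v1: "vl w (interp E [] ?fstar []) Star B0"
      using sem_adequate[OF semstar[OF w, of "\<lambda>_. Star"] c1(1), of "[]"] c1(2) by simp
    have v2: "vl w (interp E [] ?mg []) Star B0"
      using sem_adequate[OF semmaps[OF w, of "\<lambda>_. Star"] c2(1), of "[]"] c2(2) by simp
    have B0: "w \<Turnstile> B0 \<doteq> B0" using force_refl vl_tm[OF i1 v1] by blast
    show "\<exists>t. vl w (interp E [] ?fstar []) s t \<and> vl w (interp E [] ?mg []) s t"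
      using vl_cong[OF i1 e B0 v1] vl_cong[OF i2 e B0 v2] by blast
  qed
  \<comment> \<open>Validity sees a closed term only through its interpretation, so either graph may
    replace the other in a provable equation.\<close>
  have thEq: "({}, ?fstar \<doteq> t') \<in> Th E \<longleftrightarrow> ({}, ?mg \<doteq> t') \<in> Th E" if "fv t' = {}" for t'
  proof -
    have "formula LE (?fstar \<doteq> t') \<longleftrightarrow> formula LE (?mg \<doteq> t')"
      using c1(1) c2(1) has_type_unique by (auto, blast+)
    moreover have "valid E {} (?fstar \<doteq> t') \<longleftrightarrow> valid E {} (?mg \<doteq> t')"
      unfolding valid_def using c1(2) c2(2) that eq by (auto simp: Let_def)
    ultimately show ?thesis by (simp add: Th_def sequents_def)
  qed
  have "cls (Th E) ?fstar = cls (Th E) ?mg"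
    unfolding cls_def entails_def using thEq by blast
  moreover have "elem_ty LE (U (snd v)) = snd v"
    unfolding elem_ty_def by (rule the_equality) (use tyu in \<open>auto simp: U_def\<close>)
  ultimately show "sfun (Th E) ?fstar (U (snd u)) (U (snd v)) = maps_to LE (Th E) u ?f (U (snd u)) (U (snd v))"
    by (simp add: maps_to_def sfun_def)
  let ?\<Phi> = "Tuple [Var u, ?f] \<in>\<^sub>t ?fstar"
  have t\<Phi>: "formula LE ?\<Phi>"
    unfolding has_type_simps(9) using c1(1) tf tyu by (intro conjI refl exI[of _ ?Tuv]) simp_all
  have f\<Phi>: "fv ?\<Phi> = {u}" using c1(2) by simp
  have "valid E {} ?\<Phi>"
    unfolding valid_def
  proof (intro allI impI)
    fix xs :: "('g, 'f) sobj var list" and \<gamma>s :: "(('g, 'f) sobj, (('g, 'f) sobj, ('g, 'f) sarr) fsym) trm list"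
    assume a1: "distinct xs \<and> set xs = \<Union> (fv ` {}) \<union> fv ?\<Phi> \<and> distinct \<gamma>s \<and> set \<gamma>s = {}"
    then have "set xs = {u}" "distinct xs" "\<gamma>s = []" using f\<Phi> by auto
    then have xs: "xs = [u]" by (cases xs; cases "tl xs") auto
    let ?D = "Prod E (ctx E [u] [])"
    have D: "?D = Prod E [?X]" by (simp add: ctx_def obu)
    have O: "set [?X] \<subseteq> Ob E" using XO by simp
    have DO: "?D \<in> Ob E" unfolding D by (rule Prod_Ob[OF O])
    \<comment> \<open>A tuple of length one is its only component, so a context with one variable
      has the elements of its object.\<close>
    have elD: "el w ?D s \<longleftrightarrow> el w ?X s" for w s
      unfolding D el_Prod[OF O] using el_tm[OF XO] by (auto simp: mk_prj_def)
    have iH: "interp E [u] ?\<Phi> [] \<in> Hom E ?D (Omega E)"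
      using interp_Hom[OF t\<Phi>, of "[u]"] f\<Phi> tyu by simp
    have "interp E [u] ?\<Phi> [] = true_on E ?D"
    proof (rule arr_eqI_ex[OF iH true_on_Hom(1)[OF DO]], intro exI conjI)
      fix w s
      assume s: "el w ?D s"
      show "vl w (true_on E ?D) s Tru" by (rule true_on_Hom(2)[OF DO s])
      have wd: "wd w" using force_wd[OF s] .
      have sX: "el w ?X s" using s elD by blast
      \<comment> \<open>The truth value does not depend on which value \<open>t\<close> of
        \<open>f\<close> is met at a later world, so it is the value at \<open>w\<close> as
        well.\<close>
      have "sem (\<lambda>_. s) w [] ?\<Phi> Tru"
      proof (rule sLocal[OF _ aH sX])
        show "is_atom ?\<Phi>" by (auto simp: is_atom_def)
        show "tm w Tru TOmega" using wd by simp
        fix w' t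
        assume w': "w \<sqsubseteq> w'" and t: "vl w' a s t"
        have wd': "wd w'" using ext_wd(2)[OF w'] .
        have st: "w' \<Turnstile> Tuple [s, t] \<in>\<^sub>t ?G" using t av by blast
        have su: "sem (\<lambda>_. s) w' [] (Var u) s" by (rule sVar[OF wd'])
        have "sem (\<lambda>_. s) w' [] ?f t" by (rule sApp[OF su]) (use t fs in simp)
        then have "sem (\<lambda>_. s) w' [] (Tuple [Var u, ?f]) (Tuple [s, t])" using su by (intro sTuple wd') simp
        from sMem[OF this semstar[OF wd']] have 1: "sem (\<lambda>_. s) w' [] ?\<Phi> (Tuple [s, t] \<in>\<^sub>t B0)" .
        have "has_type L [?T] (Bound 0 \<in>\<^sub>t rep ?P \<and>\<^sub>t Bound 0 \<in>\<^sub>t ?G) TOmega"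
          "fv (Bound 0 \<in>\<^sub>t rep ?P \<and>\<^sub>t Bound 0 \<in>\<^sub>t ?G) \<subseteq> vars w'"
          using Ob_rep[OF PO] etP tG fG by (auto simp: closed_term_def has_type_weaken0)
        from force_mem_Compr[OF this, of "Tuple [s, t]"] have "w' \<Turnstile> Tuple [s, t] \<in>\<^sub>t B0"
          using elP(1)[OF vl_dom[OF aH t] vl_cod[OF aH t]] closed_mem_tm[OF G st] st
            closed_lc[OF Ob_rep[OF PO]] lG by (simp add: B0_def force_And del: tm_simps(3))
        then show "sem (\<lambda>_. s) w' [] ?\<Phi> Tru" using sEqual[OF 1] by (simp add: force_Tru_iff)
      qed
      from sem_adequate[OF this t\<Phi>, of "[u]"] show "vl w (interp E [u] ?\<Phi> []) s Tru"
        using f\<Phi> tyu sX obu by simp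
    qed
    then show "let D = Prod E (ctx E xs []) in
      below E D (foldr (\<lambda>\<gamma>. meet E D (interp E xs \<gamma> [])) \<gamma>s (true_on E D)) (interp E xs ?\<Phi> [])"
      using meet_true_on[OF DO] \<open>\<gamma>s = []\<close> by (simp only: xs Let_def below_def foldr.simps id_apply)
  qed
  then show "({}, ?\<Phi>) \<in> Th E" using t\<Phi> by (simp add: Th_def sequents_def)
qed

end

theorem theorem3p7:
  fixes L :: "('g, 'f) lang" and S :: "('g, 'f) sequent set"
    and x y :: "'g var" and \<alpha> \<beta> \<gamma> X Y :: "('g, 'f) trm"
    and u v :: "('g, 'f) sobj var"
    and f :: "('g, 'f) sarr"
    and E :: "(('g, 'f) sobj, ('g, 'f) sarr) topos"
    and fstar :: "(('g, 'f) sobj, (('g, 'f) sobj, ('g, 'f) sarr) fsym) trm"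
  assumes "local_language L" and "local_set_theory L S"
    and "x \<noteq> y" and "formula L \<alpha>" and "formula L \<beta>" and "formula L \<gamma>"
    and "X = compr x \<alpha>" and "is_sset L X"
    and "Y = compr y \<beta>" and "is_sset L Y"
    and "is_sfun L S (graph x y \<gamma>) X Y" and "f = sfun S (graph x y \<gamma>) X Y"
    and "E = ling_topos L S"
    and "snd u = type_sym E (cls S X)" and "snd v = type_sym E (cls S Y)" and "u \<noteq> v"
    and "fstar = star_graph L S X Y x y \<gamma> u v"
  shows "({} \<turnstile>[Th E] Tuple [Var u, App (fun_sym E f) (Var u)] \<in>\<^sub>t fstar) \<and>
    sfun (Th E) fstar (U (snd u)) (U (snd v)) =
      maps_to (int_lang E) (Th E) u (App (fun_sym E f) (Var u)) (U (snd u)) (U (snd v))"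
proof -
  interpret set_theory L S using assms(1,2) by unfold_locales
  \<comment> \<open>The form \<open>{x : \<alpha>}\<close> of \<open>X\<close> fixes its element
    type as the type of \<open>x\<close>, and likewise for \<open>Y\<close>.\<close>
  have X: "closed_term L X (TPow (snd x))" and Y: "closed_term L Y (TPow (snd y))"
    using assms(7-10) by (auto simp: is_sset_def closed_term_def compr_def)
  note m = star_graph_maps_to[OF assms(3,6) X Y assms(11), of u v]
  show ?thesis
    using m assms(14-16) unfolding entails_def assms(12,13,17) by blast
qed

end
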